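(* Let $K\subset\mathbb D$ be Lebesgue measurable, $\epsilon\in(0,1)$, $\epsilon_*:=\max\{\frac12,\epsilon\}$, and let $\zeta\subset K$ be an $\epsilon$-chain of $K$ w.r.t. $\rho$ with $\delta(\zeta)\ge1-\frac{(1-\sqrt{\epsilon_*})^2}{8}$. Let $X$ be a complex Banach space. There is a bounded linear operator $L_K^X:L^\infty(K,X)\to C_\rho(\mathbb D,X)$ of norm $\le c\frac{\epsilon}{1-\epsilon}$, $c<389423$, such that $L_K^Xf$ is a weak solution of $\frac{\partial F}{\partial\bar z}=\frac{f(z)}{1-|z|^2}$ on $\mathbb D$ for all $f\in L^\infty(K,X)$, with the following property. For every $\nu\in(0,2-\sqrt3]$, with $\epsilon_\nu:=\frac{(2-\sqrt3)^3}{6}\nu$, there exist a natural number $k_\nu^*\le\frac{c'}{\nu^2(1-\epsilon)}$ with $c'<194712$, interpolating sequences $\zeta_\nu^i\subset K$ with $\delta(\zeta_\nu^i)>\frac12$ ($1\le i\le k_\nu^*$) such that $$K\subset\bigcup_{i=1}^{k_\nu^*}B_{\zeta_\nu^i}^{-1}(\bar{\mathbb D}_{\epsilon_\nu})\subset\bigcup_{i=1}^{k_\nu^*}B_{\zeta_\nu^i}^{-1}(\mathbb D_{6\epsilon_\nu})\subset[K]_\nu,$$ holomorphic functions $H_\nu^i\in H^\infty(\mathbb C\setminus\bar{\mathbb D}_{\epsilon_\nu},\mathscr B(K,X))$ vanishing at $\infty$ with $\|H_\nu^i\|_\infty\le\frac35\nu$, and an operator $E_\nu^0\in\mathscr B(K,X)$,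 such that for every $f\in L^\infty(K,X)$ and $z\in\mathbb D\setminus\overline{[K]_\nu}$, $$(L_K^Xf)(z)=(E_\nu^0f)(z)+\sum_{i=1}^{k_\nu^*}\big(H_\nu^i(B_{\zeta_\nu^i}(z))f\big)(z).$$
   Context: $\mathbb D$ open unit disk, $\mathbb D_t=\{|z|<t\}$, $\bar{\mathbb D}_t$ its closure, $\rho(z,w)=|z-w|/|1-\bar wz|$. For $S\subset\mathbb D$, $[S]_\nu:=\{y\in\mathbb D:\inf_{z\in S}\rho(y,z)<\nu\}$ and $\overline{[S]_\nu}$ is its closure. A sequence $\zeta=\{z_n\}$ is interpolating for $H^\infty$ if every bounded data $\{a_n\}$ equals $\{g(z_n)\}$ for some bounded holomorphic $g$ on $\mathbb D$; $\delta(\zeta):=\inf_k\prod_{j\ne k}\rho(z_j,z_k)$ (equal to $1$ for one point). $B_\zeta$ is the Blaschke product with simple zeros at the points of $\zeta$. An $\epsilon$-chain of $K$ w.r.t. $\rho$ is a maximal subset of $K$ with pairwise $\rho$-distances $\ge\epsilon$. $L^\infty(K,X)$: a.e.-classes of Bochner measurable essentially bounded $f:\mathbb D\to X$ vanishing a.e. off $K$. $C_\rho(\mathbb D,X)$: bounded continuous $\mathbb D\to X$ uniformly continuous w.r.t. $\rho$, sup norm. $H^\infty(U,Y)$: bounded holomorphic $Y$-valued functions on $U$, sup norm. $\mathscr B(K,X)$: Banach space of bounded linear operators $L^\infty(K,X)\to H^\infty(\mathbb D,X)$ with operator norm. Weak solution: $\iint_{\mathbb D}F\,\partial_{\bar z}\varphi\,dz\wedge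 d\bar z=-\iint_{\mathbb D}\frac{f}{1-|z|^2}\varphi\,dz\wedge d\bar z$ for compactly supported $C^\infty$ $\varphi$ on $\mathbb D$. *)

theory Defs
  imports "HOL-Analysis.Analysis"
begin

class complex_banach = banach +
  fixes cscale :: "complex \<Rightarrow> 'a \<Rightarrow> 'a"
  assumes cscale_of_real: "cscale (complex_of_real r) x = r *\<^sub>R x"
    and cscale_add_right: "cscale a (x + y) = cscale a x + cscale a y"
    and cscale_add_left: "cscale (a + b) x = cscale a x + cscale b x"
    and cscale_mult: "cscale (a * b) x = cscale a (cscale b x)"
    and cscale_norm: "norm (cscale a x) = cmod a * norm x"

instantiation complex :: complex_banach
begin
definition cscale_complex :: "complex \<Rightarrow> complex \<Rightarrow> complex" where
  "cscale_complex a x = a * x"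
instance
  by standard (auto simp: cscale_complex_def scaleR_conv_of_real algebra_simps norm_mult)
end

definition rho :: "complex \<Rightarrow> complex \<Rightarrow> real" where
  "rho z w = cmod (z - w) / cmod (1 - cnj w * z)"

definition nbhd :: "complex set \<Rightarrow> real \<Rightarrow> complex set" where
  "nbhd S \<nu> = {y \<in> ball 0 1. S \<noteq> {} \<and> (INF z\<in>S. rho y z) < \<nu>}"

definition eps_chain :: "real \<Rightarrow> complex set \<Rightarrow> complex set \<Rightarrow> bool" where
  "eps_chain \<epsilon> K Z \<longleftrightarrow> Z \<subseteq> K \<and>
     (\<forall>z\<in>Z. \<forall>w\<in>Z. z \<noteq> w \<longrightarrow> rho z w \<ge> \<epsilon>) \<and>
     (\<forall>y\<in>K - Z. \<exists>z\<in>Z. rho y z < \<epsilon>)"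

text \<open>delta(S) = inf_k prod_{j<>k} rho(z_j,z_k); the (possibly infinite) product of
  factors in [0,1] is the infimum of its finite subproducts; delta of a single point is 1.\<close>
definition delta :: "complex set \<Rightarrow> real" where
  "delta S = (if S = {} then 1 else
     (INF z\<in>S. INF F\<in>{F. finite F \<and> F \<subseteq> S - {z}}. \<Prod>w\<in>F. rho w z))"

definition bfactor :: "complex \<Rightarrow> complex \<Rightarrow> complex" where
  "bfactor a z = (if a = 0 then z else
     (cnj a / complex_of_real (cmod a)) * (a - z) / (1 - cnj a * z))"

definition blaschke :: "complex set \<Rightarrow> complex \<Rightarrow> complex" where
  "blaschke S z = Lim (finite_subsets_at_top S) (\<lambda>F. \<Prod>a\<in>F. bfactor a z)"

definition interpolating :: "complex set \<Rightarrow> bool" where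
  "interpolating S \<longleftrightarrow> S \<subseteq> ball 0 1 \<and>
     (\<forall>a :: complex \<Rightarrow> complex. bounded (a ` S) \<longrightarrow>
        (\<exists>g. g holomorphic_on ball 0 1 \<and> bounded (g ` ball 0 1) \<and> (\<forall>z\<in>S. g z = a z)))"

definition smeas :: "(complex \<Rightarrow> 'x::real_normed_vector) \<Rightarrow> bool" where
  "smeas f \<longleftrightarrow> (\<exists>s :: nat \<Rightarrow> complex \<Rightarrow> 'x.
     (\<forall>n. finite (range (s n)) \<and> (\<forall>x. s n -` {x} \<in> sets lebesgue)) \<and>
     (AE z in lebesgue. (\<lambda>n. s n z) \<longlonglongrightarrow> f z))"

definition Linf :: "complex set \<Rightarrow> (complex \<Rightarrow> 'x::real_normed_vector) set" where
  "Linf K = {f. smeas f \<and> (\<exists>C. AE z in lebesgue. norm (f z) \<le> C) \<and>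
                (AE z in lebesgue. z \<notin> K \<longrightarrow> f z = 0)}"

definition essnorm :: "(complex \<Rightarrow> 'x::real_normed_vector) \<Rightarrow> real" where
  "essnorm f = Inf {C. C \<ge> 0 \<and> (AE z in lebesgue. norm (f z) \<le> C)}"

type_synonym 'x op = "(complex \<Rightarrow> 'x) \<Rightarrow> complex \<Rightarrow> 'x"

text \<open>Bounded complex-linear operator on L^infinity(K,X) (well defined on a.e.-classes),
  with values functions on the disc (only values on the disc matter).\<close>
definition bdd_lin_op :: "complex set \<Rightarrow> 'x::complex_banach op \<Rightarrow> bool" where
  "bdd_lin_op K T \<longleftrightarrow>
     (\<forall>f\<in>Linf K. \<forall>g\<in>Linf K. (AE z in lebesgue. f z = g z) \<longrightarrow> (\<forall>z\<in>ball 0 1. T f z = T g z)) \<and>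
     (\<forall>f\<in>Linf K. \<forall>g\<in>Linf K. \<forall>z\<in>ball 0 1. T (\<lambda>w. f w + g w) z = T f z + T g z) \<and>
     (\<forall>f\<in>Linf K. \<forall>a. \<forall>z\<in>ball 0 1. T (\<lambda>w. cscale a (f w)) z = cscale a (T f z)) \<and>
     (\<exists>M. \<forall>f\<in>Linf K. \<forall>z\<in>ball 0 1. norm (T f z) \<le> M * essnorm f)"

definition opnorm :: "complex set \<Rightarrow> 'x::complex_banach op \<Rightarrow> real" where
  "opnorm K T = Inf {M. M \<ge> 0 \<and> (\<forall>f\<in>Linf K. \<forall>z\<in>ball 0 1. norm (T f z) \<le> M * essnorm f)}"

definition vholo :: "complex set \<Rightarrow> (complex \<Rightarrow> 'x::complex_banach) \<Rightarrow> bool" where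
  "vholo U g \<longleftrightarrow> (\<forall>z\<in>U. \<exists>d. ((\<lambda>w. cscale (1 / (w - z)) (g w - g z)) \<longlongrightarrow> d) (at z))"

definition Crho :: "(complex \<Rightarrow> 'x::real_normed_vector) \<Rightarrow> bool" where
  "Crho F \<longleftrightarrow> bounded (F ` ball 0 1) \<and> continuous_on (ball 0 1) F \<and>
     (\<forall>e>0. \<exists>d>0. \<forall>z\<in>ball 0 1. \<forall>w\<in>ball 0 1. rho z w < d \<longrightarrow> dist (F z) (F w) < e)"

definition Cop :: "complex set \<Rightarrow> 'x::complex_banach op \<Rightarrow> bool" where
  "Cop K T \<longleftrightarrow> bdd_lin_op K T \<and> (\<forall>f\<in>Linf K. Crho (T f))"

definition Bop :: "complex set \<Rightarrow> 'x::complex_banach op \<Rightarrow> bool" where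
  "Bop K T \<longleftrightarrow> bdd_lin_op K T \<and>
     (\<forall>f\<in>Linf K. vholo (ball 0 1) (T f) \<and> bounded (T f ` ball 0 1))"

definition op_holo :: "complex set \<Rightarrow> complex set \<Rightarrow> (complex \<Rightarrow> 'x::complex_banach op) \<Rightarrow> bool" where
  "op_holo K U H \<longleftrightarrow> (\<forall>w\<in>U. Bop K (H w)) \<and>
     (\<forall>w\<in>U. \<exists>D. Bop K D \<and>
        ((\<lambda>w'. opnorm K (\<lambda>f z. cscale (1 / (w' - w)) (H w' f z - H w f z) - D f z)) \<longlongrightarrow> 0) (at w))"

fun Ck :: "nat \<Rightarrow> (complex \<Rightarrow> complex) \<Rightarrow> bool" where
  "Ck 0 f = continuous_on UNIV f"
| "Ck (Suc n) f = (continuous_on UNIV f \<and> (\<forall>z. f differentiable (at z)) \<and>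
      Ck n (\<lambda>z. frechet_derivative f (at z) 1) \<and> Ck n (\<lambda>z. frechet_derivative f (at z) \<i>))"

definition dzbar :: "(complex \<Rightarrow> complex) \<Rightarrow> complex \<Rightarrow> complex" where
  "dzbar \<phi> z = (frechet_derivative \<phi> (at z) 1 + \<i> * frechet_derivative \<phi> (at z) \<i>) / 2"

definition test_fn :: "(complex \<Rightarrow> complex) \<Rightarrow> bool" where
  "test_fn \<phi> \<longleftrightarrow> (\<forall>n. Ck n \<phi>) \<and> compact (closure {z. \<phi> z \<noteq> 0}) \<and>
     closure {z. \<phi> z \<noteq> 0} \<subseteq> ball 0 1"

text \<open>The common factor dz wedge dzbar = -2i dA is cancelled from both sides.\<close>
definition weak_sol :: "(complex \<Rightarrow> 'x::complex_banach) \<Rightarrow> (complex \<Rightarrow> 'x) \<Rightarrow> bool" where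
  "weak_sol F f \<longleftrightarrow> (\<forall>\<phi>. test_fn \<phi> \<longrightarrow>
     (\<exists>I. ((\<lambda>z. cscale (dzbar \<phi> z) (F z)) has_integral I) (ball 0 1) \<and>
          ((\<lambda>z. cscale (\<phi> z / complex_of_real (1 - (cmod z)\<^sup>2)) (f z)) has_integral - I) (ball 0 1)))"

end

theory Submission
  imports Defs "HOL-Complex_Analysis.Complex_Analysis"
begin

text \<open>A maximal r-separated net in K is split into boundedly many families: net points near a common point
  of the chain \<open>\<zeta>\<close> get different labels, and the hypothesis on \<open>\<delta>(\<zeta>)\<close> makes every family strongly separated.
  For w in the cell of the net point a, let \<open>\<Psi>\<close> be the exponent of P. Jones' interpolation formula for the
  family of a. The kernel \<open>exp (- (\<Psi> z - \<Psi> w) / 2) / (\<pi> (1 - cnj w * z) (z - w))\<close> is absolutely integrable in w,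
  uniformly in z, because the Jones weights of one family telescope, and by the Cauchy--Pompeiu formula it solves
  the \<open>\<partial>\<close>-bar equation. The operator L comes from the net with r = min(\<open>\<epsilon>\<close>, 1/3).

  For given \<open>\<nu>\<close> one takes a second net with r = \<open>\<epsilon>\<^sub>\<nu>\<close>. The difference of the two kernels has no pole on the
  diagonal and gives the operator E0. In the finer kernel the part belonging to the i-th family, with Blaschke
  product B, is multiplied by (B(z) - B(w)) / (\<open>\<xi>\<close> - B(w)); this removes the pole, is holomorphic in
  \<open>\<xi>\<close> outside the disc of radius \<open>\<epsilon>\<^sub>\<nu>\<close>, and gives back the kernel at \<open>\<xi>\<close> = B(z).\<close>

section \<open>The pseudohyperbolic distance\<close>

text \<open>\<open>L\<close> must not depend on \<nu>, while the cells of the representation must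
  shrink with \<nu>; hence two nets. Jones' weights need small sums of 1 - rho^2 inside a family. A
  comparison of hyperbolic areas bounds the number of labels for cells of size r by a constant over
  r^2 (1 - \<epsilon>), and the kernel of one family has mass O(r). So the coarse net costs
  \<epsilon> / (1 - \<epsilon>), and the fine one gives the bound on the number of families. The
  delicate point is the norm of the holomorphic operators as |\<xi>| decreases to the radius: 1 /
  (\<xi> - B(w)) is then unbounded on cells. Near a zero, however, B is bounded below like the
  pseudohyperbolic distance, so this weight is at most 4 / rho v w for some point v. That
  singularity is integrable, and its integral over a cell is O(r) uniformly in \<xi>.\<close>

lemma cmod_one_minus_sq:
  "(cmod (1 - cnj w * z))\<^sup>2 = (cmod (z - w))\<^sup>2 + (1 - (cmod z)\<^sup>2) * (1 - (cmod w)\<^sup>2)"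
  unfolding cmod_power2 by (simp add: power2_eq_square algebra_simps)

lemma cmod_one_minus_cnj_commute: "cmod (1 - cnj w * z) = cmod (1 - cnj z * w)"
proof -
  have "cmod (1 - cnj w * z) = cmod (cnj (1 - cnj w * z))" by (simp only: complex_mod_cnj)
  also have "\<dots> = cmod (1 - cnj z * w)" by (simp add: mult.commute)
  finally show ?thesis .
qed

lemma one_minus_cnj_mult_le:
  assumes "cmod z \<le> 1" shows "1 - cmod w \<le> cmod (1 - cnj w * z)"
proof -
  have "cmod (cnj w * z) \<le> cmod w * 1"
    unfolding norm_mult complex_mod_cnj by (rule mult_left_mono) (use assms in auto)
  moreover have "1 - cmod (cnj w * z) \<le> cmod (1 - cnj w * z)"
    using norm_triangle_ineq2[of 1 "cnj w * z"] by simp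
  ultimately show ?thesis by simp
qed

lemma one_minus_cnj_mult_le':
  assumes "cmod w \<le> 1" shows "1 - cmod z \<le> cmod (1 - cnj w * z)"
proof -
  have "cmod (1 - cnj w * z) = cmod (1 - cnj z * w)"
    by (rule cmod_one_minus_cnj_commute)
  thus ?thesis using one_minus_cnj_mult_le[OF assms, of z] by simp
qed

lemma one_minus_cnj_mult_pos:
  assumes "cmod z \<le> 1" "cmod w < 1" shows "0 < cmod (1 - cnj w * z)"
  using one_minus_cnj_mult_le[OF assms(1), of w] assms(2) by linarith

lemma one_minus_cnj_mult_nz:
  assumes "cmod z \<le> 1" "cmod w < 1" shows "1 - cnj w * z \<noteq> 0"
  using one_minus_cnj_mult_pos[OF assms] by auto

lemma one_minus_cnj_mult_upper:
  assumes "cmod z \<le> 1" "cmod w \<le> 1" shows "cmod (1 - cnj w * z) \<le> 2"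
proof -
  have "cmod (cnj w * z) \<le> 1"
    using assms by (simp add: norm_mult mult_le_one)
  thus ?thesis using norm_triangle_ineq4[of 1 "cnj w * z"] by simp
qed

lemma one_minus_sq_pos: "cmod w < 1 \<Longrightarrow> 0 < 1 - (cmod w)\<^sup>2"
  by (simp add: abs_square_less_1)

lemma one_minus_sq_nonneg: "cmod w \<le> 1 \<Longrightarrow> 0 \<le> 1 - (cmod w)\<^sup>2"
  by (simp add: abs_square_le_1)

lemma one_minus_sq_le2: "cmod w \<le> 1 \<Longrightarrow> 1 - (cmod w)\<^sup>2 \<le> 2 * (1 - cmod w)"
  using zero_le_power2[of "1 - cmod w"] by (simp add: power2_eq_square algebra_simps)

lemma one_minus_le_sq: "cmod w \<le> 1 \<Longrightarrow> 1 - cmod w \<le> 1 - (cmod w)\<^sup>2"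
  by (simp add: power2_eq_square mult_left_le)

lemma rho_nonneg [simp]: "0 \<le> rho z w"
  by (simp add: rho_def)

lemma rho_self [simp]: "rho z z = 0"
  by (simp add: rho_def)

lemma rho_commute: "rho z w = rho w z"
proof -
  have "cmod (1 - cnj w * z) = cmod (1 - cnj z * w)"
    by (rule cmod_one_minus_cnj_commute)
  thus ?thesis by (simp add: rho_def norm_minus_commute)
qed

text \<open>Separation, the Blaschke condition and all comparisons between nearby points are
  expressed through 1 - rho^2, because in this form it factors into heights and a kernel.\<close>

lemma one_minus_rho_sq:
  assumes "cmod z \<le> 1" "cmod w < 1"
  shows "1 - (rho z w)\<^sup>2 = (1 - (cmod z)\<^sup>2) * (1 - (cmod w)\<^sup>2) / (cmod (1 - cnj w * z))\<^sup>2"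
  using one_minus_cnj_mult_pos[OF assms] cmod_one_minus_sq[of w z]
  by (simp add: rho_def power_divide field_simps)

lemma rho_le_one: "cmod z \<le> 1 \<Longrightarrow> cmod w < 1 \<Longrightarrow> rho z w \<le> 1"
proof -
  assume a: "cmod z \<le> 1" "cmod w < 1"
  have "0 \<le> 1 - (rho z w)\<^sup>2"
    unfolding one_minus_rho_sq[OF a] using a
    by (intro divide_nonneg_nonneg mult_nonneg_nonneg one_minus_sq_nonneg) auto
  thus ?thesis using rho_nonneg[of z w] by (simp add: abs_square_le_1)
qed

lemma rho_less_one: "cmod z < 1 \<Longrightarrow> cmod w < 1 \<Longrightarrow> rho z w < 1"
proof -
  assume a: "cmod z < 1" "cmod w < 1"
  have "0 < 1 - (rho z w)\<^sup>2"
    unfolding one_minus_rho_sq[OF less_imp_le[OF a(1)] a(2)] using a one_minus_cnj_mult_pos[of z w]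
    by (intro divide_pos_pos mult_pos_pos one_minus_sq_pos zero_less_power) auto
  thus ?thesis using rho_nonneg[of z w] by (simp add: abs_square_less_1)
qed

lemma norm_diff_eq_rho:
  assumes "cmod z \<le> 1" "cmod w < 1"
  shows "cmod (z - w) = rho z w * cmod (1 - cnj w * z)"
  using one_minus_cnj_mult_pos[OF assms] by (simp add: rho_def)

lemma rho_eq_0_iff: "cmod z \<le> 1 \<Longrightarrow> cmod w < 1 \<Longrightarrow> rho z w = 0 \<longleftrightarrow> z = w"
  using norm_diff_eq_rho[of z w] by auto

section \<open>The involutive automorphisms of the disc, exchanging 0 and a\<close>

definition mob :: "complex \<Rightarrow> complex \<Rightarrow> complex" where
  "mob a u = (a - u) / (1 - cnj a * u)"

lemma norm_mob: "cmod (mob a u) = rho u a"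
  by (simp add: mob_def rho_def norm_divide norm_minus_commute)

lemma mob_in_disc: "cmod a < 1 \<Longrightarrow> cmod u < 1 \<Longrightarrow> cmod (mob a u) < 1"
  by (simp add: norm_mob rho_less_one)

text \<open>Cleared of denominators, the left side is affine in u. With m = a it proves the
  involution property, with general m it drives the distortion estimates.\<close>

lemma one_minus_cnj_mult_mob:
  assumes "cmod a < 1" "cmod u < 1"
  shows "(1 - cnj m * mob a u) * (1 - cnj a * u) = (1 - cnj m * a) - u * cnj (a - m)"
  using one_minus_cnj_mult_nz[of u a] assms by (simp add: mob_def field_simps)

lemma mob_mob:
  assumes "cmod a < 1" "cmod u < 1"
  shows "mob a (mob a u) = u"
proof -
  define d where "d = 1 - cnj a * u"
  have nz: "d \<noteq> 0" using one_minus_cnj_mult_nz[of u a] assms by (simp add: d_def)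
  have nz2: "1 - cnj a * mob a u \<noteq> 0"
    using one_minus_cnj_mult_nz[of "mob a u" a] assms mob_in_disc[OF assms] by simp
  have "(a - mob a u) * d = u * (1 - cnj a * a)"
  proof -
    have "(a - mob a u) * d = a * d - (a - u)"
      unfolding mob_def d_def[symmetric] left_diff_distrib[of a] using nz by simp
    thus ?thesis by (simp add: d_def algebra_simps)
  qed
  moreover have "(1 - cnj a * mob a u) * d = 1 - cnj a * a"
    using one_minus_cnj_mult_mob[OF assms, of a] by (simp add: d_def)
  ultimately have "(a - mob a u) * d = u * ((1 - cnj a * mob a u) * d)" by simp
  hence "a - mob a u = u * (1 - cnj a * mob a u)" using nz by simp
  thus ?thesis using nz2 by (simp add: mob_def[of a "mob a u"] field_simps)
qed

lemma mob_holomorphic: "cmod a < 1 \<Longrightarrow> mob a holomorphic_on ball 0 1"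
  unfolding mob_def[abs_def]
  using one_minus_cnj_mult_nz[of _ a] by (intro holomorphic_intros) (auto simp: less_imp_le)

lemma one_minus_mob_sq:
  assumes "cmod a < 1" "cmod u < 1"
  shows "1 - (cmod (mob a u))\<^sup>2 = (1 - (cmod a)\<^sup>2) * (1 - (cmod u)\<^sup>2) / (cmod (1 - cnj a * u))\<^sup>2"
  unfolding norm_mob using one_minus_rho_sq[of u a] assms by (simp add: mult.commute)

lemma rho_mob:
  assumes "cmod a < 1" "cmod u < 1" "cmod v < 1"
  shows "rho (mob a u) (mob a v) = rho u v"
proof -
  have nz: "1 - cnj a * u \<noteq> 0" "1 - cnj a * v \<noteq> 0"
    using one_minus_cnj_mult_nz assms less_imp_le by blast+
  hence nz': "1 - a * cnj v \<noteq> 0"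
    by (metis complex_cnj_cnj complex_cnj_diff complex_cnj_mult complex_cnj_one complex_cnj_zero_iff)
  have d: "mob a u - mob a v = - ((1 - cnj a * a) * (u - v)) / ((1 - cnj a * u) * (1 - cnj a * v))"
    using nz by (simp add: mob_def divide_simps) (simp add: algebra_simps)
  have e: "1 - cnj (mob a v) * mob a u
       = (1 - cnj a * a) * (1 - cnj v * u) / ((1 - cnj a * u) * (1 - a * cnj v))"
    using nz nz' by (simp add: mob_def divide_simps) (simp add: algebra_simps)
  have f: "cmod (1 - a * cnj v) = cmod (1 - cnj a * v)"
    by (metis complex_cnj_cnj complex_cnj_diff complex_cnj_mult complex_cnj_one complex_mod_cnj)
  have g: "cmod (1 - cnj a * a) \<noteq> 0"
    using one_minus_cnj_mult_nz[of a a] assms by simp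
  show ?thesis unfolding rho_def d e
    using nz nz' g by (simp add: norm_divide norm_mult f norm_minus_commute)
qed

text \<open>By \<open>one_minus_rho_sq\<close> an upper bound for |1 - cnj b * a| is an upper bound
  for \<open>rho\<close>; the trivial bound 1 + |a||b| is attained when a and b lie on opposite
  radii.\<close>

lemma rho_le_add_origin:
  assumes "cmod a < 1" "cmod b < 1"
  shows "rho a b \<le> (cmod a + cmod b) / (1 + cmod a * cmod b)"
proof -
  define A B where "A = cmod a" and "B = cmod b"
  have AB: "0 \<le> A" "A < 1" "0 \<le> B" "B < 1" using assms by (auto simp: A_def B_def)
  have "cmod (1 - cnj b * a) \<le> 1 + A * B"
    using norm_triangle_ineq4[of 1 "cnj b * a"] by (simp add: norm_mult A_def B_def mult.commute)
  hence "(cmod (1 - cnj b * a))\<^sup>2 \<le> (1 + A * B)\<^sup>2" by (intro power_mono) auto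
  moreover have "0 < (cmod (1 - cnj b * a))\<^sup>2" using one_minus_cnj_mult_pos[of a b] assms by simp
  moreover have "0 \<le> (1 - A\<^sup>2) * (1 - B\<^sup>2)"
    using assms unfolding A_def B_def by (intro mult_nonneg_nonneg one_minus_sq_nonneg) auto
  ultimately have "(1 - A\<^sup>2) * (1 - B\<^sup>2) / (1 + A * B)\<^sup>2 \<le> 1 - (rho a b)\<^sup>2"
    using one_minus_rho_sq[of a b] assms unfolding A_def B_def
    by (simp only: ) (intro divide_left_mono mult_pos_pos; simp add: add_nonneg_eq_0_iff)
  moreover have "(1 - A\<^sup>2) * (1 - B\<^sup>2) / (1 + A * B)\<^sup>2 = 1 - ((A + B) / (1 + A * B))\<^sup>2"
  proof -
    have "1 + A * B > 0" using AB by (simp add: add_pos_nonneg)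
    hence "(1 + A * B)\<^sup>2 > 0" by simp
    moreover have "(1 - A\<^sup>2) * (1 - B\<^sup>2) = (1 + A * B)\<^sup>2 - (A + B)\<^sup>2"
      by (simp add: power2_eq_square algebra_simps)
    ultimately show ?thesis by (simp add: power_divide diff_divide_distrib)
  qed
  ultimately have "(rho a b)\<^sup>2 \<le> ((A + B) / (1 + A * B))\<^sup>2" by simp
  thus ?thesis unfolding A_def B_def by (rule power2_le_imp_le) simp
qed

text \<open>\<open>mob c\<close> moves c to 0, where the addition law holds; its denominator is at
  least 1 and is dropped.\<close>

lemma rho_triangle:
  assumes "cmod a < 1" "cmod b < 1" "cmod c < 1"
  shows "rho a b \<le> rho a c + rho c b"
proof -
  have 1: "rho a b = rho (mob c a) (mob c b)" using rho_mob assms by simp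
  have 2: "rho (mob c a) (mob c b) \<le> (cmod (mob c a) + cmod (mob c b)) / (1 + cmod (mob c a) * cmod (mob c b))"
    by (rule rho_le_add_origin) (use assms mob_in_disc in auto)
  have "(A + B) / (1 + A * B) \<le> A + B" if "0 \<le> A" "0 \<le> B" for A B :: real
    using that mult_left_mono[of 1 "1 + A * B" "A + B"] by (simp add: divide_le_eq add_pos_nonneg)
  from this[of "cmod (mob c a)" "cmod (mob c b)"]
  have "(cmod (mob c a) + cmod (mob c b)) / (1 + cmod (mob c a) * cmod (mob c b)) \<le> cmod (mob c a) + cmod (mob c b)"
    by simp
  thus ?thesis using 1 2 by (simp add: norm_mob rho_commute)
qed

section \<open>Harnack-type comparison of two points at bounded pseudohyperbolic distance\<close>

lemma mob_parametrize:
  assumes "cmod a < 1" "cmod w < 1"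
  obtains u where "cmod u = rho w a" "cmod u < 1" "w = mob a u"
  by (rule that[of "mob a w"]) (use assms in \<open>auto simp: mob_mob norm_mob rho_less_one\<close>)

text \<open>In the affine expression of \<open>one_minus_cnj_mult_mob\<close> the coefficient of u
  has modulus |a - m|, which is at most |1 - cnj m * a|.\<close>

lemma distort_cnj_mult:
  assumes "cmod a < 1" "cmod u < 1" "cmod m \<le> 1" "cmod u \<le> r"
  shows "(1 - r) * cmod (1 - cnj m * a) \<le> cmod (1 - cnj m * mob a u) * cmod (1 - cnj a * u)"
proof -
  have "(cmod (a - m))\<^sup>2 \<le> (cmod (1 - cnj m * a))\<^sup>2"
    unfolding cmod_one_minus_sq[of m a]
    using mult_nonneg_nonneg[OF one_minus_sq_nonneg[of a] one_minus_sq_nonneg[of m]] assms by simp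
  hence "cmod (a - m) \<le> cmod (1 - cnj m * a)"
    by (rule power2_le_imp_le) simp
  hence "cmod (u * cnj (a - m)) \<le> r * cmod (1 - cnj m * a)"
    unfolding norm_mult complex_mod_cnj using assms by (intro mult_mono) (auto intro: order_trans[OF norm_ge_zero])
  hence "cmod (1 - cnj m * a) - r * cmod (1 - cnj m * a) \<le> cmod ((1 - cnj m * a) - u * cnj (a - m))"
    using norm_triangle_ineq2[of "1 - cnj m * a" "u * cnj (a - m)"] by linarith
  thus ?thesis unfolding norm_mult[symmetric] one_minus_cnj_mult_mob[OF assms(1,2), of m]
    by (simp add: algebra_simps)
qed

text \<open>For |z| = 1 this is Harnack's inequality for the Poisson kernel. With w =
  \<open>mob a u\<close>, the height of w and the distance to z acquire the same denominator |1 -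
  cnj a * u|, which cancels; (1 - R^2) / (1 - R)^2 remains.\<close>

lemma distort_poisson:
  assumes "cmod a < 1" "cmod w < 1" "cmod z \<le> 1" "rho w a \<le> r" "r < 1"
  shows "(1 - (cmod w)\<^sup>2) / (cmod (1 - cnj w * z))\<^sup>2
    \<le> (1 + r) / (1 - r) * ((1 - (cmod a)\<^sup>2) / (cmod (1 - cnj a * z))\<^sup>2)"
proof -
  obtain u where u: "cmod u = rho w a" "cmod u < 1" "w = mob a u"
    by (rule mob_parametrize[OF assms(1,2)])
  define R where "R = rho w a"
  define d where "d = cmod (1 - cnj a * u)"
  define A where "A = cmod (1 - cnj z * a)"
  define B where "B = cmod (1 - cnj z * w)"
  define h where "h = 1 - (cmod a)\<^sup>2"
  note sym = cmod_one_minus_cnj_commute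
  have R: "0 \<le> R" "R \<le> r" "R < 1" using assms by (auto simp: R_def)
  have d: "d > 0" unfolding d_def using one_minus_cnj_mult_pos assms u by simp
  have A: "A > 0" unfolding A_def sym[of z] using one_minus_cnj_mult_pos assms by simp
  have B: "B > 0" unfolding B_def sym[of z] using one_minus_cnj_mult_pos assms by simp
  have h: "h > 0" unfolding h_def using one_minus_sq_pos[OF assms(1)] .
  have 1: "1 - (cmod w)\<^sup>2 = h * (1 - R\<^sup>2) / d\<^sup>2"
    unfolding u(3) one_minus_mob_sq[OF assms(1) u(2)] by (simp add: u R_def h_def d_def)
  have 2: "(1 - R) * A \<le> B * d"
    unfolding A_def B_def d_def using distort_cnj_mult[OF assms(1) u(2) assms(3), of R] u by (simp add: R_def)
  hence 3: "((1 - R) * A)\<^sup>2 \<le> (B * d)\<^sup>2"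
    using R A by (intro power_mono) auto
  have "(1 - (cmod w)\<^sup>2) / B\<^sup>2 = h * (1 - R\<^sup>2) / (B * d)\<^sup>2"
    unfolding 1 by (simp add: field_simps)
  also have "\<dots> \<le> h * (1 - R\<^sup>2) / ((1 - R) * A)\<^sup>2"
    using 3 h R A B d by (intro divide_left_mono mult_nonneg_nonneg mult_pos_pos zero_less_power)
       (auto simp: abs_square_le_1)
  also have "\<dots> = (1 + R) / (1 - R) * (h / A\<^sup>2)"
    using R A by (simp add: divide_simps) (simp add: power2_eq_square algebra_simps)
  also have "\<dots> \<le> (1 + r) / (1 - r) * (h / A\<^sup>2)"
    using R assms h A by (intro mult_right_mono frac_le) auto
  finally show ?thesis by (simp add: A_def B_def h_def sym[of z])
qed

lemma distort_height:
  assumes "cmod a < 1" "cmod w < 1" "rho w a \<le> r" "r < 1"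
  shows "1 - (cmod w)\<^sup>2 \<le> (1 + r) / (1 - r) * (1 - (cmod a)\<^sup>2)"
  using distort_poisson[OF assms(1,2) _ assms(3,4), of 0] by simp

text \<open>|1 - cnj a * w| exceeds the height of a by at most |w - a|, while |w - a| is at most r
  times it; the resulting linear inequality is solved for |w - a|.\<close>

lemma distort_distance:
  assumes "cmod a < 1" "cmod w < 1" "rho w a \<le> r" "r < 1"
  shows "cmod (w - a) \<le> r / (1 - r) * (1 - (cmod a)\<^sup>2)"
proof -
  have "cmod (1 - cnj a * w) \<le> 1 - (cmod a)\<^sup>2 + cmod (w - a)"
  proof -
    have "1 - cnj a * w = of_real (1 - (cmod a)\<^sup>2) - cnj a * (w - a)"
      using complex_norm_square[of a] by (simp add: algebra_simps)
    also have "cmod \<dots> \<le> cmod (of_real (1 - (cmod a)\<^sup>2)) + cmod (cnj a * (w - a))"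
      by (rule norm_triangle_ineq4)
    also have "cmod (cnj a * (w - a)) \<le> cmod (w - a)"
      using assms by (simp add: norm_mult mult_left_le_one_le)
    also have "cmod (of_real (1 - (cmod a)\<^sup>2)) = 1 - (cmod a)\<^sup>2"
      using one_minus_sq_pos[of a] assms by (simp only: norm_of_real) simp
    finally show ?thesis by simp
  qed
  hence "cmod (w - a) \<le> r * (1 - (cmod a)\<^sup>2 + cmod (w - a))"
    unfolding norm_diff_eq_rho[OF less_imp_le[OF assms(2)] assms(1)]
    using assms order_trans[OF rho_nonneg assms(3)] by (intro mult_mono) auto
  thus ?thesis using assms by (simp add: field_simps)
qed

lemma distort_herglotz:
  assumes "cmod a < 1" "cmod w < 1" "cmod m < 1" "rho w a \<le> r" "r < 1"
  shows "(1 - (cmod m)\<^sup>2 * (cmod w)\<^sup>2) / (cmod (1 - cnj m * w))\<^sup>2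
    \<le> ((1 + r) / (1 - r))\<^sup>2 * ((1 - (cmod m)\<^sup>2 * (cmod a)\<^sup>2) / (cmod (1 - cnj m * a))\<^sup>2)"
proof -
  obtain u where u: "cmod u = rho w a" "cmod u < 1" "w = mob a u"
    by (rule mob_parametrize[OF assms(1,2)])
  define d where "d = cmod (1 - cnj a * u)"
  define A where "A = cmod (1 - cnj m * a)"
  define B where "B = cmod (1 - cnj m * w)"
  define p where "p = 1 - (cmod a)\<^sup>2"
  define q where "q = 1 - (cmod m)\<^sup>2"
  have r: "0 \<le> r" using assms rho_nonneg[of w a] by linarith
  have pos: "d > 0" "A > 0" "B > 0" "p > 0" "q > 0"
    unfolding d_def A_def B_def p_def q_def using one_minus_cnj_mult_pos assms u one_minus_sq_pos by simp_all
  have dr: "d \<le> 1 + r"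
  proof -
    have "cmod (cnj a * u) \<le> 1 * r" unfolding norm_mult using assms u by (intro mult_mono) auto
    thus ?thesis unfolding d_def using norm_triangle_ineq4[of 1 "cnj a * u"] by simp
  qed
  have 2: "((1 - r) * A)\<^sup>2 \<le> (B * d)\<^sup>2"
    unfolding A_def B_def d_def using distort_cnj_mult[OF assms(1) u(2), of m r] u assms
    by (intro power_mono) auto
  have inv: "1 / B\<^sup>2 \<le> (1 + r)\<^sup>2 / ((1 - r) * A)\<^sup>2"
  proof -
    have "1 / B\<^sup>2 = d\<^sup>2 / (B * d)\<^sup>2" using pos by (simp add: field_simps)
    also have "\<dots> \<le> (1 + r)\<^sup>2 / ((1 - r) * A)\<^sup>2"
      using pos dr 2 assms by (intro frac_le power_mono) auto
    finally show ?thesis .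
  qed
  have T: "(1 + r) / (1 - r) \<le> ((1 + r) / (1 - r))\<^sup>2"
    using r assms by (intro self_le_power) (auto simp: field_simps)
  have pw: "(1 - (cmod w)\<^sup>2) / B\<^sup>2 \<le> ((1 + r) / (1 - r))\<^sup>2 * (p / A\<^sup>2)"
  proof -
    note sym = cmod_one_minus_cnj_commute
    have "(1 - (cmod w)\<^sup>2) / B\<^sup>2 \<le> (1 + r) / (1 - r) * (p / A\<^sup>2)"
      using distort_poisson[OF assms(1,2), of m r] assms
      by (simp add: A_def B_def p_def sym[of m])
    also have "\<dots> \<le> ((1 + r) / (1 - r))\<^sup>2 * (p / A\<^sup>2)"
      using T pos by (intro mult_right_mono) auto
    finally show ?thesis .
  qed
  \<comment> \<open>Only the second summand is a Poisson kernel in w. The first has a numerator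
    independent of w, so no height compensates the change of the denominator; this is why the
    constant is squared.\<close>
  have "(1 - (cmod m)\<^sup>2 * (cmod w)\<^sup>2) / B\<^sup>2 = q * (1 / B\<^sup>2) + (cmod m)\<^sup>2 * ((1 - (cmod w)\<^sup>2) / B\<^sup>2)"
    by (simp add: q_def diff_divide_distrib right_diff_distrib)
  also have "\<dots> \<le> q * ((1 + r)\<^sup>2 / ((1 - r) * A)\<^sup>2) + (cmod m)\<^sup>2 * (((1 + r) / (1 - r))\<^sup>2 * (p / A\<^sup>2))"
    using inv pw pos by (intro add_mono mult_left_mono) auto
  also have "\<dots> = ((1 + r) / (1 - r))\<^sup>2 * ((1 - (cmod m)\<^sup>2 * (cmod a)\<^sup>2) / A\<^sup>2)"
  proof -
    have e1: "(1 + r)\<^sup>2 / ((1 - r) * A)\<^sup>2 = ((1 + r) / (1 - r))\<^sup>2 * (1 / A\<^sup>2)"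
      by (simp add: power_mult_distrib power_divide)
    have e2: "q * (t * (1 / A\<^sup>2)) + (cmod m)\<^sup>2 * (t * (p / A\<^sup>2)) = t * ((1 - (cmod m)\<^sup>2 * (cmod a)\<^sup>2) / A\<^sup>2)"
      for t
      by (simp add: q_def p_def diff_divide_distrib right_diff_distrib left_diff_distrib)
    show ?thesis unfolding e1 by (rule e2)
  qed
  finally show ?thesis unfolding A_def B_def .
qed

text \<open>For fixed v, 1 - rho^2 is a Poisson-type kernel in w times the height of v, so each of
  the two replacements costs one Harnack factor.\<close>

lemma distort_rho:
  assumes "cmod a < 1" "cmod w < 1" "cmod b < 1" "cmod v < 1"
    and "rho w a \<le> r" "rho v b \<le> r" "r < 1"
  shows "1 - (rho w v)\<^sup>2 \<le> ((1 + r) / (1 - r))\<^sup>2 * (1 - (rho a b)\<^sup>2)"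
proof -
  define T where "T = (1 + r) / (1 - r)"
  have T: "T \<ge> 0" using assms order_trans[OF rho_nonneg assms(5)] by (simp add: T_def)
  have *: "1 - (rho w v)\<^sup>2 \<le> T * (1 - (rho a v)\<^sup>2)"
    if "cmod a < 1" "cmod w < 1" "cmod v < 1" "rho w a \<le> r" for a w v
  proof -
    have "(1 - (cmod v)\<^sup>2) * ((1 - (cmod w)\<^sup>2) / (cmod (1 - cnj w * v))\<^sup>2)
       \<le> (1 - (cmod v)\<^sup>2) * (T * ((1 - (cmod a)\<^sup>2) / (cmod (1 - cnj a * v))\<^sup>2))"
      unfolding T_def using that assms
      by (intro mult_left_mono distort_poisson one_minus_sq_nonneg) auto
    moreover have "1 - (rho w v)\<^sup>2 = (1 - (cmod v)\<^sup>2) * ((1 - (cmod w)\<^sup>2) / (cmod (1 - cnj w * v))\<^sup>2)"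
      unfolding rho_commute[of w v] using one_minus_rho_sq[of v w] that by simp
    moreover have "1 - (rho a v)\<^sup>2 = (1 - (cmod v)\<^sup>2) * ((1 - (cmod a)\<^sup>2) / (cmod (1 - cnj a * v))\<^sup>2)"
      unfolding rho_commute[of a v] using one_minus_rho_sq[of v a] that by simp
    ultimately show ?thesis by (simp add: mult.left_commute)
  qed
  have "1 - (rho w v)\<^sup>2 \<le> T * (1 - (rho a v)\<^sup>2)" by (rule *) (use assms in auto)
  moreover have "1 - (rho v a)\<^sup>2 \<le> T * (1 - (rho b a)\<^sup>2)" by (rule *) (use assms in auto)
  hence "1 - (rho a v)\<^sup>2 \<le> T * (1 - (rho a b)\<^sup>2)"
    by (simp only: rho_commute[of v a] rho_commute[of b a])
  hence "T * (1 - (rho a v)\<^sup>2) \<le> T * (T * (1 - (rho a b)\<^sup>2))"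
    using T by (rule mult_left_mono)
  ultimately have "1 - (rho w v)\<^sup>2 \<le> T * (T * (1 - (rho a b)\<^sup>2))" by linarith
  thus ?thesis unfolding T_def power2_eq_square mult.assoc .
qed

section \<open>Radial integrals\<close>

lemma emeasure_ball_complex:
  fixes c :: complex
  assumes "0 \<le> R" shows "emeasure lborel (ball c R) = ennreal (pi * R\<^sup>2)"
    and "emeasure lborel (cball c R) = ennreal (pi * R\<^sup>2)"
  using assms by (simp_all add: emeasure_ball emeasure_cball unit_ball_vol_2)

lemma nn_integral_FTC_Icc:
  fixes f F :: "real \<Rightarrow> real"
  assumes [measurable]: "f \<in> borel_measurable borel" and "a \<le> b"
    and "\<And>x. x \<in> {a..b} \<Longrightarrow> DERIV F x :> f x" "\<And>x. x \<in> {a..b} \<Longrightarrow> 0 \<le> f x"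
  shows "(\<integral>\<^sup>+x. ennreal (f x) * indicator {a..b} x \<partial>lborel) = ennreal (F b - F a)"
proof -
  have "(f has_integral (F b - F a)) {a..b}"
    using assms by (intro fundamental_theorem_of_calculus)
      (auto simp: has_real_derivative_iff_has_vector_derivative[symmetric] intro: DERIV_subset)
  hence "((\<lambda>x. f x * indicator {a..b} x) has_integral (F b - F a)) UNIV"
    by (subst (asm) has_integral_restrict_UNIV[symmetric]) (simp add: indicator_def of_bool_def if_distrib cong: if_cong)
  hence "(\<integral>\<^sup>+x. ennreal (f x * indicator {a..b} x) \<partial>lborel) = ennreal (F b - F a)"
    using assms(4) by (intro nn_integral_has_integral_lborel) (auto simp: indicator_def)
  thus ?thesis by (simp add: ennreal_mult'' ennreal_indicator)
qed

text \<open>Polar coordinates without a change of variables: the areas of discs centred at 0 give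
  the distribution function of the modulus, and half-lines generate the Borel sets.\<close>

lemma distr_norm_complex:
  "distr lborel borel (cmod) = density lborel (\<lambda>r. ennreal (2 * pi * r) * indicator {0..} r)"
proof (rule measure_eqI_generator_eq[where E = "range (\<lambda>a::real. {..a})" and \<Omega> = UNIV and A = "\<lambda>n. {..real n}"])
  show "Int_stable (range (\<lambda>a::real. {..a}))"
    by (auto simp: Int_stable_def)
  have d: "emeasure (distr lborel borel cmod) {..a} = (if a < 0 then 0 else ennreal (pi * a\<^sup>2))" for a
  proof -
    have "emeasure (distr lborel borel cmod) {..a} = emeasure lborel (cball (0::complex) a)"
      by (subst emeasure_distr) (auto intro!: arg_cong[where f = "emeasure lborel"])
    thus ?thesis by (simp add: emeasure_ball_complex cball_empty)
  qed
  show "emeasure (distr lborel borel cmod) X = emeasure (density lborel (\<lambda>r. ennreal (2 * pi * r) * indicator {0..} r)) X"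
    if X: "X \<in> range (\<lambda>a::real. {..a})" for X
  proof -
    obtain a where a: "X = {..a}" using X by auto
    have "emeasure (density lborel (\<lambda>r. ennreal (2 * pi * r) * indicator {0..} r)) X
        = (\<integral>\<^sup>+r. ennreal (2 * pi * r) * indicator {0..a} r \<partial>lborel)"
      unfolding a by (subst emeasure_density) (auto intro!: nn_integral_cong simp: indicator_def)
    also have "\<dots> = (if a < 0 then 0 else ennreal (pi * a\<^sup>2))"
    proof (cases "a < 0")
      case True thus ?thesis by simp
    next
      case False
      have "(\<integral>\<^sup>+r. ennreal (2 * pi * r) * indicator {0..a} r \<partial>lborel) = ennreal (pi * a\<^sup>2 - pi * 0\<^sup>2)"
        by (rule nn_integral_FTC_Icc) (use False in \<open>auto intro!: derivative_eq_intros\<close>)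
      thus ?thesis using False by simp
    qed
    finally show ?thesis unfolding a d by simp
  qed
  show "sets (distr lborel borel cmod) = sigma_sets UNIV (range (\<lambda>a::real. {..a}))"
    by (simp add: borel_eq_atMost[where 'a=real])
  show "sets (density lborel (\<lambda>r. ennreal (2 * pi * r) * indicator {0..} r)) = sigma_sets UNIV (range (\<lambda>a::real. {..a}))"
    by (simp add: borel_eq_atMost[where 'a=real])
  show "(\<Union>i. {..real i}) = UNIV" using real_arch_simple by auto
  show "emeasure (distr lborel borel cmod) {..real i} \<noteq> \<infinity>" for i
    by (simp add: d)
qed auto

lemma nn_integral_radial:
  assumes [measurable]: "h \<in> borel_measurable borel"
  shows "(\<integral>\<^sup>+z. h (cmod z) \<partial>lborel) = (\<integral>\<^sup>+r. ennreal (2 * pi * r) * indicator {0..} r * h r \<partial>lborel)"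
proof -
  have "(\<integral>\<^sup>+z. h (cmod z) \<partial>lborel) = (\<integral>\<^sup>+r. h r \<partial>distr lborel borel cmod)"
    by (subst nn_integral_distr) auto
  also have "\<dots> = (\<integral>\<^sup>+r. ennreal (2 * pi * r) * indicator {0..} r * h r \<partial>lborel)"
    unfolding distr_norm_complex by (subst nn_integral_density) auto
  finally show ?thesis .
qed

lemma nn_integral_translate:
  fixes h :: "complex \<Rightarrow> ennreal"
  assumes [measurable]: "h \<in> borel_measurable borel"
  shows "(\<integral>\<^sup>+z. h (c + z) \<partial>lborel) = (\<integral>\<^sup>+z. h z \<partial>lborel)"
proof -
  have "(\<integral>\<^sup>+z. h z \<partial>lborel) = (\<integral>\<^sup>+z. h z \<partial>distr lborel borel ((+) c))"
    by (simp add: lborel_distr_plus)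
  also have "\<dots> = (\<integral>\<^sup>+z. h (c + z) \<partial>lborel)"
    by (subst nn_integral_distr) auto
  finally show ?thesis by simp
qed

lemma nn_integral_reflect:
  fixes h :: "complex \<Rightarrow> ennreal"
  assumes [measurable]: "h \<in> borel_measurable borel"
  shows "(\<integral>\<^sup>+z. h (c - z) \<partial>lborel) = (\<integral>\<^sup>+z. h z \<partial>lborel)"
proof -
  have "(\<integral>\<^sup>+z. h z \<partial>lborel) = (\<integral>\<^sup>+z. h z \<partial>distr lborel borel (\<lambda>x. c + (-1) *\<^sub>R x))"
    using lborel_affine[of "-1" c] by (simp add: density_1)
  also have "\<dots> = (\<integral>\<^sup>+z. h (c - z) \<partial>lborel)"
    by (subst nn_integral_distr) auto
  finally show ?thesis by simp
qed

lemma nn_integral_inverse_norm: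
  assumes "0 \<le> R"
  shows "(\<integral>\<^sup>+w. ennreal (1 / cmod (w - z)) * indicator (ball z R) w \<partial>lborel) \<le> ennreal (2 * pi * R)"
proof -
  have [measurable]: "ball z R \<in> sets borel" by simp
  have "(\<integral>\<^sup>+w. ennreal (1 / cmod (w - z)) * indicator (ball z R) w \<partial>lborel)
      = (\<integral>\<^sup>+w. ennreal (1 / cmod ((z + w) - z)) * indicator (ball z R) (z + w) \<partial>lborel)"
    by (rule nn_integral_translate[symmetric]) measurable
  also have "\<dots> = (\<integral>\<^sup>+w. ennreal (1 / cmod w) * indicator {..<R} (cmod w) \<partial>lborel)"
    by (intro nn_integral_cong) (auto simp: indicator_def dist_norm)
  also have "\<dots> = (\<integral>\<^sup>+r. ennreal (2 * pi * r) * indicator {0..} r * (ennreal (1 / r) * indicator {..<R} r) \<partial>lborel)"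
    by (rule nn_integral_radial) measurable
  also have "\<dots> \<le> (\<integral>\<^sup>+r. ennreal (2 * pi) * indicator {0..R} r \<partial>lborel)"
  proof (intro nn_integral_mono)
    fix r :: real
    have "ennreal (2 * pi * r) * ennreal (1 / r) \<le> ennreal (2 * pi)" if "r \<ge> 0"
      using that by (cases "r = 0") (auto simp: ennreal_mult''[symmetric])
    thus "ennreal (2 * pi * r) * indicator {0..} r * (ennreal (1 / r) * indicator {..<R} r) \<le> ennreal (2 * pi) * indicator {0..R} r"
      by (auto simp: indicator_def)
  qed
  also have "\<dots> = ennreal (2 * pi * R)"
    using assms by (simp add: nn_integral_cmult ennreal_mult'')
  finally show ?thesis .
qed

text \<open>Within distance R of the pole the radial integral gives 2 pi R; elsewhere the integrand
  is at most 1/R on a set of area at most pi R^2. The pole may lie anywhere.\<close>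

lemma nn_integral_inverse_norm_subset:
  assumes "0 < R" "E \<subseteq> cball c R"
  shows "(\<integral>\<^sup>+w. ennreal (1 / cmod (w - z)) * indicator E w \<partial>lborel) \<le> ennreal (3 * pi * R)"
proof -
  have [measurable]: "ball z R \<in> sets borel" "cball c R \<in> sets borel" by simp_all
  have "(\<integral>\<^sup>+w. ennreal (1 / cmod (w - z)) * indicator E w \<partial>lborel)
    \<le> (\<integral>\<^sup>+w. ennreal (1 / cmod (w - z)) * indicator (ball z R) w + ennreal (1 / R) * indicator (cball c R) w \<partial>lborel)"
  proof (intro nn_integral_mono)
    fix w
    have "1 / cmod (w - z) \<le> 1 / R" if "w \<notin> ball z R"
      using that assms by (intro divide_left_mono mult_pos_pos) (auto simp: dist_norm norm_minus_commute)
    thus "ennreal (1 / cmod (w - z)) * indicator E w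
       \<le> ennreal (1 / cmod (w - z)) * indicator (ball z R) w + ennreal (1 / R) * indicator (cball c R) w"
      using assms by (cases "w \<in> ball z R"; cases "w \<in> E") (auto intro: ennreal_leI)
  qed
  also have "\<dots> = (\<integral>\<^sup>+w. ennreal (1 / cmod (w - z)) * indicator (ball z R) w \<partial>lborel)
       + (\<integral>\<^sup>+w. ennreal (1 / R) * indicator (cball c R) w \<partial>lborel)"
    by (rule nn_integral_add) (measurable; simp)+
  also have "(\<integral>\<^sup>+w. ennreal (1 / R) * indicator (cball c R) w \<partial>lborel) = ennreal (1 / R) * ennreal (pi * R\<^sup>2)"
    using assms by (subst nn_integral_cmult) (auto simp: emeasure_ball_complex)
  also have "\<dots> = ennreal (pi * R)"
    using assms by (simp add: ennreal_mult''[symmetric] power2_eq_square)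
  also have "(\<integral>\<^sup>+w. ennreal (1 / cmod (w - z)) * indicator (ball z R) w \<partial>lborel) + ennreal (pi * R)
     \<le> ennreal (2 * pi * R) + ennreal (pi * R)"
    using assms by (intro add_mono nn_integral_inverse_norm) auto
  also have "\<dots> = ennreal (3 * pi * R)"
    using assms by (subst ennreal_plus[symmetric]) auto
  finally show ?thesis .
qed

lemma nn_integral_hyperbolic_disc:
  assumes "0 \<le> R" "R < 1"
  shows "(\<integral>\<^sup>+w. ennreal (1 / (1 - (cmod w)\<^sup>2)\<^sup>2) * indicator (cball 0 R) w \<partial>lborel) = ennreal (pi * R\<^sup>2 / (1 - R\<^sup>2))"
proof -
  have sq: "1 - r\<^sup>2 \<noteq> 0" if "0 \<le> r" "r \<le> R" for r
    using that assms abs_square_less_1[of r] by auto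
  have "(\<integral>\<^sup>+w. ennreal (1 / (1 - (cmod w)\<^sup>2)\<^sup>2) * indicator (cball 0 R) w \<partial>lborel)
      = (\<integral>\<^sup>+w. ennreal (1 / (1 - (cmod w)\<^sup>2)\<^sup>2) * indicator {..R} (cmod w) \<partial>lborel)"
    by (intro nn_integral_cong) (auto simp: indicator_def)
  also have "\<dots> = (\<integral>\<^sup>+r. ennreal (2 * pi * r) * indicator {0..} r * (ennreal (1 / (1 - r\<^sup>2)\<^sup>2) * indicator {..R} r) \<partial>lborel)"
    by (rule nn_integral_radial) measurable
  also have "\<dots> = (\<integral>\<^sup>+r. ennreal (2 * pi * r * (1 / (1 - r\<^sup>2)\<^sup>2)) * indicator {0..R} r \<partial>lborel)"
    by (intro nn_integral_cong) (auto simp: indicator_def simp del: ennreal_mult' ennreal_mult'' simp flip: ennreal_mult)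
  also have "\<dots> = ennreal (pi / (1 - R\<^sup>2) - pi / (1 - 0\<^sup>2))"
    by (rule nn_integral_FTC_Icc)
       (use sq assms in \<open>auto intro!: derivative_eq_intros simp: power2_eq_square\<close>)
  also have "pi / (1 - R\<^sup>2) - pi / (1 - 0\<^sup>2) = pi * R\<^sup>2 / (1 - R\<^sup>2)"
    using sq[of R] assms by (simp add: field_simps)
  finally show ?thesis .
qed

text \<open>The hyperbolic density is convex, so reflecting a disc in its centre bounds its area from below.\<close>

lemma nn_integral_hyperbolic_disc_ge:
  assumes "0 \<le> R" "ball c R \<subseteq> ball 0 1"
  shows "ennreal (pi * R\<^sup>2 / (1 - (cmod c)\<^sup>2)\<^sup>2)
    \<le> (\<integral>\<^sup>+w. ennreal (1 / (1 - (cmod w)\<^sup>2)\<^sup>2) * indicator (ball c R) w \<partial>lborel)"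
proof -
  define F where "F w = ennreal (1 / (1 - (cmod w)\<^sup>2)\<^sup>2) * indicator (ball c R) w" for w :: complex
  have [measurable]: "ball c R \<in> sets borel" by simp
  have [measurable]: "F \<in> borel_measurable borel" unfolding F_def by measurable
  have pt: "2 * (ennreal (1 / (1 - (cmod c)\<^sup>2)\<^sup>2) * indicator (ball c R) w) \<le> F w + F (2 * c - w)" for w
  proof (cases "w \<in> ball c R")
    case True
    hence v: "2 * c - w \<in> ball c R" by (auto simp: dist_norm norm_minus_commute)
    define x y s where "x = 1 - (cmod w)\<^sup>2" and "y = 1 - (cmod (2 * c - w))\<^sup>2" and "s = 1 - (cmod c)\<^sup>2"
    have "cmod w < 1" "cmod (2 * c - w) < 1" using True v assms(2) by (auto simp: subset_iff)
    hence xy: "x > 0" "y > 0" by (auto simp: x_def y_def abs_square_less_1)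
    \<comment> \<open>The parallelogram law for w and its reflection: their heights average to at
      most the height of the centre.\<close>
    have "(cmod w)\<^sup>2 + (cmod (2 * c - w))\<^sup>2 - 2 * (cmod c)\<^sup>2 = 2 * (cmod (w - c))\<^sup>2"
      unfolding cmod_power2 by (simp add: power2_eq_square algebra_simps)
    hence s: "x + y \<le> 2 * s" 
    proof -
      have "2 * s - (x + y) = (cmod w)\<^sup>2 + (cmod (2 * c - w))\<^sup>2 - 2 * (cmod c)\<^sup>2"
        unfolding x_def y_def s_def by (simp add: algebra_simps)
      also have "\<dots> \<ge> 0" unfolding \<open>_ = 2 * (cmod (w - c))\<^sup>2\<close> by simp
      finally show ?thesis by simp
    qed
    have sp: "s > 0" using s xy by linarith
    have "(x + y)\<^sup>2 \<le> (2 * s)\<^sup>2" using s xy by (intro power_mono) auto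
    hence "x * y \<le> s\<^sup>2" using zero_le_power2[of "x - y"] by (simp add: power2_eq_square algebra_simps)
    hence "2 / s\<^sup>2 \<le> 2 / (x * y)" using xy sp by (intro divide_left_mono) auto
    also have "\<dots> \<le> 1 / x\<^sup>2 + 1 / y\<^sup>2"
      using zero_le_power2[of "1 / x - 1 / y"] xy by (simp add: power2_eq_square algebra_simps)
    finally have "2 * (1 / s\<^sup>2) \<le> 1 / x\<^sup>2 + 1 / y\<^sup>2" by simp
    hence "ennreal (2 * (1 / s\<^sup>2)) \<le> ennreal (1 / x\<^sup>2 + 1 / y\<^sup>2)" by (rule ennreal_leI)
    moreover have "ennreal (2 * (1 / s\<^sup>2)) = 2 * ennreal (1 / s\<^sup>2)"
      by (subst ennreal_mult) auto
    moreover have "ennreal (1 / x\<^sup>2 + 1 / y\<^sup>2) = ennreal (1 / x\<^sup>2) + ennreal (1 / y\<^sup>2)"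
      by (rule ennreal_plus) auto
    ultimately have "2 * ennreal (1 / s\<^sup>2) \<le> ennreal (1 / x\<^sup>2) + ennreal (1 / y\<^sup>2)" by (simp only:)
    thus ?thesis using True v unfolding F_def x_def[symmetric] y_def[symmetric] s_def[symmetric]
      by simp
  qed auto
  have "2 * (ennreal (1 / (1 - (cmod c)\<^sup>2)\<^sup>2) * emeasure lborel (ball c R))
      = (\<integral>\<^sup>+w. 2 * (ennreal (1 / (1 - (cmod c)\<^sup>2)\<^sup>2) * indicator (ball c R) w) \<partial>lborel)"
    by (simp add: nn_integral_cmult)
  also have "\<dots> \<le> (\<integral>\<^sup>+w. F w + F (2 * c - w) \<partial>lborel)"
    by (intro nn_integral_mono pt)
  also have "\<dots> = (\<integral>\<^sup>+w. F w \<partial>lborel) + (\<integral>\<^sup>+w. F (2 * c - w) \<partial>lborel)"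
    by (rule nn_integral_add) auto
  also have "\<dots> = 2 * (\<integral>\<^sup>+w. F w \<partial>lborel)"
    by (subst nn_integral_reflect) (auto simp: mult_2)
  finally have "ennreal (1 / (1 - (cmod c)\<^sup>2)\<^sup>2) * emeasure lborel (ball c R) \<le> (\<integral>\<^sup>+w. F w \<partial>lborel)"
    by (rule ennreal_mult_le_mult_iff[THEN iffD1, rotated 2]) auto
  moreover have "ennreal (1 / (1 - (cmod c)\<^sup>2)\<^sup>2) * emeasure lborel (ball c R) = ennreal (pi * R\<^sup>2 / (1 - (cmod c)\<^sup>2)\<^sup>2)"
    using assms by (simp add: emeasure_ball_complex ennreal_mult''[symmetric])
  ultimately show ?thesis unfolding F_def by simp
qed

text \<open>The integrand is the d-bar derivative of the regularised Cauchy kernel used in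
  \<open>Cauchy_Pompeiu\<close>; its mass pi does not depend on \<delta>, so it is pi times an
  approximate identity.\<close>

lemma nn_integral_inverse_quartic:
  assumes "\<delta> > 0"
  shows "(\<integral>\<^sup>+z. ennreal (\<delta>\<^sup>2 / ((cmod z)\<^sup>2 + \<delta>\<^sup>2)\<^sup>2) \<partial>lborel) = ennreal pi"
proof -
  have pos: "r\<^sup>2 + \<delta>\<^sup>2 > 0" for r using assms by (simp add: add_nonneg_pos)
  have "(\<integral>\<^sup>+z. ennreal (\<delta>\<^sup>2 / ((cmod z)\<^sup>2 + \<delta>\<^sup>2)\<^sup>2) \<partial>lborel)
    = (\<integral>\<^sup>+r. ennreal (2 * pi * r) * indicator {0..} r * ennreal (\<delta>\<^sup>2 / (r\<^sup>2 + \<delta>\<^sup>2)\<^sup>2) \<partial>lborel)"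
    by (rule nn_integral_radial) measurable
  also have "\<dots> = (\<integral>\<^sup>+r. ennreal (2 * pi * r * (\<delta>\<^sup>2 / (r\<^sup>2 + \<delta>\<^sup>2)\<^sup>2)) * indicator {0..} r \<partial>lborel)"
    by (intro nn_integral_cong) (auto simp: indicator_def simp del: ennreal_mult' ennreal_mult'' simp flip: ennreal_mult)
  also have "\<dots> = ennreal (0 - (- pi * \<delta>\<^sup>2 / (\<delta>\<^sup>2 + 0\<^sup>2)))"
  proof (rule nn_integral_FTC_atLeast)
    show "DERIV (\<lambda>r. - pi * \<delta>\<^sup>2 / (\<delta>\<^sup>2 + r\<^sup>2)) x :> 2 * pi * x * (\<delta>\<^sup>2 / (x\<^sup>2 + \<delta>\<^sup>2)\<^sup>2)" for x
      using pos[of x] by (auto intro!: derivative_eq_intros simp: power2_eq_square add.commute)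
    show "((\<lambda>r::real. - pi * \<delta>\<^sup>2 / (\<delta>\<^sup>2 + r\<^sup>2)) \<longlongrightarrow> 0) at_top"
      by (intro tendsto_divide_0[OF tendsto_const] filterlim_at_top_imp_at_infinity
          filterlim_tendsto_add_at_top[OF tendsto_const] filterlim_pow_at_top filterlim_ident) simp
  qed auto
  also have "\<dots> = ennreal pi" using assms by simp
  finally show ?thesis .
qed

section \<open>Counting separated points in a pseudohyperbolic disc\<close>

text \<open>A pseudohyperbolic disc is a Euclidean disc; these are its centre and radius.\<close>

lemma euclid_disc_subset_rho_disc:
  fixes a :: complex and s :: real
  defines "c \<equiv> ((1 - s\<^sup>2) / (1 - s\<^sup>2 * (cmod a)\<^sup>2)) *\<^sub>R a"
    and "R \<equiv> s * (1 - (cmod a)\<^sup>2) / (1 - s\<^sup>2 * (cmod a)\<^sup>2)"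
  assumes a: "cmod a < 1" and s: "0 < s" "s < 1"
  shows "ball c R \<subseteq> {w. cmod w < 1 \<and> rho w a < s}" "0 < R"
    and "s\<^sup>2 * (1 - s\<^sup>2)\<^sup>2 \<le> R\<^sup>2 / (1 - (cmod c)\<^sup>2)\<^sup>2"
proof -
  define A where "A = (cmod a)\<^sup>2"
  have A: "0 \<le> A" "A < 1" using a by (auto simp: A_def abs_square_less_1)
  have s2: "0 < s\<^sup>2" "s\<^sup>2 < 1" using s by (auto simp: abs_square_less_1)
  have sA: "s\<^sup>2 * A < 1" using mult_strict_mono'[of "s\<^sup>2" 1 A 1] A s2 by simp
  define D where "D = 1 - s\<^sup>2 * A"
  have D: "0 < D" "D \<le> 1" using sA A by (auto simp: D_def)
  have c: "c = ((1 - s\<^sup>2) / D) *\<^sub>R a" and R: "R = s * (1 - A) / D" by (simp_all add: c_def R_def D_def A_def)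
  show Rp: "0 < R" using D A s by (simp add: R)
  \<comment> \<open>Both squared moduli are quadratic in w, and the leading coefficient of the
    difference is D; completing the square produces the centre c and the radius R.\<close>
  have key: "(cmod (w - a))\<^sup>2 - s\<^sup>2 * (cmod (1 - cnj a * w))\<^sup>2 = D * ((cmod (w - c))\<^sup>2 - R\<^sup>2)" for w
  proof -
    obtain x y where w: "w = Complex x y" by (cases w)
    obtain p q where pq: "a = Complex p q" by (cases a)
    have Aq: "A = p\<^sup>2 + q\<^sup>2" by (simp add: A_def cmod_power2 pq)
    define k where "k = (1 - s\<^sup>2) / D"
    have kD: "k * D = 1 - s\<^sup>2" using D by (simp add: k_def)
    have RD: "R * D = s * (1 - A)" using D by (simp add: R)
    have e1: "(cmod (w - c))\<^sup>2 = (x - k * p)\<^sup>2 + (y - k * q)\<^sup>2"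
      by (simp add: c k_def[symmetric] w pq cmod_power2)
    have e2: "(cmod (w - a))\<^sup>2 = (x - p)\<^sup>2 + (y - q)\<^sup>2" by (simp add: w pq cmod_power2)
    have e3: "(cmod (1 - cnj a * w))\<^sup>2 = (1 - (p * x + q * y))\<^sup>2 + (p * y - q * x)\<^sup>2"
      unfolding cmod_power2 by (simp add: w pq) (simp add: power2_eq_square algebra_simps)
    have e4: "D * (D * ((x - k * p)\<^sup>2 + (y - k * q)\<^sup>2 - R\<^sup>2))
       = (D * x - (k * D) * p)\<^sup>2 + (D * y - (k * D) * q)\<^sup>2 - (R * D)\<^sup>2"
      by (simp add: power2_eq_square algebra_simps)
    have e5: "D * (D * ((x - k * p)\<^sup>2 + (y - k * q)\<^sup>2 - R\<^sup>2))
       = (D * x - (1 - s\<^sup>2) * p)\<^sup>2 + (D * y - (1 - s\<^sup>2) * q)\<^sup>2 - (s * (1 - A))\<^sup>2"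
      unfolding e4 kD RD ..
    have "D * ((x - p)\<^sup>2 + (y - q)\<^sup>2 - s\<^sup>2 * ((1 - (p * x + q * y))\<^sup>2 + (p * y - q * x)\<^sup>2))
       = D * (D * ((x - k * p)\<^sup>2 + (y - k * q)\<^sup>2 - R\<^sup>2))"
      unfolding e5 unfolding D_def Aq by (simp add: power2_eq_square algebra_simps)
    thus ?thesis unfolding e1 e2 e3 using D by simp
  qed
  have hc: "1 - (cmod c)\<^sup>2 = (1 - A) * (1 - s\<^sup>2 * s\<^sup>2 * A) / D\<^sup>2"
  proof -
    have "(cmod c)\<^sup>2 = ((1 - s\<^sup>2) / D)\<^sup>2 * A"
      by (simp add: c power_mult_distrib A_def power_divide)
    hence "(cmod c)\<^sup>2 = (1 - s\<^sup>2)\<^sup>2 * A / D\<^sup>2"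
      unfolding power_divide by simp
    hence "1 - (cmod c)\<^sup>2 = (D\<^sup>2 - (1 - s\<^sup>2)\<^sup>2 * A) / D\<^sup>2"
      using D by (simp add: power_divide diff_divide_distrib)
    moreover have "D\<^sup>2 - (1 - s\<^sup>2)\<^sup>2 * A = (1 - A) * (1 - s\<^sup>2 * s\<^sup>2 * A)"
      by (simp add: D_def power2_eq_square algebra_simps)
    ultimately show ?thesis by simp
  qed
  have s4: "0 < 1 - s\<^sup>2 * s\<^sup>2 * A" "1 - s\<^sup>2 * s\<^sup>2 * A \<le> 1"
  proof -
    have "s\<^sup>2 * (s\<^sup>2 * A) \<le> 1 * (s\<^sup>2 * A)" using s2 A by (intro mult_right_mono) auto
    thus "0 < 1 - s\<^sup>2 * s\<^sup>2 * A" "1 - s\<^sup>2 * s\<^sup>2 * A \<le> 1" using sA A s2 by (auto simp: mult.assoc)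
  qed
  have Rc: "R / (1 - (cmod c)\<^sup>2) = s * D / (1 - s\<^sup>2 * s\<^sup>2 * A)"
  proof -
    have "R / (1 - (cmod c)\<^sup>2) = (s * (1 - A) / D) * (D\<^sup>2 / ((1 - A) * (1 - s\<^sup>2 * s\<^sup>2 * A)))"
      unfolding hc R by simp
    also have "\<dots> = s * D / (1 - s\<^sup>2 * s\<^sup>2 * A)" using A D by (simp add: power2_eq_square)
    finally show ?thesis .
  qed
  have "s * (1 - s\<^sup>2) \<le> R / (1 - (cmod c)\<^sup>2)"
  proof -
    have "s\<^sup>2 * A \<le> s\<^sup>2 * 1" using A by (intro mult_left_mono) auto
    hence "s * (1 - s\<^sup>2) \<le> s * D / 1" using s by (simp add: D_def)
    also have "\<dots> \<le> s * D / (1 - s\<^sup>2 * s\<^sup>2 * A)"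
      using s4 s D by (intro divide_left_mono) auto
    finally show ?thesis using Rc by simp
  qed
  hence "(s * (1 - s\<^sup>2))\<^sup>2 \<le> (R / (1 - (cmod c)\<^sup>2))\<^sup>2"
    using s s2 by (intro power_mono) auto
  thus "s\<^sup>2 * (1 - s\<^sup>2)\<^sup>2 \<le> R\<^sup>2 / (1 - (cmod c)\<^sup>2)\<^sup>2"
    by (simp add: power_mult_distrib power_divide)
  show "ball c R \<subseteq> {w. cmod w < 1 \<and> rho w a < s}"
  proof
    fix w assume "w \<in> ball c R"
    hence "(cmod (w - c))\<^sup>2 < R\<^sup>2" by (intro power_strict_mono) (auto simp: dist_norm norm_minus_commute)
    hence "D * ((cmod (w - c))\<^sup>2 - R\<^sup>2) < 0" using D by (simp add: mult_pos_neg)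
    hence lt: "(cmod (w - a))\<^sup>2 < s\<^sup>2 * (cmod (1 - cnj a * w))\<^sup>2" using key[of w] by linarith
    have "cmod w < 1"
    proof (rule ccontr)
      assume "\<not> cmod w < 1"
      hence "(1 - (cmod w)\<^sup>2) * (1 - (cmod a)\<^sup>2) \<le> 0"
        using A by (intro mult_nonpos_nonneg) (auto simp: A_def)
      hence "(cmod (1 - cnj a * w))\<^sup>2 \<le> (cmod (w - a))\<^sup>2"
        unfolding cmod_one_minus_sq[of a w] by simp
      moreover have "s\<^sup>2 * (cmod (1 - cnj a * w))\<^sup>2 \<le> 1 * (cmod (1 - cnj a * w))\<^sup>2"
        using s2 by (intro mult_right_mono) auto
      ultimately show False using lt by linarith
    qed
    moreover have "rho w a < s"
    proof -
      have p: "0 < cmod (1 - cnj a * w)" using one_minus_cnj_mult_pos[of w a] \<open>cmod w < 1\<close> a by simp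
      have "(cmod (w - a))\<^sup>2 < (s * cmod (1 - cnj a * w))\<^sup>2" using lt by (simp add: power_mult_distrib)
      hence "cmod (w - a) < s * cmod (1 - cnj a * w)" using s by (intro power2_less_imp_less[of "cmod (w - a)"]) auto
      thus ?thesis using p by (simp add: rho_def divide_less_eq)
    qed
    ultimately show "w \<in> {w. cmod w < 1 \<and> rho w a < s}" by simp
  qed
qed

text \<open>Packing by hyperbolic area: the discs of pseudohyperbolic radius s about the points are
  disjoint and lie in the disc of radius Q. Each contributes at least pi s^2 (1 - s^2)^2; the third
  factor 1 - s^2 comes from the area of the large disc.\<close>

lemma card_separated_origin:
  assumes fin: "finite F" and F: "\<And>a. a \<in> F \<Longrightarrow> cmod a < \<epsilon>"
    and sep: "\<And>a b. a \<in> F \<Longrightarrow> b \<in> F \<Longrightarrow> a \<noteq> b \<Longrightarrow> 2 * s \<le> rho a b"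
    and s: "0 < s" "s < 1" and eps: "0 < \<epsilon>" "\<epsilon> < 1"
  shows "real (card F) * (s\<^sup>2 * (1 - s\<^sup>2) ^ 3 * (1 - \<epsilon>\<^sup>2)) \<le> (\<epsilon> + s)\<^sup>2"
proof -
  define c where "c a = ((1 - s\<^sup>2) / (1 - s\<^sup>2 * (cmod a)\<^sup>2)) *\<^sub>R a" for a :: complex
  define R where "R a = s * (1 - (cmod a)\<^sup>2) / (1 - s\<^sup>2 * (cmod a)\<^sup>2)" for a :: complex
  define Q where "Q = (\<epsilon> + s) / (1 + \<epsilon> * s)"
  define M where "M = density lborel (\<lambda>w::complex. ennreal (1 / (1 - (cmod w)\<^sup>2)\<^sup>2))"
  have a1: "cmod a < 1" if "a \<in> F" for a using F[OF that] eps by simp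
  note disc = euclid_disc_subset_rho_disc[OF a1 s, folded c_def R_def]
  have Q: "0 \<le> Q" "Q < 1"
  proof -
    have "0 < (1 - \<epsilon>) * (1 - s)" using s eps by simp
    hence "\<epsilon> + s < 1 + \<epsilon> * s" by (simp add: algebra_simps)
    thus "0 \<le> Q" "Q < 1" using s eps by (auto simp: Q_def add_pos_nonneg)
  qed
  have sub: "ball (c a) (R a) \<subseteq> cball 0 Q" if a: "a \<in> F" for a
  proof
    fix w assume "w \<in> ball (c a) (R a)"
    hence w: "cmod w < 1" "rho w a < s" using disc(1)[OF a] by auto
    obtain u where u: "cmod u = rho w a" "cmod u < 1" "w = mob a u"
      by (rule mob_parametrize[OF a1[OF a] w(1)])
    have "cmod w = rho u a" by (simp add: u(3) norm_mob)
    also have "\<dots> \<le> (cmod u + cmod a) / (1 + cmod u * cmod a)"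
      by (rule rho_le_add_origin) (use u a1 a in auto)
    \<comment> \<open>The addition law (x + y) / (1 + x y) increases in each variable on [0, 1]; y
      is raised to \<epsilon> and then x to s.\<close>
    also have "\<dots> \<le> Q"
    proof -
      define x y where "x = cmod u" and "y = cmod a"
      have xy: "0 \<le> x" "x \<le> s" "0 \<le> y" "y \<le> \<epsilon>" using u w F[OF a] by (auto simp: x_def y_def)
      have xx: "x * x \<le> 1" "\<epsilon> * \<epsilon> \<le> 1" using xy s eps by (auto intro!: mult_le_one)
      have "(x + y) * (1 + x * \<epsilon>) \<le> (x + \<epsilon>) * (1 + x * y)"
        using mult_nonneg_nonneg[of "1 - x * x" "\<epsilon> - y"] xx xy by (simp add: algebra_simps)
      hence "(x + y) / (1 + x * y) \<le> (x + \<epsilon>) / (1 + x * \<epsilon>)"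
        using xy eps by (simp add: frac_le_eq divide_simps add_pos_nonneg add_nonneg_eq_0_iff)
      also have "(x + \<epsilon>) * (1 + \<epsilon> * s) \<le> (\<epsilon> + s) * (1 + x * \<epsilon>)"
        using mult_nonneg_nonneg[of "1 - \<epsilon> * \<epsilon>" "s - x"] xx xy by (simp add: algebra_simps)
      hence "(x + \<epsilon>) / (1 + x * \<epsilon>) \<le> Q"
        using xy eps s by (simp add: Q_def divide_simps add_pos_nonneg add_nonneg_eq_0_iff)
      finally show ?thesis by (simp add: x_def y_def)
    qed
    finally show "w \<in> cball 0 Q" by simp
  qed
  have disj: "disjoint_family_on (\<lambda>a. ball (c a) (R a)) F"
    unfolding disjoint_family_on_def
  proof (intro ballI impI equals0I)
    fix a b w assume ab: "a \<in> F" "b \<in> F" "a \<noteq> b" and "w \<in> ball (c a) (R a) \<inter> ball (c b) (R b)"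
    hence "cmod w < 1" "rho w a < s" "rho w b < s" using disc(1) by blast+
    moreover have "rho a b \<le> rho a w + rho w b" by (rule rho_triangle) (use ab a1 \<open>cmod w < 1\<close> in auto)
    ultimately show False using sep[OF ab] rho_commute[of a w] by simp
  qed
  have em: "ennreal (pi * (s\<^sup>2 * (1 - s\<^sup>2)\<^sup>2)) \<le> emeasure M (ball (c a) (R a))" if a: "a \<in> F" for a
  proof -
    have "pi * (s\<^sup>2 * (1 - s\<^sup>2)\<^sup>2) \<le> pi * ((R a)\<^sup>2 / (1 - (cmod (c a))\<^sup>2)\<^sup>2)"
      using disc(3)[OF a] by (intro mult_left_mono) auto
    hence "ennreal (pi * (s\<^sup>2 * (1 - s\<^sup>2)\<^sup>2)) \<le> ennreal (pi * (R a)\<^sup>2 / (1 - (cmod (c a))\<^sup>2)\<^sup>2)"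
      by (intro ennreal_leI) simp
    also have "\<dots> \<le> (\<integral>\<^sup>+w. ennreal (1 / (1 - (cmod w)\<^sup>2)\<^sup>2) * indicator (ball (c a) (R a)) w \<partial>lborel)"
      by (rule nn_integral_hyperbolic_disc_ge) (use disc[OF a] in auto)
    also have "\<dots> = emeasure M (ball (c a) (R a))"
      unfolding M_def by (subst emeasure_density) auto
    finally show ?thesis .
  qed
  have "ennreal (real (card F) * (pi * (s\<^sup>2 * (1 - s\<^sup>2)\<^sup>2))) = (\<Sum>a\<in>F. ennreal (pi * (s\<^sup>2 * (1 - s\<^sup>2)\<^sup>2)))"
    by (simp add: ennreal_mult ennreal_of_nat_eq_real_of_nat)
  also have "\<dots> \<le> (\<Sum>a\<in>F. emeasure M (ball (c a) (R a)))"
    by (intro sum_mono em)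
  also have "\<dots> = emeasure M (\<Union>a\<in>F. ball (c a) (R a))"
    by (rule sum_emeasure) (use fin disj in \<open>auto simp: M_def\<close>)
  also have "\<dots> \<le> emeasure M (cball 0 Q)"
    by (rule emeasure_mono) (use sub in \<open>auto simp: M_def\<close>)
  also have "\<dots> = (\<integral>\<^sup>+w. ennreal (1 / (1 - (cmod w)\<^sup>2)\<^sup>2) * indicator (cball 0 Q) w \<partial>lborel)"
    unfolding M_def by (subst emeasure_density) auto
  also have "\<dots> = ennreal (pi * Q\<^sup>2 / (1 - Q\<^sup>2))" by (rule nn_integral_hyperbolic_disc) fact+
  finally have le: "ennreal (real (card F) * (pi * (s\<^sup>2 * (1 - s\<^sup>2)\<^sup>2))) \<le> ennreal (pi * Q\<^sup>2 / (1 - Q\<^sup>2))" .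
  have Q1: "0 < 1 - Q\<^sup>2" using Q by (simp add: abs_square_less_1)
  have "real (card F) * (pi * (s\<^sup>2 * (1 - s\<^sup>2)\<^sup>2)) \<le> pi * Q\<^sup>2 / (1 - Q\<^sup>2)"
    using le Q1 by (subst (asm) ennreal_le_iff) auto
  hence "pi * (real (card F) * (s\<^sup>2 * (1 - s\<^sup>2)\<^sup>2)) \<le> pi * (Q\<^sup>2 / (1 - Q\<^sup>2))"
    by (simp add: mult_ac)
  hence "real (card F) * (s\<^sup>2 * (1 - s\<^sup>2)\<^sup>2) \<le> Q\<^sup>2 / (1 - Q\<^sup>2)"
    by (rule mult_left_le_imp_le) simp
  also have "Q\<^sup>2 / (1 - Q\<^sup>2) = (\<epsilon> + s)\<^sup>2 / ((1 - \<epsilon>\<^sup>2) * (1 - s\<^sup>2))"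
  proof -
    have d: "1 + \<epsilon> * s > 0" using s eps by (simp add: add_pos_nonneg)
    hence "1 - Q\<^sup>2 = ((1 + \<epsilon> * s)\<^sup>2 - (\<epsilon> + s)\<^sup>2) / (1 + \<epsilon> * s)\<^sup>2"
      by (simp add: Q_def power_divide diff_divide_distrib)
    moreover have "(1 + \<epsilon> * s)\<^sup>2 - (\<epsilon> + s)\<^sup>2 = (1 - \<epsilon>\<^sup>2) * (1 - s\<^sup>2)"
      by (simp add: power2_eq_square algebra_simps)
    ultimately have "1 - Q\<^sup>2 = (1 - \<epsilon>\<^sup>2) * (1 - s\<^sup>2) / (1 + \<epsilon> * s)\<^sup>2" by simp
    thus ?thesis using d by (simp add: Q_def power_divide)
  qed
  finally have "real (card F) * (s\<^sup>2 * (1 - s\<^sup>2)\<^sup>2) * ((1 - \<epsilon>\<^sup>2) * (1 - s\<^sup>2)) \<le> (\<epsilon> + s)\<^sup>2"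
    using s eps by (subst (asm) pos_le_divide_eq) (auto intro!: mult_pos_pos simp: abs_square_less_1)
  thus ?thesis by (simp add: power3_eq_cube power2_eq_square mult_ac)
qed

text \<open>\<open>mob b\<close> preserves \<open>rho\<close> and carries the disc about b to one
  about the origin.\<close>

lemma card_separated:
  assumes F: "finite F" "\<And>a. a \<in> F \<Longrightarrow> cmod a < 1" "\<And>a. a \<in> F \<Longrightarrow> rho a b < \<epsilon>" and b: "cmod b < 1"
    and sep: "\<And>a c. a \<in> F \<Longrightarrow> c \<in> F \<Longrightarrow> a \<noteq> c \<Longrightarrow> 2 * s \<le> rho a c"
    and s: "0 < s" "s < 1" and eps: "0 < \<epsilon>" "\<epsilon> < 1"
  shows "real (card F) * (s\<^sup>2 * (1 - s\<^sup>2) ^ 3 * (1 - \<epsilon>\<^sup>2)) \<le> (\<epsilon> + s)\<^sup>2"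
proof -
  have inj: "inj_on (mob b) F"
    by (rule inj_on_inverseI[of _ "mob b"]) (use F b in \<open>auto simp: mob_mob\<close>)
  have sep': "2 * s \<le> rho x y" if xy: "x \<in> mob b ` F" "y \<in> mob b ` F" "x \<noteq> y" for x y
  proof -
    obtain u v where "u \<in> F" "v \<in> F" "x = mob b u" "y = mob b v" using xy by blast
    moreover have "u \<noteq> v" using calculation xy by blast
    ultimately show ?thesis using sep[of u v] F b by (simp add: rho_mob)
  qed
  have "real (card (mob b ` F)) * (s\<^sup>2 * (1 - s\<^sup>2) ^ 3 * (1 - \<epsilon>\<^sup>2)) \<le> (\<epsilon> + s)\<^sup>2"
    by (rule card_separated_origin) (use F b sep' s eps in \<open>auto simp: norm_mob rho_mob\<close>)
  thus ?thesis using inj by (simp add: card_image)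
qed

section \<open>Banach-valued integrals\<close>

lemma cscale_zero_right [simp]: "cscale a (0::'x::complex_banach) = 0"
  using cscale_norm[of a "0::'x"] by simp

lemma cscale_zero_left [simp]: "cscale 0 (x::'x::complex_banach) = 0"
  using cscale_norm[of 0 x] by simp

lemma cscale_minus_left: "cscale (- a) (x::'x::complex_banach) = - cscale a x"
  using cscale_add_left[of a "-a" x] by (simp add: eq_neg_iff_add_eq_0 add.commute)

lemma cscale_minus_right: "cscale a (- x::'x::complex_banach) = - cscale a x"
  using cscale_add_right[of a x "-x"] by (simp add: eq_neg_iff_add_eq_0 add.commute)

lemma cscale_diff_left: "cscale (a - b) (x::'x::complex_banach) = cscale a x - cscale b x"
  using cscale_add_left[of a "-b" x] by (simp add: cscale_minus_left)

lemma cscale_diff_right: "cscale a (x - y::'x::complex_banach) = cscale a x - cscale a y"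
  using cscale_add_right[of a x "-y"] by (simp add: cscale_minus_right)

lemma bounded_linear_cscale_left: "bounded_linear (\<lambda>a. cscale a (x::'x::complex_banach))"
proof (rule bounded_linear_intro[of _ "norm x"])
  show "cscale (r *\<^sub>R a) x = r *\<^sub>R cscale a x" for r a
    unfolding scaleR_conv_of_real cscale_mult cscale_of_real ..
qed (auto simp: cscale_add_left cscale_norm)

lemma bounded_linear_cscale_right: "bounded_linear (cscale a :: 'x::complex_banach \<Rightarrow> 'x)"
proof (rule bounded_linear_intro[of _ "cmod a"])
  show "cscale a (r *\<^sub>R x) = r *\<^sub>R cscale a x" for r and x :: 'x
    unfolding cscale_of_real[symmetric] cscale_mult[symmetric] by (simp add: mult.commute)
qed (auto simp: cscale_add_right cscale_norm mult.commute)

lemma cscale_sum_left: "cscale (\<Sum>i\<in>A. a i) (x::'x::complex_banach) = (\<Sum>i\<in>A. cscale (a i) x)"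
  by (rule bounded_linear.linear[OF bounded_linear_cscale_left, THEN linear_sum])

lemma cscale_sum_right: "cscale a (\<Sum>i\<in>A. (x i::'x::complex_banach)) = (\<Sum>i\<in>A. cscale a (x i))"
  by (rule bounded_linear.linear[OF bounded_linear_cscale_right, THEN linear_sum])

text \<open>The values lie in a Banach space that need not be separable, so the Bochner integral of the
  library does not apply; the Henstock--Kurzweil integral does, by the next criterion.\<close>

lemma integrable_on_cbox_approx:
  fixes f :: "'n::euclidean_space \<Rightarrow> 'x::banach"
  assumes approx: "\<And>e. e > 0 \<Longrightarrow> \<exists>g h. g integrable_on cbox a b \<and> (h::'n\<Rightarrow>real) integrable_on cbox a b
    \<and> (\<forall>x\<in>cbox a b. norm (f x - g x) \<le> h x) \<and> integral (cbox a b) h < e"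
  shows "f integrable_on cbox a b"
  unfolding integrable_Cauchy
proof (intro allI impI)
  fix e :: real assume "e > 0"
  then obtain g :: "'n \<Rightarrow> 'x" and h :: "'n \<Rightarrow> real" where g: "g integrable_on cbox a b" and h: "h integrable_on cbox a b"
    and le: "\<And>x. x \<in> cbox a b \<Longrightarrow> norm (f x - g x) \<le> h x" and int: "integral (cbox a b) h < e / 8"
    using approx[of "e/8"] by auto
  have "(g has_integral integral (cbox a b) g) (cbox a b)" using g by (rule integrable_integral)
  then obtain \<gamma>1 where \<gamma>1: "gauge \<gamma>1" and g1: "\<And>D. D tagged_division_of cbox a b \<Longrightarrow> \<gamma>1 fine D \<Longrightarrow>
      norm ((\<Sum>(x,K)\<in>D. measure lborel K *\<^sub>R g x) - integral (cbox a b) g) < e / 4"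
    by (rule has_integralD[of _ _ _ _ "e/4"]) (use \<open>e > 0\<close> in auto)
  have "(h has_integral integral (cbox a b) h) (cbox a b)" using h by (rule integrable_integral)
  then obtain \<gamma>2 where \<gamma>2: "gauge \<gamma>2" and g2: "\<And>D. D tagged_division_of cbox a b \<Longrightarrow> \<gamma>2 fine D \<Longrightarrow>
      norm ((\<Sum>(x,K)\<in>D. measure lborel K *\<^sub>R h x) - integral (cbox a b) h) < e / 8"
    by (rule has_integralD[of _ _ _ _ "e/8"]) (use \<open>e > 0\<close> in auto)
  \<comment> \<open>A Riemann sum of h dominates the difference of the Riemann sums of f and g, and
    the gauge for h keeps that sum near the integral of h.\<close>
  have close: "norm ((\<Sum>(x,K)\<in>D. measure lborel K *\<^sub>R f x) - (\<Sum>(x,K)\<in>D. measure lborel K *\<^sub>R g x)) < e / 4"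
    if D: "D tagged_division_of cbox a b" "\<gamma>2 fine D" for D
  proof -
    have "norm ((\<Sum>(x,K)\<in>D. measure lborel K *\<^sub>R f x) - (\<Sum>(x,K)\<in>D. measure lborel K *\<^sub>R g x))
        = norm (\<Sum>(x,K)\<in>D. measure lborel K *\<^sub>R (f x - g x))"
      by (simp add: sum_subtractf[symmetric] case_prod_unfold scaleR_diff_right)
    also have "\<dots> \<le> (\<Sum>(x,K)\<in>D. measure lborel K *\<^sub>R h x)"
    proof (rule sum_norm_le)
      fix p assume p: "p \<in> D"
      obtain x K where xK: "p = (x, K)" by (cases p)
      have "x \<in> K" "K \<subseteq> cbox a b" using tagged_division_ofD(2,3)[OF D(1), of x K] p xK by auto
      hence "x \<in> cbox a b" by blast
      thus "norm (case p of (x, K) \<Rightarrow> measure lborel K *\<^sub>R (f x - g x)) \<le> (case p of (x, K) \<Rightarrow> measure lborel K *\<^sub>R h x)"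
        using le by (simp add: xK mult_left_mono)
    qed
    also have "\<dots> < e / 8 + integral (cbox a b) h"
    proof -
      have "\<bar>x - y\<bar> < c \<Longrightarrow> x < c + y" for x y c :: real by linarith
      from this[OF g2[OF D, unfolded real_norm_def]] show ?thesis by simp
    qed
    finally show ?thesis using int by simp
  qed
  show "\<exists>\<gamma>. gauge \<gamma> \<and> (\<forall>D1 D2. D1 tagged_division_of (cbox a b) \<and> \<gamma> fine D1 \<and>
            D2 tagged_division_of (cbox a b) \<and> \<gamma> fine D2 \<longrightarrow>
            norm ((\<Sum>(x,K)\<in>D1. measure lborel K *\<^sub>R f x) - (\<Sum>(x,K)\<in>D2. measure lborel K *\<^sub>R f x)) < e)"
  proof (intro exI[of _ "\<lambda>x. \<gamma>1 x \<inter> \<gamma>2 x"] conjI allI impI)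
    show "gauge (\<lambda>x. \<gamma>1 x \<inter> \<gamma>2 x)" using \<gamma>1 \<gamma>2 by (rule gauge_Int)
    fix D1 D2
    assume D: "D1 tagged_division_of (cbox a b) \<and> (\<lambda>x. \<gamma>1 x \<inter> \<gamma>2 x) fine D1 \<and>
            D2 tagged_division_of (cbox a b) \<and> (\<lambda>x. \<gamma>1 x \<inter> \<gamma>2 x) fine D2"
    hence fine: "\<gamma>1 fine D1" "\<gamma>2 fine D1" "\<gamma>1 fine D2" "\<gamma>2 fine D2" by (auto simp: fine_Int)
    let ?F1 = "\<Sum>(x,K)\<in>D1. measure lborel K *\<^sub>R f x" and ?F2 = "\<Sum>(x,K)\<in>D2. measure lborel K *\<^sub>R f x"
    let ?G1 = "\<Sum>(x,K)\<in>D1. measure lborel K *\<^sub>R g x" and ?G2 = "\<Sum>(x,K)\<in>D2. measure lborel K *\<^sub>R g x"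
    let ?I = "integral (cbox a b) g"
    have "norm (?F1 - ?F2) = norm (((?F1 - ?G1) + (?G1 - ?I)) - ((?F2 - ?G2) + (?G2 - ?I)))" by simp
    also have "\<dots> \<le> norm ((?F1 - ?G1) + (?G1 - ?I)) + norm ((?F2 - ?G2) + (?G2 - ?I))"
      by (rule norm_triangle_ineq4)
    also have "\<dots> \<le> (norm (?F1 - ?G1) + norm (?G1 - ?I)) + (norm (?F2 - ?G2) + norm (?G2 - ?I))"
      using norm_triangle_ineq[of "?F1 - ?G1" "?G1 - ?I"] norm_triangle_ineq[of "?F2 - ?G2" "?G2 - ?I"] by (rule add_mono)
    also have "\<dots> < (e/4 + e/4) + (e/4 + e/4)"
      using close[of D1] close[of D2] g1[of D1] g1[of D2] D fine by (intro add_strict_mono) auto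
    finally show "norm (?F1 - ?F2) < e" by simp
  qed
qed

abbreviation "disc \<equiv> ball (0::complex) 1"
text \<open>The integrability criterion speaks of boxes; functions on the disc are extended by zero
  to this square.\<close>

abbreviation "dbox \<equiv> cbox (Complex (-1) (-1)) (Complex 1 1)"

lemma disc_subset_dbox: "disc \<subseteq> dbox"
proof
  fix z :: complex assume "z \<in> disc"
  hence "\<bar>Re z\<bar> < 1" "\<bar>Im z\<bar> < 1"
    using abs_Re_le_cmod[of z] abs_Im_le_cmod[of z] by auto
  thus "z \<in> dbox" by (auto simp: in_cbox_complex_iff)
qed

lemma integrable_on_disc_iff:
  fixes f :: "complex \<Rightarrow> 'x::banach"
  shows "f integrable_on disc \<longleftrightarrow> (\<lambda>z. if z \<in> disc then f z else 0) integrable_on dbox"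
  unfolding integrable_on_def has_integral_restrict[OF disc_subset_dbox] ..

lemma integral_disc_eq:
  fixes f :: "complex \<Rightarrow> 'x::banach"
  shows "integral disc f = integral dbox (\<lambda>z. if z \<in> disc then f z else 0)"
  unfolding integral_def integrable_on_disc_iff has_integral_restrict[OF disc_subset_dbox] ..

lemma integrable_on_disc_approx:
  fixes f :: "complex \<Rightarrow> 'x::banach"
  assumes approx: "\<And>e. e > 0 \<Longrightarrow> \<exists>g h. g integrable_on disc \<and> (h::complex\<Rightarrow>real) integrable_on disc
    \<and> (\<forall>x\<in>disc. norm (f x - g x) \<le> h x) \<and> integral disc h < e"
  shows "f integrable_on disc"
  unfolding integrable_on_disc_iff
proof (rule integrable_on_cbox_approx)
  fix e :: real assume "e > 0"
  then obtain g :: "complex \<Rightarrow> 'x" and h where "g integrable_on disc" "(h::complex\<Rightarrow>real) integrable_on disc"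
    "\<forall>x\<in>disc. norm (f x - g x) \<le> h x" "integral disc h < e" using approx by blast
  thus "\<exists>g h. g integrable_on dbox \<and> (h::complex\<Rightarrow>real) integrable_on dbox \<and>
      (\<forall>x\<in>dbox. norm ((if x \<in> disc then f x else 0) - g x) \<le> h x) \<and> integral dbox h < e"
    unfolding integrable_on_disc_iff integral_disc_eq
    by (intro exI[of _ "\<lambda>z. if z \<in> disc then g z else 0"] exI[of _ "\<lambda>z. if z \<in> disc then h z else 0"]) auto
qed


lemma AE_lebesgue_negligible:
  "(AE w in lebesgue. P w) \<Longrightarrow> negligible {w. \<not> P (w::complex)}"
proof -
  assume "AE w in lebesgue. P w"
  then obtain N where "N \<in> null_sets lebesgue" "{w \<in> space lebesgue. \<not> P w} \<subseteq> N"
    unfolding eventually_ae_filter by blast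
  thus ?thesis by (auto simp: negligible_iff_null_sets[symmetric] intro: negligible_subset)
qed

text \<open>The envelope \<open>e n\<close> is a supremum of differences of the simple functions
  alone. It is therefore a bounded Borel majorant of the norm of f - s n, and it tends to 0 because
  the values s n w form a Cauchy sequence. All later limits become scalar dominated convergence for
  \<open>e n\<close>.\<close>

lemma Linf_approx:
  fixes f :: "complex \<Rightarrow> 'x::complex_banach"
  assumes "f \<in> Linf K"
  obtains C s e where "0 \<le> C" "\<And>n. simple_function lborel (s n)" "\<And>n w. norm (s n w) \<le> C"
    "\<And>n. (e n :: complex \<Rightarrow> real) \<in> borel_measurable borel" "\<And>n w. 0 \<le> e n w" "\<And>n w. e n w \<le> 2 * C"
    "AE w in lebesgue. (\<lambda>n. e n w) \<longlonglongrightarrow> 0" "AE w in lebesgue. \<forall>n. norm (f w - s n w) \<le> e n w"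
proof -
  obtain s0 :: "nat \<Rightarrow> complex \<Rightarrow> 'x" where s0: "\<And>n. finite (range (s0 n))" "\<And>n x. s0 n -` {x} \<in> sets lebesgue"
    and lim: "AE z in lebesgue. (\<lambda>n. s0 n z) \<longlonglongrightarrow> f z"
    using assms unfolding Linf_def smeas_def by auto
  obtain C0 where "AE z in lebesgue. norm (f z) \<le> C0" using assms unfolding Linf_def by auto
  hence C0: "AE z in lebesgue. norm (f z) \<le> \<bar>C0\<bar>" by eventually_elim simp
  have "simple_function lebesgue (s0 n)" for n
    using s0[of n] by (auto simp: simple_function_def)
  hence "\<exists>s1. simple_function lborel s1 \<and> (AE x in lborel. s0 n x = s1 x)" for n
    by (metis completion_ex_simple_function)
  then obtain s1 where s1: "\<And>n. simple_function lborel (s1 n)" "\<And>n. AE x in lborel. s0 n x = s1 n x" by metis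
  \<comment> \<open>The extra 1 makes the truncation at C eventually inactive wherever the
    approximation converges.\<close>
  define C where "C = \<bar>C0\<bar> + 1"
  define s where "s n w = (if norm (s1 n w) \<le> C then s1 n w else 0)" for n w
  have C: "0 \<le> C" by (simp add: C_def)
  have s: "simple_function lborel (s n)" for n
    unfolding s_def by (rule simple_function_compose1[where g = "\<lambda>y. if norm y \<le> C then y else 0", OF s1(1)])
  have sC: "norm (s n w) \<le> C" for n w using C by (simp add: s_def)
  \<comment> \<open>For m < n the term is set to 0, so that a supremum over all m is the supremum
    over m at least n.\<close>
  define d where "d m n w = (if n \<le> m then norm (s m w - s n w) else 0)" for m n w
  have dm: "d m n \<in> borel_measurable borel" for m n
  proof (cases "n \<le> m")
    case True
    have "simple_function lborel (\<lambda>w. norm (s m w - s n w))"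
      by (rule simple_function_compose2[OF s s])
    from borel_measurable_simple_function[OF this] show ?thesis using True by (simp add: d_def[abs_def])
  qed (simp add: d_def[abs_def])
  have d2: "d m n w \<le> 2 * C" for m n w
    using norm_triangle_ineq4[of "s m w" "s n w"] sC[of m w] sC[of n w] C by (simp add: d_def)
  have d0: "0 \<le> d m n w" for m n w by (simp add: d_def)
  have bdd: "bdd_above (range (\<lambda>m. d m n w))" for n w using d2 by (auto intro!: bdd_aboveI)
  define e where "e n w = (SUP m. d m n w)" for n w
  have em: "e n \<in> borel_measurable borel" for n
    unfolding e_def by (rule borel_measurable_cSUP) (use dm bdd in auto)
  have e0: "0 \<le> e n w" for n w unfolding e_def by (rule cSUP_upper2[OF bdd UNIV_I d0])
  have e2: "e n w \<le> 2 * C" for n w unfolding e_def by (rule cSUP_least) (auto simp: d2)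
  have de: "d m n w \<le> e n w" for m n w unfolding e_def by (rule cSUP_upper[OF UNIV_I bdd])
  have "AE w in lebesgue. \<forall>n. s0 n w = s1 n w"
    using s1(2) by (simp add: AE_all_countable AE_completion_iff)
  hence conv: "AE w in lebesgue. (\<lambda>n. s n w) \<longlonglongrightarrow> f w"
    using lim C0
  proof eventually_elim
    case (elim w)
    have "(\<lambda>n. norm (s0 n w)) \<longlonglongrightarrow> norm (f w)" using elim(2) by (rule tendsto_norm)
    hence "eventually (\<lambda>n. norm (s0 n w) < C) sequentially"
      by (rule order_tendstoD) (use elim in \<open>simp add: C_def\<close>)
    hence "eventually (\<lambda>n. s0 n w = s n w) sequentially"
      by eventually_elim (use elim in \<open>simp add: s_def\<close>)
    thus ?case using elim(2) by (simp add: filterlim_cong)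
  qed
  have lim0: "AE w in lebesgue. (\<lambda>n. e n w) \<longlonglongrightarrow> 0"
    using conv
  proof eventually_elim
    case (elim w)
    show ?case
    proof (rule LIMSEQ_I)
      fix r :: real assume "r > 0"
      have "Cauchy (\<lambda>n. s n w)" using elim by (rule LIMSEQ_imp_Cauchy)
      then obtain N where N: "\<And>m n. m \<ge> N \<Longrightarrow> n \<ge> N \<Longrightarrow> norm (s m w - s n w) < r / 2"
        using \<open>r > 0\<close> unfolding Cauchy_iff by (meson half_gt_zero)
      have "e n w \<le> r / 2" if "n \<ge> N" for n
        unfolding e_def
        by (rule cSUP_least) (use that \<open>r > 0\<close> N[of _ n] in \<open>auto simp: d_def less_imp_le\<close>)
      thus "\<exists>no. \<forall>n\<ge>no. norm (e n w - 0) < r" using e0 \<open>r > 0\<close> by (intro exI[of _ N]) force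
    qed
  qed
  have le: "AE w in lebesgue. \<forall>n. norm (f w - s n w) \<le> e n w"
    using conv
  proof eventually_elim
    case (elim w)
    show ?case
    proof
      fix n
      have "(\<lambda>m. norm (s m w - s n w)) \<longlonglongrightarrow> norm (f w - s n w)"
        by (intro tendsto_intros elim)
      moreover have "eventually (\<lambda>m. norm (s m w - s n w) \<le> e n w) sequentially"
        using eventually_ge_at_top[of n]
      proof eventually_elim
        case (elim m)
        thus ?case using de[of m n w] by (simp add: d_def)
      qed
      ultimately show "norm (f w - s n w) \<le> e n w" by (rule tendsto_upperbound) simp
    qed
  qed
  show ?thesis by (rule that[of C s e]) fact+
qed

section \<open>Integration of a vector-valued function against a scalar kernel\<close>

definition vint :: "(complex \<Rightarrow> complex) \<Rightarrow> (complex \<Rightarrow> 'x::complex_banach) \<Rightarrow> 'x" where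
  "vint k f = integral disc (\<lambda>w. cscale (k w) (f w))"

lemma set_integrable_disc_cmult_bounded:
  fixes k :: "complex \<Rightarrow> complex" and e :: "complex \<Rightarrow> real"
  assumes k: "set_integrable lborel disc k" and [measurable]: "e \<in> borel_measurable borel"
    and e: "\<And>w. \<bar>e w\<bar> \<le> C"
  shows "set_integrable lborel disc (\<lambda>w. cmod (k w) * e w)"
proof -
  have "integrable lborel (\<lambda>w. cmod (indicator disc w *\<^sub>R k w) * C)"
    using k unfolding set_integrable_def by (intro integrable_mult_left integrable_norm) 
  moreover have [measurable]: "(\<lambda>w. indicator disc w *\<^sub>R k w) \<in> borel_measurable lborel"
    using k unfolding set_integrable_def by auto
  have "(\<lambda>w. cmod (indicator disc w *\<^sub>R k w) * e w) \<in> borel_measurable lborel" by measurable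
  ultimately have "integrable lborel (\<lambda>w. cmod (indicator disc w *\<^sub>R k w) * e w)"
    by (rule Bochner_Integration.integrable_bound) (use order_trans[OF e abs_ge_self] in \<open>auto simp: abs_mult intro!: AE_I2 mult_left_mono\<close>)
  thus ?thesis unfolding set_integrable_def by (simp add: mult_ac)
qed

lemma vint_integrable_simple:
  fixes s :: "complex \<Rightarrow> 'x::complex_banach"
  assumes k: "set_integrable lborel disc k" and s: "simple_function lborel s"
  shows "((\<lambda>w. cscale (k w) (s w)) has_integral
     (\<Sum>y\<in>range s. cscale (LINT w:disc|lborel. indicator (s -` {y}) w *\<^sub>R k w) y)) disc"
proof -
  have fin: "finite (range s)" using s by (simp add: simple_function_def)
  have meas: "s -` {y} \<in> sets borel" for y
    using simple_functionD(2)[OF s, of "{y}"] by simp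
  have ki: "set_integrable lborel disc (\<lambda>w. indicator (s -` {y}) w *\<^sub>R k w)" for y
  proof -
    have "integrable lborel (\<lambda>w. indicator (s -` {y}) w *\<^sub>R (indicator disc w *\<^sub>R k w))"
      by (rule integrable_mult_indicator) (use k meas in \<open>auto simp: set_integrable_def\<close>)
    thus ?thesis by (simp add: set_integrable_def mult.commute)
  qed
  have "((\<lambda>w. \<Sum>y\<in>range s. cscale (indicator (s -` {y}) w *\<^sub>R k w) y) has_integral
     (\<Sum>y\<in>range s. cscale (LINT w:disc|lborel. indicator (s -` {y}) w *\<^sub>R k w) y)) disc"
  proof (rule has_integral_sum[OF fin])
    fix y
    have "((\<lambda>w. indicator (s -` {y}) w *\<^sub>R k w) has_integral (LINT w:disc|lborel. indicator (s -` {y}) w *\<^sub>R k w)) disc"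
      using set_borel_integral_eq_integral[OF ki[of y]] by (simp add: has_integral_integral)
    from has_integral_linear[OF this bounded_linear_cscale_left[of y]]
    show "((\<lambda>w. cscale (indicator (s -` {y}) w *\<^sub>R k w) y) has_integral
       cscale (LINT w:disc|lborel. indicator (s -` {y}) w *\<^sub>R k w) y) disc" by (simp add: o_def)
  qed
  moreover have "(\<Sum>y\<in>range s. cscale (indicator (s -` {y}) w *\<^sub>R k w) y) = cscale (k w) (s w)" for w
  proof -
    have "(\<Sum>y\<in>range s. cscale (indicator (s -` {y}) w *\<^sub>R k w) y)
        = (\<Sum>y\<in>range s. if y = s w then cscale (k w) y else 0)"
      by (intro sum.cong) (auto simp: indicator_def)
    thus ?thesis using fin by (simp add: sum.delta)
  qed
  ultimately show ?thesis by simp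
qed

text \<open>The majorant e holds only almost everywhere. Both integrands are set to 0 on the
  exceptional null set before the pointwise comparison, which changes neither integral.\<close>

lemma vint_norm_le:
  fixes f :: "complex \<Rightarrow> 'x::complex_banach"
  assumes int: "(\<lambda>w. cscale (k w) (f w)) integrable_on disc"
    and e: "set_integrable lborel disc (\<lambda>w. cmod (k w) * e w)" and le: "AE w in lebesgue. norm (f w) \<le> e w"
  shows "norm (vint k f) \<le> (LINT w:disc|lborel. cmod (k w) * e w)"
proof -
  define N where "N = {w. \<not> norm (f w) \<le> e w}"
  have N: "negligible N" unfolding N_def by (rule AE_lebesgue_negligible[OF le])
  define g where "g w = (if w \<in> N then 0 else cscale (k w) (f w))" for w
  define h where "h w = (if w \<in> N then 0 else cmod (k w) * e w)" for w
  have gi: "g integrable_on disc" by (rule integrable_spike[OF int N]) (auto simp: g_def)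
  have hi: "h integrable_on disc"
    by (rule integrable_spike[OF set_borel_integral_eq_integral(1)[OF e] N]) (auto simp: h_def)
  have "vint k f = integral disc g"
    unfolding vint_def by (rule integral_spike[OF N]) (auto simp: g_def)
  also have "norm \<dots> \<le> integral disc h"
    by (rule Henstock_Kurzweil_Integration.integral_norm_bound_integral[OF gi hi])
       (auto simp: g_def h_def cscale_norm N_def intro: mult_left_mono)
  also have "integral disc h = integral disc (\<lambda>w. cmod (k w) * e w)"
    by (rule integral_spike[OF N]) (auto simp: h_def)
  also have "\<dots> = (LINT w:disc|lborel. cmod (k w) * e w)"
    using set_borel_integral_eq_integral(2)[OF e] by simp
  finally show ?thesis .
qed

lemma vint_dominated_tendsto:
  fixes k :: "complex \<Rightarrow> complex"
  assumes k: "set_integrable lborel disc k" and "\<And>n. (e n :: complex \<Rightarrow> real) \<in> borel_measurable borel"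
    "\<And>n w. 0 \<le> e n w" "\<And>n w. e n w \<le> C" "AE w in lebesgue. (\<lambda>n. e n w) \<longlonglongrightarrow> 0"
  shows "(\<lambda>n. LINT w:disc|lborel. cmod (k w) * e n w) \<longlonglongrightarrow> 0"
proof -
  have "AE w in lborel. (\<lambda>n. e n w) \<longlonglongrightarrow> 0" using assms(5) by (simp add: AE_completion_iff)
  hence ae: "AE w in lborel. (\<lambda>n. indicator disc w *\<^sub>R (cmod (k w) * e n w)) \<longlonglongrightarrow> 0"
    by eventually_elim (auto intro!: tendsto_eq_intros)
  have si: "set_integrable lborel disc (\<lambda>w. cmod (k w) * e n w)" for n
    by (rule set_integrable_disc_cmult_bounded[OF k, of _ C]) (use assms in \<open>auto simp: abs_of_nonneg\<close>)
  have "(\<lambda>n. LINT w|lborel. indicator disc w *\<^sub>R (cmod (k w) * e n w)) \<longlonglongrightarrow> integral\<^sup>L lborel (\<lambda>w::complex. 0::real)"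
  proof (rule integral_dominated_convergence[OF _ _ _ ae])
    show "integrable lborel (\<lambda>w. cmod (indicator disc w *\<^sub>R k w) * C)"
      using k unfolding set_integrable_def by (intro integrable_mult_left integrable_norm)
    show "(\<lambda>w. indicator disc w *\<^sub>R (cmod (k w) * e n w)) \<in> borel_measurable lborel" for n
      using si[of n] unfolding set_integrable_def by auto
    show "AE w in lborel. norm (indicator disc w *\<^sub>R (cmod (k w) * e n w)) \<le> cmod (indicator disc w *\<^sub>R k w) * C" for n
      using assms(3,4) by (intro AE_I2) (auto simp: indicator_def abs_mult intro!: mult_left_mono)
  qed auto
  thus ?thesis by (simp add: set_lebesgue_integral_def)
qed

text \<open>The approximation criterion is fed with the simple functions and the error |k| * e n,
  whose integral tends to 0 by dominated convergence; the null set where the error bound fails is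
  cut out.\<close>

lemma vint_integrable:
  fixes f :: "complex \<Rightarrow> 'x::complex_banach"
  assumes k: "set_integrable lborel disc k" and f: "f \<in> Linf K"
  shows "(\<lambda>w. cscale (k w) (f w)) integrable_on disc"
proof -
  obtain C s e where C: "0 \<le> C" and s: "\<And>n. simple_function lborel (s n)" "\<And>n w. norm (s n w) \<le> C"
    and e: "\<And>n. (e n :: complex \<Rightarrow> real) \<in> borel_measurable borel" "\<And>n w. 0 \<le> e n w" "\<And>n w. e n w \<le> 2 * C"
    "AE w in lebesgue. (\<lambda>n. e n w) \<longlonglongrightarrow> 0" and le: "AE w in lebesgue. \<forall>n. norm (f w - s n w) \<le> e n w"
    by (rule Linf_approx[OF f]) blast
  define N where "N = {w. \<not> (\<forall>n. norm (f w - s n w) \<le> e n w)}"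
  have N: "negligible N" unfolding N_def by (rule AE_lebesgue_negligible[OF le])
  have "(\<lambda>w. if w \<in> N then 0 else cscale (k w) (f w)) integrable_on disc"
  proof (rule integrable_on_disc_approx)
    fix r :: real assume "r > 0"
    have lim: "(\<lambda>n. LINT w:disc|lborel. cmod (k w) * e n w) \<longlonglongrightarrow> 0"
      by (rule vint_dominated_tendsto[OF k]) fact+
    hence "eventually (\<lambda>n. (LINT w:disc|lborel. cmod (k w) * e n w) < r) sequentially"
      using \<open>r > 0\<close> by (rule order_tendstoD)
    then obtain n where n: "(LINT w:disc|lborel. cmod (k w) * e n w) < r"
      by (auto simp: eventually_sequentially)
    have si: "set_integrable lborel disc (\<lambda>w. cmod (k w) * e n w)"
      by (rule set_integrable_disc_cmult_bounded[OF k, of _ "2 * C"]) (use e in \<open>auto simp: abs_of_nonneg\<close>)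
    have gi: "(\<lambda>w. if w \<in> N then 0 else cscale (k w) (s n w)) integrable_on disc"
      by (rule integrable_spike[OF has_integral_integrable[OF vint_integrable_simple[OF k s(1)[of n]]] N]) auto
    show "\<exists>g h. g integrable_on disc \<and> (h::complex\<Rightarrow>real) integrable_on disc \<and>
        (\<forall>x\<in>disc. norm ((if x \<in> N then 0 else cscale (k x) (f x)) - g x) \<le> h x) \<and> integral disc h < r"
    proof (intro exI conjI ballI)
      show "(\<lambda>w. if w \<in> N then 0 else cscale (k w) (s n w)) integrable_on disc" by fact
      show "(\<lambda>w. cmod (k w) * e n w) integrable_on disc"
        using set_borel_integral_eq_integral(1)[OF si] .
      show "integral disc (\<lambda>w. cmod (k w) * e n w) < r"
        using set_borel_integral_eq_integral(2)[OF si] n by simp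
      show "norm ((if x \<in> N then 0 else cscale (k x) (f x)) - (if x \<in> N then 0 else cscale (k x) (s n x))) \<le> cmod (k x) * e n x"
        if "x \<in> disc" for x
        using e(2)[of n x] by (auto simp: cscale_diff_right[symmetric] cscale_norm N_def intro!: mult_left_mono)
    qed
  qed
  thus ?thesis by (rule integrable_spike[OF _ N]) auto
qed

text \<open>The infimum is attained: the sets where the bounds \<open>essnorm f\<close> + 1/(n+1)
  fail form a countable union of null sets.\<close>

lemma AE_le_essnorm:
  fixes f :: "complex \<Rightarrow> 'x::complex_banach"
  assumes "f \<in> Linf K"
  shows "AE w in lebesgue. norm (f w) \<le> essnorm f" "0 \<le> essnorm f"
proof -
  define S where "S = {C. C \<ge> 0 \<and> (AE z in lebesgue. norm (f z) \<le> C)}"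
  obtain C0 where "AE z in lebesgue. norm (f z) \<le> C0" using assms unfolding Linf_def by auto
  hence "AE z in lebesgue. norm (f z) \<le> \<bar>C0\<bar>" by eventually_elim simp
  hence ne: "S \<noteq> {}" by (auto simp: S_def intro: abs_ge_zero)
  show "0 \<le> essnorm f" unfolding essnorm_def S_def[symmetric] by (rule cInf_greatest[OF ne]) (auto simp: S_def)
  have "AE w in lebesgue. norm (f w) \<le> essnorm f + 1 / real (Suc n)" for n
  proof -
    have "Inf S < essnorm f + 1 / real (Suc n)" by (simp add: essnorm_def S_def)
    then obtain C where "C \<in> S" "C < essnorm f + 1 / real (Suc n)" using cInf_lessD[OF ne] by blast
    thus ?thesis unfolding S_def by (auto elim!: eventually_mono)
  qed
  hence "AE w in lebesgue. \<forall>n. norm (f w) \<le> essnorm f + 1 / real (Suc n)" by (simp add: AE_all_countable)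
  thus "AE w in lebesgue. norm (f w) \<le> essnorm f"
  proof eventually_elim
    case (elim w)
    have "(\<lambda>n. essnorm f + 1 / real (Suc n)) \<longlonglongrightarrow> essnorm f + 0"
      by (intro tendsto_intros LIMSEQ_inverse_real_of_nat[unfolded inverse_eq_divide])
    thus ?case using elim by (intro LIMSEQ_le_const[of _ "essnorm f"]) auto
  qed
qed

lemma vint_bound:
  fixes f :: "complex \<Rightarrow> 'x::complex_banach"
  assumes k: "set_integrable lborel disc k" and f: "f \<in> Linf K"
    and M: "(LINT w:disc|lborel. cmod (k w)) \<le> M"
  shows "norm (vint k f) \<le> M * essnorm f"
proof -
  have "norm (vint k f) \<le> (LINT w:disc|lborel. cmod (k w) * essnorm f)"
    by (rule vint_norm_le[OF vint_integrable[OF k f] set_integrable_disc_cmult_bounded[OF k, of _ "essnorm f"] AE_le_essnorm(1)[OF f]])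
       (use AE_le_essnorm(2)[OF f] in auto)
  also have "\<dots> = (LINT w:disc|lborel. cmod (k w)) * essnorm f" by simp
  also have "\<dots> \<le> M * essnorm f" using M AE_le_essnorm(2)[OF f] by (rule mult_right_mono)
  finally show ?thesis .
qed

lemma vint_add_right:
  assumes "set_integrable lborel disc k" "f \<in> Linf K" "g \<in> Linf K"
  shows "vint k (\<lambda>w. f w + g w) = vint k f + vint k g"
  unfolding vint_def cscale_add_right
  by (rule Henstock_Kurzweil_Integration.integral_add) (use assms vint_integrable in auto)

lemma vint_cscale_right:
  assumes "set_integrable lborel disc k" "f \<in> Linf K"
  shows "vint k (\<lambda>w. cscale a (f w)) = cscale a (vint k f)"
proof -
  have "cscale (k w) (cscale a (f w)) = cscale a (cscale (k w) (f w))" for w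
    unfolding cscale_mult[symmetric] by (simp add: mult.commute)
  thus ?thesis using integral_linear[OF vint_integrable[OF assms] bounded_linear_cscale_right[of a]]
    by (simp add: vint_def o_def)
qed

lemma vint_cmult_left:
  assumes "set_integrable lborel disc k" "f \<in> Linf K"
  shows "vint (\<lambda>w. a * k w) f = cscale a (vint k f)"
  using integral_linear[OF vint_integrable[OF assms] bounded_linear_cscale_right[of a]]
  by (simp add: vint_def o_def cscale_mult)

lemma vint_diff_left:
  assumes "set_integrable lborel disc k" "set_integrable lborel disc l" "f \<in> Linf K"
  shows "vint (\<lambda>w. k w - l w) f = vint k f - vint l f"
  unfolding vint_def cscale_diff_left
  by (rule Henstock_Kurzweil_Integration.integral_diff) (use assms vint_integrable in auto)

lemma vint_sum_left:
  assumes "finite I" "\<And>i. i \<in> I \<Longrightarrow> set_integrable lborel disc (k i)" "f \<in> Linf K"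
  shows "vint (\<lambda>w. \<Sum>i\<in>I. k i w) f = (\<Sum>i\<in>I. vint (k i) f)"
  unfolding vint_def cscale_sum_left
  by (rule Henstock_Kurzweil_Integration.integral_sum) (use assms vint_integrable in auto)

lemma vint_cong:
  fixes f g :: "complex \<Rightarrow> 'x::complex_banach"
  assumes "AE w in lebesgue. w \<in> disc \<longrightarrow> cscale (k w) (f w) = cscale (l w) (g w)"
  shows "vint k f = vint l g"
  unfolding vint_def
  by (rule integral_spike[OF AE_lebesgue_negligible[OF assms]]) auto

section \<open>Holomorphic dependence on a parameter\<close>

text \<open>The non-strict bound is reduced to the strict one by scaling with t < 1; the estimate
  for every such t gives the claim.\<close>

lemma Schwarz_le:
  assumes "f holomorphic_on ball 0 1" "f 0 = 0" "\<And>z. cmod z < 1 \<Longrightarrow> cmod (f z) \<le> 1" "cmod z < 1"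
  shows "cmod (f z) \<le> cmod z"
proof (rule field_le_mult_one_interval)
  fix t :: real assume t: "0 < t" "t < 1"
  have "cmod (of_real t * f z) \<le> cmod z"
  proof (rule Schwarz_Lemma(1))
    show "(\<lambda>z. of_real t * f z) holomorphic_on ball 0 1" using assms by (intro holomorphic_intros)
    show "cmod (of_real t * f z) < 1" if "cmod z < 1" for z
    proof -
      have "t * cmod (f z) \<le> t * 1" using assms(3)[OF that] t by (intro mult_left_mono) auto
      moreover have "cmod (of_real t * f z) = t * cmod (f z)" using t by (simp add: norm_mult)
      ultimately show ?thesis using t by linarith
    qed
  qed (use assms in auto)
  thus "t * cmod (f z) \<le> cmod z" using t by (simp add: norm_mult)
qed

text \<open>Schwarz applied to the increment f - f c, bounded by 2 M, after rescaling the ball to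
  the unit disc; M = 0 is set apart since M is a divisor.\<close>

lemma Schwarz_ball:
  assumes hol: "f holomorphic_on ball c d" and d: "0 < d" and M: "\<And>z. z \<in> ball c d \<Longrightarrow> cmod (f z) \<le> M" and z: "z \<in> ball c d"
  shows "cmod (f z - f c) \<le> 2 * M / d * cmod (z - c)"
proof (cases "M = 0")
  case True
  thus ?thesis using M[OF z] M[of c] d by simp
next
  case False
  have "0 \<le> M" using M[of c] d by (meson centre_in_ball norm_ge_zero order_trans)
  hence Mp: "0 < M" using False by simp
  define g where "g u = (f (c + of_real d * u) - f c) / of_real (2 * M)" for u
  have in_ball: "c + of_real d * u \<in> ball c d" if "cmod u < 1" for u
    using that d by (simp add: dist_norm norm_mult)
  have "cmod (g ((z - c) / of_real d)) \<le> cmod ((z - c) / of_real d)"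
  proof (rule Schwarz_le)
    have "(f \<circ> (\<lambda>u. c + of_real d * u)) holomorphic_on ball 0 1"
      by (rule holomorphic_on_compose_gen[OF _ hol]) (use in_ball in \<open>auto intro!: holomorphic_intros\<close>)
    thus "g holomorphic_on ball 0 1" unfolding g_def using Mp
      by (intro holomorphic_intros) (auto simp: o_def)
    show "cmod (g u) \<le> 1" if u: "cmod u < 1" for u
    proof -
      have "cmod (f (c + of_real d * u) - f c) \<le> M + M"
        using M[OF in_ball[OF u]] M[of c] d by (intro order_trans[OF norm_triangle_ineq4] add_mono) auto
      thus ?thesis using Mp by (simp add: g_def norm_divide norm_mult)
    qed
    show "cmod ((z - c) / of_real d) < 1" using z d by (simp add: norm_divide dist_norm norm_minus_commute)
  qed (simp add: g_def)
  thus ?thesis using d Mp by (simp add: g_def norm_divide norm_mult field_simps)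
qed

lemma norm_deriv_ball_le:
  assumes hol: "f holomorphic_on ball c d" and d: "0 < d" and M: "\<And>z. z \<in> ball c d \<Longrightarrow> cmod (f z) \<le> M"
  shows "cmod (deriv f c) \<le> 2 * M / d"
proof -
  have "(f has_field_derivative deriv f c) (at c)"
    using hol d by (meson centre_in_ball holomorphic_derivI open_ball)
  hence "((\<lambda>z. (f z - f c) / (z - c)) \<longlongrightarrow> deriv f c) (at c)" by (simp add: has_field_derivative_iff)
  moreover have "eventually (\<lambda>z. cmod ((f z - f c) / (z - c)) \<le> 2 * M / d) (at c)"
    unfolding eventually_at
  proof (intro exI[of _ d] conjI ballI impI)
    fix z assume "z \<noteq> c \<and> dist z c < d"
    thus "cmod ((f z - f c) / (z - c)) \<le> 2 * M / d"
      using Schwarz_ball[OF hol d M, of z] by (simp add: norm_divide divide_le_eq dist_commute)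
  qed (use d in auto)
  ultimately show ?thesis by (rule Lim_norm_ubound[rotated]) simp
qed

text \<open>With its removable singularity filled in, the difference quotient is holomorphic and
  bounded by 2 M / d, so Schwarz applies to it again. The bound depends on f only through M, which
  permits differentiation under an integral.\<close>

lemma difference_quotient_remainder:
  assumes hol: "f holomorphic_on ball c d" and d: "0 < d" and M: "\<And>z. z \<in> ball c d \<Longrightarrow> cmod (f z) \<le> M"
    and z: "z \<in> ball c d" "z \<noteq> c"
  shows "cmod ((f z - f c) / (z - c) - deriv f c) \<le> 4 * M / d\<^sup>2 * cmod (z - c)"
proof -
  define Q where "Q z = (if z = c then deriv f c else (f z - f c) / (z - c))" for z
  have Q: "Q holomorphic_on ball c d" unfolding Q_def by (rule pole_lemma_open) (use hol in auto)
  have "cmod (Q z) \<le> 2 * M / d" if "z \<in> ball c d" for z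
    using Schwarz_ball[OF hol d M that] norm_deriv_ball_le[OF hol d M]
    by (auto simp: Q_def norm_divide divide_le_eq)
  from Schwarz_ball[OF Q d this z(1)] show ?thesis
    using z by (simp add: Q_def power2_eq_square)
qed

text \<open>The constant 1 + |g w| rather than 2 matters where g w is small: on a cell it is close
  to 1 for the Blaschke product of the family.\<close>

lemma Schwarz_Pick_diff:
  assumes "g holomorphic_on disc" "\<And>z. z \<in> disc \<Longrightarrow> cmod (g z) \<le> 1" "z \<in> disc" "w \<in> disc"
  shows "cmod (g z - g w) \<le> (1 + cmod (g w)) * rho z w"
proof -
  define K where "K = 1 + cmod (g w)"
  define h where "h u = (g (mob w u) - g w) / of_real K" for u
  have p: "0 < K" by (simp add: K_def add_pos_nonneg)
  have w: "cmod w < 1" "cmod z < 1" using assms by auto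
  have "cmod (h (mob w z)) \<le> cmod (mob w z)"
  proof (rule Schwarz_le)
    have "(g \<circ> mob w) holomorphic_on ball 0 1"
      by (rule holomorphic_on_compose_gen[OF mob_holomorphic[OF w(1)] assms(1)]) (use mob_in_disc w in auto)
    hence "(\<lambda>u. g (mob w u)) holomorphic_on ball 0 1" by (simp add: o_def)
    thus "h holomorphic_on ball 0 1" unfolding h_def using p
      by (intro holomorphic_intros) auto
    show "h 0 = 0" by (simp add: h_def mob_def)
    show "cmod (h u) \<le> 1" if "cmod u < 1" for u
    proof -
      have "cmod (g (mob w u) - g w) \<le> 1 + cmod (g w)"
        using assms(2)[of "mob w u"] mob_in_disc[OF w(1) that]
        by (intro order_trans[OF norm_triangle_ineq4 add_right_mono]) auto
      thus ?thesis using p by (simp add: h_def norm_divide K_def[symmetric])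
    qed
    show "cmod (mob w z) < 1" using mob_in_disc w by simp
  qed
  hence "cmod (g z - g w) / K \<le> rho z w"
    using p w by (simp add: h_def mob_mob norm_mob norm_divide)
  thus ?thesis using p by (simp add: K_def[symmetric] divide_le_eq mult.commute)
qed

lemma set_integrable_disc_bounded:
  fixes k :: "complex \<Rightarrow> complex"
  assumes "(\<lambda>w. indicator disc w *\<^sub>R k w) \<in> borel_measurable borel" "\<And>w. w \<in> disc \<Longrightarrow> cmod (k w) \<le> B"
  shows "set_integrable lborel disc k" "(LINT w:disc|lborel. cmod (k w)) \<le> pi * B"
proof -
  have "0 \<le> B" using assms(2)[of 0] by (meson centre_in_ball norm_ge_zero order_trans zero_less_one)
  have fm: "emeasure lborel disc < \<infinity>" by (simp add: emeasure_ball_complex)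
  have i: "integrable lborel (\<lambda>w. indicator disc w *\<^sub>R B :: real)"
  proof -
    have "integrable lborel (indicator disc :: complex \<Rightarrow> real)"
      by (rule integrable_real_indicator) (use fm in auto)
    thus ?thesis by simp
  qed
  show si: "set_integrable lborel disc k"
    unfolding set_integrable_def
    by (rule Bochner_Integration.integrable_bound[OF i])
       (use assms \<open>0 \<le> B\<close> in \<open>auto simp: indicator_def\<close>)
  have "(LINT w:disc|lborel. cmod (k w)) \<le> (LINT w:disc|lborel. B)"
    unfolding set_lebesgue_integral_def
    by (rule integral_mono[OF _ i]) (use si[unfolded set_integrable_def, THEN integrable_norm] assms in \<open>auto simp: indicator_def\<close>)
  also have "\<dots> = measure lborel disc * B" by (simp add: set_lebesgue_integral_def)
  also have "measure lborel disc = pi" by (simp add: measure_def emeasure_ball_complex)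
  finally show "(LINT w:disc|lborel. cmod (k w)) \<le> pi * B" .
qed

text \<open>Here q is the kernel as written and p the same kernel with the diagonal value filled in;
  for fixed z they differ in at most one point w. The remainder bound of
  \<open>difference_quotient_remainder\<close> is uniform in w and thus turns pointwise
  differentiability of the kernel into norm differentiability of the integral.\<close>

lemma vholo_vint:
  fixes f :: "complex \<Rightarrow> 'x::complex_banach"
  assumes meas: "\<And>z. z \<in> disc \<Longrightarrow> set_integrable lborel disc (q z)"
    and hol: "\<And>w. w \<in> disc \<Longrightarrow> (\<lambda>z. p z w) holomorphic_on disc"
    and eq: "\<And>z w. z \<in> disc \<Longrightarrow> w \<in> disc \<Longrightarrow> z \<noteq> w \<Longrightarrow> p z w = q z w"
    and bnd: "\<And>R. 0 < R \<Longrightarrow> R < 1 \<Longrightarrow> \<exists>M. \<forall>w\<in>disc. \<forall>z\<in>cball 0 R. cmod (p z w) \<le> M"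
    and f: "f \<in> Linf K"
  shows "vholo disc (\<lambda>z. vint (q z) f)"
  unfolding vholo_def
proof
  fix c assume c: "c \<in> disc"
  define d where "d = (1 - cmod c) / 2"
  have d: "0 < d" using c by (simp add: d_def)
  have dR: "z \<in> cball 0 ((1 + cmod c) / 2)" if "z \<in> ball c d" for z
    using that norm_triangle_ineq2[of z c] by (simp add: d_def dist_norm norm_minus_commute field_simps)
  have "0 < (1 + cmod c) / 2" "(1 + cmod c) / 2 < 1" using c by (auto simp: add_pos_nonneg)
  then obtain M where "\<forall>w\<in>disc. \<forall>z\<in>cball 0 ((1 + cmod c) / 2). cmod (p z w) \<le> M" using bnd by blast
  hence M: "\<And>w z. w \<in> disc \<Longrightarrow> z \<in> cball 0 ((1 + cmod c) / 2) \<Longrightarrow> cmod (p z w) \<le> M" by blast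
  have M0: "0 \<le> M" by (rule order_trans[OF norm_ge_zero M[of 0 c]]) (use c in auto)
  have sub: "ball c d \<subseteq> disc" using dR c by fastforce
  define D where "D w = deriv (\<lambda>z. p z w) c" for w
  have holc: "(\<lambda>z. p z w) holomorphic_on ball c d" if "w \<in> disc" for w
    using hol[OF that] sub by (rule holomorphic_on_subset)
  have Mc: "cmod (p z w) \<le> M" if "w \<in> disc" "z \<in> ball c d" for z w
    using M[OF that(1) dR[OF that(2)]] .
  note rem = difference_quotient_remainder[OF holc d Mc, folded D_def]
  have Dle: "cmod (D w) \<le> 2 * M / d" if "w \<in> disc" for w
    unfolding D_def by (rule norm_deriv_ball_le[OF holc[OF that] d Mc[OF that]])
  have ind: "(\<lambda>w. indicator disc w *\<^sub>R p z w) \<in> borel_measurable borel" if z: "z \<in> disc" for z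
  proof -
    have m: "(\<lambda>w. indicator disc w *\<^sub>R q z w) \<in> borel_measurable borel"
      using meas[OF z] by (auto simp: set_integrable_def)
    have "(\<lambda>w. indicator disc w *\<^sub>R p z w) = (\<lambda>w. if w = z then p z z else indicator disc w *\<^sub>R q z w)"
      using z eq by (auto simp: indicator_def fun_eq_iff)
    thus ?thesis using m by (simp add: measurable_If)
  qed
  have p_int: "set_integrable lborel disc (p z)" if "z \<in> ball c d" for z
    by (rule set_integrable_disc_bounded[of _ M]) (use ind sub that Mc in auto)
  \<comment> \<open>The derivative in z is a measurable function of w because it is the limit of
    difference quotients along one fixed sequence.\<close>
  have Dmeas: "(\<lambda>w. indicator disc w *\<^sub>R D w) \<in> borel_measurable borel"
  proof (rule borel_measurable_LIMSEQ_metric)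
    define h where "h n = c + of_real (d / real (Suc (Suc n)))" for n
    have h: "h n \<in> ball c d" "h n \<noteq> c" for n
    proof -
      define t where "t = d / real (Suc (Suc n))"
      have "0 < t" "t < d" using d by (auto simp: t_def divide_less_eq)
      moreover have "h n = c + of_real t" by (simp only: h_def t_def)
      ultimately show "h n \<in> ball c d" "h n \<noteq> c" by (auto simp: dist_norm)
    qed
    have hlim: "h \<longlonglongrightarrow> c"
    proof -
      have "(\<lambda>n. d * inverse (real (Suc (Suc n)))) \<longlonglongrightarrow> d * 0"
        by (intro tendsto_intros LIMSEQ_Suc[OF LIMSEQ_inverse_real_of_nat])
      hence "(\<lambda>n. c + of_real (d / real (Suc (Suc n)))) \<longlonglongrightarrow> c + of_real 0"
        by (intro tendsto_intros) (simp add: divide_inverse)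
      thus ?thesis by (simp add: h_def[abs_def])
    qed
    show "(\<lambda>w. (indicator disc w *\<^sub>R p (h n) w - indicator disc w *\<^sub>R p c w) / (h n - c)) \<in> borel_measurable borel" for n
    proof -
      have "h n \<in> disc" using h(1) sub by blast
      from ind[OF this] ind[OF c] show ?thesis
        by (intro borel_measurable_divide borel_measurable_diff borel_measurable_const) 
    qed
    fix w :: complex
    show "(\<lambda>n. (indicator disc w *\<^sub>R p (h n) w - indicator disc w *\<^sub>R p c w) / (h n - c)) \<longlonglongrightarrow> indicator disc w *\<^sub>R D w"
    proof (cases "w \<in> disc")
      case True
      have "((\<lambda>z. p z w) has_field_derivative D w) (at c)"
        unfolding D_def using holc[OF True] d by (meson centre_in_ball holomorphic_derivI open_ball)
      hence "((\<lambda>z. (p z w - p c w) / (z - c)) \<longlongrightarrow> D w) (at c)" by (simp add: has_field_derivative_iff)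
      hence "(\<lambda>n. (p (h n) w - p c w) / (h n - c)) \<longlonglongrightarrow> D w"
        by (rule filterlim_compose) (use h hlim in \<open>auto simp: filterlim_at\<close>)
      thus ?thesis using True by simp
    qed simp
  qed
  have D_int: "set_integrable lborel disc D" by (rule set_integrable_disc_bounded[OF Dmeas Dle])
  have veq: "vint (q z) f = vint (p z) f" if z: "z \<in> disc" for z
  proof (rule vint_cong)
    have "AE w in lebesgue. w \<noteq> z" using AE_lborel_singleton[of z] by (simp add: AE_completion_iff)
    thus "AE w in lebesgue. w \<in> disc \<longrightarrow> cscale (q z w) (f w) = cscale (p z w) (f w)"
      by eventually_elim (use z eq in auto)
  qed
  define B where "B = pi * (4 * M / d\<^sup>2) * essnorm f"
  have key: "norm (cscale (1 / (z - c)) (vint (q z) f - vint (q c) f) - vint D f) \<le> B * cmod (z - c)"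
    if z: "z \<in> ball c d" "z \<noteq> c" for z
  proof -
    have zc: "z \<in> disc" using z sub by auto
    define k where "k w = 1 / (z - c) * (p z w - p c w) - D w" for w
    have pz: "set_integrable lborel disc (p z)" "set_integrable lborel disc (p c)"
      using p_int z d by auto
    have "cscale (1 / (z - c)) (vint (q z) f - vint (q c) f) - vint D f = vint k f"
      unfolding veq[OF zc] veq[OF c] k_def
      by (subst vint_diff_left[OF _ D_int f], intro set_integrable_mult_right set_integral_diff pz)
         (subst vint_cmult_left[OF _ f], intro set_integral_diff pz, subst vint_diff_left[OF pz f], simp)
    also have "norm \<dots> \<le> pi * (4 * M / d\<^sup>2 * cmod (z - c)) * essnorm f"
    proof (rule vint_bound[OF _ f])
      have km: "(\<lambda>w. indicator disc w *\<^sub>R k w) \<in> borel_measurable borel"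
      proof -
        have "(\<lambda>w. indicator disc w *\<^sub>R k w) = (\<lambda>w. 1 / (z - c) * (indicator disc w *\<^sub>R p z w - indicator disc w *\<^sub>R p c w) - indicator disc w *\<^sub>R D w)"
          by (auto simp: k_def indicator_def fun_eq_iff)
        thus ?thesis using ind[OF zc] ind[OF c] Dmeas by simp
      qed
      have kb: "cmod (k w) \<le> 4 * M / d\<^sup>2 * cmod (z - c)" if "w \<in> disc" for w
        using rem[of w z] that z by (simp add: k_def)
      show "set_integrable lborel disc k" "(LINT w:disc|lborel. cmod (k w)) \<le> pi * (4 * M / d\<^sup>2 * cmod (z - c))"
        by (rule set_integrable_disc_bounded[OF km kb]; assumption)+
    qed
    also have "\<dots> = B * cmod (z - c)" by (simp add: B_def)
    finally show ?thesis .
  qed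
  show "\<exists>d. ((\<lambda>w. cscale (1 / (w - c)) (vint (q w) f - vint (q c) f)) \<longlongrightarrow> d) (at c)"
  proof (rule exI[of _ "vint D f"], rule LIM_zero_cancel, rule Lim_null_comparison)
    show "eventually (\<lambda>z. norm (cscale (1 / (z - c)) (vint (q z) f - vint (q c) f) - vint D f) \<le> B * cmod (z - c)) (at c)"
      unfolding eventually_at by (intro exI[of _ d]) (use d key in \<open>auto simp: dist_commute\<close>)
    show "((\<lambda>z. B * cmod (z - c)) \<longlongrightarrow> 0) (at c)" by (auto intro!: tendsto_eq_intros)
  qed
qed

text \<open>Since u vanishes on the diagonal, the quotient has a removable singularity there; a
  bound for u on a slightly larger disc bounds the quotient.\<close>

lemma vholo_vint_quotient:
  fixes f :: "complex \<Rightarrow> 'x::complex_banach"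
  assumes meas: "\<And>z. z \<in> disc \<Longrightarrow> set_integrable lborel disc (\<lambda>w. u z w / (z - w))"
    and hol: "\<And>w. w \<in> disc \<Longrightarrow> (\<lambda>z. u z w) holomorphic_on disc"
    and zero: "\<And>w. w \<in> disc \<Longrightarrow> u w w = 0"
    and bnd: "\<And>R. 0 < R \<Longrightarrow> R < 1 \<Longrightarrow> \<exists>M. \<forall>w\<in>disc. \<forall>z\<in>cball 0 R. cmod (u z w) \<le> M"
    and f: "f \<in> Linf K"
  shows "vholo disc (\<lambda>z. vint (\<lambda>w. u z w / (z - w)) f)"
proof (rule vholo_vint[where p = "\<lambda>z w. if z = w then deriv (\<lambda>z. u z w) w else u z w / (z - w)", OF meas _ _ _ f])
  show "(\<lambda>z. if z = w then deriv (\<lambda>z. u z w) w else u z w / (z - w)) holomorphic_on disc" if "w \<in> disc" for w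
    using pole_lemma_open[OF hol[OF that] open_ball, of w] unfolding zero[OF that] diff_0_right .
  fix R :: real assume R: "0 < R" "R < 1"
  \<comment> \<open>If |z - w| is at least d, division by it costs 1/d. Otherwise the whole ball of
    radius d about w lies within (1 + R) / 2 of the origin, since R + 2 d = (1 + R) / 2, and Schwarz
    applies on it.\<close>
  define d where "d = (1 - R) / 4"
  have d: "0 < d" using R by (simp add: d_def)
  have "0 < (1 + R) / 2" "(1 + R) / 2 < 1" using R by auto
  then obtain M where "\<forall>w\<in>disc. \<forall>z\<in>cball 0 ((1 + R) / 2). cmod (u z w) \<le> M" using bnd by blast
  hence M: "\<And>w z. w \<in> disc \<Longrightarrow> z \<in> cball 0 ((1 + R) / 2) \<Longrightarrow> cmod (u z w) \<le> M" by blast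
  have "cmod (if z = w then deriv (\<lambda>z. u z w) w else u z w / (z - w)) \<le> 2 * M / d"
    if w: "w \<in> disc" and z: "z \<in> cball 0 R" for w z
  proof (cases "z \<in> ball w d")
    case False
    hence "d \<le> cmod (z - w)" by (simp add: dist_norm norm_minus_commute)
    moreover have "cmod (u z w) \<le> M" using M[OF w] z R by simp
    ultimately have "cmod (u z w) / cmod (z - w) \<le> M / d" using d
      by (intro frac_le) (auto intro: order_trans[OF norm_ge_zero])
    also have "\<dots> \<le> 2 * M / d" using \<open>cmod (u z w) \<le> M\<close> d norm_ge_zero[of "u z w"] by (intro divide_right_mono) linarith+
    finally show ?thesis using False d by (auto simp: norm_divide)
  next
    case True
    have sub: "y \<in> cball 0 ((1 + R) / 2)" if "y \<in> ball w d" for y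
    proof -
      have "cmod y \<le> cmod (y - w) + cmod (w - z) + cmod z"
        using norm_triangle_ineq[of "y - w" "w - z"] norm_triangle_ineq[of "y - z" z] by simp
      thus ?thesis using that True z by (simp add: dist_norm norm_minus_commute d_def)
    qed
    have hol': "(\<lambda>z. u z w) holomorphic_on ball w d"
      by (rule holomorphic_on_subset[OF hol[OF w]]) (use sub R in force)
    have M': "cmod (u z w) \<le> M" if "z \<in> ball w d" for z using M[OF w sub[OF that]] .
    show ?thesis
      using Schwarz_ball[OF hol' d M' True] norm_deriv_ball_le[OF hol' d M'] zero[OF w]
      by (auto simp: norm_divide divide_le_eq)
  qed
  thus "\<exists>M. \<forall>w\<in>disc. \<forall>z\<in>cball 0 R. cmod (if z = w then deriv (\<lambda>z. u z w) w else u z w / (z - w)) \<le> M" by blast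
qed auto

section \<open>Blaschke products\<close>

lemma bfactor_eq_mob:
  obtains e where "cmod e = 1" "\<And>z. bfactor a z = e * mob a z"
proof (cases "a = 0")
  case True
  show ?thesis by (rule that[of "-1"]) (auto simp: bfactor_def mob_def True)
next
  case False
  show ?thesis
    by (rule that[of "cnj a / complex_of_real (cmod a)"]) (use False in \<open>auto simp: bfactor_def mob_def norm_divide\<close>)
qed

lemma norm_bfactor: "cmod (bfactor a z) = rho z a"
  by (rule bfactor_eq_mob[of a]) (simp add: norm_mult norm_mob)

lemma bfactor_holomorphic:
  assumes "\<And>z. z \<in> S \<Longrightarrow> 1 - cnj a * z \<noteq> 0" shows "bfactor a holomorphic_on S"
proof -
  obtain e where e: "\<And>z. bfactor a z = e * mob a z" by (rule bfactor_eq_mob[of a]) blast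
  show ?thesis unfolding e[abs_def] mob_def using assms by (intro holomorphic_intros) auto
qed

lemma norm_bfactor_le_one: "cmod a < 1 \<Longrightarrow> cmod z \<le> 1 \<Longrightarrow> cmod (bfactor a z) \<le> 1"
  by (simp add: norm_bfactor rho_le_one)

text \<open>The unimodular normalisation of the factor extracts 1 - |a| from its distance to 1; the
  Blaschke condition then makes the product converge.\<close>

lemma bfactor_near_one:
  assumes a: "cmod a < 1" and z: "cmod z \<le> R" and R: "R < 1"
  shows "cmod (bfactor a z - 1) \<le> 2 / (1 - R) * (1 - cmod a)"
proof (cases "a = 0")
  case True
  have "0 \<le> R" using z norm_ge_zero order_trans by blast
  hence "2 \<le> 2 / (1 - R)" using R by (simp add: field_simps)
  moreover have "cmod (z - 1) \<le> 2" using norm_triangle_ineq4[of z 1] z R by simp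
  ultimately show ?thesis by (simp add: True bfactor_def)
next
  case False
  define t where "t = cmod a"
  have t: "0 < t" "t < 1" using a False by (auto simp: t_def)
  have tt: "a * cnj a = of_real t * of_real t" using complex_norm_square[of a] by (simp add: t_def power2_eq_square)
  have nz: "1 - cnj a * z \<noteq> 0" using one_minus_cnj_mult_nz[of z a] z R a by simp
  have "bfactor a z - 1 = ((cnj a / of_real t) * (a - z) - (1 - cnj a * z)) / (1 - cnj a * z)"
    using nz False by (simp add: bfactor_def t_def diff_divide_distrib)
  also have "(cnj a / of_real t) * (a - z) - (1 - cnj a * z) = - of_real (1 - t) * (1 + cnj a * z / of_real t)"
    using t tt by (simp add: field_simps)
  finally have E: "bfactor a z - 1 = - of_real (1 - t) * (1 + cnj a * z / of_real t) / (1 - cnj a * z)" .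
  have "cmod (- complex_of_real (1 - t)) = 1 - t"
    unfolding norm_minus_cancel norm_of_real using t by simp
  hence "cmod (bfactor a z - 1) = (1 - t) * cmod (1 + cnj a * z / of_real t) / cmod (1 - cnj a * z)"
    unfolding E norm_divide[of "_ * _"] norm_mult[of "- _"] by simp
  also have "cmod (1 + cnj a * z / of_real t) \<le> 2"
  proof -
    have "cmod (cnj a * z / of_real t) \<le> 1" using t z R by (simp add: norm_divide norm_mult t_def)
    thus ?thesis using norm_triangle_ineq[of 1 "cnj a * z / of_real t"] by simp
  qed
  hence "(1 - t) * cmod (1 + cnj a * z / of_real t) / cmod (1 - cnj a * z) \<le> (1 - t) * 2 / (1 - R)"
    using one_minus_cnj_mult_le'[of a z] a t z R by (intro frac_le mult_left_mono mult_nonneg_nonneg) auto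
  finally show ?thesis by (simp add: t_def mult_ac)
qed

lemma summable_on_tail:
  fixes m :: "'a \<Rightarrow> real"
  assumes "m summable_on Z" "0 < e"
  obtains F0 where "finite F0" "F0 \<subseteq> Z" "\<And>G. finite G \<Longrightarrow> G \<subseteq> Z - F0 \<Longrightarrow> sum m G < e"
proof -
  have "(sum m \<longlongrightarrow> infsum m Z) (finite_subsets_at_top Z)"
    using assms(1) by (simp add: has_sum_infsum has_sum_def[symmetric])
  hence "eventually (\<lambda>F. dist (sum m F) (infsum m Z) < e / 2) (finite_subsets_at_top Z)"
    using assms(2) by (intro tendstoD) auto
  then obtain F0 where F0: "finite F0" "F0 \<subseteq> Z"
    and "\<forall>F. finite F \<and> F0 \<subseteq> F \<and> F \<subseteq> Z \<longrightarrow> dist (sum m F) (infsum m Z) < e / 2"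
    unfolding eventually_finite_subsets_at_top by (elim exE conjE)
  hence F0': "dist (sum m F) (infsum m Z) < e / 2" if "finite F" "F0 \<subseteq> F" "F \<subseteq> Z" for F
    using that by simp
  have "sum m G < e" if G: "finite G" "G \<subseteq> Z - F0" for G
  proof -
    have "sum m (F0 \<union> G) = sum m F0 + sum m G" using G F0 by (intro sum.union_disjoint) auto
    moreover have "dist (sum m (F0 \<union> G)) (infsum m Z) < e / 2" "dist (sum m F0) (infsum m Z) < e / 2"
      by (rule F0'; use F0 G in blast)+
    ultimately show ?thesis unfolding dist_real_def by linarith
  qed
  thus ?thesis using F0 that by blast
qed

definition blaschke_set :: "complex set \<Rightarrow> bool" where
  "blaschke_set Z \<longleftrightarrow> Z \<subseteq> disc \<and> (\<lambda>a. 1 - cmod a) summable_on Z"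

lemma blaschke_set_subset: "blaschke_set Z \<Longrightarrow> Y \<subseteq> Z \<Longrightarrow> blaschke_set Y"
  unfolding blaschke_set_def by (meson order_trans summable_on_subset_banach)

abbreviation "bprod F z \<equiv> \<Prod>a\<in>F. bfactor a z"

lemma norm_bprod_le_one: "F \<subseteq> disc \<Longrightarrow> cmod z \<le> 1 \<Longrightarrow> cmod (bprod F z) \<le> 1"
  unfolding prod_norm[symmetric] by (intro prod_le_1) (auto intro!: norm_bfactor_le_one)

text \<open>\<open>blaschke\<close> is defined as a \<open>Lim\<close>, which says nothing until
  convergence is known. Completeness gives a pointwise limit, and the tail estimate, being uniform
  on the closed disc, upgrades it.\<close>

lemma blaschke_uniform_limit:
  assumes Z: "blaschke_set Z" and R: "R < 1"
  shows "uniform_limit (cball 0 R) (\<lambda>F z. bprod F z) (blaschke Z) (finite_subsets_at_top Z)"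
proof -
  have Zd: "a \<in> Z \<Longrightarrow> cmod a < 1" for a using Z by (auto simp: blaschke_set_def)
  define m where "m a = 2 / (1 - R) * (1 - cmod a)" for a
  have ms: "m summable_on Z" unfolding m_def
    by (rule summable_on_cmult_right) (use Z in \<open>simp add: blaschke_set_def\<close>)
  have tail: "\<exists>F0. finite F0 \<and> F0 \<subseteq> Z \<and> (\<forall>F z. finite F \<longrightarrow> F0 \<subseteq> F \<longrightarrow> F \<subseteq> Z \<longrightarrow> cmod z \<le> R \<longrightarrow> cmod (bprod F z - bprod F0 z) < e)"
    if "0 < e" for e
  proof -
    obtain F0 where F0: "finite F0" "F0 \<subseteq> Z" "\<And>G. finite G \<Longrightarrow> G \<subseteq> Z - F0 \<Longrightarrow> sum m G < e"
      by (rule summable_on_tail[OF ms \<open>0 < e\<close>]) blast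
    have "cmod (bprod F z - bprod F0 z) < e" if F: "finite F" "F0 \<subseteq> F" "F \<subseteq> Z" and z: "cmod z \<le> R" for F z
    proof -
      \<comment> \<open>All factors have modulus at most 1, so the product over the new points
        differs from 1 by at most the sum of the individual differences.\<close>
      have "bprod F z - bprod F0 z = bprod F0 z * (bprod (F - F0) z - (\<Prod>a\<in>F-F0. 1))"
        using prod.subset_diff[OF F(2) F(1), of "\<lambda>a. bfactor a z"] by (simp add: algebra_simps)
      also have "cmod \<dots> \<le> 1 * cmod (bprod (F - F0) z - (\<Prod>a\<in>F-F0. 1))"
        unfolding norm_mult by (intro mult_right_mono norm_bprod_le_one) (use F0 Zd z R in auto)
      also have "\<dots> \<le> 1 * (\<Sum>a\<in>F-F0. cmod (bfactor a z - 1))"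
        by (intro mult_left_mono norm_prod_diff) (use F Zd z R in \<open>auto intro!: norm_bfactor_le_one\<close>)
      also have "\<dots> \<le> 1 * (\<Sum>a\<in>F-F0. m a)"
        unfolding m_def by (intro mult_left_mono sum_mono bfactor_near_one) (use F Zd z R in auto)
      also have "\<dots> < e" using F0(3)[of "F - F0"] F by auto
      finally show ?thesis .
    qed
    thus ?thesis using F0 by blast
  qed
  have lim: "((\<lambda>F. bprod F z) \<longlongrightarrow> blaschke Z z) (finite_subsets_at_top Z)" if z: "cmod z \<le> R" for z
  proof -
    have "cauchy_filter (filtermap (\<lambda>F. bprod F z) (finite_subsets_at_top Z))"
      unfolding cauchy_filter_metric_filtermap
    proof (intro allI impI)
      fix e :: real assume "0 < e"
      obtain F0 where F0: "finite F0" "F0 \<subseteq> Z"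
        "\<And>F. finite F \<Longrightarrow> F0 \<subseteq> F \<Longrightarrow> F \<subseteq> Z \<Longrightarrow> cmod (bprod F z - bprod F0 z) < e / 2"
        using tail[of "e/2"] \<open>0 < e\<close> z by auto
      show "\<exists>P. eventually P (finite_subsets_at_top Z) \<and> (\<forall>x y. P x \<and> P y \<longrightarrow> dist (bprod x z) (bprod y z) < e)"
      proof (intro exI[of _ "\<lambda>F. finite F \<and> F0 \<subseteq> F \<and> F \<subseteq> Z"] conjI allI impI)
        show "eventually (\<lambda>F. finite F \<and> F0 \<subseteq> F \<and> F \<subseteq> Z) (finite_subsets_at_top Z)"
          unfolding eventually_finite_subsets_at_top using F0 by blast
        fix x y assume "(finite x \<and> F0 \<subseteq> x \<and> x \<subseteq> Z) \<and> (finite y \<and> F0 \<subseteq> y \<and> y \<subseteq> Z)"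
        hence "cmod (bprod x z - bprod F0 z) < e / 2" "cmod (bprod y z - bprod F0 z) < e / 2" using F0 by auto
        thus "dist (bprod x z) (bprod y z) < e"
          using dist_triangle_half_l[of "bprod x z" "bprod F0 z" e "bprod y z"] by (simp add: dist_norm norm_minus_commute)
      qed
    qed
    moreover have "complete (UNIV :: complex set)"
      by (meson Cauchy_convergent UNIV_I complete_def convergent_def)
    ultimately obtain L where "((\<lambda>F. bprod F z) \<longlongrightarrow> L) (finite_subsets_at_top Z)"
      using complete_uniform[where S = "UNIV :: complex set"] by (force simp: filterlim_def)
    thus ?thesis unfolding blaschke_def by (simp add: tendsto_Lim)
  qed
  show ?thesis
  proof (rule uniform_limitI)
    fix e :: real assume "0 < e"
    obtain F0 where F0: "finite F0" "F0 \<subseteq> Z"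
      "\<And>F z. finite F \<Longrightarrow> F0 \<subseteq> F \<Longrightarrow> F \<subseteq> Z \<Longrightarrow> cmod z \<le> R \<Longrightarrow> cmod (bprod F z - bprod F0 z) < e / 3"
      using tail[of "e/3"] \<open>0 < e\<close> by auto
    have ev: "eventually (\<lambda>F. finite F \<and> F0 \<subseteq> F \<and> F \<subseteq> Z) (finite_subsets_at_top Z)"
      unfolding eventually_finite_subsets_at_top using F0 by blast
    have b: "cmod (blaschke Z z - bprod F0 z) \<le> e / 3" if z: "cmod z \<le> R" for z
    proof (rule Lim_norm_ubound)
      show "((\<lambda>F. bprod F z - bprod F0 z) \<longlongrightarrow> blaschke Z z - bprod F0 z) (finite_subsets_at_top Z)"
        by (intro tendsto_intros lim z)
      show "eventually (\<lambda>F. cmod (bprod F z - bprod F0 z) \<le> e / 3) (finite_subsets_at_top Z)"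
        using ev by eventually_elim (use F0(3) z in \<open>auto intro: less_imp_le\<close>)
    qed simp
    show "eventually (\<lambda>F. \<forall>z\<in>cball 0 R. dist (bprod F z) (blaschke Z z) < e) (finite_subsets_at_top Z)"
      using ev
    proof eventually_elim
      case (elim F)
      show ?case
      proof
        fix z :: complex assume "z \<in> cball 0 R"
        hence "cmod (bprod F z - bprod F0 z) < e / 3" "cmod (blaschke Z z - bprod F0 z) \<le> e / 3"
          using F0(3)[of F z] elim b[of z] by auto
        moreover have "dist (bprod F z) (blaschke Z z) \<le> cmod (bprod F z - bprod F0 z) + cmod (blaschke Z z - bprod F0 z)"
          using norm_triangle_ineq4[of "bprod F z - bprod F0 z" "blaschke Z z - bprod F0 z"] by (simp add: dist_norm)
        ultimately show "dist (bprod F z) (blaschke Z z) < e" using \<open>0 < e\<close> by linarith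
      qed
    qed
  qed
qed

lemma blaschke_tendsto:
  assumes "blaschke_set Z" "cmod z < 1"
  shows "((\<lambda>F. bprod F z) \<longlongrightarrow> blaschke Z z) (finite_subsets_at_top Z)"
  using tendsto_uniform_limitI[OF blaschke_uniform_limit[OF assms]] by simp

lemma bprod_holomorphic:
  assumes "F \<subseteq> disc" shows "(\<lambda>z. bprod F z) holomorphic_on disc"
  by (intro holomorphic_on_prod bfactor_holomorphic one_minus_cnj_mult_nz) (use assms in \<open>auto intro: less_imp_le\<close>)

lemma eventually_finite_subset: "eventually (\<lambda>F. finite F \<and> F \<subseteq> Z) (finite_subsets_at_top Z)"
  unfolding eventually_finite_subsets_at_top by auto

lemma blaschke_holomorphic:
  assumes Z: "blaschke_set Z"
  shows "blaschke Z holomorphic_on disc"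
  unfolding holomorphic_on_def
proof
  fix z :: complex assume z: "z \<in> disc"
  define R where "R = (1 + cmod z) / 2"
  have R: "R < 1" "cmod z < R" using z by (auto simp: R_def)
  have sub: "cball 0 R \<subseteq> disc" using R by auto
  have "eventually (\<lambda>F. continuous_on (cball 0 R) (\<lambda>z. bprod F z) \<and> (\<lambda>z. bprod F z) holomorphic_on ball 0 R) (finite_subsets_at_top Z)"
    using eventually_finite_subset[of Z]
  proof eventually_elim
    case (elim F)
    hence h: "(\<lambda>z. bprod F z) holomorphic_on disc" using Z by (intro bprod_holomorphic) (auto simp: blaschke_set_def)
    have "ball 0 R \<subseteq> disc" using sub by auto
    thus ?case using holomorphic_on_subset[OF h sub] holomorphic_on_subset[OF h] holomorphic_on_imp_continuous_on by blast
  qed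
  then obtain "blaschke Z holomorphic_on ball 0 R"
    by (rule holomorphic_uniform_limit[OF _ blaschke_uniform_limit[OF Z R(1)]]) auto
  moreover have "z \<in> ball 0 R" using R by simp
  ultimately have "blaschke Z field_differentiable (at z)"
    by (simp add: holomorphic_on_imp_differentiable_at)
  thus "blaschke Z field_differentiable (at z within disc)" by (rule field_differentiable_at_within)
qed

lemma norm_blaschke_le_one:
  assumes "blaschke_set Z" "cmod z < 1" shows "cmod (blaschke Z z) \<le> 1"
proof (rule Lim_norm_ubound[OF _ blaschke_tendsto[OF assms]])
  show "eventually (\<lambda>F. cmod (bprod F z) \<le> 1) (finite_subsets_at_top Z)"
    using eventually_finite_subset[of Z]
    by eventually_elim (use assms in \<open>auto simp: blaschke_set_def intro!: norm_bprod_le_one\<close>)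
qed simp

lemma blaschke_factor:
  assumes Z: "blaschke_set Z" and a: "a \<in> Z" and z: "cmod z < 1"
  shows "blaschke Z z = bfactor a z * blaschke (Z - {a}) z"
proof (rule tendsto_unique[OF _ blaschke_tendsto[OF Z z]])
  have Z': "blaschke_set (Z - {a})" using Z by (rule blaschke_set_subset) auto
  have "filterlim (\<lambda>F. F - {a}) (finite_subsets_at_top (Z - {a})) (finite_subsets_at_top Z)"
    unfolding filterlim_finite_subsets_at_top
  proof (intro allI impI)
    fix X assume X: "finite X \<and> X \<subseteq> Z - {a}"
    show "eventually (\<lambda>F. finite (F - {a}) \<and> X \<subseteq> F - {a} \<and> F - {a} \<subseteq> Z - {a}) (finite_subsets_at_top Z)"
      unfolding eventually_finite_subsets_at_top by (rule exI[of _ X]) (use X in auto)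
  qed
  from filterlim_compose[OF blaschke_tendsto[OF Z' z] this]
  have "((\<lambda>F. bfactor a z * bprod (F - {a}) z) \<longlongrightarrow> bfactor a z * blaschke (Z - {a}) z) (finite_subsets_at_top Z)"
    by (intro tendsto_intros)
  moreover have "eventually (\<lambda>F. bfactor a z * bprod (F - {a}) z = bprod F z) (finite_subsets_at_top Z)"
    unfolding eventually_finite_subsets_at_top
    by (rule exI[of _ "{a}"]) (use a in \<open>auto simp: prod.remove\<close>)
  ultimately show "((\<lambda>F. bprod F z) \<longlongrightarrow> bfactor a z * blaschke (Z - {a}) z) (finite_subsets_at_top Z)"
    by (rule Lim_transform_eventually)
qed simp

lemma norm_blaschke_le_rho:
  assumes "blaschke_set Z" "a \<in> Z" "cmod z < 1" shows "cmod (blaschke Z z) \<le> rho z a"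
  using norm_blaschke_le_one[OF blaschke_set_subset[OF assms(1), of "Z - {a}"] assms(3)]
  unfolding blaschke_factor[OF assms] norm_mult norm_bfactor by (simp add: mult_left_le)

lemma norm_blaschke_ge:
  assumes "blaschke_set Z" "cmod z < 1" "\<And>F. finite F \<Longrightarrow> F \<subseteq> Z \<Longrightarrow> \<delta> \<le> (\<Prod>a\<in>F. rho z a)"
  shows "\<delta> \<le> cmod (blaschke Z z)"
proof (rule tendsto_lowerbound[OF tendsto_norm[OF blaschke_tendsto[OF assms(1,2)]]])
  show "eventually (\<lambda>F. \<delta> \<le> cmod (bprod F z)) (finite_subsets_at_top Z)"
    using eventually_finite_subset[of Z]
    by eventually_elim (use assms(3) in \<open>simp add: prod_norm[symmetric] norm_bfactor\<close>)
qed simp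

text \<open>By the maximum principle for the reciprocal, only the boundary of the region matters: there either
  the modulus of the product is 1 or the point has distance exactly \<open>\<nu>\<close> from a zero.\<close>

lemma norm_bprod_ge_away:
  assumes F: "finite F" "F \<subseteq> disc" and sep: "\<And>a. a \<in> F \<Longrightarrow> 4 / 5 \<le> (\<Prod>b\<in>F-{a}. rho a b)"
    and \<nu>: "0 < \<nu>" "\<nu> \<le> 3 / 10" and z: "cmod z < 1" "\<And>a. a \<in> F \<Longrightarrow> \<nu> \<le> rho z a"
  shows "\<nu> / 5 \<le> cmod (bprod F z)"
proof -
  define S where "S = {z. cmod z \<le> 1 \<and> (\<forall>a\<in>F. \<nu> \<le> rho z a)}"
  have nz: "1 - cnj a * z \<noteq> 0" if "a \<in> F" "cmod z \<le> 1" for a z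
    by (rule one_minus_cnj_mult_nz) (use that F in auto)
  have cont: "continuous_on (cball 0 1) (\<lambda>z. rho z a)" if "a \<in> F" for a
    unfolding rho_def using nz[OF that] by (intro continuous_intros) auto
  have S_eq: "S = (\<Inter>a\<in>F. cball 0 1 \<inter> (\<lambda>z. rho z a) -` {\<nu>..}) \<inter> cball 0 1" by (auto simp: S_def)
  have closed: "closed S"
    unfolding S_eq by (intro closed_Int closed_INT ballI continuous_closed_preimage cont) auto
  have bf0: "bfactor a z \<noteq> 0" if "a \<in> F" "z \<in> S" for a z
    using norm_bfactor[of a z] that \<nu> by (auto simp: S_def)
  define f where "f z = inverse (bprod F z)" for z
  have holf: "f holomorphic_on S"
    unfolding f_def using nz bf0 F(1)
    by (intro holomorphic_intros holomorphic_on_prod bfactor_holomorphic) (auto simp: S_def)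
  have "cmod (f z) \<le> 5 / \<nu>"
  proof (rule maximum_modulus_frontier[of f S])
    show "f holomorphic_on interior S" using holf interior_subset by (rule holomorphic_on_subset)
    show "continuous_on (closure S) f" using holf closed by (simp add: closure_closed holomorphic_on_imp_continuous_on)
    show "bounded S" by (rule bounded_subset[of "cball 0 1"]) (auto simp: S_def)
    show "z \<in> S" using z by (simp add: S_def)
    fix x assume x: "x \<in> frontier S"
    hence xS: "x \<in> S" using closed by (simp add: frontier_def closure_closed)
    have "cmod x = 1 \<or> (cmod x < 1 \<and> (\<exists>a\<in>F. rho x a = \<nu>))"
    proof (rule ccontr)
      assume c: "\<not> ?thesis"
      define U where "U = disc \<inter> (\<Inter>a\<in>F. {z \<in> disc. \<nu> < rho z a})"
      have "open {z \<in> disc. \<nu> < rho z a}" if "a \<in> F" for a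
      proof -
        have "open (disc \<inter> (\<lambda>z. rho z a) -` {\<nu><..})"
          by (rule continuous_open_preimage) (use cont[OF that] in \<open>auto intro: continuous_on_subset\<close>)
        moreover have "disc \<inter> (\<lambda>z. rho z a) -` {\<nu><..} = {z \<in> disc. \<nu> < rho z a}" by auto
        ultimately show ?thesis by simp
      qed
      hence "open U" unfolding U_def using F(1) by (intro open_Int open_INT) auto
      moreover have "U \<subseteq> S" by (auto simp: U_def S_def intro: less_imp_le)
      moreover have "x \<in> U" using c xS by (force simp: U_def S_def)
      ultimately have "x \<in> interior S" by (meson interiorI)
      thus False using x by (simp add: frontier_def)
    qed
    thus "cmod (f x) \<le> 5 / \<nu>"
    proof (elim disjE conjE bexE)
      assume x1: "cmod x = 1"
      have "rho x a = 1" if "a \<in> F" for a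
      proof -
        have "cmod a < 1" using F that by auto
        hence "1 - (rho x a)\<^sup>2 = 0" using one_minus_rho_sq[of x a] x1 by simp
        thus ?thesis using rho_nonneg[of x a] by (simp add: power2_eq_1_iff)
      qed
      hence "cmod (f x) = 1" by (simp add: f_def norm_inverse prod_norm[symmetric] norm_bfactor)
      thus ?thesis using \<nu> by (simp add: field_simps)
    next
      fix a assume x1: "cmod x < 1" and a: "a \<in> F" and r: "rho x a = \<nu>"
      have Fa: "F - {a} \<subseteq> disc" using F(2) by blast
      \<comment> \<open>At the zero a the remaining product has modulus at least 4/5; at distance
        \<nu> it loses at most 2 \<nu>, hence at most 3/5, and 1/5 is left.\<close>
      have "cmod (bprod (F - {a}) a - bprod (F - {a}) x) \<le> (1 + cmod (bprod (F - {a}) x)) * rho a x"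
        by (rule Schwarz_Pick_diff[OF bprod_holomorphic[OF Fa]]) (use norm_bprod_le_one[OF Fa] x1 a F in auto)
      also have "\<dots> \<le> 2 * \<nu>"
        unfolding rho_commute[of a x] r using norm_bprod_le_one[OF Fa, of x] x1 \<nu> by (intro mult_right_mono) auto
      finally have "cmod (bprod (F - {a}) a) - 2 * \<nu> \<le> cmod (bprod (F - {a}) x)"
        using norm_triangle_ineq2[of "bprod (F - {a}) a" "bprod (F - {a}) x"] by linarith
      moreover have "4 / 5 \<le> cmod (bprod (F - {a}) a)"
        using sep[OF a] by (simp add: prod_norm[symmetric] norm_bfactor)
      ultimately have g: "1 / 5 \<le> cmod (bprod (F - {a}) x)" using \<nu> by linarith
      have "cmod (bprod F x) = \<nu> * cmod (bprod (F - {a}) x)"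
        using prod.remove[OF F(1) a, of "\<lambda>a. bfactor a x"] by (simp add: norm_mult norm_bfactor r)
      hence "\<nu> / 5 \<le> cmod (bprod F x)" using mult_left_mono[OF g, of \<nu>] \<nu> by simp
      thus ?thesis using \<nu> unfolding f_def norm_inverse
        by (simp add: inverse_eq_divide divide_le_eq field_simps)
    qed
  qed
  moreover have "0 < cmod (bprod F z)" using bf0 z F(1) by (auto simp: S_def)
  moreover have "\<nu> / 5 \<le> x" if "inverse x \<le> 5 / \<nu>" "0 < x" for x :: real
    using that \<nu> by (simp add: field_simps)
  ultimately show ?thesis unfolding f_def norm_inverse by blast
qed

text \<open>The lower bound for finite products does not depend on the number of factors, so it
  survives the limit.\<close>

lemma norm_blaschke_ge_away:
  assumes Z: "blaschke_set Z" and sep: "\<And>a F. a \<in> Z \<Longrightarrow> finite F \<Longrightarrow> F \<subseteq> Z - {a} \<Longrightarrow> 4 / 5 \<le> (\<Prod>b\<in>F. rho a b)"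
    and \<nu>: "0 < \<nu>" "\<nu> \<le> 3 / 10" and z: "cmod z < 1" "\<And>a. a \<in> Z \<Longrightarrow> \<nu> \<le> rho z a"
  shows "\<nu> / 5 \<le> cmod (blaschke Z z)"
proof (rule norm_blaschke_ge[OF Z z(1)])
  fix F assume F: "finite F" "F \<subseteq> Z"
  have "4 / 5 \<le> (\<Prod>b\<in>F-{a}. rho a b)" if "a \<in> F" for a using sep[of a "F - {a}"] F that by auto
  from norm_bprod_ge_away[OF F(1) _ this \<nu> z(1)]
  have "\<nu> / 5 \<le> cmod (bprod F z)" using F z(2) Z by (auto simp: blaschke_set_def)
  thus "\<nu> / 5 \<le> (\<Prod>a\<in>F. rho z a)" by (simp add: prod_norm[symmetric] norm_bfactor)
qed

text \<open>Near its zero a the product is \<open>bfactor a\<close> times the remaining product. The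
  first factor is almost an isometry from \<open>rho\<close> to the Euclidean distance, and the
  second stays close to its value at a, of modulus at least 4/5.\<close>

lemma blaschke_lower_Lipschitz:
  assumes Z: "blaschke_set Z" and a: "a \<in> Z" and sep: "\<And>F. finite F \<Longrightarrow> F \<subseteq> Z - {a} \<Longrightarrow> 4 / 5 \<le> (\<Prod>b\<in>F. rho a b)"
    and z: "cmod z < 1" "rho z a \<le> 1 / 100" and w: "cmod w < 1" "rho w a \<le> 1 / 100"
  shows "rho z w / 2 \<le> cmod (blaschke Z z - blaschke Z w)"
proof -
  have a1: "cmod a < 1" using Z a by (auto simp: blaschke_set_def)
  have Z': "blaschke_set (Z - {a})" using Z by (rule blaschke_set_subset) auto
  define g where "g = blaschke (Z - {a})"
  have SP: "cmod (g x - g y) \<le> 2 * rho x y" if "cmod x < 1" "cmod y < 1" for x y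
  proof -
    have "cmod (g x - g y) \<le> (1 + cmod (g y)) * rho x y"
      unfolding g_def by (rule Schwarz_Pick_diff[OF blaschke_holomorphic[OF Z']]) (use norm_blaschke_le_one[OF Z'] that in auto)
    also have "\<dots> \<le> 2 * rho x y"
      using norm_blaschke_le_one[OF Z', of y] that by (intro mult_right_mono) (auto simp: g_def)
    finally show ?thesis .
  qed
  have "4 / 5 \<le> cmod (g a)" unfolding g_def by (rule norm_blaschke_ge[OF Z' a1]) (use sep in auto)
  moreover have "cmod (g a - g z) \<le> 2 * (1 / 100)" using SP[OF a1 z(1)] z(2) by (simp add: rho_commute[of a])
  ultimately have gz: "39 / 50 \<le> cmod (g z)" using norm_triangle_ineq2[of "g a" "g z"] by linarith
  obtain e where e: "cmod e = 1" "\<And>z. bfactor a z = e * mob a z" by (rule bfactor_eq_mob[of a]) blast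
  define b where "b = bfactor a"
  define r where "r = rho z w"
  have r: "0 \<le> r" by (simp add: r_def)
  have bz: "cmod (b z) \<le> 1 / 100" "cmod (b w) \<le> 1 / 100" using z w by (auto simp: b_def norm_bfactor)
  have m: "cmod (mob a z) \<le> 1 / 100" "cmod (mob a w) \<le> 1 / 100" using z w by (auto simp: norm_mob)
  have "cmod (b z - b w) = cmod (mob a z - mob a w)"
    unfolding b_def e(2) right_diff_distrib[symmetric] norm_mult e(1) by simp
  also have "\<dots> = rho (mob a z) (mob a w) * cmod (1 - cnj (mob a w) * mob a z)"
    by (rule norm_diff_eq_rho) (use m in auto)
  also have "rho (mob a z) (mob a w) = r" unfolding r_def by (rule rho_mob[OF a1 z(1) w(1)])
  finally have bd: "cmod (b z - b w) = r * cmod (1 - cnj (mob a w) * mob a z)" .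
  have "99 / 100 \<le> cmod (1 - cnj (mob a w) * mob a z)"
    using one_minus_cnj_mult_le[of "mob a z" "mob a w"] m by simp
  hence "r * (99 / 100) \<le> cmod (b z - b w)" unfolding bd using r by (intro mult_left_mono) auto
  hence "r * (99 / 100) * (39 / 50) \<le> cmod (b z - b w) * cmod (g z)" using gz r by (intro mult_mono) auto
  moreover have "cmod (b w) * cmod (g z - g w) \<le> (1 / 100) * (2 * r)"
    using bz SP[OF z(1) w(1)] by (intro mult_mono) (auto simp: r_def)
  moreover have "blaschke Z z - blaschke Z w = (b z - b w) * g z + b w * (g z - g w)"
    unfolding blaschke_factor[OF Z a z(1)] blaschke_factor[OF Z a w(1)] b_def g_def by (simp add: algebra_simps)
  hence "cmod (b z - b w) * cmod (g z) - cmod (b w) * cmod (g z - g w) \<le> cmod (blaschke Z z - blaschke Z w)"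
    using norm_triangle_ineq2[of "(b z - b w) * g z" "- (b w * (g z - g w))"] by (simp add: norm_mult)
  \<comment> \<open>The coefficients give 0.7722 - 0.02, comfortably above the claimed 1/2.\<close>
  ultimately have "r * (99 / 100) * (39 / 50) - (1 / 100) * (2 * r) \<le> cmod (blaschke Z z - blaschke Z w)" by linarith
  hence "r / 2 \<le> cmod (blaschke Z z - blaschke Z w)" using r by linarith
  thus ?thesis by (simp add: r_def)
qed

section \<open>Separated sequences and Jones' exponential weights\<close>

lemma holomorphic_infsum:
  assumes hol: "\<And>a. a \<in> X \<Longrightarrow> f a holomorphic_on disc"
    and dom: "\<And>R. R < 1 \<Longrightarrow> \<exists>M. M summable_on X \<and> (\<forall>a\<in>X. \<forall>z\<in>cball 0 R. cmod (f a z) \<le> M a)"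
  shows "(\<lambda>z. \<Sum>\<^sub>\<infinity>a\<in>X. f a z) holomorphic_on disc"
  unfolding holomorphic_on_def
proof
  fix z :: complex assume z: "z \<in> disc"
  define R where "R = (1 + cmod z) / 2"
  have R: "R < 1" "cmod z < R" using z by (auto simp: R_def)
  have sub: "cball 0 R \<subseteq> disc" "ball 0 R \<subseteq> disc" using R by auto
  obtain M where M: "M summable_on X" "\<And>a z. a \<in> X \<Longrightarrow> z \<in> cball 0 R \<Longrightarrow> cmod (f a z) \<le> M a"
    using dom[OF R(1)] by blast
  have ul: "uniform_limit (cball 0 R) (\<lambda>F z. \<Sum>a\<in>F. f a z) (\<lambda>z. \<Sum>\<^sub>\<infinity>a\<in>X. f a z) (finite_subsets_at_top X)"
    by (rule Weierstrass_m_test_general[OF M(2) M(1)])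
  have "eventually (\<lambda>F. continuous_on (cball 0 R) (\<lambda>z. \<Sum>a\<in>F. f a z) \<and> (\<lambda>z. \<Sum>a\<in>F. f a z) holomorphic_on ball 0 R) (finite_subsets_at_top X)"
    using eventually_finite_subset[of X]
  proof eventually_elim
    case (elim F)
    hence h: "(\<lambda>z. \<Sum>a\<in>F. f a z) holomorphic_on disc" by (intro holomorphic_on_sum hol) auto
    thus ?case using holomorphic_on_subset[OF h sub(1)] holomorphic_on_subset[OF h sub(2)] holomorphic_on_imp_continuous_on by blast
  qed
  then obtain "(\<lambda>z. \<Sum>\<^sub>\<infinity>a\<in>X. f a z) holomorphic_on ball 0 R"
    by (rule holomorphic_uniform_limit[OF _ ul]) auto
  moreover have "z \<in> ball 0 R" using R by simp
  ultimately have "(\<lambda>z. \<Sum>\<^sub>\<infinity>a\<in>X. f a z) field_differentiable (at z)"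
    using holomorphic_on_imp_differentiable_at[OF _ open_ball] by blast
  thus "(\<lambda>z. \<Sum>\<^sub>\<infinity>a\<in>X. f a z) field_differentiable (at z within disc)" by (rule field_differentiable_at_within)
qed

text \<open>Up to the factor \<open>1 - (cmod a)\<^sup>2\<close>, the real part of \<open>herg a\<close> dominates the Poisson kernel at a; this is
  the exponent in P. Jones' weights.\<close>

definition herg :: "complex \<Rightarrow> complex \<Rightarrow> complex" where
  "herg a z = of_real (1 - (cmod a)\<^sup>2) * ((1 + cnj a * z) / (1 - cnj a * z))"

lemma herg_holomorphic: "cmod a < 1 \<Longrightarrow> herg a holomorphic_on disc"
  unfolding herg_def[abs_def] using one_minus_cnj_mult_nz[of _ a]
  by (intro holomorphic_intros) (auto simp: less_imp_le)

lemma Re_herg: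
  "Re (herg a z) = (1 - (cmod a)\<^sup>2) * ((1 - (cmod a)\<^sup>2 * (cmod z)\<^sup>2) / (cmod (1 - cnj a * z))\<^sup>2)"
proof -
  define u where "u = cnj a * z"
  have "Re ((1 + u) / (1 - u)) = (1 - (cmod u)\<^sup>2) / (cmod (1 - u))\<^sup>2"
    unfolding Re_divide cmod_power2 by (simp add: power2_eq_square algebra_simps)
  moreover have "(cmod u)\<^sup>2 = (cmod a)\<^sup>2 * (cmod z)\<^sup>2" by (simp add: u_def norm_mult power_mult_distrib)
  moreover have rc: "Re (of_real c * x) = c * Re x" for c x by simp
  ultimately show ?thesis unfolding herg_def u_def[symmetric] rc by simp
qed

lemma Re_herg_nonneg:
  assumes "cmod a < 1" "cmod z < 1" shows "0 \<le> Re (herg a z)"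
proof -
  have "cmod a * cmod z \<le> 1 * 1" using assms by (intro mult_mono) auto
  hence "(cmod a * cmod z)\<^sup>2 \<le> 1" by (simp add: abs_square_le_1)
  thus ?thesis unfolding Re_herg using assms one_minus_sq_nonneg[of a]
    by (auto simp: power_mult_distrib)
qed

text \<open>The first bound makes the exponent converge locally uniformly under the Blaschke
  condition; the second confines the real part to the interval [0, 4] on which
  \<open>one_minus_exp_ge\<close> works.\<close>

lemma norm_herg_le:
  assumes "cmod a < 1" "cmod z < 1"
  shows "cmod (herg a z) \<le> 4 * (1 - cmod a) / (1 - cmod z)" "cmod (herg a z) \<le> 4"
proof -
  have "cmod (cnj a * z) \<le> 1" using assms by (simp add: norm_mult mult_le_one)
  hence n: "cmod (1 + cnj a * z) \<le> 2" using norm_triangle_ineq[of 1 "cnj a * z"] by simp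
  have e: "cmod (herg a z) = (1 - (cmod a)\<^sup>2) * cmod (1 + cnj a * z) / cmod (1 - cnj a * z)"
    unfolding herg_def norm_mult norm_divide norm_of_real using one_minus_sq_nonneg[of a] assms by simp
  have h: "0 \<le> 1 - (cmod a)\<^sup>2" "1 - (cmod a)\<^sup>2 \<le> 2 * (1 - cmod a)"
    using one_minus_sq_nonneg[of a] one_minus_sq_le2[of a] assms by auto
  have d: "1 - cmod z \<le> cmod (1 - cnj a * z)" "1 - cmod a \<le> cmod (1 - cnj a * z)"
    using one_minus_cnj_mult_le'[of a z] one_minus_cnj_mult_le[of z a] assms by auto
  have "(1 - (cmod a)\<^sup>2) * cmod (1 + cnj a * z) \<le> 2 * (1 - cmod a) * 2"
    using h n assms by (intro mult_mono) auto
  hence u: "(1 - (cmod a)\<^sup>2) * cmod (1 + cnj a * z) \<le> 4 * (1 - cmod a)" by simp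
  show "cmod (herg a z) \<le> 4 * (1 - cmod a) / (1 - cmod z)"
    unfolding e by (rule frac_le[OF _ u]) (use d assms in auto)
  have "cmod (herg a z) \<le> 4 * (1 - cmod a) / (1 - cmod a)"
    unfolding e by (rule frac_le[OF _ u]) (use d assms in auto)
  also have "\<dots> = 4"
    using nonzero_mult_div_cancel_right[of "1 - cmod a" 4] assms by simp
  finally show "cmod (herg a z) \<le> 4" .
qed

lemma Re_herg_ge:
  assumes "cmod a < 1" "cmod z < 1"
  shows "(1 - (cmod a)\<^sup>2)\<^sup>2 / (cmod (1 - cnj a * z))\<^sup>2 \<le> Re (herg a z)"
proof -
  have "(cmod a)\<^sup>2 * (cmod z)\<^sup>2 \<le> (cmod a)\<^sup>2 * 1" using assms by (intro mult_left_mono) (auto simp: abs_square_le_1)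
  hence "(1 - (cmod a)\<^sup>2) * ((1 - (cmod a)\<^sup>2) / (cmod (1 - cnj a * z))\<^sup>2) \<le> Re (herg a z)"
    unfolding Re_herg using one_minus_sq_nonneg[of a] assms
    by (intro mult_left_mono divide_right_mono) auto
  thus ?thesis by (simp add: power2_eq_square)
qed

text \<open>The constant \<open>13 / 50\<close> is what the hypothesis on \<open>\<delta>(\<zeta>)\<close> leaves for one point from each disc.\<close>

definition sepset :: "complex set \<Rightarrow> bool" where
  "sepset Z \<longleftrightarrow> Z \<subseteq> disc \<and>
     (\<forall>a\<in>Z. \<forall>F. finite F \<and> F \<subseteq> Z - {a} \<longrightarrow> (\<Sum>b\<in>F. 1 - (rho a b)\<^sup>2) \<le> 13 / 50)"

lemma sepsetD: "sepset Z \<Longrightarrow> a \<in> Z \<Longrightarrow> finite F \<Longrightarrow> F \<subseteq> Z - {a} \<Longrightarrow> (\<Sum>b\<in>F. 1 - (rho a b)\<^sup>2) \<le> 13 / 50"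
  by (auto simp: sepset_def)

lemma sepset_disc: "sepset Z \<Longrightarrow> a \<in> Z \<Longrightarrow> cmod a < 1"
  by (auto simp: sepset_def)

text \<open>The sum about a single point a suffices: |1 - cnj b * a| is at most 2, so 1 - rho^2 is
  at least a quarter of the product of the heights of a and b.\<close>

lemma sepset_blaschke_set:
  assumes "sepset Z" shows "blaschke_set Z"
proof (cases "Z = {}")
  case True thus ?thesis by (simp add: blaschke_set_def)
next
  case False
  then obtain a where a: "a \<in> Z" by blast
  have a1: "0 < 1 - (cmod a)\<^sup>2" using sepset_disc[OF assms a] by (rule one_minus_sq_pos)
  have "(\<lambda>b. 1 - cmod b) summable_on Z - {a}"
  proof (rule nonneg_bdd_above_summable_on)
    show "0 \<le> 1 - cmod b" if "b \<in> Z - {a}" for b using sepset_disc[OF assms, of b] that by simp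
    have "(\<Sum>b\<in>F. 1 - cmod b) \<le> (4 / (1 - (cmod a)\<^sup>2)) * (13 / 50)" if F: "F \<subseteq> Z - {a}" "finite F" for F
    proof -
      have "1 - cmod b \<le> (4 / (1 - (cmod a)\<^sup>2)) * (1 - (rho a b)\<^sup>2)" if b: "b \<in> F" for b
      proof -
        have b1: "cmod b < 1" "cmod a < 1" using sepset_disc[OF assms] a F b by auto
        have "(cmod (1 - cnj b * a))\<^sup>2 \<le> 2\<^sup>2" using b1 by (intro power_mono one_minus_cnj_mult_upper) auto
        hence "(1 - (cmod a)\<^sup>2) * (1 - (cmod b)\<^sup>2) / 4 \<le> 1 - (rho a b)\<^sup>2"
          unfolding one_minus_rho_sq[OF less_imp_le[OF b1(2)] b1(1)]
          using b1 one_minus_sq_nonneg[of b] a1 one_minus_cnj_mult_pos[of a b]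
          by (intro divide_left_mono) auto
        hence "1 - (cmod b)\<^sup>2 \<le> (4 / (1 - (cmod a)\<^sup>2)) * (1 - (rho a b)\<^sup>2)" using a1 by (simp add: field_simps)
        thus ?thesis using one_minus_le_sq[of b] b1 by simp
      qed
      hence "(\<Sum>b\<in>F. 1 - cmod b) \<le> (\<Sum>b\<in>F. (4 / (1 - (cmod a)\<^sup>2)) * (1 - (rho a b)\<^sup>2))" by (rule sum_mono)
      also have "\<dots> \<le> (4 / (1 - (cmod a)\<^sup>2)) * (13 / 50)"
        unfolding sum_distrib_left[symmetric] using sepsetD[OF assms a F(2,1)] a1 by (intro mult_left_mono) auto
      finally show ?thesis .
    qed
    thus "bdd_above (sum (\<lambda>b. 1 - cmod b) ` {F. F \<subseteq> Z - {a} \<and> finite F})" by (auto intro!: bdd_aboveI)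
  qed
  hence "(\<lambda>b. 1 - cmod b) summable_on insert a (Z - {a})" by (simp only: summable_on_insert_iff)
  thus ?thesis using assms a by (simp add: blaschke_set_def sepset_def insert_absorb)
qed

lemma prod_one_minus_ge:
  fixes t :: "'a \<Rightarrow> real"
  assumes "finite F" "\<And>b. b \<in> F \<Longrightarrow> 0 \<le> t b" "\<And>b. b \<in> F \<Longrightarrow> t b \<le> 1"
  shows "1 - sum t F \<le> (\<Prod>b\<in>F. 1 - t b)"
  using assms
proof (induction F rule: finite_induct)
  case (insert x F)
  have p: "0 \<le> (\<Prod>b\<in>F. 1 - t b)" "(\<Prod>b\<in>F. 1 - t b) \<le> 1" using insert by (auto intro!: prod_nonneg prod_le_1)
  have IH: "1 - sum t F \<le> (\<Prod>b\<in>F. 1 - t b)" using insert by auto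
  have "t x * (\<Prod>b\<in>F. 1 - t b) \<le> t x * 1" using insert p by (intro mult_left_mono) auto
  thus ?case using insert(1,2) IH by (simp add: left_diff_distrib)
qed simp

text \<open>The product of the rho^2 is at least 1 minus the sum of the 1 - rho^2, hence at least
  37/50, which exceeds 16/25.\<close>

lemma sepset_prod_rho:
  assumes Z: "sepset Z" and a: "a \<in> Z" and F: "finite F" "F \<subseteq> Z - {a}"
  shows "4 / 5 \<le> (\<Prod>b\<in>F. rho a b)"
proof -
  have b1: "cmod b < 1" if "b \<in> F" for b using sepset_disc[OF Z] F that by auto
  have a1: "cmod a < 1" using sepset_disc[OF Z a] .
  have t: "0 \<le> 1 - (rho a b)\<^sup>2" "1 - (rho a b)\<^sup>2 \<le> 1" if "b \<in> F" for b
    using rho_le_one[of a b] b1[OF that] a1 rho_nonneg[of a b] by (auto simp: abs_square_le_1)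
  have "(4 / 5)\<^sup>2 \<le> (37 / 50 :: real)" by (simp add: power2_eq_square)
  also have "37 / 50 \<le> 1 - (\<Sum>b\<in>F. 1 - (rho a b)\<^sup>2)" using sepsetD[OF Z a F] by linarith
  also have "\<dots> \<le> (\<Prod>b\<in>F. 1 - (1 - (rho a b)\<^sup>2))" by (rule prod_one_minus_ge[OF F(1) t])
  also have "\<dots> = (\<Prod>b\<in>F. rho a b)\<^sup>2" by (simp add: prod_power_distrib)
  finally show ?thesis by (rule power2_le_imp_le) (auto intro: prod_nonneg)
qed

text \<open>Summing only over the points that are not closer to the origin than a keeps the exponent bounded near a
  and makes the sum of the weights telescope.\<close>

definition later :: "complex set \<Rightarrow> complex \<Rightarrow> complex set" where
  "later Z a = {m \<in> Z. m \<noteq> a \<and> cmod a \<le> cmod m}"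

definition Psi :: "complex set \<Rightarrow> complex \<Rightarrow> complex \<Rightarrow> complex" where
  "Psi Z a z = (\<Sum>\<^sub>\<infinity>m\<in>later Z a. herg m z)"

lemma later_subset: "later Z a \<subseteq> Z - {a}" by (auto simp: later_def)

lemma Psi_dominated:
  assumes "blaschke_set Z" "R < 1"
  shows "\<exists>M. M summable_on later Z a \<and> (\<forall>m\<in>later Z a. \<forall>z\<in>cball 0 R. cmod (herg m z) \<le> M m)"
proof (intro exI conjI ballI)
  have "(\<lambda>m. 1 - cmod m) summable_on later Z a"
    using blaschke_set_subset[OF assms(1), of "later Z a"] by (auto simp: blaschke_set_def later_def)
  hence "(\<lambda>m. 4 / (1 - R) * (1 - cmod m)) summable_on later Z a" by (rule summable_on_cmult_right)
  thus "(\<lambda>m. 4 * (1 - cmod m) / (1 - R)) summable_on later Z a" by simp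
  fix m z :: complex assume m: "m \<in> later Z a" and z: "z \<in> cball 0 R"
  have m1: "cmod m < 1" using assms m by (auto simp: blaschke_set_def later_def)
  have "cmod (herg m z) \<le> 4 * (1 - cmod m) / (1 - cmod z)" by (rule norm_herg_le) (use m1 z assms in auto)
  also have "\<dots> \<le> 4 * (1 - cmod m) / (1 - R)" using m1 z assms by (intro divide_left_mono) auto
  finally show "cmod (herg m z) \<le> 4 * (1 - cmod m) / (1 - R)" .
qed

lemma Psi_holomorphic:
  assumes "blaschke_set Z" shows "Psi Z a holomorphic_on disc"
  unfolding Psi_def[abs_def]
  by (rule holomorphic_infsum[OF herg_holomorphic Psi_dominated[OF assms]])
     (use assms in \<open>auto simp: blaschke_set_def later_def\<close>)

lemma Re_Psi_has_sum:
  assumes "blaschke_set Z" "cmod z < 1"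
  shows "((\<lambda>m. Re (herg m z)) has_sum Re (Psi Z a z)) (later Z a)"
proof -
  obtain M where "M summable_on later Z a" "\<forall>m\<in>later Z a. \<forall>x\<in>cball 0 (cmod z). cmod (herg m x) \<le> M m"
    using Psi_dominated[OF assms] by blast
  hence "(\<lambda>m. norm (M m)) summable_on later Z a" "\<And>m. m \<in> later Z a \<Longrightarrow> cmod (herg m z) \<le> norm (M m)"
    using summable_on_iff_abs_summable_on_real[of M "later Z a"] by (auto intro: order_trans[OF _ abs_ge_self])
  hence "(\<lambda>m. cmod (herg m z)) summable_on later Z a"
    by (rule Infinite_Sum.abs_summable_on_comparison_test)
  hence "(\<lambda>m. herg m z) summable_on later Z a"
    by (rule Infinite_Sum.abs_summable_summable)
  hence "((\<lambda>m. herg m z) has_sum Psi Z a z) (later Z a)" unfolding Psi_def by (rule has_sum_infsum)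
  thus ?thesis by (rule has_sum_Re)
qed

lemma sum_Re_herg_le_Re_Psi:
  assumes Z: "blaschke_set Z" and z: "cmod z < 1" and F: "finite F" "F \<subseteq> later Z a"
  shows "(\<Sum>m\<in>F. Re (herg m z)) \<le> Re (Psi Z a z)"
proof (rule finite_sum_le_has_sum[OF Re_Psi_has_sum[OF Z z, of a]])
  have "cmod m < 1" if "m \<in> later Z a" for m using that Z by (auto simp: blaschke_set_def later_def)
  thus "0 \<le> Re (herg m z)" if "m \<in> later Z a - F" for m using that z by (auto intro: Re_herg_nonneg)
qed (use F in auto)

lemma Re_Psi_nonneg: "blaschke_set Z \<Longrightarrow> cmod z < 1 \<Longrightarrow> 0 \<le> Re (Psi Z a z)"
  using sum_Re_herg_le_Re_Psi[of Z z "{}" a] by simp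

text \<open>At a itself each summand is at most 2 (1 - rho^2), so the exponent there is at most
  twice 13/50. Moving from a to w costs the squared Harnack factor of
  \<open>distort_herglotz\<close>.\<close>

lemma Re_Psi_le:
  assumes Z: "sepset Z" and a: "a \<in> Z" and w: "cmod w < 1" "rho w a \<le> r" "r < 1"
  shows "Re (Psi Z a w) \<le> ((1 + r) / (1 - r))\<^sup>2 * (13 / 25)"
proof -
  have a1: "cmod a < 1" using sepset_disc[OF Z a] .
  have m1: "cmod m < 1" if "m \<in> later Z a" for m using sepset_disc[OF Z] that by (auto simp: later_def)
  have "(\<Sum>m\<in>F. Re (herg m w)) \<le> ((1 + r) / (1 - r))\<^sup>2 * (13 / 25)" if F: "finite F" "F \<subseteq> later Z a" for F
  proof -
    have "Re (herg m w) \<le> ((1 + r) / (1 - r))\<^sup>2 * (2 * (1 - (rho a m)\<^sup>2))" if m: "m \<in> F" for m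
    proof -
      have mm: "cmod m < 1" "cmod a \<le> cmod m" using m1 F m by (auto simp: later_def)
      have "Re (herg m w) \<le> (1 - (cmod m)\<^sup>2) * (((1 + r) / (1 - r))\<^sup>2 * ((1 - (cmod m)\<^sup>2 * (cmod a)\<^sup>2) / (cmod (1 - cnj m * a))\<^sup>2))"
        unfolding Re_herg using mm w a1 by (intro mult_left_mono distort_herglotz one_minus_sq_nonneg) auto
      also have "\<dots> = ((1 + r) / (1 - r))\<^sup>2 * ((1 - (cmod m)\<^sup>2) * (1 - (cmod m)\<^sup>2 * (cmod a)\<^sup>2) / (cmod (1 - cnj m * a))\<^sup>2)"
        by (simp add: mult_ac)
      also have "\<dots> \<le> ((1 + r) / (1 - r))\<^sup>2 * (2 * (1 - (rho a m)\<^sup>2))"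
      proof (rule mult_left_mono)
        define A where "A = (cmod a)\<^sup>2"
        have A: "0 \<le> A" "A \<le> 1" "A \<le> (cmod m)\<^sup>2" using mm a1 by (auto simp: A_def abs_square_le_1 power_mono)
        \<comment> \<open>This is where |a| \<le> |m|, the defining property of
          \<open>later\<close>, enters: it replaces |m|^2 |a|^2 by |a|^4 and so extracts the height
          of a that 1 - rho^2 contains.\<close>
        have "A * A \<le> (cmod m)\<^sup>2 * A" using A by (intro mult_right_mono) auto
        hence "1 - (cmod m)\<^sup>2 * A \<le> 1 - A * A" by simp
        also have "\<dots> = (1 + A) * (1 - A)" by (simp add: algebra_simps)
        also have "\<dots> \<le> 2 * (1 - A)" using A by (intro mult_right_mono) auto
        finally have "(1 - (cmod m)\<^sup>2) * (1 - (cmod m)\<^sup>2 * A) \<le> (1 - (cmod m)\<^sup>2) * (2 * (1 - A))"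
          using mm by (intro mult_left_mono one_minus_sq_nonneg) auto
        hence "(1 - (cmod m)\<^sup>2) * (1 - (cmod m)\<^sup>2 * A) / (cmod (1 - cnj m * a))\<^sup>2
          \<le> (1 - (cmod m)\<^sup>2) * (2 * (1 - A)) / (cmod (1 - cnj m * a))\<^sup>2" by (rule divide_right_mono) simp
        also have "\<dots> = 2 * (1 - (rho a m)\<^sup>2)"
          unfolding one_minus_rho_sq[OF less_imp_le[OF a1] mm(1)] by (simp add: A_def mult_ac)
        finally show "(1 - (cmod m)\<^sup>2) * (1 - (cmod m)\<^sup>2 * (cmod a)\<^sup>2) / (cmod (1 - cnj m * a))\<^sup>2 \<le> 2 * (1 - (rho a m)\<^sup>2)"
          by (simp add: A_def)
      qed simp
      finally show ?thesis .
    qed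
    hence "(\<Sum>m\<in>F. Re (herg m w)) \<le> (\<Sum>m\<in>F. ((1 + r) / (1 - r))\<^sup>2 * (2 * (1 - (rho a m)\<^sup>2)))" by (rule sum_mono)
    also have "\<dots> = ((1 + r) / (1 - r))\<^sup>2 * (2 * (\<Sum>m\<in>F. 1 - (rho a m)\<^sup>2))" by (simp only: sum_distrib_left)
    also have "\<dots> \<le> ((1 + r) / (1 - r))\<^sup>2 * (2 * (13 / 50))"
      using sepsetD[OF Z a F(1)] F(2) later_subset[of Z a] by (intro mult_left_mono) auto
    finally show ?thesis by simp
  qed
  thus ?thesis using has_sum_le_finite_sums[OF Re_Psi_has_sum[OF sepset_blaschke_set[OF Z] w(1), of a]] by blast
qed

text \<open>A point of least modulus has all the others later than itself, so its term is an exact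
  increment of exp (- sum). Removing it can only shrink the later sets of the other points, by ties
  in modulus, and so only increases their terms.\<close>

lemma telescoping_exp:
  assumes "finite F" "\<And>a. 0 \<le> A a"
  shows "(\<Sum>n\<in>F. (1 - exp (- A n)) * exp (- (\<Sum>m\<in>later F n. A m))) \<le> 1 - exp (- (\<Sum>n\<in>F. A n :: real))"
  using assms(1)
proof (induction F rule: finite_psubset_induct)
  case (psubset F)
  show ?case
  proof (cases "F = {}")
    case False
    then obtain n0 where n0: "n0 \<in> F" "\<And>n. n \<in> F \<Longrightarrow> cmod n0 \<le> cmod n"
      using ex_min_if_finite[of "cmod ` F"] psubset(1) by (metis (mono_tags, lifting) arg_min_if_finite(1,2) linorder_not_le)
    define G where "G = F - {n0}"
    have G: "finite G" "G \<subset> F" "n0 \<notin> G" "F = insert n0 G" using n0 psubset(1) by (auto simp: G_def)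
    have l0: "later F n0 = G" using n0 by (auto simp: later_def G_def)
    have "(\<Sum>n\<in>G. (1 - exp (- A n)) * exp (- (\<Sum>m\<in>later F n. A m)))
        \<le> (\<Sum>n\<in>G. (1 - exp (- A n)) * exp (- (\<Sum>m\<in>later G n. A m)))"
    proof (rule sum_mono)
      fix n assume "n \<in> G"
      have "(\<Sum>m\<in>later G n. A m) \<le> (\<Sum>m\<in>later F n. A m)"
        using assms(2) psubset(1) G by (intro sum_mono2) (auto simp: later_def)
      thus "(1 - exp (- A n)) * exp (- (\<Sum>m\<in>later F n. A m)) \<le> (1 - exp (- A n)) * exp (- (\<Sum>m\<in>later G n. A m))"
        using assms(2)[of n] by (intro mult_left_mono) auto
    qed
    also have "\<dots> \<le> 1 - exp (- (\<Sum>n\<in>G. A n))" by (rule psubset(2)[OF G(2)])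
    finally have "(\<Sum>n\<in>F. (1 - exp (- A n)) * exp (- (\<Sum>m\<in>later F n. A m)))
       \<le> (1 - exp (- A n0)) * exp (- (\<Sum>m\<in>G. A m)) + (1 - exp (- (\<Sum>n\<in>G. A n)))"
      using G(1,3) by (subst G(4), subst sum.insert) (auto simp: l0)
    also have "\<dots> = 1 - exp (- (A n0 + (\<Sum>n\<in>G. A n)))"
      by (simp add: algebra_simps exp_add[symmetric])
    also have "A n0 + (\<Sum>n\<in>G. A n) = (\<Sum>n\<in>F. A n)" using G by (subst G(4)) simp
    finally show ?thesis .
  qed simp
qed

text \<open>By convexity exp (- x / 2) lies below its chord on [0, 4]; exp (- 2) \<le> 1/5 makes the
  slope sufficient.\<close>

lemma one_minus_exp_ge:
  assumes "0 \<le> x" "x \<le> (4::real)" shows "x \<le> 5 * (1 - exp (- (x / 2)))"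
proof -
  have "exp ((1 - x / 4) *\<^sub>R 0 + (x / 4) *\<^sub>R (- 2 :: real)) \<le> (1 - x / 4) * exp 0 + (x / 4) * exp (- 2 :: real)"
    using assms by (intro convex_onD[OF exp_convex]) auto
  hence 1: "exp (- (x / 2)) \<le> 1 - x / 4 + (x / 4) * exp (- 2)" by simp
  have "1 + 2 + (2::real)\<^sup>2 / 2 \<le> exp 2" by (rule exp_lower_Taylor_quadratic) simp
  hence "exp (- 2 :: real) \<le> 1 / 5" by (simp add: exp_minus inverse_eq_divide divide_le_eq)
  hence "(x / 4) * exp (- 2) \<le> (x / 4) * (1 / 5)" using assms by (intro mult_left_mono) auto
  thus ?thesis using 1 by simp
qed

text \<open>Each term is at most 5 times a term of the telescoping sum for A = Re
  \<open>herg\<close> / 2. \<open>Psi\<close> runs over all later points of Z, not only those in F,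
  which makes the weights smaller still.\<close>

lemma sum_herg_exp_le:
  assumes Z: "blaschke_set Z" and z: "cmod z < 1" and F: "finite F" "F \<subseteq> Z"
  shows "(\<Sum>a\<in>F. Re (herg a z) * exp (- (Re (Psi Z a z) / 2))) \<le> 5"
proof -
  have F1: "cmod a < 1" if "a \<in> F" for a using F Z that by (auto simp: blaschke_set_def)
  \<comment> \<open>The value 0 off F provides the nonnegativity everywhere that
    \<open>telescoping_exp\<close> asks for.\<close>
  define A where "A a = (if a \<in> F then Re (herg a z) / 2 else 0)" for a
  have A0: "0 \<le> A a" for a using F1 z by (auto simp: A_def Re_herg_nonneg)
  have "Re (herg a z) * exp (- (Re (Psi Z a z) / 2)) \<le> 5 * ((1 - exp (- A a)) * exp (- (\<Sum>m\<in>later F a. A m)))"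
    if a: "a \<in> F" for a
  proof -
    have "Re (herg a z) \<le> 4" using complex_Re_le_cmod[of "herg a z"] norm_herg_le(2)[of a z] F1[OF a] z by linarith
    hence "Re (herg a z) \<le> 5 * (1 - exp (- A a))"
      using one_minus_exp_ge[of "Re (herg a z)"] Re_herg_nonneg[of a z] F1 a z by (auto simp: A_def)
    moreover have "(\<Sum>m\<in>later F a. A m) \<le> Re (Psi Z a z) / 2"
    proof -
      have "(\<Sum>m\<in>later F a. A m) = (\<Sum>m\<in>later F a. Re (herg m z)) / 2"
        unfolding sum_divide_distrib by (intro sum.cong) (auto simp: A_def later_def)
      moreover have "(\<Sum>m\<in>later F a. Re (herg m z)) \<le> Re (Psi Z a z)"
        by (rule sum_Re_herg_le_Re_Psi[OF Z z]) (use F in \<open>auto simp: later_def\<close>)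
      ultimately show ?thesis by simp
    qed
    ultimately have "Re (herg a z) * exp (- (Re (Psi Z a z) / 2)) \<le> (5 * (1 - exp (- A a))) * exp (- (\<Sum>m\<in>later F a. A m))"
      using A0[of a] by (intro mult_mono) auto
    thus ?thesis by (simp only: mult.assoc)
  qed
  hence "(\<Sum>a\<in>F. Re (herg a z) * exp (- (Re (Psi Z a z) / 2)))
      \<le> (\<Sum>a\<in>F. 5 * ((1 - exp (- A a)) * exp (- (\<Sum>m\<in>later F a. A m))))" by (rule sum_mono)
  also have "\<dots> = 5 * (\<Sum>a\<in>F. (1 - exp (- A a)) * exp (- (\<Sum>m\<in>later F a. A m)))" by (simp only: sum_distrib_left)
  also have "\<dots> \<le> 5 * (1 - exp (- (\<Sum>n\<in>F. A n)))" by (intro mult_left_mono telescoping_exp F A0) auto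
  also have "\<dots> \<le> 5" by simp
  finally show ?thesis .
qed

section \<open>Separated sequences are interpolating\<close>

lemma exp_13_50_le: "exp (13 / 50 :: real) \<le> 7 / 5"
proof -
  have "exp (13 / 50) \<le> 1 + 13 / 50 + (13 / 50 :: real)\<^sup>2" by (rule exp_bound) auto
  also have "\<dots> \<le> (7 / 5 :: real)" by (simp add: power2_eq_square)
  finally show ?thesis .
qed

text \<open>Jones' explicit series: f a is 1 at a and vanishes at the other points. Its Blaschke
  quotient costs 5/4, its exponential at a costs 7/5, and its squared kernel is dominated by Re
  \<open>herg\<close>, so the weights sum to at most 5.\<close>

lemma sepset_interpolating:
  assumes Z: "sepset Z"
  shows "interpolating Z"
  unfolding interpolating_def
proof (intro conjI allI impI)
  show "Z \<subseteq> disc" using Z by (simp add: sepset_def)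
  fix c :: "complex \<Rightarrow> complex" assume "bounded (c ` Z)"
  then obtain A where A: "\<And>a. a \<in> Z \<Longrightarrow> cmod (c a) \<le> A" by (auto simp: bounded_iff)
  note Zb = sepset_blaschke_set[OF Z]
  have Zb': "blaschke_set (Z - {a})" for a by (rule blaschke_set_subset[OF Zb]) auto
  have Z1: "cmod a < 1" if "a \<in> Z" for a using sepset_disc[OF Z that] .
  define f where "f a z = blaschke (Z - {a}) z / blaschke (Z - {a}) a * ((of_real (1 - (cmod a)\<^sup>2)) / (1 - cnj a * z))\<^sup>2
      * exp (- ((Psi Z a z - Psi Z a a) / 2))" for a z
  have Ba: "4 / 5 \<le> cmod (blaschke (Z - {a}) a)" if a: "a \<in> Z" for a
    by (rule norm_blaschke_ge[OF Zb' Z1[OF a]]) (use sepset_prod_rho[OF Z a] in auto)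
  have hol: "f a holomorphic_on disc" if a: "a \<in> Z" for a
    unfolding f_def[abs_def] using Ba[OF a] one_minus_cnj_mult_nz[of _ a] Z1[OF a]
    by (intro holomorphic_intros blaschke_holomorphic Zb' Psi_holomorphic Zb) (auto simp: less_imp_le)
  have fle: "cmod (f a z) \<le> 7 / 4 * ((1 - (cmod a)\<^sup>2)\<^sup>2 / (cmod (1 - cnj a * z))\<^sup>2) * exp (- (Re (Psi Z a z) / 2))"
    if a: "a \<in> Z" and z: "cmod z < 1" for a z
  proof -
    have h: "0 \<le> 1 - (cmod a)\<^sup>2" using one_minus_sq_nonneg[of a] Z1[OF a] by simp
    have 1: "cmod (blaschke (Z - {a}) z / blaschke (Z - {a}) a) \<le> 5 / 4"
      using norm_blaschke_le_one[OF Zb' z, of a] Ba[OF a] frac_le[of 1 "cmod (blaschke (Z - {a}) z)" "4/5" "cmod (blaschke (Z - {a}) a)"]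
      by (simp add: norm_divide)
    have "Re (Psi Z a a) \<le> ((1 + 0) / (1 - 0))\<^sup>2 * (13 / 25)"
      by (rule Re_Psi_le[OF Z a Z1[OF a]]) auto
    hence "exp (Re (Psi Z a a) / 2) \<le> exp (13 / 50)" by simp
    hence 2: "exp (Re (Psi Z a a) / 2) \<le> 7 / 5" using exp_13_50_le by linarith
    have "cmod (exp (- ((Psi Z a z - Psi Z a a) / 2))) = exp (Re (Psi Z a a) / 2) * exp (- (Re (Psi Z a z) / 2))"
      by (simp add: norm_exp_eq_Re exp_add[symmetric] field_simps)
    also have "\<dots> \<le> 7 / 5 * exp (- (Re (Psi Z a z) / 2))" using 2 by (rule mult_right_mono) simp
    finally have 3: "cmod (exp (- ((Psi Z a z - Psi Z a a) / 2))) \<le> 7 / 5 * exp (- (Re (Psi Z a z) / 2))" .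
    have 4: "cmod (((of_real (1 - (cmod a)\<^sup>2)) / (1 - cnj a * z))\<^sup>2) = (1 - (cmod a)\<^sup>2)\<^sup>2 / (cmod (1 - cnj a * z))\<^sup>2"
      unfolding norm_power norm_divide norm_of_real power_divide power2_abs ..
    have "cmod (f a z) \<le> 5 / 4 * ((1 - (cmod a)\<^sup>2)\<^sup>2 / (cmod (1 - cnj a * z))\<^sup>2) * (7 / 5 * exp (- (Re (Psi Z a z) / 2)))"
      unfolding f_def norm_mult 4 by (intro mult_mono 1 3 mult_nonneg_nonneg order_refl) auto
    thus ?thesis by (simp add: mult_ac)
  qed
  have sum_le: "(\<Sum>a\<in>F. cmod (f a z)) \<le> 35 / 4" if F: "finite F" "F \<subseteq> Z" and z: "cmod z < 1" for F z
  proof -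
    have "cmod (f a z) \<le> 7 / 4 * (Re (herg a z) * exp (- (Re (Psi Z a z) / 2)))" if a: "a \<in> F" for a
    proof -
      have aZ: "a \<in> Z" using F a by auto
      have "7 / 4 * ((1 - (cmod a)\<^sup>2)\<^sup>2 / (cmod (1 - cnj a * z))\<^sup>2) * exp (- (Re (Psi Z a z) / 2))
         \<le> 7 / 4 * Re (herg a z) * exp (- (Re (Psi Z a z) / 2))"
        using Re_herg_ge[OF Z1[OF aZ] z] by (intro mult_right_mono mult_left_mono) auto
      from order_trans[OF fle[OF aZ z] this] show ?thesis by (simp only: mult.assoc)
    qed
    hence "(\<Sum>a\<in>F. cmod (f a z)) \<le> (\<Sum>a\<in>F. 7 / 4 * (Re (herg a z) * exp (- (Re (Psi Z a z) / 2))))" by (rule sum_mono)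
    also have "\<dots> \<le> 7 / 4 * 5" unfolding sum_distrib_left[symmetric]
      by (intro mult_left_mono sum_herg_exp_le[OF Zb z F]) auto
    finally show ?thesis by simp
  qed
  define g where "g z = (\<Sum>\<^sub>\<infinity>a\<in>Z. c a * f a z)" for z
  \<comment> \<open>Two dominations are needed: this one, by the Blaschke sum, is locally uniform
    and gives holomorphy; \<open>sum_le\<close> holds on the whole disc but only for sums, and gives
    boundedness.\<close>
  have dom: "\<exists>M. M summable_on Z \<and> (\<forall>a\<in>Z. \<forall>z\<in>cball 0 R. cmod (c a * f a z) \<le> M a)" if R: "R < 1" for R
  proof (intro exI conjI ballI)
    have "(\<lambda>a. \<bar>A\<bar> * (7 / 4 * (2 / (1 - R)\<^sup>2)) * (1 - cmod a)) summable_on Z"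
      using Zb by (intro summable_on_cmult_right) (simp add: blaschke_set_def)
    thus "(\<lambda>a. \<bar>A\<bar> * (7 / 4 * (2 / (1 - R)\<^sup>2)) * (1 - cmod a)) summable_on Z" .
    fix a z :: complex assume a: "a \<in> Z" and z: "z \<in> cball 0 R"
    have z1: "cmod z < 1" using z R by simp
    define h where "h = 1 - (cmod a)\<^sup>2"
    have h: "0 \<le> h" "h \<le> 1" "h \<le> 2 * (1 - cmod a)"
      using one_minus_sq_nonneg[of a] one_minus_sq_le2[of a] Z1[OF a] by (auto simp: h_def)
    have hh: "h\<^sup>2 \<le> 2 * (1 - cmod a)" using h mult_left_mono[of h 1 h] by (simp add: power2_eq_square)
    have "1 - R \<le> cmod (1 - cnj a * z)" using one_minus_cnj_mult_le'[of a z] Z1[OF a] z by simp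
    hence "(1 - R)\<^sup>2 \<le> (cmod (1 - cnj a * z))\<^sup>2" using R by (intro power_mono) auto
    hence 1: "h\<^sup>2 / (cmod (1 - cnj a * z))\<^sup>2 \<le> 2 * (1 - cmod a) / (1 - R)\<^sup>2"
      using hh R Z1[OF a] by (intro frac_le) auto
    have "exp (- (Re (Psi Z a z) / 2)) \<le> 1" using Re_Psi_nonneg[OF Zb z1, of a] by simp
    hence "7 / 4 * (h\<^sup>2 / (cmod (1 - cnj a * z))\<^sup>2) * exp (- (Re (Psi Z a z) / 2)) \<le> 7 / 4 * (2 * (1 - cmod a) / (1 - R)\<^sup>2) * 1"
      using 1 Z1[OF a] by (intro mult_mono) auto
    moreover have "7 / 4 * (2 * x / y) * 1 = 7 / 4 * (2 / y) * x" for x y :: real by simp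
    ultimately have "cmod (f a z) \<le> 7 / 4 * (2 / (1 - R)\<^sup>2) * (1 - cmod a)"
      using order_trans[OF fle[OF a z1, folded h_def]] by (simp only:)
    hence "cmod (c a * f a z) \<le> \<bar>A\<bar> * (7 / 4 * (2 / (1 - R)\<^sup>2) * (1 - cmod a))"
      unfolding norm_mult using A[OF a] by (intro mult_mono) auto
    thus "cmod (c a * f a z) \<le> \<bar>A\<bar> * (7 / 4 * (2 / (1 - R)\<^sup>2)) * (1 - cmod a)" by (simp only: mult.assoc)
  qed
  show "\<exists>g. g holomorphic_on disc \<and> bounded (g ` disc) \<and> (\<forall>z\<in>Z. g z = c z)"
  proof (intro exI[of _ g] conjI ballI)
    show "g holomorphic_on disc" unfolding g_def[abs_def]
      by (rule holomorphic_infsum[OF _ dom]) (use hol in \<open>auto intro!: holomorphic_intros\<close>)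
    have "cmod (g z) \<le> \<bar>A\<bar> * (35 / 4)" if z: "z \<in> disc" for z
    proof -
      have s: "(\<Sum>a\<in>F. cmod (c a * f a z)) \<le> \<bar>A\<bar> * (35 / 4)" if F: "finite F" "F \<subseteq> Z" for F
      proof -
        have "(\<Sum>a\<in>F. cmod (c a * f a z)) \<le> (\<Sum>a\<in>F. \<bar>A\<bar> * cmod (f a z))"
          unfolding norm_mult using F A by (intro sum_mono mult_right_mono) (auto intro: order_trans[OF _ abs_ge_self])
        also have "\<dots> \<le> \<bar>A\<bar> * (35 / 4)"
          unfolding sum_distrib_left[symmetric] using sum_le[OF F, of z] z by (intro mult_left_mono) auto
        finally show ?thesis .
      qed
      have sm: "(\<lambda>a. cmod (c a * f a z)) summable_on Z"
      proof (rule nonneg_bdd_above_summable_on)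
        show "bdd_above (sum (\<lambda>a. cmod (c a * f a z)) ` {F. F \<subseteq> Z \<and> finite F})"
          by (rule bdd_aboveI2[of _ _ "\<bar>A\<bar> * (35 / 4)"]) (rule s; simp)
      qed simp
      have "cmod (g z) \<le> (\<Sum>\<^sub>\<infinity>a\<in>Z. cmod (c a * f a z))" unfolding g_def by (rule norm_infsum_bound[OF sm])
      also have "\<dots> \<le> \<bar>A\<bar> * (35 / 4)" by (rule infsum_le_finite_sums[OF sm s])
      finally show ?thesis .
    qed
    thus "bounded (g ` disc)" unfolding bounded_iff by (intro exI[of _ "\<bar>A\<bar> * (35 / 4)"]) blast
    fix m assume m: "m \<in> Z"
    \<comment> \<open>For a different from m the point m is one of the zeros of the Blaschke product
      in f a.\<close>
    have z: "c a * f a m = 0" if "a \<noteq> m" "a \<in> Z" for a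
    proof -
      have "m \<in> Z - {a}" using that m by auto
      from norm_blaschke_le_rho[OF Zb' this Z1[OF m]] have "blaschke (Z - {a}) m = 0" by simp
      thus ?thesis by (simp add: f_def)
    qed
    have "(\<Sum>\<^sub>\<infinity>a\<in>Z. c a * f a m) = (\<Sum>\<^sub>\<infinity>a\<in>{m}. c a * f a m)"
      by (rule infsum_cong_neutral) (use z m in auto)
    moreover have "f m m = 1"
    proof -
      have "blaschke (Z - {m}) m \<noteq> 0" using Ba[OF m] by auto
      moreover have "of_real (1 - (cmod m)\<^sup>2) = 1 - cnj m * m" using complex_norm_square[of m] by (simp add: mult.commute)
      moreover have "1 - cnj m * m \<noteq> 0" using one_minus_cnj_mult_nz[of m m] Z1[OF m] by simp
      ultimately show ?thesis by (simp add: f_def)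
    qed
    ultimately show "g m = c m" by (simp add: g_def)
  qed
qed

lemma sepset_delta:
  assumes "sepset Z" shows "delta Z > 1 / 2"
proof (cases "Z = {}")
  case False
  have "4 / 5 \<le> (INF z\<in>Z. INF F\<in>{F. finite F \<and> F \<subseteq> Z - {z}}. \<Prod>w\<in>F. rho w z)"
  proof (intro cINF_greatest False)
    fix z assume z: "z \<in> Z"
    show "{F. finite F \<and> F \<subseteq> Z - {z}} \<noteq> {}" by blast
    fix F assume "F \<in> {F. finite F \<and> F \<subseteq> Z - {z}}"
    thus "4 / 5 \<le> (\<Prod>w\<in>F. rho w z)" using sepset_prod_rho[OF assms z, of F] by (simp add: rho_commute[of _ z])
  qed
  thus ?thesis using False by (simp add: delta_def)
qed (simp add: delta_def)

section \<open>The Cauchy--Pompeiu formula\<close>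

lemma integral_translate_complex:
  fixes f :: "complex \<Rightarrow> complex"
  assumes "integrable lborel f"
  shows "integrable lborel (\<lambda>z. f (z + c))" "(LINT z|lborel. f (z + c)) = (LINT z|lborel. f z)"
proof -
  have d: "distr lborel borel (\<lambda>z. z + c) = lborel"
    using lborel_distr_plus[of c] by (simp add: add.commute[of c] plus_complex_def[symmetric] cong: distr_cong)
  have [measurable]: "f \<in> borel_measurable borel" using assms by auto
  show "integrable lborel (\<lambda>z. f (z + c))"
    using assms by (subst integrable_distr_eq[of "\<lambda>z. z + c" lborel borel f, symmetric]) (auto simp: d)
  show "(LINT z|lborel. f (z + c)) = (LINT z|lborel. f z)"
    using integral_distr[of "\<lambda>z. z + c" lborel borel f] by (simp add: d)
qed

lemma integrable_continuous_compact_support: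
  fixes f :: "complex \<Rightarrow> complex"
  assumes "continuous_on UNIV f" "\<And>z. R \<le> cmod z \<Longrightarrow> f z = 0"
  shows "integrable lborel f" "\<exists>C. \<forall>z. cmod (f z) \<le> C"
proof -
  have "integrable lborel (\<lambda>z. indicator (cball 0 R) z *\<^sub>R f z)"
    by (rule borel_integrable_compact) (use assms in \<open>auto intro: continuous_on_subset\<close>)
  moreover have "(\<lambda>z. indicator (cball 0 R) z *\<^sub>R f z) = f"
    using assms(2) by (auto simp: indicator_def fun_eq_iff)
  ultimately show "integrable lborel f" by simp
  have "compact (f ` cball 0 R)" by (rule compact_continuous_image) (use assms in \<open>auto intro: continuous_on_subset\<close>)
  then obtain C where C: "\<And>z. z \<in> cball 0 R \<Longrightarrow> cmod (f z) \<le> C" by (meson bounded_iff compact_imp_bounded imageI)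
  have "cmod (f z) \<le> \<bar>C\<bar>" for z using C[of z] assms(2)[of z] by (cases "z \<in> cball 0 R") auto
  thus "\<exists>C. \<forall>z. cmod (f z) \<le> C" by blast
qed

text \<open>By translation invariance all difference quotients in direction v have integral 0;
  dominated convergence passes to the derivative. This replaces Green's theorem.\<close>

lemma integral_directional_derivative:
  fixes f :: "complex \<Rightarrow> complex"
  assumes der: "\<And>z. (f has_derivative f' z) (at z)" and cont: "continuous_on UNIV (\<lambda>z. f' z v)"
    and supp: "\<And>z. R \<le> cmod z \<Longrightarrow> f z = 0" "\<And>z. R \<le> cmod z \<Longrightarrow> f' z v = 0"
  shows "integrable lborel (\<lambda>z. f' z v)" "(LINT z|lborel. f' z v) = 0"
proof -
  note i' = integrable_continuous_compact_support[OF cont supp(2)]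
  show int': "integrable lborel (\<lambda>z. f' z v)" by (rule i'(1))
  obtain C where C: "\<And>z. cmod (f' z v) \<le> C" using i'(2) by blast
  have C0: "0 \<le> C" using C[of 0] norm_ge_zero order_trans by blast
  have cf: "continuous_on UNIV f" by (rule continuous_at_imp_continuous_on) (use has_derivative_continuous[OF der] in blast)
  have intf: "integrable lborel f" by (rule integrable_continuous_compact_support[OF cf supp(1)])
  define h where "h n = inverse (real (Suc n))" for n
  have h: "0 < h n" "h n \<le> 1" for n by (auto simp: h_def inverse_eq_divide divide_le_eq)
  have hlim: "h \<longlonglongrightarrow> 0" unfolding h_def[abs_def] by (rule LIMSEQ_inverse_real_of_nat)
  define D where "D n z = (f (z + h n *\<^sub>R v) - f z) /\<^sub>R h n" for n z
  have pt: "((\<lambda>t. f (z + t *\<^sub>R v)) has_derivative (\<lambda>s. s *\<^sub>R f' (z + t *\<^sub>R v) v)) (at t within S)" for z t S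
  proof -
    have "((\<lambda>t. z + t *\<^sub>R v) has_derivative (\<lambda>s. s *\<^sub>R v)) (at t within S)"
      by (auto intro!: derivative_eq_intros)
    from has_derivative_compose[OF this der[of "z + t *\<^sub>R v"]]
    have "((\<lambda>t. f (z + t *\<^sub>R v)) has_derivative (\<lambda>s. f' (z + t *\<^sub>R v) (s *\<^sub>R v))) (at t within S)" .
    thus ?thesis using has_derivative_bounded_linear[OF der[of "z + t *\<^sub>R v"]]
      by (simp add: linear_simps(5))
  qed
  have Dlim: "(\<lambda>n. D n z) \<longlonglongrightarrow> f' z v" for z
  proof -
    have "((\<lambda>t. norm (f (z + t *\<^sub>R v) - f z - t *\<^sub>R f' z v) / norm t) \<longlongrightarrow> 0) (at 0)"
      using pt[of z 0 UNIV] unfolding has_derivative_at by simp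
    moreover have "eventually (\<lambda>t. norm (f (z + t *\<^sub>R v) - f z - t *\<^sub>R f' z v) / norm t
        = norm ((f (z + t *\<^sub>R v) - f z) /\<^sub>R t - f' z v)) (at 0)"
      unfolding eventually_at
    proof (intro exI[of _ 1] conjI ballI impI)
      fix t :: real assume "t \<noteq> 0 \<and> dist t 0 < 1"
      hence "(f (z + t *\<^sub>R v) - f z) /\<^sub>R t - f' z v = (f (z + t *\<^sub>R v) - f z - t *\<^sub>R f' z v) /\<^sub>R t"
        by (simp add: scaleR_diff_right)
      thus "norm (f (z + t *\<^sub>R v) - f z - t *\<^sub>R f' z v) / norm t
        = norm ((f (z + t *\<^sub>R v) - f z) /\<^sub>R t - f' z v)" by (simp add: divide_inverse mult.commute)
    qed simp
    ultimately have "((\<lambda>t. norm ((f (z + t *\<^sub>R v) - f z) /\<^sub>R t - f' z v)) \<longlongrightarrow> 0) (at 0)"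
      by (rule Lim_transform_eventually)
    hence "((\<lambda>t. (f (z + t *\<^sub>R v) - f z) /\<^sub>R t) \<longlongrightarrow> f' z v) (at 0)"
      by (rule LIM_zero_cancel[OF tendsto_norm_zero_cancel])
    thus ?thesis unfolding D_def
      by (rule filterlim_compose) (use hlim h in \<open>auto simp: filterlim_at less_imp_neq[symmetric]\<close>)
  qed
  \<comment> \<open>Inside, the mean value inequality bounds the quotient; the ball is enlarged by
    |v| because steps of length at most 1 may start outside the support.\<close>
  have Dbound: "cmod (D n z) \<le> C * indicator (cball 0 (\<bar>R\<bar> + cmod v)) z" for n z
  proof (cases "cmod z \<le> \<bar>R\<bar> + cmod v")
    case True
    have "cmod (f (z + h n *\<^sub>R v) - f (z + 0 *\<^sub>R v)) \<le> C * norm (h n - 0)"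
    proof (rule differentiable_bound[of "{0..h n}" "\<lambda>t. f (z + t *\<^sub>R v)" "\<lambda>t s. s *\<^sub>R f' (z + t *\<^sub>R v) v"])
      show "onorm (\<lambda>s. s *\<^sub>R f' (z + t *\<^sub>R v) v) \<le> C" for t
      proof (rule onorm_le)
        fix s :: real
        show "norm (s *\<^sub>R f' (z + t *\<^sub>R v) v) \<le> C * norm s"
          using mult_right_mono[OF C[of "z + t *\<^sub>R v"], of "norm s"] by (simp add: mult.commute)
      qed
    qed (use pt h[of n] in \<open>auto intro: less_imp_le\<close>)
    hence "cmod (f (z + h n *\<^sub>R v) - f z) \<le> C * h n" using h[of n] by simp
    moreover have "cmod (D n z) = cmod (f (z + h n *\<^sub>R v) - f z) / h n"
      unfolding D_def norm_scaleR using h[of n] by (simp add: divide_inverse mult.commute)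
    ultimately have "cmod (D n z) \<le> C" using h[of n] by (simp add: divide_le_eq)
    thus ?thesis using True by simp
  next
    case False
    have "cmod (h n *\<^sub>R v) \<le> 1 * cmod v" unfolding norm_scaleR using h[of n] by (intro mult_right_mono) auto
    hence "\<bar>R\<bar> \<le> cmod (z + h n *\<^sub>R v)" using False norm_triangle_ineq2[of z "- (h n *\<^sub>R v)"] by simp
    hence "f (z + h n *\<^sub>R v) = 0" "f z = 0" 
    proof -
      have "R \<le> cmod z" using False norm_ge_zero[of v] abs_ge_self[of R] by linarith
      moreover have "R \<le> cmod (z + h n *\<^sub>R v)" using \<open>\<bar>R\<bar> \<le> _\<close> by linarith
      ultimately show "f (z + h n *\<^sub>R v) = 0" "f z = 0" using supp(1) by auto
    qed
    thus ?thesis by (simp add: D_def C0)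
  qed
  have Dint: "(LINT z|lborel. D n z) = 0" for n
  proof -
    have "(LINT z|lborel. D n z) = ((LINT z|lborel. f (z + h n *\<^sub>R v)) - (LINT z|lborel. f z)) /\<^sub>R h n"
      unfolding D_def using intf integral_translate_complex(1)[OF intf, of "h n *\<^sub>R v"]
      by (subst integral_scaleR_right, subst Bochner_Integration.integral_diff) auto
    thus ?thesis by (simp add: integral_translate_complex(2)[OF intf])
  qed
  have "(\<lambda>n. LINT z|lborel. D n z) \<longlonglongrightarrow> (LINT z|lborel. f' z v)"
  proof (rule integral_dominated_convergence)
    show "integrable lborel (\<lambda>z. C * indicator (cball (0::complex) (\<bar>R\<bar> + cmod v)) z :: real)"
      by (intro integrable_mult_right integrable_real_indicator) (auto simp: emeasure_ball_complex)
    have [measurable]: "f \<in> borel_measurable borel" using intf by auto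
    show "D n \<in> borel_measurable lborel" for n unfolding D_def[abs_def] by measurable
    show "(\<lambda>z. f' z v) \<in> borel_measurable lborel" using int' by auto
  qed (use Dlim Dbound in auto)
  thus "(LINT z|lborel. f' z v) = 0" unfolding Dint by (simp add: LIMSEQ_const_iff)
qed

lemma integrable_inverse_quartic:
  assumes "\<delta> > 0"
  shows "integrable lborel (\<lambda>z. \<delta>\<^sup>2 / ((cmod (z - w))\<^sup>2 + \<delta>\<^sup>2)\<^sup>2 :: real)"
    and "(LINT z|lborel. \<delta>\<^sup>2 / ((cmod (z - w))\<^sup>2 + \<delta>\<^sup>2)\<^sup>2) = pi"
proof -
  have "(\<integral>\<^sup>+z. ennreal (\<delta>\<^sup>2 / ((cmod (z - w))\<^sup>2 + \<delta>\<^sup>2)\<^sup>2) \<partial>lborel)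
     = (\<integral>\<^sup>+z. ennreal (\<delta>\<^sup>2 / ((cmod ((w + z) - w))\<^sup>2 + \<delta>\<^sup>2)\<^sup>2) \<partial>lborel)"
    by (rule nn_integral_translate[symmetric]) measurable
  hence nn: "(\<integral>\<^sup>+z. ennreal (\<delta>\<^sup>2 / ((cmod (z - w))\<^sup>2 + \<delta>\<^sup>2)\<^sup>2) \<partial>lborel) = ennreal pi"
    using nn_integral_inverse_quartic[OF assms] by simp
  show i: "integrable lborel (\<lambda>z. \<delta>\<^sup>2 / ((cmod (z - w))\<^sup>2 + \<delta>\<^sup>2)\<^sup>2 :: real)"
    by (rule integrableI_nonneg) (auto simp: nn)
  show "(LINT z|lborel. \<delta>\<^sup>2 / ((cmod (z - w))\<^sup>2 + \<delta>\<^sup>2)\<^sup>2) = pi"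
    by (rule integral_eq_nn_integral[THEN trans]) (auto simp: nn)
qed

lemma integrable_inverse_norm:
  assumes "0 < R"
  shows "integrable lborel (\<lambda>z. indicator (cball 0 R) z / cmod (z - w) :: real)"
proof (rule integrableI_nonneg)
  have [measurable]: "cball (0::complex) R \<in> sets borel" by simp
  show "(\<lambda>z. indicator (cball 0 R) z / cmod (z - w) :: real) \<in> borel_measurable lborel" by measurable
  have "(\<integral>\<^sup>+z. ennreal (indicator (cball 0 R) z / cmod (z - w)) \<partial>lborel)
      = (\<integral>\<^sup>+z. ennreal (1 / cmod (z - w)) * indicator (cball 0 R) z \<partial>lborel)"
    by (intro nn_integral_cong) (auto simp: indicator_def)
  also have "\<dots> \<le> ennreal (3 * pi * R)" by (rule nn_integral_inverse_norm_subset[OF assms order_refl])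
  also have "\<dots> < \<infinity>" by simp
  finally show "(\<integral>\<^sup>+z. ennreal (indicator (cball 0 R) z / cmod (z - w)) \<partial>lborel) < \<infinity>" .
qed auto

text \<open>The Cauchy kernel is regularised to \<kappa> \<delta>, which is smooth and has d-bar
  derivative Q \<delta>. Integrating the derivatives of g times \<kappa> to 0 moves d-bar onto the
  kernel; as \<delta> tends to 0, the left side converges by domination and Q \<delta> concentrates
  mass pi at w.\<close>

lemma Cauchy_Pompeiu:
  fixes g :: "complex \<Rightarrow> complex"
  assumes der: "\<And>z. (g has_derivative g' z) (at z)"
    and cont: "continuous_on UNIV (\<lambda>z. g' z 1)" "continuous_on UNIV (\<lambda>z. g' z \<i>)"
    and supp: "\<And>z. R \<le> cmod z \<Longrightarrow> g z = 0" "\<And>z v. R \<le> cmod z \<Longrightarrow> g' z v = 0"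
  defines "gb \<equiv> \<lambda>z. (g' z 1 + \<i> * g' z \<i>) / 2"
  shows "integrable lborel (\<lambda>z. gb z / (z - w))" "(LINT z|lborel. gb z / (z - w)) = - pi * g w"
proof -
  have cg: "continuous_on UNIV g" by (rule continuous_at_imp_continuous_on) (use has_derivative_continuous[OF der] in blast)
  have cgb: "continuous_on UNIV gb" unfolding gb_def by (intro continuous_intros cont) auto
  have sgb: "gb z = 0" if "R \<le> cmod z" for z using supp(2)[OF that] by (simp add: gb_def)
  have ig: "integrable lborel g" "integrable lborel gb"
    using integrable_continuous_compact_support(1) cg cgb supp(1) sgb by blast+
  have [measurable]: "g \<in> borel_measurable borel" "gb \<in> borel_measurable borel" using ig by auto
  obtain G where G: "\<And>z. cmod (g z) \<le> G" using integrable_continuous_compact_support(2)[OF cg supp(1)] by blast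
  obtain B where B: "\<And>z. cmod (gb z) \<le> B" using integrable_continuous_compact_support(2)[OF cgb sgb] by blast
  have GB: "0 \<le> G" "0 \<le> B" using G[of 0] B[of 0] norm_ge_zero order_trans by blast+
  define Dm where "Dm z = B * (indicator (cball 0 (\<bar>R\<bar> + 1)) z / cmod (z - w))" for z
  have Dmi: "integrable lborel Dm" unfolding Dm_def by (intro integrable_mult_right integrable_inverse_norm) auto
  have Dm: "cmod (gb z) / cmod (z - w) \<le> Dm z" for z
  proof (cases "z \<in> cball 0 (\<bar>R\<bar> + 1)")
    case True thus ?thesis using B[of z] by (simp add: Dm_def divide_right_mono)
  next
    case False hence "gb z = 0" by (intro sgb) auto
    thus ?thesis using False by (simp add: Dm_def)
  qed
  show int: "integrable lborel (\<lambda>z. gb z / (z - w))"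
  proof (rule Bochner_Integration.integrable_bound[OF Dmi])
    show "AE z in lborel. norm (gb z / (z - w)) \<le> norm (Dm z)"
      unfolding norm_divide real_norm_def by (rule AE_I2, rule order_trans[OF Dm abs_ge_self])
  qed measurable
  define \<kappa> where "\<kappa> \<delta> z = cnj (z - w) / of_real ((cmod (z - w))\<^sup>2 + \<delta>\<^sup>2)" for \<delta> z
  define Q where "Q \<delta> z = \<delta>\<^sup>2 / ((cmod (z - w))\<^sup>2 + \<delta>\<^sup>2)\<^sup>2" for \<delta> z
  have id: "(LINT z|lborel. gb z * \<kappa> \<delta> z) = - (LINT z|lborel. g z * of_real (Q \<delta> z))" if \<delta>: "\<delta> > 0" for \<delta>
  proof -
    define N where "N z = (z - w) * cnj (z - w) + of_real (\<delta>\<^sup>2)" for z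
    have N: "N z = of_real ((cmod (z - w))\<^sup>2 + \<delta>\<^sup>2)" for z
      unfolding N_def by (simp only: complex_norm_square[symmetric] of_real_add of_real_power)
    have Nz: "N z \<noteq> 0" for z unfolding N of_real_eq_0_iff using \<delta> by (simp add: add_nonneg_eq_0_iff)
    have \<kappa>N: "\<kappa> \<delta> z = cnj (z - w) / N z" for z unfolding \<kappa>_def N ..
    define \<kappa>' where "\<kappa>' z v = (cnj v * N z - cnj (z - w) * (v * cnj (z - w) + (z - w) * cnj v)) / (N z * N z)" for z v
    have d\<kappa>: "(\<kappa> \<delta> has_derivative \<kappa>' z) (at z)" for z
    proof -
      have d1: "((\<lambda>z. z - w) has_derivative (\<lambda>v. v)) (at z)" by (auto intro!: derivative_eq_intros)
      note d2 = bounded_linear.has_derivative[OF bounded_linear_cnj d1]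
      have dN: "(N has_derivative (\<lambda>v. v * cnj (z - w) + (z - w) * cnj v)) (at z)"
        using has_derivative_add[OF has_derivative_mult[OF d1 d2] has_derivative_const, of "of_real (\<delta>\<^sup>2)"]
        by (simp add: N_def[abs_def] add.commute)
      show ?thesis unfolding \<kappa>N[abs_def] \<kappa>'_def by (rule has_derivative_divide'[OF d2 dN Nz])
    qed
    define F' where "F' z v = g z * \<kappa>' z v + g' z v * \<kappa> \<delta> z" for z v
    have dF: "((\<lambda>z. g z * \<kappa> \<delta> z) has_derivative F' z) (at z)" for z
      unfolding F'_def by (rule has_derivative_mult[OF der d\<kappa>])
    have cN: "continuous_on UNIV N" unfolding N_def by (intro continuous_intros)
    have cF: "continuous_on UNIV (\<lambda>z. F' z v)" if "continuous_on UNIV (\<lambda>z. g' z v)" for v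
      unfolding F'_def \<kappa>N \<kappa>'_def by (intro continuous_intros cg cN that) (use Nz in auto)
    have z0: "g z * \<kappa> \<delta> z = 0" "F' z v = 0" if "R \<le> cmod z" for z v
      using supp(1)[OF that] supp(2)[OF that] by (auto simp: F'_def)
    note i1 = integral_directional_derivative[OF dF cF[OF cont(1)] z0]
    note ii = integral_directional_derivative[OF dF cF[OF cont(2)] z0]
    have comb: "F' z 1 + \<i> * F' z \<i> = 2 * (gb z * \<kappa> \<delta> z + g z * of_real (Q \<delta> z))" for z
    proof -
      have k: "\<kappa>' z 1 + \<i> * \<kappa>' z \<i> = 2 * of_real (Q \<delta> z)"
      proof -
        have "\<kappa>' z 1 + \<i> * \<kappa>' z \<i> = 2 * of_real (\<delta>\<^sup>2) / (N z * N z)"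
          unfolding \<kappa>'_def by (simp add: add_divide_distrib[symmetric] N_def algebra_simps)
        also have "\<dots> = 2 * of_real (Q \<delta> z)" unfolding N Q_def by (simp add: power2_eq_square)
        finally show ?thesis .
      qed
      have "F' z 1 + \<i> * F' z \<i> = g z * (\<kappa>' z 1 + \<i> * \<kappa>' z \<i>) + 2 * (gb z * \<kappa> \<delta> z)"
        by (simp add: F'_def gb_def algebra_simps)
      thus ?thesis unfolding k by (simp add: algebra_simps)
    qed
    have iQ: "integrable lborel (\<lambda>z. g z * of_real (Q \<delta> z))"
    proof (rule Bochner_Integration.integrable_bound)
      show "integrable lborel (\<lambda>z. G * Q \<delta> z)" unfolding Q_def using integrable_inverse_quartic(1)[OF \<delta>] by (rule integrable_mult_right)
      show "AE z in lborel. norm (g z * of_real (Q \<delta> z)) \<le> norm (G * Q \<delta> z)"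
        using GB G by (intro AE_I2) (simp add: norm_mult abs_mult mult_right_mono)
    qed (auto simp: Q_def)
    have ik: "integrable lborel (\<lambda>z. gb z * \<kappa> \<delta> z)"
    proof (rule integrable_continuous_compact_support(1))
      show "continuous_on UNIV (\<lambda>z. gb z * \<kappa> \<delta> z)" unfolding \<kappa>N by (intro continuous_intros cgb cN) (use Nz in auto)
    qed (use sgb in auto)
    have "0 = (LINT z|lborel. F' z 1 + \<i> * F' z \<i>)"
      using i1 ii by (subst Bochner_Integration.integral_add) auto
    also have "\<dots> = 2 * ((LINT z|lborel. gb z * \<kappa> \<delta> z) + (LINT z|lborel. g z * of_real (Q \<delta> z)))"
      unfolding comb using ik iQ by (subst integral_mult_right_zero, subst Bochner_Integration.integral_add) auto
    finally have "0 = 2 * ((LINT z|lborel. gb z * \<kappa> \<delta> z) + (LINT z|lborel. g z * of_real (Q \<delta> z)))" .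
    moreover have "Y = 0" if "0 = 2 * Y" for Y :: complex using that by simp
    ultimately show ?thesis by (simp only: eq_neg_iff_add_eq_0)
  qed
  define d where "d n = inverse (real (Suc n))" for n
  have d: "0 < d n" "d n \<le> 1" for n by (auto simp: d_def inverse_eq_divide divide_le_eq)
  have dlim: "d \<longlonglongrightarrow> 0" unfolding d_def[abs_def] by (rule LIMSEQ_inverse_real_of_nat)
  have L1: "(\<lambda>n. LINT z|lborel. gb z * \<kappa> (d n) z) \<longlonglongrightarrow> (LINT z|lborel. gb z / (z - w))"
  proof (rule integral_dominated_convergence[OF _ _ Dmi])
    show "(\<lambda>z. gb z / (z - w)) \<in> borel_measurable lborel" "(\<lambda>z. gb z * \<kappa> (d n) z) \<in> borel_measurable lborel" for n
    proof -
      have [measurable]: "\<kappa> \<delta> \<in> borel_measurable borel" for \<delta>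
        unfolding \<kappa>_def[abs_def]
        by (intro borel_measurable_divide borel_measurable_continuous_onI continuous_intros)
      show "(\<lambda>z. gb z / (z - w)) \<in> borel_measurable lborel" "(\<lambda>z. gb z * \<kappa> (d n) z) \<in> borel_measurable lborel" for n
        by measurable
    qed
    show "AE z in lborel. (\<lambda>n. gb z * \<kappa> (d n) z) \<longlonglongrightarrow> gb z / (z - w)"
    proof (rule AE_I2)
      fix z
      show "(\<lambda>n. gb z * \<kappa> (d n) z) \<longlonglongrightarrow> gb z / (z - w)"
      proof (cases "z = w")
        case False
        hence nz: "of_real ((cmod (z - w))\<^sup>2 + 0\<^sup>2) \<noteq> (0::complex)" by simp
        have "(\<lambda>n. gb z * \<kappa> (d n) z) \<longlonglongrightarrow> gb z * (cnj (z - w) / of_real ((cmod (z - w))\<^sup>2 + 0\<^sup>2))"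
          unfolding \<kappa>_def by (intro tendsto_intros dlim nz)
        moreover have "cnj (z - w) / of_real ((cmod (z - w))\<^sup>2 + 0\<^sup>2) = 1 / (z - w)"
          using False complex_norm_square[of "z - w"] by (simp add: divide_simps)
        ultimately have "(\<lambda>n. gb z * \<kappa> (d n) z) \<longlonglongrightarrow> gb z * (1 / (z - w))" by (simp only:)
        thus ?thesis by simp
      qed (simp add: \<kappa>_def)
    qed
    show "AE z in lborel. cmod (gb z * \<kappa> (d n) z) \<le> Dm z" for n
    proof (rule AE_I2)
      fix z
      have "cmod (\<kappa> (d n) z) = cmod (z - w) / ((cmod (z - w))\<^sup>2 + (d n)\<^sup>2)"
        unfolding \<kappa>_def norm_divide norm_of_real complex_mod_cnj by simp
      also have "\<dots> \<le> 1 / cmod (z - w)"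
        using d[of n] by (cases "z = w") (auto simp: divide_simps power2_eq_square add_pos_pos)
      finally have "cmod (gb z * \<kappa> (d n) z) \<le> cmod (gb z) * (1 / cmod (z - w))"
        unfolding norm_mult by (rule mult_left_mono) simp
      thus "cmod (gb z * \<kappa> (d n) z) \<le> Dm z" using Dm[of z] by simp
    qed
  qed
  have L2: "(\<lambda>n. LINT z|lborel. g z * of_real (Q (d n) z)) \<longlonglongrightarrow> of_real pi * g w"
  proof (rule LIMSEQ_I)
    fix e :: real assume "e > 0"
    define e' where "e' = e / (2 * pi)"
    have e': "e' > 0" using \<open>e > 0\<close> by (simp add: e'_def)
    have "isCont g w" using cg by (simp add: continuous_on_eq_continuous_at)
    then obtain \<eta> where \<eta>: "\<eta> > 0" "\<And>z. dist z w < \<eta> \<Longrightarrow> dist (g z) (g w) < e'"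
      unfolding continuous_at_eps_delta using e' by blast
    \<comment> \<open>Outside the \<eta>-ball about w, Q \<delta> is at most c \<delta>^2 times Q 1,
      whose integral is again pi; this bounds the tail of the approximate identity.\<close>
    define c where "c = ((1 + \<eta>\<^sup>2) / \<eta>\<^sup>2)\<^sup>2"
    have "(\<lambda>n. 2 * G * c * pi * (d n)\<^sup>2) \<longlonglongrightarrow> 2 * G * c * pi * 0\<^sup>2" by (intro tendsto_intros dlim)
    hence "eventually (\<lambda>n. 2 * G * c * pi * (d n)\<^sup>2 < e / 2) sequentially" by (rule order_tendstoD) (use \<open>e > 0\<close> in simp)
    then obtain n0 where n0: "\<And>n. n \<ge> n0 \<Longrightarrow> 2 * G * c * pi * (d n)\<^sup>2 < e / 2" by (auto simp: eventually_sequentially)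
    have "cmod ((LINT z|lborel. g z * of_real (Q (d n) z)) - of_real pi * g w) < e" if "n \<ge> n0" for n
    proof -
      note Qi = integrable_inverse_quartic[OF d(1)[of n], of w, folded Q_def]
      note Q1 = integrable_inverse_quartic[OF zero_less_one, of w, folded Q_def]
      have iQ: "integrable lborel (\<lambda>z. g z * of_real (Q (d n) z))"
      proof (rule Bochner_Integration.integrable_bound)
        show "integrable lborel (\<lambda>z. G * Q (d n) z)" using Qi(1) by (rule integrable_mult_right)
        show "AE z in lborel. norm (g z * of_real (Q (d n) z)) \<le> norm (G * Q (d n) z)"
          using GB G by (intro AE_I2) (simp add: norm_mult abs_mult mult_right_mono)
      qed (auto simp: Q_def)
      have iw: "integrable lborel (\<lambda>z. g w * of_real (Q (d n) z))"
        using Qi(1) by (intro integrable_mult_right integrable_of_real)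
      have "(LINT z|lborel. g z * of_real (Q (d n) z)) - of_real pi * g w
          = (LINT z|lborel. g z * of_real (Q (d n) z)) - (LINT z|lborel. g w * of_real (Q (d n) z))"
        by (simp add: Qi(2) mult.commute)
      also have "\<dots> = (LINT z|lborel. (g z - g w) * of_real (Q (d n) z))"
        unfolding left_diff_distrib by (rule Bochner_Integration.integral_diff[symmetric, OF iQ iw])
      also have "cmod \<dots> \<le> (LINT z|lborel. e' * Q (d n) z + 2 * G * c * (d n)\<^sup>2 * Q 1 z)"
      proof (rule Bochner_Integration.integral_norm_bound_integral)
        show "integrable lborel (\<lambda>z. (g z - g w) * of_real (Q (d n) z))"
          unfolding left_diff_distrib by (intro Bochner_Integration.integrable_diff iQ iw)
        show "integrable lborel (\<lambda>z. e' * Q (d n) z + 2 * G * c * (d n)\<^sup>2 * Q 1 z)"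
          by (intro Bochner_Integration.integrable_add integrable_mult_right Qi Q1)
        fix z
        have Q0: "0 \<le> Q (d n) z" "0 \<le> Q 1 z" by (auto simp: Q_def)
        have c0: "0 \<le> 2 * G * c * (d n)\<^sup>2 * Q 1 z" using GB Q0 by (simp add: c_def)
        have nm: "cmod ((g z - g w) * of_real (Q (d n) z)) = cmod (g z - g w) * Q (d n) z"
          using Q0 by (simp add: norm_mult)
        show "cmod ((g z - g w) * of_real (Q (d n) z)) \<le> e' * Q (d n) z + 2 * G * c * (d n)\<^sup>2 * Q 1 z"
        proof (cases "dist z w < \<eta>")
          case True
          hence "cmod (g z - g w) * Q (d n) z \<le> e' * Q (d n) z"
            using \<eta>(2)[of z] Q0 by (intro mult_right_mono) (auto simp: dist_norm)
          thus ?thesis unfolding nm using c0 by linarith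
        next
          case False
          define x where "x = (cmod (z - w))\<^sup>2"
          have x: "\<eta>\<^sup>2 \<le> x" "0 < x" using False \<eta>(1) by (auto simp: x_def dist_norm intro!: power_mono)
          have "x + 1\<^sup>2 \<le> (1 + \<eta>\<^sup>2) / \<eta>\<^sup>2 * x" using x \<eta>(1) by (simp add: field_simps)
          also have "\<dots> \<le> (1 + \<eta>\<^sup>2) / \<eta>\<^sup>2 * (x + (d n)\<^sup>2)" by (intro mult_left_mono) auto
          finally have "(x + 1\<^sup>2)\<^sup>2 \<le> ((1 + \<eta>\<^sup>2) / \<eta>\<^sup>2 * (x + (d n)\<^sup>2))\<^sup>2" using x by (intro power_mono) auto
          hence le: "(x + 1\<^sup>2)\<^sup>2 \<le> c * (x + (d n)\<^sup>2)\<^sup>2" by (simp only: c_def power_mult_distrib)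
          have p: "0 < (x + (d n)\<^sup>2)\<^sup>2" "0 < (x + 1\<^sup>2)\<^sup>2" using x by (auto simp: add_pos_nonneg add_nonneg_eq_0_iff)
          have "1 / (x + (d n)\<^sup>2)\<^sup>2 \<le> c / (x + 1\<^sup>2)\<^sup>2" using le p by (simp add: divide_simps mult.commute)
          hence "(d n)\<^sup>2 * (1 / (x + (d n)\<^sup>2)\<^sup>2) \<le> (d n)\<^sup>2 * (c / (x + 1\<^sup>2)\<^sup>2)" by (rule mult_left_mono) simp
          hence "Q (d n) z \<le> c * (d n)\<^sup>2 * Q 1 z" by (simp add: Q_def x_def mult.commute)
          moreover have "cmod (g z - g w) \<le> 2 * G" using norm_triangle_ineq4[of "g z" "g w"] G[of z] G[of w] by linarith
          ultimately have "cmod (g z - g w) * Q (d n) z \<le> (2 * G) * (c * (d n)\<^sup>2 * Q 1 z)"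
            using Q0 GB by (intro mult_mono) auto
          moreover have "0 \<le> e' * Q (d n) z" using e' Q0 by simp
          ultimately show ?thesis unfolding nm by (simp add: mult.assoc)
        qed
      qed
      also have "\<dots> = e' * pi + 2 * G * c * (d n)\<^sup>2 * pi"
        using Qi Q1 by (subst Bochner_Integration.integral_add) auto
      also have "\<dots> < e" using n0[OF that] \<open>e > 0\<close> by (simp add: e'_def mult_ac)
      finally show ?thesis .
    qed
    thus "\<exists>no. \<forall>n\<ge>no. norm ((LINT z|lborel. g z * of_real (Q (d n) z)) - of_real pi * g w) < e" by blast
  qed
  have "(\<lambda>n. LINT z|lborel. gb z * \<kappa> (d n) z) \<longlonglongrightarrow> - (of_real pi * g w)"
    unfolding id[OF d(1)] by (intro tendsto_intros L2)
  from LIMSEQ_unique[OF L1 this] show "(LINT z|lborel. gb z / (z - w)) = - pi * g w" by simp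
qed

section \<open>The Jones kernel of a net of points\<close>

lemma rho_measurable [measurable]: "rho z \<in> borel_measurable borel"
  unfolding rho_def by (intro borel_measurable_divide borel_measurable_continuous_onI continuous_intros)

lemma open_rho_disc: "cmod a < 1 \<Longrightarrow> open {w \<in> disc. rho w a < r}"
proof -
  assume a: "cmod a < 1"
  have "continuous_on disc (\<lambda>w. rho w a)"
    unfolding rho_def using one_minus_cnj_mult_nz[of _ a] a by (intro continuous_intros) (auto simp: less_imp_le)
  hence "open (disc \<inter> (\<lambda>w. rho w a) -` {..<r})" by (intro continuous_open_preimage) auto
  moreover have "disc \<inter> (\<lambda>w. rho w a) -` {..<r} = {w \<in> disc. rho w a < r}" by auto
  ultimately show ?thesis by simp
qed

text \<open>Y is the net, \<open>idx\<close> the label of its family and r the radius of the cells.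
  Countability of Y makes the cells a measurable partition; r \<le> 1/3 keeps the Harnack constant
  at most 2.\<close>

locale jones =
  fixes Y :: "complex set" and idx :: "complex \<Rightarrow> nat" and k :: nat and r :: real
  assumes Y_disc: "Y \<subseteq> disc" and Y_countable: "countable Y" and r: "0 < r" "r \<le> 1 / 3"
    and idx: "\<And>a. a \<in> Y \<Longrightarrow> idx a \<in> {1..k}" and sep: "\<And>i. sepset {a \<in> Y. idx a = i}"
begin

definition fam :: "nat \<Rightarrow> complex set" where "fam i = {a \<in> Y. idx a = i}"

definition U :: "complex set" where "U = {w \<in> disc. \<exists>a\<in>Y. rho w a < r}"

text \<open>The covering discs overlap; taking the first net point in a fixed enumeration makes the
  cells disjoint, and each cell is an open set minus open sets.\<close>

definition pt :: "complex \<Rightarrow> complex" where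
  "pt w = from_nat_into Y (LEAST n. \<exists>a\<in>Y. to_nat_on Y a = n \<and> rho w a < r)"

definition cell :: "complex \<Rightarrow> complex set" where "cell a = {w \<in> U. pt w = a}"

text \<open>The Harnack constant of a cell.\<close>

definition T :: real where "T = (1 + r) / (1 - r)"

text \<open>Bounds exp (Re \<open>E\<close> / 2) on a cell: the exponent is half the bound of
  \<open>Re_Psi_le\<close>.\<close>

definition KK :: real where "KK = exp (T\<^sup>2 * (13 / 50))"

lemma Y1: "a \<in> Y \<Longrightarrow> cmod a < 1" using Y_disc by auto

lemma U_disc: "w \<in> U \<Longrightarrow> cmod w < 1" by (simp add: U_def)

lemma sepset_fam: "sepset (fam i)" unfolding fam_def by (rule sep)

lemma blaschke_fam: "blaschke_set (fam i)" by (rule sepset_blaschke_set[OF sepset_fam])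

lemma T_bounds: "1 \<le> T" "T \<le> 2" "0 < T" "r < 1"
  using r by (auto simp: T_def field_simps)

lemma KK_pos: "0 < KK" by (simp add: KK_def)

lemma pt:
  assumes "w \<in> U" shows "pt w \<in> Y" "rho w (pt w) < r"
proof -
  define P where "P n \<longleftrightarrow> (\<exists>a\<in>Y. to_nat_on Y a = n \<and> rho w a < r)" for n
  have "\<exists>n. P n" using assms by (auto simp: P_def U_def)
  hence "P (LEAST n. P n)" by (rule LeastI_ex)
  then obtain a where a: "a \<in> Y" "to_nat_on Y a = (LEAST n. P n)" "rho w a < r" unfolding P_def by blast
  have "pt w = from_nat_into Y (to_nat_on Y a)" unfolding pt_def a(2) P_def ..
  also have "\<dots> = a" by (rule from_nat_into_to_nat_on[OF Y_countable a(1)])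
  finally show "pt w \<in> Y" "rho w (pt w) < r" using a by auto
qed

lemma cell_subset: "cell a \<subseteq> {w. cmod w < 1 \<and> rho w a < r}"
  using pt U_disc by (auto simp: cell_def)

lemma cell_eq:
  assumes a: "a \<in> Y"
  shows "cell a = {w \<in> disc. rho w a < r} - (\<Union>b\<in>{b\<in>Y. to_nat_on Y b < to_nat_on Y a}. {w \<in> disc. rho w b < r})"
proof (intro equalityI subsetI)
  fix w assume w: "w \<in> cell a"
  hence wU: "w \<in> U" and pa: "pt w = a" by (auto simp: cell_def)
  have "\<not> rho w b < r" if b: "b \<in> Y" "to_nat_on Y b < to_nat_on Y a" for b
  proof
    assume "rho w b < r"
    hence "(LEAST n. \<exists>a\<in>Y. to_nat_on Y a = n \<and> rho w a < r) \<le> to_nat_on Y b" by (intro Least_le) (use b in auto)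
    moreover have "to_nat_on Y a = (LEAST n. \<exists>a\<in>Y. to_nat_on Y a = n \<and> rho w a < r)"
    proof -
      have "\<exists>n. \<exists>a\<in>Y. to_nat_on Y a = n \<and> rho w a < r" using wU by (auto simp: U_def)
      from LeastI_ex[OF this] obtain c where c: "c \<in> Y" "to_nat_on Y c = (LEAST n. \<exists>a\<in>Y. to_nat_on Y a = n \<and> rho w a < r)" by blast
      hence "pt w = c" unfolding pt_def c(2)[symmetric] by (intro from_nat_into_to_nat_on Y_countable)
      thus ?thesis using c pa by simp
    qed
    ultimately show False using b by simp
  qed
  thus "w \<in> {w \<in> disc. rho w a < r} - (\<Union>b\<in>{b\<in>Y. to_nat_on Y b < to_nat_on Y a}. {w \<in> disc. rho w b < r})"
    using cell_subset w by auto
next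
  fix w assume w: "w \<in> {w \<in> disc. rho w a < r} - (\<Union>b\<in>{b\<in>Y. to_nat_on Y b < to_nat_on Y a}. {w \<in> disc. rho w b < r})"
  hence wU: "w \<in> U" using a by (auto simp: U_def)
  have "(LEAST n. \<exists>a\<in>Y. to_nat_on Y a = n \<and> rho w a < r) = to_nat_on Y a"
    by (rule Least_equality) (use w a in \<open>auto simp: not_less[symmetric]\<close>)
  hence "pt w = a" by (simp add: pt_def from_nat_into_to_nat_on[OF Y_countable a])
  thus "w \<in> cell a" using wU by (simp add: cell_def)
qed

lemma U_measurable [measurable]: "U \<in> sets borel"
proof -
  have "U = (\<Union>a\<in>Y. {w \<in> disc. rho w a < r})" by (auto simp: U_def)
  hence "open U" using open_rho_disc Y1 by auto
  thus ?thesis by simp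
qed

lemma cell_measurable: "a \<in> Y \<Longrightarrow> cell a \<in> sets borel"
  unfolding cell_eq using Y_countable open_rho_disc Y1
  by (intro sets.Diff sets.countable_UN') (auto intro!: borel_open)

text \<open>The kernel depends on w also through \<open>pt w\<close>, which takes only countably
  many values; \<open>None\<close> stands for the points outside U.\<close>

lemma measurable_pt:
  assumes G: "\<And>a. a \<in> Y \<Longrightarrow> G a \<in> borel_measurable M" and h: "h \<in> M \<rightarrow>\<^sub>M borel"
  shows "(\<lambda>x. if h x \<in> U then G (pt (h x)) x else (0::complex)) \<in> borel_measurable M"
proof -
  define I where "I = insert None (Some ` Y)"
  define g where "g x = (if h x \<in> U then Some (pt (h x)) else None)" for x
  have "g \<in> M \<rightarrow>\<^sub>M count_space I"
  proof (subst measurable_count_space_eq_countable)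
    show "countable I" using Y_countable by (simp add: I_def)
    show "g \<in> space M \<rightarrow> I \<and> (\<forall>b\<in>I. g -` {b} \<inter> space M \<in> sets M)"
    proof (intro conjI ballI)
      show "g \<in> space M \<rightarrow> I" using pt by (auto simp: g_def I_def)
      fix b assume "b \<in> I"
      then consider "b = None" | a where "a \<in> Y" "b = Some a" by (auto simp: I_def)
      thus "g -` {b} \<inter> space M \<in> sets M"
      proof cases
        case 1
        have "g -` {b} \<inter> space M = h -` (- U) \<inter> space M" by (auto simp: g_def 1 split: if_splits)
        thus ?thesis using measurable_sets[OF h, of "- U"] U_measurable by auto
      next
        case 2
        have "g -` {b} \<inter> space M = h -` cell a \<inter> space M" by (auto simp: g_def 2 cell_def split: if_splits)
        thus ?thesis using measurable_sets[OF h cell_measurable[OF 2(1)]] by simp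
      qed
    qed
  qed
  hence "(\<lambda>x. (\<lambda>i x. case i of None \<Rightarrow> 0 | Some a \<Rightarrow> G a x) (g x) x) \<in> borel_measurable M"
    by (rule measurable_compose_countable'[rotated]) (use Y_countable G in \<open>auto simp: I_def\<close>)
  moreover have "(\<lambda>x. (\<lambda>i x. case i of None \<Rightarrow> 0 | Some a \<Rightarrow> G a x) (g x) x) = (\<lambda>x. if h x \<in> U then G (pt (h x)) x else 0)"
    by (auto simp: g_def fun_eq_iff)
  ultimately show ?thesis by simp
qed

section \<open>The kernel without its Cauchy factor\<close>

definition E :: "complex \<Rightarrow> complex \<Rightarrow> complex" where "E a z = Psi (fam (idx a)) a z"

lemma E_holomorphic: "E a holomorphic_on disc"
  unfolding E_def[abs_def] by (rule Psi_holomorphic[OF blaschke_fam])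

definition jexp :: "complex \<Rightarrow> complex \<Rightarrow> complex \<Rightarrow> complex" where
  "jexp a z w = exp (- ((E a z - E a w) / 2))"

lemma norm_jexp_le:
  assumes a: "a \<in> Y" and z: "cmod z < 1" and w: "cmod w < 1" "rho w a \<le> r"
  shows "cmod (jexp a z w) \<le> KK * exp (- (Re (E a z) / 2))" "cmod (jexp a z w) \<le> KK"
proof -
  have af: "a \<in> fam (idx a)" using a by (simp add: fam_def)
  have "Re (E a w) \<le> T\<^sup>2 * (13 / 25)"
    unfolding E_def T_def by (rule Re_Psi_le[OF sepset_fam af w T_bounds(4)])
  hence 1: "exp (Re (E a w) / 2) \<le> KK" by (simp add: KK_def)
  have "cmod (jexp a z w) = exp (Re (E a w) / 2) * exp (- (Re (E a z) / 2))"
    by (simp add: jexp_def norm_exp_eq_Re exp_add[symmetric] field_simps)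
  also have "\<dots> \<le> KK * exp (- (Re (E a z) / 2))" using 1 by (rule mult_right_mono) simp
  finally show 2: "cmod (jexp a z w) \<le> KK * exp (- (Re (E a z) / 2))" .
  have "exp (- (Re (E a z) / 2)) \<le> 1" using Re_Psi_nonneg[OF blaschke_fam z] by (simp add: E_def)
  hence "KK * exp (- (Re (E a z) / 2)) \<le> KK * 1" using KK_pos by (intro mult_left_mono) auto
  thus "cmod (jexp a z w) \<le> KK" using 2 by simp
qed

text \<open>On the diagonal of U the value is 1 / (pi (1 - |w|^2)), which is where the weight on the
  right-hand side of the equation comes from. The default 0 makes it a measurable function on the
  whole plane.\<close>

definition num :: "complex \<Rightarrow> complex \<Rightarrow> complex" where
  "num z w = (if w \<in> U then (if z \<in> disc then jexp (pt w) z w / (of_real pi * (1 - cnj w * z)) else 0) else 0)"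

lemma num_eq: "w \<in> U \<Longrightarrow> z \<in> disc \<Longrightarrow> num z w = jexp (pt w) z w / (of_real pi * (1 - cnj w * z))"
  by (simp add: num_def)

lemma num_diag: "w \<in> U \<Longrightarrow> num w w = 1 / of_real (pi * (1 - (cmod w)\<^sup>2))"
  using U_disc[of w] complex_norm_square[of w] by (simp add: num_eq jexp_def mult.commute)

lemma num_holomorphic:
  assumes "cmod w < 1" shows "(\<lambda>z. num z w) holomorphic_on disc"
proof (cases "w \<in> U")
  case True
  have "(\<lambda>z. jexp (pt w) z w / (of_real pi * (1 - cnj w * z))) holomorphic_on disc"
    unfolding jexp_def using one_minus_cnj_mult_nz[of _ w] assms
    by (intro holomorphic_intros E_holomorphic) (auto simp: less_imp_le)
  thus ?thesis by (rule holomorphic_transform) (use True in \<open>auto simp: num_def\<close>)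
qed (simp add: num_def)

text \<open>Joint measurability is what Fubini's theorem requires in the weak formulation.\<close>

lemma num_measurable_pair: "(\<lambda>(z, w). num z w) \<in> borel_measurable borel"
proof -
  define G where "G a x = indicator (disc \<times> disc) x *\<^sub>R
     (jexp a (fst x) (snd x) / (of_real pi * (1 - cnj (snd x) * fst x)))" for a and x :: "complex \<times> complex"
  have "G a \<in> borel_measurable borel" for a
    unfolding G_def
  proof (rule borel_measurable_continuous_on_indicator)
    show "disc \<times> disc \<in> sets borel" by (intro borel_open open_Times) auto
    have c: "continuous_on disc (E a)" by (rule holomorphic_on_imp_continuous_on[OF E_holomorphic])
    have "continuous_on (disc \<times> disc) (\<lambda>x. E a (fst x))" "continuous_on (disc \<times> disc) (\<lambda>x. E a (snd x))"
      by (rule continuous_on_compose2[OF c]; auto intro!: continuous_intros)+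
    thus "continuous_on (disc \<times> disc) (\<lambda>x. jexp a (fst x) (snd x) / (of_real pi * (1 - cnj (snd x) * fst x)))"
      unfolding jexp_def using one_minus_cnj_mult_nz by (intro continuous_intros) (auto simp: less_imp_le)
  qed
  hence "(\<lambda>x. if snd x \<in> U then G (pt (snd x)) x else 0) \<in> borel_measurable borel"
    by (intro measurable_pt) (auto intro!: borel_measurable_continuous_onI continuous_intros)
  moreover have "(\<lambda>x. if snd x \<in> U then G (pt (snd x)) x else 0) = (\<lambda>(z, w). num z w)"
    using U_disc by (auto simp: fun_eq_iff num_def G_def indicator_def)
  ultimately show ?thesis by simp
qed

lemma num_measurable [measurable]: "num z \<in> borel_measurable borel"
proof -
  have "(\<lambda>w. (\<lambda>(z, w). num z w) (z, w)) \<in> borel_measurable borel"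
    by (rule measurable_compose[OF _ num_measurable_pair]) (auto intro!: borel_measurable_continuous_onI continuous_intros)
  thus ?thesis by simp
qed

lemma norm_num_le:
  assumes "cmod z < 1" shows "cmod (num z w) \<le> KK / (1 - cmod z)"
proof (cases "w \<in> U")
  case True
  have w: "cmod w < 1" using U_disc[OF True] .
  have "cmod (num z w) = cmod (jexp (pt w) z w) / (pi * cmod (1 - cnj w * z))"
    using True assms by (simp add: num_eq norm_divide norm_mult)
  also have "\<dots> \<le> KK / (1 * (1 - cmod z))"
    using pt[OF True] w assms KK_pos norm_jexp_le(2)[of "pt w" z w] one_minus_cnj_mult_le'[of w z] pi_gt3
    by (intro frac_le mult_mono) auto
  finally show ?thesis by simp
qed (use assms KK_pos in \<open>simp add: num_def\<close>)

text \<open>The central estimate. On the cell of a, the kernel is bounded by the Jones weight of a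
  times the hyperbolic density, so only the integral of g over a cell, against that density,
  matters; the sum of the weights over the family is at most 5. The function g is left free to serve
  both \<open>ker\<close>, with 1 / \<open>rho\<close>, and the operators with an inserted Blaschke
  factor.\<close>

lemma family_bound:
  fixes g :: "complex \<Rightarrow> ennreal"
  assumes [measurable]: "g \<in> borel_measurable borel"
    and M: "\<And>a. a \<in> fam i \<Longrightarrow> (\<integral>\<^sup>+w. ennreal (1 / (1 - (cmod w)\<^sup>2)\<^sup>2) * g w * indicator (cell a) w \<partial>lborel) \<le> ennreal M"
    and M0: "0 \<le> M" and z: "cmod z < 1"
  shows "(\<integral>\<^sup>+w. ennreal (cmod (num z w) * pi / cmod (1 - cnj w * z)) * g w * indicator {w\<in>U. idx (pt w) = i} w \<partial>lborel)
     \<le> ennreal (5 * T\<^sup>2 * KK * M)"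
proof -
  define F where "F w = ennreal (cmod (num z w) * pi / cmod (1 - cnj w * z)) * g w" for w
  have [measurable]: "(\<lambda>w. cmod (1 - cnj w * z)) \<in> borel_measurable borel"
    by (intro borel_measurable_continuous_onI continuous_intros)
  have Fm [measurable]: "F \<in> borel_measurable borel" unfolding F_def by measurable
  define \<mu> where "\<mu> = density lborel F"
  define h where "h a = Re (herg a z) * exp (- (Re (E a z) / 2))" for a
  have cell_le: "emeasure \<mu> (cell a) \<le> ennreal (T\<^sup>2 * KK * h a * M)" if a: "a \<in> fam i" for a
  proof -
    have aY: "a \<in> Y" using a by (simp add: fam_def)
    have a1: "cmod a < 1" using Y1[OF aY] .
    have h0: "0 \<le> h a" using Re_herg_nonneg[OF a1 z] by (simp add: h_def)
    have c0: "0 \<le> T\<^sup>2 * KK * h a" using h0 KK_pos by simp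
    have "F w * indicator (cell a) w \<le> ennreal (T\<^sup>2 * KK * h a) * (ennreal (1 / (1 - (cmod w)\<^sup>2)\<^sup>2) * g w * indicator (cell a) w)" for w
    proof (cases "w \<in> cell a")
      case True
      hence wU: "w \<in> U" and pa: "pt w = a" by (auto simp: cell_def)
      have w1: "cmod w < 1" and wr: "rho w a \<le> r" using pt[OF wU] U_disc[OF wU] pa by auto
      define x where "x = 1 - (cmod w)\<^sup>2"
      have x: "0 < x" using one_minus_sq_pos[OF w1] by (simp add: x_def)
      define D where "D = cmod (1 - cnj w * z)"
      have D: "0 < D" unfolding D_def using one_minus_cnj_mult_pos[of z w] z w1 by simp
      have "x / D\<^sup>2 \<le> T * ((1 - (cmod a)\<^sup>2) / (cmod (1 - cnj a * z))\<^sup>2)"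
        unfolding x_def D_def T_def by (rule distort_poisson) (use a1 w1 z wr T_bounds in auto)
      moreover have "x \<le> T * (1 - (cmod a)\<^sup>2)"
        unfolding x_def T_def by (rule distort_height) (use a1 w1 wr T_bounds in auto)
      ultimately have "x * (x / D\<^sup>2) \<le> (T * (1 - (cmod a)\<^sup>2)) * (T * ((1 - (cmod a)\<^sup>2) / (cmod (1 - cnj a * z))\<^sup>2))"
        using x T_bounds one_minus_sq_nonneg[of a] a1 by (intro mult_mono) auto
      also have "\<dots> = T\<^sup>2 * ((1 - (cmod a)\<^sup>2)\<^sup>2 / (cmod (1 - cnj a * z))\<^sup>2)" by (simp add: power2_eq_square mult_ac)
      also have "\<dots> \<le> T\<^sup>2 * Re (herg a z)" using Re_herg_ge[OF a1 z] by (intro mult_left_mono) auto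
      finally have p: "x * (x / D\<^sup>2) \<le> T\<^sup>2 * Re (herg a z)" .
      have je: "cmod (jexp a z w) \<le> KK * exp (- (Re (E a z) / 2))" by (rule norm_jexp_le(1)[OF aY z w1 wr])
      \<comment> \<open>1 / D^2 is written as x^2 / D^2 times the density 1 / x^2. One factor x is
        compared with the height of a, the other with the Poisson kernel at a; together they give (1
        - |a|^2)^2 / |1 - cnj a * z|^2.\<close>
      have "cmod (num z w) * pi / D = cmod (jexp a z w) * (x * (x / D\<^sup>2)) * (1 / x\<^sup>2)"
      proof -
        have nn: "cmod (num z w) = cmod (jexp a z w) / (pi * D)"
          using wU z by (simp add: num_eq pa norm_divide norm_mult D_def)
        show ?thesis unfolding nn using x D by (simp add: power2_eq_square field_simps)
      qed
      also have "\<dots> \<le> (KK * exp (- (Re (E a z) / 2))) * (T\<^sup>2 * Re (herg a z)) * (1 / x\<^sup>2)"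
        by (rule mult_right_mono[OF mult_mono[OF je p]]) (use x KK_pos in auto)
      also have "\<dots> = T\<^sup>2 * KK * h a * (1 / x\<^sup>2)" by (simp add: h_def mult_ac)
      finally have "ennreal (cmod (num z w) * pi / D) \<le> ennreal (T\<^sup>2 * KK * h a) * ennreal (1 / x\<^sup>2)"
        using c0 by (subst ennreal_mult[symmetric]) (auto intro: ennreal_leI)
      hence "ennreal (cmod (num z w) * pi / D) * g w \<le> ennreal (T\<^sup>2 * KK * h a) * ennreal (1 / x\<^sup>2) * g w" by (rule mult_right_mono) simp
      thus ?thesis using True by (simp add: F_def x_def D_def mult.assoc)
    qed simp
    hence "(\<integral>\<^sup>+w. F w * indicator (cell a) w \<partial>lborel)
      \<le> (\<integral>\<^sup>+w. ennreal (T\<^sup>2 * KK * h a) * (ennreal (1 / (1 - (cmod w)\<^sup>2)\<^sup>2) * g w * indicator (cell a) w) \<partial>lborel)"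
      by (rule nn_integral_mono)
    also have "\<dots> = ennreal (T\<^sup>2 * KK * h a) * (\<integral>\<^sup>+w. (ennreal (1 / (1 - (cmod w)\<^sup>2)\<^sup>2) * g w * indicator (cell a) w) \<partial>lborel)"
    proof -
      have [measurable]: "cell a \<in> sets borel" by (rule cell_measurable[OF aY])
      show ?thesis by (rule nn_integral_cmult) measurable
    qed
    also have "\<dots> \<le> ennreal (T\<^sup>2 * KK * h a) * ennreal M" by (intro mult_left_mono M a) auto
    also have "\<dots> = ennreal (T\<^sup>2 * KK * h a * M)" using c0 M0 by (simp add: ennreal_mult)
    finally show ?thesis using cell_measurable[OF aY] by (simp add: \<mu>_def emeasure_density)
  qed
  have h0: "0 \<le> h a" if "a \<in> Y" for a using Re_herg_nonneg[OF Y1[OF that] z] by (simp add: h_def)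
  \<comment> \<open>The weight estimate is for finite sets, so the family is exhausted along the
    enumeration of Y.\<close>
  define A where "A n = {a \<in> fam i. to_nat_on Y a < n}" for n
  have Afin: "finite (A n)" for n
  proof (rule inj_on_finite[of "to_nat_on Y" _ "{..<n}"])
    show "inj_on (to_nat_on Y) (A n)" using inj_on_to_nat_on[OF Y_countable] by (rule inj_on_subset) (auto simp: A_def fam_def)
  qed (auto simp: A_def)
  have AY: "A n \<subseteq> Y" "A n \<subseteq> fam i" for n by (auto simp: A_def fam_def)
  have fin_le: "emeasure \<mu> (\<Union>a\<in>A n. cell a) \<le> ennreal (5 * T\<^sup>2 * KK * M)" for n
  proof -
    have "emeasure \<mu> (\<Union>a\<in>A n. cell a) = (\<Sum>a\<in>A n. emeasure \<mu> (cell a))"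
      by (rule sum_emeasure[symmetric])
         (use cell_measurable AY Afin in \<open>auto simp: \<mu>_def disjoint_family_on_def cell_def\<close>)
    also have "\<dots> \<le> (\<Sum>a\<in>A n. ennreal (T\<^sup>2 * KK * h a * M))" using AY by (intro sum_mono cell_le) auto
    also have "\<dots> = ennreal (\<Sum>a\<in>A n. T\<^sup>2 * KK * h a * M)"
      using subsetD[OF AY(1)] h0 KK_pos M0 by (intro sum_ennreal mult_nonneg_nonneg) auto
    also have "(\<Sum>a\<in>A n. T\<^sup>2 * KK * h a * M) = T\<^sup>2 * KK * M * (\<Sum>a\<in>A n. h a)"
      unfolding sum_distrib_left by (intro sum.cong) (simp_all add: mult_ac)
    also have "\<dots> \<le> T\<^sup>2 * KK * M * 5"
    proof (rule mult_left_mono)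
      have "(\<Sum>a\<in>A n. h a) = (\<Sum>a\<in>A n. Re (herg a z) * exp (- (Re (Psi (fam i) a z) / 2)))"
        by (intro sum.cong) (auto simp: h_def E_def A_def fam_def)
      also have "\<dots> \<le> 5" by (rule sum_herg_exp_le[OF blaschke_fam z Afin AY(2)])
      finally show "(\<Sum>a\<in>A n. h a) \<le> 5" .
    qed (use KK_pos M0 in auto)
    finally show ?thesis by (simp add: mult_ac ennreal_leI)
  qed
  have "emeasure \<mu> (\<Union>n. \<Union>a\<in>A n. cell a) = (SUP n. emeasure \<mu> (\<Union>a\<in>A n. cell a))"
  proof (rule SUP_emeasure_incseq[symmetric])
    show "range (\<lambda>n. \<Union>a\<in>A n. cell a) \<subseteq> sets \<mu>"
      using cell_measurable AY Afin by (auto simp: \<mu>_def intro!: sets.finite_UN)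
    show "incseq (\<lambda>n. \<Union>a\<in>A n. cell a)" by (fastforce simp: incseq_def A_def)
  qed
  also have "\<dots> \<le> ennreal (5 * T\<^sup>2 * KK * M)" using fin_le by (intro SUP_least)
  also have "(\<Union>n. \<Union>a\<in>A n. cell a) = {w\<in>U. idx (pt w) = i}"
    using pt by (auto simp: A_def fam_def cell_def)
  finally have le: "emeasure \<mu> {w\<in>U. idx (pt w) = i} \<le> ennreal (5 * T\<^sup>2 * KK * M)" .
  have "{w\<in>U. idx (pt w) = i} = (\<Union>a\<in>fam i. cell a)" using pt by (auto simp: fam_def cell_def)
  hence "{w\<in>U. idx (pt w) = i} \<in> sets borel"
    using cell_measurable Y_countable by (auto simp: fam_def intro!: sets.countable_UN')
  thus ?thesis using le by (simp add: \<mu>_def emeasure_density F_def)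
qed

lemma family_measurable [measurable]: "{w\<in>U. idx (pt w) = i} \<in> sets borel"
proof -
  have "{w\<in>U. idx (pt w) = i} = (\<Union>a\<in>fam i. cell a)" using pt by (auto simp: fam_def cell_def)
  thus ?thesis using cell_measurable Y_countable by (auto simp: fam_def intro!: sets.countable_UN')
qed

section \<open>Integrals over one cell and the total mass of the kernel\<close>

lemma cell_geometry:
  assumes a: "a \<in> Y" and w: "cmod w < 1" "rho w a \<le> r"
  defines "h \<equiv> 1 - (cmod a)\<^sup>2"
  shows "w \<in> cball a (r * h / (1 - r))" "h / T \<le> 1 - (cmod w)\<^sup>2" "0 < h"
proof -
  have a1: "cmod a < 1" using Y1[OF a] .
  show "0 < h" unfolding h_def by (rule one_minus_sq_pos[OF a1])
  show "w \<in> cball a (r * h / (1 - r))"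
    using distort_distance[OF a1 w T_bounds(4)] by (simp add: h_def dist_norm norm_minus_commute)
  have "h \<le> T * (1 - (cmod w)\<^sup>2)"
    unfolding h_def T_def by (rule distort_height) (use a1 w T_bounds in \<open>auto simp: rho_commute\<close>)
  thus "h / T \<le> 1 - (cmod w)\<^sup>2" using T_bounds by (simp add: divide_le_eq mult.commute)
qed

text \<open>|1 - cnj w * z| is at most x + |w - z| with x the height of w, so 1 / rho is at most 1 +
  x / |w - z|. The first part gives an area of order r^2, the second the dominant term of order r;
  the height h of a cancels in both.\<close>

lemma cell_integral_rho_sharp:
  assumes a: "a \<in> Y" and z: "cmod z < 1"
  shows "(\<integral>\<^sup>+w. ennreal (1 / (1 - (cmod w)\<^sup>2)\<^sup>2) * ennreal (1 / rho z w) * indicator (cell a) w \<partial>lborel)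
     \<le> ennreal (pi * (T\<^sup>2 * (r / (1 - r))\<^sup>2 + 3 * T * (r / (1 - r))))"
proof -
  define h where "h = 1 - (cmod a)\<^sup>2"
  define R where "R = r * h / (1 - r)"
  have h: "0 < h" unfolding h_def by (rule one_minus_sq_pos[OF Y1[OF a]])
  have R: "0 < R" using h r T_bounds by (simp add: R_def)
  have m: "cell a \<in> sets borel" by (rule cell_measurable[OF a])
  have sub: "cell a \<subseteq> cball a R" using cell_geometry(1)[OF a] cell_subset[of a] unfolding R_def h_def by fastforce
  have pw: "ennreal (1 / (1 - (cmod w)\<^sup>2)\<^sup>2) * ennreal (1 / rho z w) * indicator (cell a) w
     \<le> ennreal (T\<^sup>2 / h\<^sup>2) * indicator (cball a R) w + ennreal (T / h) * (ennreal (1 / cmod (w - z)) * indicator (cell a) w)" for w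
  proof (cases "w \<in> cell a \<and> w \<noteq> z")
    case True
    define x where "x = 1 - (cmod w)\<^sup>2"
    have w: "cmod w < 1" "rho w a \<le> r" using cell_subset[of a] True by auto
    have x: "0 < x" "h / T \<le> x" unfolding x_def h_def using one_minus_sq_pos[OF w(1)] cell_geometry(2)[OF a w] by auto
    have wz: "0 < cmod (w - z)" using True by simp
    have "cmod (1 - cnj w * z) \<le> x + cmod (w - z)"
    proof -
      have "1 - cnj w * z = of_real x + cnj w * (w - z)"
        using complex_norm_square[of w] by (simp add: x_def algebra_simps)
      also have "cmod \<dots> \<le> cmod (of_real x) + cmod (cnj w * (w - z))" by (rule norm_triangle_ineq)
      also have "cmod (cnj w * (w - z)) \<le> 1 * cmod (w - z)"
        unfolding norm_mult complex_mod_cnj using w by (intro mult_right_mono) auto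
      finally show ?thesis using x by simp
    qed
    hence "1 / rho z w \<le> (x + cmod (w - z)) / cmod (w - z)"
      unfolding rho_def norm_minus_commute[of z w] using wz by (simp add: divide_right_mono)
    hence "1 / x\<^sup>2 * (1 / rho z w) \<le> 1 / x\<^sup>2 * ((x + cmod (w - z)) / cmod (w - z))" by (rule mult_left_mono) simp
    also have "\<dots> = 1 / x\<^sup>2 + (1 / x) * (1 / cmod (w - z))" using x wz by (simp add: field_simps power2_eq_square)
    also have "\<dots> \<le> T\<^sup>2 / h\<^sup>2 + (T / h) * (1 / cmod (w - z))"
    proof -
      have i: "1 / x \<le> T / h" using x h T_bounds by (simp add: field_simps)
      hence "(1 / x)\<^sup>2 \<le> (T / h)\<^sup>2" using x by (intro power_mono) auto
      thus ?thesis using i by (intro add_mono mult_right_mono) (auto simp: power_divide)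
    qed
    finally have "ennreal (1 / x\<^sup>2 * (1 / rho z w)) \<le> ennreal (T\<^sup>2 / h\<^sup>2 + (T / h) * (1 / cmod (w - z)))" by (rule ennreal_leI)
    moreover have "ennreal (1 / x\<^sup>2 * (1 / rho z w)) = ennreal (1 / x\<^sup>2) * ennreal (1 / rho z w)" by (rule ennreal_mult) auto
    moreover have "ennreal (T\<^sup>2 / h\<^sup>2 + (T / h) * (1 / cmod (w - z))) = ennreal (T\<^sup>2 / h\<^sup>2) + ennreal (T / h) * ennreal (1 / cmod (w - z))"
      using h T_bounds by (subst ennreal_plus) (auto simp: ennreal_mult[symmetric])
    ultimately show ?thesis using True sub by (auto simp: x_def indicator_def)
  qed auto
  have "(\<integral>\<^sup>+w. ennreal (1 / (1 - (cmod w)\<^sup>2)\<^sup>2) * ennreal (1 / rho z w) * indicator (cell a) w \<partial>lborel)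
    \<le> (\<integral>\<^sup>+w. ennreal (T\<^sup>2 / h\<^sup>2) * indicator (cball a R) w + ennreal (T / h) * (ennreal (1 / cmod (w - z)) * indicator (cell a) w) \<partial>lborel)"
    by (intro nn_integral_mono pw)
  also have "\<dots> = ennreal (T\<^sup>2 / h\<^sup>2) * emeasure lborel (cball a R) + ennreal (T / h) * (\<integral>\<^sup>+w. ennreal (1 / cmod (w - z)) * indicator (cell a) w \<partial>lborel)"
  proof -
    have [measurable]: "cell a \<in> sets borel" "cball a R \<in> sets borel" using m by auto
    have 1: "(\<integral>\<^sup>+w. ennreal (T\<^sup>2 / h\<^sup>2) * indicator (cball a R) w \<partial>lborel) = ennreal (T\<^sup>2 / h\<^sup>2) * emeasure lborel (cball a R)"
      by (rule nn_integral_cmult_indicator) simp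
    have 2: "(\<integral>\<^sup>+w. ennreal (T / h) * (ennreal (1 / cmod (w - z)) * indicator (cell a) w) \<partial>lborel)
       = ennreal (T / h) * (\<integral>\<^sup>+w. ennreal (1 / cmod (w - z)) * indicator (cell a) w \<partial>lborel)"
      by (rule nn_integral_cmult) measurable
    show ?thesis unfolding 1[symmetric] 2[symmetric] by (rule nn_integral_add) measurable
  qed
  also have "\<dots> \<le> ennreal (T\<^sup>2 / h\<^sup>2) * ennreal (pi * R\<^sup>2) + ennreal (T / h) * ennreal (3 * pi * R)"
    using R by (intro add_mono mult_left_mono nn_integral_inverse_norm_subset[OF _ sub]) (auto simp: emeasure_ball_complex)
  also have "\<dots> = ennreal (T\<^sup>2 / h\<^sup>2 * (pi * R\<^sup>2) + T / h * (3 * pi * R))"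
  proof -
    have "ennreal a * ennreal b + ennreal c * ennreal d = ennreal (a * b + c * d)"
      if "0 \<le> a" "0 \<le> b" "0 \<le> c" "0 \<le> d" for a b c d
      using that by (simp add: ennreal_mult)
    thus ?thesis using h R T_bounds by simp
  qed
  also have "T\<^sup>2 / h\<^sup>2 * (pi * R\<^sup>2) + T / h * (3 * pi * R) = pi * (T\<^sup>2 * (r / (1 - r))\<^sup>2 + 3 * T * (r / (1 - r)))"
  proof -
    have "T\<^sup>2 / h\<^sup>2 * (pi * R\<^sup>2) + T / h * (3 * pi * R) = pi * (T\<^sup>2 * (R / h)\<^sup>2 + 3 * T * (R / h))"
      using h by (simp add: field_simps power2_eq_square)
    thus ?thesis using h by (simp add: R_def)
  qed
  finally show ?thesis .
qed

lemma cell_integral_rho: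
  assumes a: "a \<in> Y" and z: "cmod z < 1"
  shows "(\<integral>\<^sup>+w. ennreal (1 / (1 - (cmod w)\<^sup>2)\<^sup>2) * ennreal (1 / rho z w) * indicator (cell a) w \<partial>lborel) \<le> ennreal (12 * pi * r)"
proof (rule order_trans[OF cell_integral_rho_sharp[OF a z] ennreal_leI])
  have rr: "r / (1 - r) \<le> 3 / 2 * r" "0 \<le> r / (1 - r)" using r by (auto simp: field_simps)
  have "pi * (T\<^sup>2 * (r / (1 - r))\<^sup>2 + 3 * T * (r / (1 - r))) \<le> pi * (2\<^sup>2 * (3 / 2 * r)\<^sup>2 + 3 * 2 * (3 / 2 * r))"
    using rr T_bounds by (intro mult_left_mono add_mono mult_mono power_mono) auto
  also have "\<dots> \<le> pi * (12 * r)"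
    using r mult_left_mono[of r "1/3" r] by (intro mult_left_mono) (auto simp: power2_eq_square)
  finally show "pi * (T\<^sup>2 * (r / (1 - r))\<^sup>2 + 3 * T * (r / (1 - r))) \<le> 12 * pi * r" by simp
qed

definition ker :: "complex \<Rightarrow> complex \<Rightarrow> complex" where "ker z w = num z w / (z - w)"

lemma ker_measurable [measurable]: "ker z \<in> borel_measurable borel"
  unfolding ker_def by measurable

lemma KK_le: "KK \<le> 3"
proof -
  have "T\<^sup>2 \<le> 2\<^sup>2" using T_bounds by (intro power_mono) auto
  hence "KK \<le> exp (1 + 1 / 25)" by (simp add: KK_def)
  also have "\<dots> = exp 1 * exp (1 / 25 :: real)" by (simp only: exp_add)
  also have "\<dots> \<le> (272 / 100) * (1 + 1 / 25 + (1 / 25)\<^sup>2)"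
    using e_less_272 by (intro mult_mono exp_bound) auto
  also have "\<dots> \<le> 3" by (simp add: power2_eq_square)
  finally show ?thesis .
qed

text \<open>720 = 5 * 4 * 3 * 12: the telescoping constant, the bounds for T^2 and
  \<open>KK\<close>, and the cell integral divided by pi r.\<close>

lemma family_ker_integral:
  assumes z: "cmod z < 1"
  shows "(\<integral>\<^sup>+w. ennreal (cmod (ker z w)) * indicator {w\<in>U. idx (pt w) = i} w \<partial>lborel) \<le> ennreal (720 * r)"
proof -
  have eq: "ennreal (cmod (ker z w)) * indicator {w\<in>U. idx (pt w) = i} w
     = ennreal (cmod (num z w) * pi / cmod (1 - cnj w * z)) * ennreal (1 / (pi * rho z w)) * indicator {w\<in>U. idx (pt w) = i} w" for w
  proof (cases "w \<in> U")
    case True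
    have D: "0 < cmod (1 - cnj w * z)" using one_minus_cnj_mult_pos[of z w] z U_disc[OF True] by simp
    have "cmod (ker z w) = (cmod (num z w) * pi / cmod (1 - cnj w * z)) * (1 / (pi * rho z w))"
      using D by (simp add: ker_def norm_divide rho_def)
    thus ?thesis by (simp add: ennreal_mult[symmetric])
  qed simp
  have "(\<integral>\<^sup>+w. ennreal (cmod (ker z w)) * indicator {w\<in>U. idx (pt w) = i} w \<partial>lborel) \<le> ennreal (5 * T\<^sup>2 * KK * (12 * r))"
    unfolding eq
  proof (rule family_bound)
    fix a assume "a \<in> fam i"
    hence a: "a \<in> Y" by (simp add: fam_def)
    have "(\<integral>\<^sup>+w. ennreal (1 / (1 - (cmod w)\<^sup>2)\<^sup>2) * ennreal (1 / (pi * rho z w)) * indicator (cell a) w \<partial>lborel)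
       = (\<integral>\<^sup>+w. ennreal (1 / pi) * (ennreal (1 / (1 - (cmod w)\<^sup>2)\<^sup>2) * ennreal (1 / rho z w) * indicator (cell a) w) \<partial>lborel)"
    proof (rule nn_integral_cong)
      fix w
      have "ennreal (1 / (pi * rho z w)) = ennreal (1 / pi) * ennreal (1 / rho z w)"
        by (subst ennreal_mult[symmetric]) auto
      thus "ennreal (1 / (1 - (cmod w)\<^sup>2)\<^sup>2) * ennreal (1 / (pi * rho z w)) * indicator (cell a) w
        = ennreal (1 / pi) * (ennreal (1 / (1 - (cmod w)\<^sup>2)\<^sup>2) * ennreal (1 / rho z w) * indicator (cell a) w)"
        by (simp only: mult_ac)
    qed
    also have "\<dots> = ennreal (1 / pi) * (\<integral>\<^sup>+w. (ennreal (1 / (1 - (cmod w)\<^sup>2)\<^sup>2) * ennreal (1 / rho z w) * indicator (cell a) w) \<partial>lborel)"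
    proof -
      have [measurable]: "cell a \<in> sets borel" by (rule cell_measurable[OF a])
      show ?thesis by (rule nn_integral_cmult) measurable
    qed
    also have "\<dots> \<le> ennreal (1 / pi) * ennreal (12 * pi * r)" by (intro mult_left_mono cell_integral_rho a z) auto
    also have "\<dots> = ennreal (12 * r)" using r by (subst ennreal_mult[symmetric]) auto
    finally show "(\<integral>\<^sup>+w. ennreal (1 / (1 - (cmod w)\<^sup>2)\<^sup>2) * ennreal (1 / (pi * rho z w)) * indicator (cell a) w \<partial>lborel) \<le> ennreal (12 * r)" .
  qed (use r z in auto)
  also have "\<dots> \<le> ennreal (720 * r)"
  proof (rule ennreal_leI)
    have "T\<^sup>2 \<le> 2\<^sup>2" using T_bounds by (intro power_mono) auto
    hence "T\<^sup>2 * KK \<le> 4 * 3" using KK_le KK_pos by (intro mult_mono) auto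
    hence "T\<^sup>2 * KK * (60 * r) \<le> 12 * (60 * r)" using r by (intro mult_right_mono) auto
    thus "5 * T\<^sup>2 * KK * (12 * r) \<le> 720 * r" by simp
  qed
  finally show ?thesis .
qed

lemma indicator_family_sum:
  "w \<in> U \<Longrightarrow> (\<Sum>i=1..k. indicator {w\<in>U. idx (pt w) = i} w) = (1 :: 'b :: semiring_1)"
proof -
  assume w: "w \<in> U"
  have "(\<Sum>i=1..k. indicator {w\<in>U. idx (pt w) = i} w) = (\<Sum>i\<in>{1..k}. if i = idx (pt w) then 1 else (0::'b))"
    by (intro sum.cong) (use w in auto)
  also have "\<dots> = 1" using idx[OF pt(1)[OF w]] by (simp add: sum.delta)
  finally show ?thesis .
qed

lemma ker_integral:
  assumes z: "cmod z < 1"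
  shows "(\<integral>\<^sup>+w. ennreal (cmod (ker z w)) \<partial>lborel) \<le> ennreal (real k * (720 * r))"
proof -
  have "(\<integral>\<^sup>+w. ennreal (cmod (ker z w)) \<partial>lborel) = (\<integral>\<^sup>+w. (\<Sum>i=1..k. ennreal (cmod (ker z w)) * indicator {w\<in>U. idx (pt w) = i} w) \<partial>lborel)"
  proof (rule nn_integral_cong)
    fix w
    show "ennreal (cmod (ker z w)) = (\<Sum>i=1..k. ennreal (cmod (ker z w)) * indicator {w\<in>U. idx (pt w) = i} w)"
    proof (cases "w \<in> U")
      case True
      show ?thesis unfolding sum_distrib_left[symmetric] indicator_family_sum[OF True] by simp
    qed (simp add: ker_def num_def)
  qed
  also have "\<dots> = (\<Sum>i=1..k. \<integral>\<^sup>+w. ennreal (cmod (ker z w)) * indicator {w\<in>U. idx (pt w) = i} w \<partial>lborel)"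
    by (rule nn_integral_sum) measurable
  also have "\<dots> \<le> (\<Sum>i=1..k. ennreal (720 * r))" by (intro sum_mono family_ker_integral z)
  also have "\<dots> = ennreal (real k * (720 * r))" using r by (simp add: ennreal_mult ennreal_of_nat_eq_real_of_nat)
  finally show ?thesis .
qed

end

section \<open>Uniform continuity and weak solutions\<close>

lemma set_integrable_disc_nn:
  fixes q :: "complex \<Rightarrow> complex"
  assumes [measurable]: "q \<in> borel_measurable borel" and le: "(\<integral>\<^sup>+w. ennreal (cmod (q w)) \<partial>lborel) \<le> ennreal C" and C: "0 \<le> C"
  shows "integrable lborel q" "set_integrable lborel disc q" "(LINT w:disc|lborel. cmod (q w)) \<le> C"
proof -
  show i: "integrable lborel q"
    by (rule integrableI_bounded) (use le_less_trans[OF le ennreal_less_top] in auto)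
  show "set_integrable lborel disc q"
    unfolding set_integrable_def by (rule integrable_mult_indicator[OF _ i]) simp
  have "(LINT w:disc|lborel. cmod (q w)) \<le> (LINT w|lborel. cmod (q w))"
    unfolding set_lebesgue_integral_def
    using set_integrable_norm[OF \<open>set_integrable lborel disc q\<close>] i
    by (intro integral_mono) (auto simp: set_integrable_def indicator_def)
  also have "\<dots> \<le> C"
    by (rule integral_real_bounded[OF C]) (use le in simp)
  finally show "(LINT w:disc|lborel. cmod (q w)) \<le> C" .
qed

lemma vholo_complex:
  fixes g :: "complex \<Rightarrow> complex"
  assumes "vholo disc g" shows "g holomorphic_on disc"
  unfolding holomorphic_on_def
proof
  fix z assume "z \<in> disc"
  then obtain d where "((\<lambda>w. cscale (1 / (w - z)) (g w - g z)) \<longlongrightarrow> d) (at z)" using assms unfolding vholo_def by blast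
  hence "(g has_field_derivative d) (at z)" by (simp add: has_field_derivative_iff cscale_complex_def)
  hence "g field_differentiable (at z)" by (auto simp: field_differentiable_def)
  thus "g field_differentiable (at z within disc)" by (rule field_differentiable_at_within)
qed

lemma one_in_Linf: "(\<lambda>_. 1 :: complex) \<in> Linf UNIV" "essnorm (\<lambda>_. 1 :: complex) \<le> 1"
proof -
  have "smeas (\<lambda>_. 1 :: complex)" unfolding smeas_def
    by (rule exI[of _ "\<lambda>_ _. 1"]) (auto simp: vimage_def)
  thus "(\<lambda>_. 1 :: complex) \<in> Linf UNIV" by (auto simp: Linf_def intro!: exI[of _ 1])
  show "essnorm (\<lambda>_. 1 :: complex) \<le> 1" unfolding essnorm_def by (rule cInf_lower) (auto intro: bdd_belowI[of _ 0])
qed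

lemma vint_one:
  assumes "set_integrable lborel disc p"
  shows "vint p (\<lambda>_. 1 :: complex) = (LINT w:disc|lborel. p w)"
  using set_borel_integral_eq_integral(2)[OF assms] by (simp add: vint_def cscale_complex_def)

text \<open>A pseudohyperbolic disc of radius s about z has Euclidean size comparable to s (1 -
  |z|), which compensates the blow-up of u.\<close>

lemma near_integral:
  fixes u :: "complex \<Rightarrow> complex"
  assumes z: "cmod z < 1" and s: "0 < s" "s \<le> 1 / 2" and M: "0 \<le> M" and u: "\<And>w. cmod (u w) \<le> M / (1 - cmod z)"
    and N: "N \<subseteq> {w. cmod w < 1 \<and> rho w z < s}"
  shows "(\<integral>\<^sup>+w. ennreal (cmod (u w / (z - w))) * indicator N w \<partial>lborel) \<le> ennreal (12 * pi * M * s)"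
proof -
  define h where "h = 1 - cmod z"
  define R where "R = 4 * s * h"
  have h: "0 < h" using z by (simp add: h_def)
  have R: "0 < R" using h s by (simp add: R_def)
  have sub: "N \<subseteq> cball z R"
  proof
    fix w assume "w \<in> N"
    hence w: "cmod w < 1" "rho w z \<le> s" using N by auto
    have "cmod (w - z) \<le> s / (1 - s) * (1 - (cmod z)\<^sup>2)" by (rule distort_distance[OF z w]) (use s in simp)
    also have "\<dots> \<le> (2 * s) * (2 * h)"
    proof (rule mult_mono)
      show "s / (1 - s) \<le> 2 * s" using s by (simp add: divide_le_eq algebra_simps)
      show "1 - (cmod z)\<^sup>2 \<le> 2 * h" using one_minus_sq_le2[of z] z by (simp add: h_def)
    qed (use s z one_minus_sq_nonneg[of z] in auto)
    finally show "w \<in> cball z R" by (simp add: R_def dist_norm norm_minus_commute)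
  qed
  have "(\<integral>\<^sup>+w. ennreal (cmod (u w / (z - w))) * indicator N w \<partial>lborel)
     \<le> (\<integral>\<^sup>+w. ennreal (M / h) * (ennreal (1 / cmod (w - z)) * indicator (cball z R) w) \<partial>lborel)"
  proof (rule nn_integral_mono)
    fix w
    have "cmod (u w / (z - w)) \<le> M / h * (1 / cmod (w - z))"
      using divide_right_mono[OF u[of w] norm_ge_zero[of "w - z"]] by (simp add: h_def norm_divide norm_minus_commute[of z])
    hence "ennreal (cmod (u w / (z - w))) \<le> ennreal (M / h) * ennreal (1 / cmod (w - z))"
      using M h by (subst ennreal_mult[symmetric]) (auto intro: ennreal_leI)
    thus "ennreal (cmod (u w / (z - w))) * indicator N w \<le> ennreal (M / h) * (ennreal (1 / cmod (w - z)) * indicator (cball z R) w)"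
      using sub by (auto simp: indicator_def)
  qed
  also have "\<dots> = ennreal (M / h) * (\<integral>\<^sup>+w. (ennreal (1 / cmod (w - z)) * indicator (cball z R) w) \<partial>lborel)"
  proof -
    have [measurable]: "cball z R \<in> sets borel" by simp
    show ?thesis by (rule nn_integral_cmult) measurable
  qed
  also have "\<dots> \<le> ennreal (M / h) * ennreal (3 * pi * R)"
    by (intro mult_left_mono nn_integral_inverse_norm_subset R) auto
  also have "\<dots> = ennreal (12 * pi * M * s)"
    using M h R by (subst ennreal_mult[symmetric]) (auto simp: R_def mult_ac)
  finally show ?thesis .
qed

text \<open>Away from the diagonal, uniform continuity comes from the Schwarz lemma applied to the scalar
  holomorphic function obtained by integrating the kernel against a unimodular weight.\<close>

lemma Crho_vint:
  fixes f :: "complex \<Rightarrow> 'x::complex_banach" and u :: "complex \<Rightarrow> complex \<Rightarrow> complex"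
  assumes f: "f \<in> Linf K" and um: "\<And>z. u z \<in> borel_measurable borel"
    and hol: "\<And>w. cmod w < 1 \<Longrightarrow> (\<lambda>z. u z w) holomorphic_on disc"
    and bnd: "\<And>z w. cmod z < 1 \<Longrightarrow> cmod (u z w) \<le> M / (1 - cmod z)" and M: "0 \<le> M"
    and int: "\<And>z. cmod z < 1 \<Longrightarrow> (\<integral>\<^sup>+w. ennreal (cmod (u z w / (z - w))) \<partial>lborel) \<le> ennreal C" and C: "0 \<le> C"
  shows "Crho (\<lambda>z. vint (\<lambda>w. u z w / (z - w)) f)"
proof -
  define q where "q z w = u z w / (z - w)" for z w
  have qm [measurable]: "q z \<in> borel_measurable borel" for z unfolding q_def using um[of z] by measurable
  note qi = set_integrable_disc_nn[OF qm int[folded q_def] C]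
  define B where "B = essnorm f"
  have B: "0 \<le> B" unfolding B_def by (rule AE_le_essnorm(2)[OF f])
  define F where "F z = vint (q z) f" for z
  have key: "norm (F z1 - F z0) \<le> (36 * pi * M * \<eta> + 4 * C * rho z1 z0 / \<eta>) * B"
    if z: "cmod z0 < 1" "cmod z1 < 1" and \<eta>: "0 < \<eta>" "\<eta> \<le> 1 / 4" and near: "rho z1 z0 < \<eta> / 2" for z0 z1 \<eta>
  proof -
    define N where "N = {w \<in> disc. rho w z0 < \<eta>}"
    define d where "d w = q z1 w - q z0 w" for w
    have [measurable]: "disc \<in> sets borel" by simp
    have rm: "(\<lambda>w. rho w z0) \<in> borel_measurable borel" using rho_measurable[of z0] by (simp add: rho_commute[of _ z0])
    have Nm [measurable]: "N \<in> sets borel" unfolding N_def using rm by measurable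
    have dm [measurable]: "d \<in> borel_measurable borel" unfolding d_def by measurable
    \<comment> \<open>The phase that turns d into |d| off N. It depends on the two chosen points,
      but is fixed when the first variable moves, so the integral against it is holomorphic.\<close>
    define \<theta> where "\<theta> w = (if w \<in> disc - N then cnj (d w) / of_real (cmod (d w)) else 0)" for w
    have [measurable]: "(\<lambda>w. cnj (d w)) \<in> borel_measurable borel"
      by (rule measurable_compose[OF dm]) (intro borel_measurable_continuous_onI continuous_intros)
    have \<theta>m [measurable]: "\<theta> \<in> borel_measurable borel" unfolding \<theta>_def by measurable
    have \<theta>1: "cmod (\<theta> w) \<le> 1" for w by (auto simp: \<theta>_def norm_divide)
    have \<theta>d: "\<theta> w * d w = of_real (indicator (disc - N) w * cmod (d w))" for w
      using complex_norm_square[of "d w"] by (auto simp: \<theta>_def power2_eq_square divide_simps mult.commute)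
    \<comment> \<open>Parametrises the pseudohyperbolic disc of radius \<eta> / 2 about z0 by the
      unit disc; it stays at distance \<eta> / 2 from every w outside N, so the integrand has no
      pole.\<close>
    define mz where "mz \<zeta> = mob z0 (of_real (\<eta> / 2) * \<zeta>)" for \<zeta>
    have sc: "cmod (of_real (\<eta> / 2) * \<zeta>) < \<eta> / 2" if "cmod \<zeta> < 1" for \<zeta>
      using that \<eta> by (simp add: norm_mult)
    have mz1: "cmod (mz \<zeta>) < 1" if "cmod \<zeta> < 1" for \<zeta>
      unfolding mz_def by (rule mob_in_disc[OF z(1)]) (use sc[OF that] \<eta> in linarith)
    have mzr: "rho (mz \<zeta>) z0 < \<eta> / 2" if "cmod \<zeta> < 1" for \<zeta>
    proof -
      have c1: "cmod (of_real (\<eta> / 2) * \<zeta>) < 1" using sc[OF that] \<eta> by linarith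
      have "rho (mz \<zeta>) z0 = cmod (mob z0 (mz \<zeta>))" by (simp add: norm_mob)
      also have "mob z0 (mz \<zeta>) = of_real (\<eta> / 2) * \<zeta>" unfolding mz_def by (rule mob_mob[OF z(1) c1])
      finally show ?thesis using sc[OF that] by simp
    qed
    define p where "p \<zeta> w = \<theta> w * q (mz \<zeta>) w" for \<zeta> w
    have pm [measurable]: "p \<zeta> \<in> borel_measurable borel" for \<zeta> unfolding p_def by measurable
    have pint: "(\<integral>\<^sup>+w. ennreal (cmod (p \<zeta> w)) \<partial>lborel) \<le> ennreal C" if "cmod \<zeta> < 1" for \<zeta>
    proof -
      have "(\<integral>\<^sup>+w. ennreal (cmod (p \<zeta> w)) \<partial>lborel) \<le> (\<integral>\<^sup>+w. ennreal (cmod (q (mz \<zeta>) w)) \<partial>lborel)"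
        using \<theta>1 by (intro nn_integral_mono ennreal_leI) (auto simp: p_def norm_mult intro: mult_left_le_one_le)
      also have "\<dots> \<le> ennreal C" unfolding q_def by (rule int[OF mz1[OF that]])
      finally show ?thesis .
    qed
    note pi = set_integrable_disc_nn[OF pm pint C]
    define G where "G \<zeta> = vint (p \<zeta>) (\<lambda>_. 1 :: complex)" for \<zeta>
    define h0 where "h0 = 1 - (cmod z0)\<^sup>2"
    have h0: "0 < h0" unfolding h0_def by (rule one_minus_sq_pos[OF z(1)])
    have far: "\<eta> / 2 \<le> rho (mz \<zeta>) w" if "cmod \<zeta> < 1" "w \<in> disc - N" for \<zeta> w
    proof -
      have "rho w z0 \<le> rho w (mz \<zeta>) + rho (mz \<zeta>) z0" by (rule rho_triangle) (use that z mz1 in auto)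
      moreover have "\<eta> \<le> rho w z0" using that by (auto simp: N_def)
      ultimately show ?thesis using mzr[OF that(1)] by (simp add: rho_commute[of w "mz \<zeta>"])
    qed
    have "vholo disc G"
      unfolding G_def
    proof (rule vholo_vint[where q = p and p = p, OF _ _ _ _ one_in_Linf(1)])
      show "set_integrable lborel disc (p \<zeta>)" if "\<zeta> \<in> disc" for \<zeta> using pi(2)[of \<zeta>] that by simp
      show "(\<lambda>\<zeta>. p \<zeta> w) holomorphic_on disc" if w: "w \<in> disc" for w
      proof (cases "w \<in> N")
        case False
        have mzh: "mz holomorphic_on disc" unfolding mz_def[abs_def]
        proof -
          have "(mob z0 \<circ> (\<lambda>\<zeta>. of_real (\<eta> / 2) * \<zeta>)) holomorphic_on disc"
            by (rule holomorphic_on_compose_gen[OF _ mob_holomorphic[OF z(1)]])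
               (use sc \<eta> in \<open>force intro!: holomorphic_intros intro: less_trans\<close>)+
          thus "(\<lambda>\<zeta>. mob z0 (of_real (\<eta> / 2) * \<zeta>)) holomorphic_on disc" by (simp add: o_def)
        qed
        have "((\<lambda>z. u z w) \<circ> mz) holomorphic_on disc"
          by (rule holomorphic_on_compose_gen[OF mzh hol]) (use w mz1 in auto)
        hence uh: "(\<lambda>\<zeta>. u (mz \<zeta>) w) holomorphic_on disc" by (simp add: o_def)
        have "mz \<zeta> - w \<noteq> 0" if "\<zeta> \<in> disc" for \<zeta>
          using far[of \<zeta> w] that w False \<eta> by auto
        thus ?thesis unfolding p_def q_def by (intro holomorphic_intros uh mzh) auto
      qed (simp add: p_def \<theta>_def)
      show "\<exists>M'. \<forall>w\<in>disc. \<forall>\<zeta>\<in>cball 0 R. cmod (p \<zeta> w) \<le> M'" if R: "0 < R" "R < 1" for R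
      proof (intro exI ballI)
        fix w \<zeta> :: complex assume w: "w \<in> disc" and "\<zeta> \<in> cball 0 R"
        hence \<zeta>: "cmod \<zeta> < 1" using R by simp
        have "h0 \<le> (1 + 1/8) / (1 - 1/8) * (1 - (cmod (mz \<zeta>))\<^sup>2)"
          unfolding h0_def by (rule distort_height) (use mz1[OF \<zeta>] z mzr[OF \<zeta>] \<eta> in \<open>auto simp: rho_commute[of z0]\<close>)
        hence "h0 \<le> 2 * (1 - (cmod (mz \<zeta>))\<^sup>2)" using one_minus_sq_nonneg[of "mz \<zeta>"] mz1[OF \<zeta>] by simp
        hence hz: "h0 / 4 \<le> 1 - cmod (mz \<zeta>)" using one_minus_sq_le2[of "mz \<zeta>"] mz1[OF \<zeta>] by simp
        show "cmod (p \<zeta> w) \<le> (M / (h0 / 4)) / (\<eta> / 2 * (h0 / 4))"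
        proof (cases "w \<in> N")
          case False
          have "cmod (mz \<zeta> - w) = rho (mz \<zeta>) w * cmod (1 - cnj w * mz \<zeta>)"
            by (rule norm_diff_eq_rho) (use mz1[OF \<zeta>] w in auto)
          moreover have "h0 / 4 \<le> cmod (1 - cnj w * mz \<zeta>)"
            using hz one_minus_cnj_mult_le'[of w "mz \<zeta>"] w by simp
          moreover have "\<eta> / 2 * (h0 / 4) \<le> rho (mz \<zeta>) w * cmod (1 - cnj w * mz \<zeta>)"
            using far[OF \<zeta>, of w] w False \<eta> h0 calculation(2) by (intro mult_mono) auto
          ultimately have den: "\<eta> / 2 * (h0 / 4) \<le> cmod (mz \<zeta> - w)" by (simp only:)
          have "cmod (u (mz \<zeta>) w) \<le> M / (1 - cmod (mz \<zeta>))" by (rule bnd[OF mz1[OF \<zeta>]])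
          also have "\<dots> \<le> M / (h0 / 4)" using hz M h0 mz1[OF \<zeta>] by (intro divide_left_mono mult_pos_pos) auto
          finally have "cmod (q (mz \<zeta>) w) \<le> (M / (h0 / 4)) / (\<eta> / 2 * (h0 / 4))"
            unfolding q_def norm_divide using den \<eta> h0 M by (intro frac_le) auto
          thus ?thesis using \<theta>1[of w] unfolding p_def norm_mult
            by (meson mult_left_le_one_le norm_ge_zero order_trans)
        qed (use M \<eta> h0 in \<open>simp add: p_def \<theta>_def\<close>)
      qed
    qed simp
    hence Ghol: "G holomorphic_on ball 0 1" by (rule vholo_complex)
    have Gle: "cmod (G \<zeta>) \<le> C" if "\<zeta> \<in> ball 0 1" for \<zeta>
    proof -
      have "cmod (G \<zeta>) \<le> C * essnorm (\<lambda>_. 1 :: complex)"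
        unfolding G_def by (rule vint_bound[OF pi(2) one_in_Linf(1) pi(3)]) (use that in auto)
      also have "\<dots> \<le> C * 1" using C one_in_Linf(2) by (rule mult_left_mono[rotated])
      finally show ?thesis by simp
    qed
    define \<zeta>1 where "\<zeta>1 = mob z0 z1 / of_real (\<eta> / 2)"
    have n\<zeta>1: "cmod \<zeta>1 = rho z1 z0 / (\<eta> / 2)" using \<eta> by (simp add: \<zeta>1_def norm_divide norm_mob)
    have \<zeta>1: "cmod \<zeta>1 < 1" unfolding n\<zeta>1 using near \<eta> by (simp add: divide_less_eq)
    have mz_1: "mz \<zeta>1 = z1" using \<eta> z by (simp add: mz_def \<zeta>1_def mob_mob)
    have mz_0: "mz 0 = z0" by (simp add: mz_def mob_def)
    have dfi: "set_integrable lborel disc (\<lambda>w. of_real (indicator (disc - N) w * cmod (d w)) :: complex)"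
    proof -
      have "set_integrable lborel disc (\<lambda>w. p \<zeta>1 w - p 0 w)"
        by (rule set_integral_diff(1)) (use pi(2) \<zeta>1 in auto)
      thus ?thesis by (simp add: p_def mz_1 mz_0 right_diff_distrib[symmetric] d_def[symmetric] \<theta>d)
    qed
    have "G \<zeta>1 - G 0 = vint (\<lambda>w. p \<zeta>1 w - p 0 w) (\<lambda>_. 1)"
      unfolding G_def by (rule vint_diff_left[symmetric, OF _ _ one_in_Linf(1)]) (use pi(2) \<zeta>1 in auto)
    also have "(\<lambda>w. p \<zeta>1 w - p 0 w) = (\<lambda>w. of_real (indicator (disc - N) w * cmod (d w)))"
      by (simp add: p_def mz_1 mz_0 right_diff_distrib[symmetric] d_def[symmetric] \<theta>d)
    also have "vint \<dots> (\<lambda>_. 1 :: complex) = (LINT w:disc|lborel. complex_of_real (indicator (disc - N) w * cmod (d w)))" by (rule vint_one[OF dfi])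
    also have "\<dots> = of_real (LINT w:disc|lborel. indicator (disc - N) w * cmod (d w))"
      by (simp add: set_lebesgue_integral_def scaleR_conv_of_real flip: integral_complex_of_real)
    finally have "\<bar>LINT w:disc|lborel. indicator (disc - N) w * cmod (d w)\<bar> = cmod (G \<zeta>1 - G 0)" by simp
    also have "\<dots> \<le> 2 * C / 1 * cmod (\<zeta>1 - 0)"
      by (rule Schwarz_ball[OF Ghol _ Gle]) (use \<zeta>1 in auto)
    finally have farle: "(LINT w:disc|lborel. indicator (disc - N) w * cmod (d w)) \<le> 4 * C * rho z1 z0 / \<eta>"
      using n\<zeta>1 by simp
    have N0: "(\<integral>\<^sup>+w. ennreal (cmod (q z0 w)) * indicator N w \<partial>lborel) \<le> ennreal (12 * pi * M * \<eta>)"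
      unfolding q_def by (rule near_integral[OF z(1)]) (use \<eta> M bnd z in \<open>auto simp: N_def\<close>)
    have N1: "(\<integral>\<^sup>+w. ennreal (cmod (q z1 w)) * indicator N w \<partial>lborel) \<le> ennreal (12 * pi * M * (2 * \<eta>))"
      unfolding q_def
    proof (rule near_integral[OF z(2)])
      show "N \<subseteq> {w. cmod w < 1 \<and> rho w z1 < 2 * \<eta>}"
      proof
        fix w assume w: "w \<in> N"
        have "rho w z1 \<le> rho w z0 + rho z0 z1" by (rule rho_triangle) (use w z in \<open>auto simp: N_def\<close>)
        thus "w \<in> {w. cmod w < 1 \<and> rho w z1 < 2 * \<eta>}" using w near \<eta> by (auto simp: N_def rho_commute[of z0])
      qed
    qed (use \<eta> M bnd z in auto)
    have conv: "set_integrable lborel disc (\<lambda>w. indicator N w * cmod (q x w))"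
      "(LINT w:disc|lborel. indicator N w * cmod (q x w)) \<le> c"
      if x: "cmod x < 1" and le: "(\<integral>\<^sup>+w. ennreal (cmod (q x w)) * indicator N w \<partial>lborel) \<le> ennreal c" and c: "0 \<le> c" for x c
    proof -
      define q' where "q' w = indicator N w *\<^sub>R q x w" for w
      have [measurable]: "q' \<in> borel_measurable borel" unfolding q'_def by measurable
      have cm: "cmod (q' w) = indicator N w * cmod (q x w)" for w by (simp add: q'_def)
      have "(\<integral>\<^sup>+w. ennreal (cmod (q' w)) \<partial>lborel) \<le> ennreal c"
        using le by (simp add: cm ennreal_mult ennreal_indicator mult.commute)
      note q' = set_integrable_disc_nn[OF \<open>q' \<in> _\<close> this c]
      show "(LINT w:disc|lborel. indicator N w * cmod (q x w)) \<le> c" using q'(3) by (simp only: cm)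
      show "set_integrable lborel disc (\<lambda>w. indicator N w * cmod (q x w))"
        using set_integrable_norm[OF q'(2)] by (simp only: cm)
    qed
    have c0: "0 \<le> 12 * pi * M * \<eta>" "0 \<le> 12 * pi * M * (2 * \<eta>)" using M \<eta> by auto
    note I0 = conv[OF z(1) N0 c0(1)] and I1 = conv[OF z(2) N1 c0(2)]
    have di: "set_integrable lborel disc d" unfolding d_def by (rule set_integral_diff(1)) (use qi(2) z in auto)
    have dfi': "set_integrable lborel disc (\<lambda>w. indicator (disc - N) w * cmod (d w))"
    proof -
      have eq: "cmod (complex_of_real (indicator A w * cmod x)) = indicator A w * cmod x" for A x and w :: complex
        by (simp add: norm_mult indicator_def)
      show ?thesis using set_integrable_norm[OF dfi] unfolding eq .
    qed
    \<comment> \<open>Inside N the two kernels are estimated separately, being small with \<eta>;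
      outside N their difference is the increment of G.\<close>
    have "(LINT w:disc|lborel. cmod (d w)) \<le> (LINT w:disc|lborel. indicator N w * cmod (q z1 w) + indicator N w * cmod (q z0 w) + indicator (disc - N) w * cmod (d w))"
    proof (rule set_integral_mono)
      show "set_integrable lborel disc (\<lambda>w. indicator N w * cmod (q z1 w) + indicator N w * cmod (q z0 w) + indicator (disc - N) w * cmod (d w))"
        by (intro set_integral_add(1) I0 I1 dfi')
      show "set_integrable lborel disc (\<lambda>w. cmod (d w))" by (rule set_integrable_norm[OF di])
      show "cmod (d w) \<le> indicator N w * cmod (q z1 w) + indicator N w * cmod (q z0 w) + indicator (disc - N) w * cmod (d w)" if "w \<in> disc" for w
        using norm_triangle_ineq4[of "q z1 w" "q z0 w"] that by (auto simp: d_def indicator_def)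
    qed
    also have "\<dots> = (LINT w:disc|lborel. indicator N w * cmod (q z1 w)) + (LINT w:disc|lborel. indicator N w * cmod (q z0 w))
        + (LINT w:disc|lborel. indicator (disc - N) w * cmod (d w))"
      by (subst set_integral_add(2), intro set_integral_add(1) I0 I1, rule dfi', subst set_integral_add(2)) (use I0 I1 in auto)
    also have "\<dots> \<le> 12 * pi * M * (2 * \<eta>) + 12 * pi * M * \<eta> + 4 * C * rho z1 z0 / \<eta>"
      by (intro add_mono I0 I1 farle)
    finally have dle: "(LINT w:disc|lborel. cmod (d w)) \<le> 36 * pi * M * \<eta> + 4 * C * rho z1 z0 / \<eta>" by (simp add: mult_ac)
    have "F z1 - F z0 = vint d f"
      unfolding F_def d_def by (rule vint_diff_left[symmetric, OF _ _ f]) (use qi(2) z in auto)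
    thus ?thesis using vint_bound[OF di f dle] by (simp add: B_def)
  qed
  have bounded: "norm (F z) \<le> C * B" if "cmod z < 1" for z
    unfolding F_def B_def by (rule vint_bound[OF qi(2)[OF that] f qi(3)[OF that]])
  have unif: "\<exists>d>0. \<forall>z\<in>disc. \<forall>w\<in>disc. rho z w < d \<longrightarrow> dist (F z) (F w) < e" if e: "0 < e" for e
  proof -
    define L where "L = 36 * pi * M * B + 1"
    have L: "0 < L" using M B by (simp add: L_def add_nonneg_pos)
    \<comment> \<open>First \<eta> makes the near contribution less than e / 2; then D, depending on
      \<eta>, does the same for the far one.\<close>
    define \<eta> where "\<eta> = min (1 / 4) (e / (2 * L))"
    have \<eta>: "0 < \<eta>" "\<eta> \<le> 1 / 4" "\<eta> \<le> e / (2 * L)" using e L by (auto simp: \<eta>_def)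
    define D where "D = min (\<eta> / 2) (e * \<eta> / (4 * (2 * C * B + 1) * 2))"
    have CB: "0 < 2 * C * B + 1" using C B by (simp add: add_nonneg_pos)
    have D: "0 < D" using \<eta> e CB by (simp add: D_def)
    show ?thesis
    proof (intro exI[of _ D] conjI D ballI impI)
      fix z w assume zw: "z \<in> disc" "w \<in> disc" and r: "rho z w < D"
      have "norm (F z - F w) \<le> (36 * pi * M * \<eta> + 4 * C * rho z w / \<eta>) * B"
        by (rule key) (use zw r \<eta> in \<open>auto simp: D_def\<close>)
      also have "\<dots> = (36 * pi * M * B) * \<eta> + (4 * C * B) * rho z w / \<eta>" by (simp add: algebra_simps add_divide_distrib)
      also have "\<dots> < e / 2 + e / 2"
      proof (rule add_less_le_mono)
        have "(36 * pi * M * B) * \<eta> < L * \<eta>" using \<eta> by (intro mult_strict_right_mono) (auto simp: L_def)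
        also have "\<dots> \<le> L * (e / (2 * L))" using \<eta> L by (intro mult_left_mono) auto
        finally show "(36 * pi * M * B) * \<eta> < e / 2" using L by simp
        have "(4 * C * B) * rho z w / \<eta> \<le> (4 * (2 * C * B + 1)) * (e * \<eta> / (4 * (2 * C * B + 1) * 2)) / \<eta>"
        proof (rule divide_right_mono, rule mult_mono)
          have "4 * X \<le> 4 * (2 * X + 1)" if "0 \<le> X" for X :: real using that by simp
          from this[of "C * B"] show "4 * C * B \<le> 4 * (2 * C * B + 1)" using C B by (simp only: mult.assoc mult_nonneg_nonneg)
          show "0 \<le> 4 * (2 * C * B + 1)" by (rule mult_nonneg_nonneg) (use CB in auto)
          show "rho z w \<le> e * \<eta> / (4 * (2 * C * B + 1) * 2)" using r unfolding D_def by linarith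
          show "0 \<le> rho z w" by (rule rho_nonneg)
          show "0 \<le> \<eta>" using \<eta> by simp
        qed
        also have "\<dots> = e / 2"
        proof -
          have "(4 * X) * (e * \<eta> / (4 * X * 2)) / \<eta> = e / 2" if "0 < X" for X using that \<eta> by simp
          from this[OF CB] show ?thesis .
        qed
        finally show "(4 * C * B) * rho z w / \<eta> \<le> e / 2" .
      qed
      finally show "dist (F z) (F w) < e" by (simp add: dist_norm)
    qed
  qed
  have cont: "continuous_on disc F"
    unfolding continuous_on_iff
  proof (intro ballI allI impI)
    fix z and e :: real assume z: "z \<in> disc" and "0 < e"
    obtain d where d: "d > 0" "\<And>w. w \<in> disc \<Longrightarrow> rho w z < d \<Longrightarrow> dist (F w) (F z) < e" using unif[OF \<open>0 < e\<close>] z by blast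
    have "rho w z < d" if "w \<in> disc" "dist w z < d * (1 - cmod z)" for w
    proof -
      have "1 - cmod z \<le> cmod (1 - cnj z * w)" using one_minus_cnj_mult_le[of w z] that by simp
      hence "d * (1 - cmod z) \<le> d * cmod (1 - cnj z * w)" using d by (intro mult_left_mono) auto
      hence "cmod (w - z) < d * cmod (1 - cnj z * w)" using that by (simp add: dist_norm)
      thus ?thesis using one_minus_cnj_mult_pos[of w z] that z by (simp add: rho_def divide_less_eq)
    qed
    thus "\<exists>d>0. \<forall>w\<in>disc. dist w z < d \<longrightarrow> dist (F w) (F z) < e"
      using d z by (intro exI[of _ "d * (1 - cmod z)"]) auto
  qed
  have "bounded (F ` disc)" using bounded unfolding bounded_iff by (intro exI[of _ "C * B"]) auto
  hence "Crho F" unfolding Crho_def using unif cont by blast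
  thus ?thesis unfolding F_def[abs_def] q_def[abs_def] .
qed

text \<open>Fubini for vector values without a vector-valued product integral: scalar Fubini on each
  level set handles simple f, and the envelopes \<open>e n\<close> control the passage to f on both
  sides.\<close>

lemma kernel_duality:
  fixes q :: "complex \<Rightarrow> complex \<Rightarrow> complex" and D p :: "complex \<Rightarrow> complex" and f :: "complex \<Rightarrow> 'x::complex_banach"
  assumes qm: "(\<lambda>(z, w). q z w) \<in> borel_measurable borel"
    and int: "\<And>z. cmod z < 1 \<Longrightarrow> (\<integral>\<^sup>+w. ennreal (cmod (q z w)) \<partial>lborel) \<le> ennreal C" and C: "0 \<le> C"
    and Dm: "D \<in> borel_measurable borel" and D: "\<And>z. cmod (D z) \<le> B" "\<And>z. 1 \<le> cmod z \<Longrightarrow> D z = 0"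
    and dual: "\<And>w. w \<in> disc \<Longrightarrow> (LINT z|lborel. D z * q z w) = - p w"
    and p: "set_integrable lborel disc p" and f: "f \<in> Linf K"
  shows "((\<lambda>z. cscale (D z) (vint (q z) f)) has_integral - vint p f) disc"
proof -
  have qm' [measurable]: "(\<lambda>(z, w). q z w) \<in> borel_measurable (lborel \<Otimes>\<^sub>M lborel)" using qm by (simp add: lborel_prod)
  have qzm [measurable]: "q z \<in> borel_measurable borel" for z
    using measurable_Pair2[OF qm', of z] by simp
  note [measurable] = Dm
  have dm [measurable]: "disc \<in> sets borel" by simp
  note qi = set_integrable_disc_nn[OF qzm int C]
  have B0: "0 \<le> B" using D(1)[of 0] norm_ge_zero order_trans by blast
  have Di: "set_integrable lborel disc D"
    unfolding set_integrable_def
  proof (rule integrableI_bounded_set_indicator[where B = B])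
    show "emeasure lborel disc < \<infinity>" using emeasure_lborel_ball_finite[of "0::complex" 1] by simp
  qed (use D in auto)
  have fub: "set_integrable lborel disc (\<lambda>z. D z * (LINT w:disc|lborel. indicator A w *\<^sub>R q z w))"
     "(LINT z:disc|lborel. D z * (LINT w:disc|lborel. indicator A w *\<^sub>R q z w)) = - (LINT w:disc|lborel. indicator A w *\<^sub>R p w)"
    if A [measurable]: "A \<in> sets borel" for A
  proof -
    define h where "h z w = D z * (indicator disc w *\<^sub>R (indicator A w *\<^sub>R q z w))" for z w
    have hm [measurable]: "(\<lambda>(z, w). h z w) \<in> borel_measurable (lborel \<Otimes>\<^sub>M lborel)"
      unfolding h_def by measurable
    have hle: "(\<integral>\<^sup>+w. ennreal (cmod (h z w)) \<partial>lborel) \<le> ennreal (B * C) * indicator disc z" for z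
    proof (cases "cmod z < 1")
      case True
      have "(\<integral>\<^sup>+w. ennreal (cmod (h z w)) \<partial>lborel) \<le> (\<integral>\<^sup>+w. ennreal B * ennreal (cmod (q z w)) \<partial>lborel)"
        unfolding h_def norm_mult using D(1)[of z] B0
        by (intro nn_integral_mono) (auto simp: ennreal_mult[symmetric] indicator_def intro!: ennreal_leI mult_right_mono)
      also have "\<dots> = ennreal B * (\<integral>\<^sup>+w. ennreal (cmod (q z w)) \<partial>lborel)" by (rule nn_integral_cmult) measurable
      also have "\<dots> \<le> ennreal B * ennreal C" by (intro mult_left_mono int True) auto
      finally show ?thesis using True B0 C by (simp add: ennreal_mult)
    qed (simp add: h_def D)
    have hi: "integrable (lborel \<Otimes>\<^sub>M lborel) (\<lambda>(z, w). h z w)"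
    proof (rule integrableI_bounded[OF hm])
      have "(\<integral>\<^sup>+x. ennreal (cmod (case x of (z, w) \<Rightarrow> h z w)) \<partial>(lborel \<Otimes>\<^sub>M lborel))
         = (\<integral>\<^sup>+z. \<integral>\<^sup>+w. ennreal (cmod (h z w)) \<partial>lborel \<partial>lborel)"
        by (subst lborel.nn_integral_fst[symmetric]) (use hm in \<open>auto simp: split_beta\<close>)
      also have "\<dots> \<le> (\<integral>\<^sup>+z. ennreal (B * C) * indicator disc z \<partial>lborel)" by (intro nn_integral_mono hle)
      also have "\<dots> = ennreal (B * C) * emeasure lborel disc" by (rule nn_integral_cmult_indicator) simp
      also have "\<dots> < \<infinity>" using emeasure_lborel_ball_finite[of "0::complex" 1] by (simp add: ennreal_mult_less_top)
      finally show "(\<integral>\<^sup>+x. ennreal (cmod (case x of (z, w) \<Rightarrow> h z w)) \<partial>(lborel \<Otimes>\<^sub>M lborel)) < \<infinity>" .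
    qed
    have hz: "(LINT w|lborel. h z w) = D z * (LINT w:disc|lborel. indicator A w *\<^sub>R q z w)" for z
      unfolding h_def set_lebesgue_integral_def by (rule integral_mult_right_zero)
    have i1: "integrable lborel (\<lambda>z. D z * (LINT w:disc|lborel. indicator A w *\<^sub>R q z w))"
      using lborel_pair.integrable_fst[OF hi] by (simp add: hz)
    thus "set_integrable lborel disc (\<lambda>z. D z * (LINT w:disc|lborel. indicator A w *\<^sub>R q z w))"
      unfolding set_integrable_def by (rule integrable_mult_indicator[rotated]) simp
    have hw: "(LINT z|lborel. h z w) = - (indicator disc w *\<^sub>R (indicator A w *\<^sub>R p w))" for w
    proof (cases "w \<in> disc")
      case True
      have "(LINT z|lborel. h z w) = (LINT z|lborel. indicator A w *\<^sub>R (D z * q z w))"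
        using True by (intro Bochner_Integration.integral_cong) (auto simp: h_def)
      also have "\<dots> = indicator A w *\<^sub>R (LINT z|lborel. D z * q z w)" by (rule integral_scaleR_right) 
      finally show ?thesis using True by (simp add: dual)
    qed (simp add: h_def)
    have "(LINT z:disc|lborel. D z * (LINT w:disc|lborel. indicator A w *\<^sub>R q z w)) = (LINT z|lborel. LINT w|lborel. h z w)"
      unfolding set_lebesgue_integral_def[of lborel disc "\<lambda>z. D z * _ z"] hz
      by (intro Bochner_Integration.integral_cong) (use D(2) in \<open>auto simp: indicator_def not_less\<close>)
    also have "\<dots> = (LINT w|lborel. LINT z|lborel. h z w)" by (rule lborel_pair.Fubini_integral[OF hi, symmetric])
    also have "\<dots> = - (LINT w:disc|lborel. indicator A w *\<^sub>R p w)" unfolding hw set_lebesgue_integral_def by simp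
    finally show "(LINT z:disc|lborel. D z * (LINT w:disc|lborel. indicator A w *\<^sub>R q z w)) = - (LINT w:disc|lborel. indicator A w *\<^sub>R p w)" .
  qed
  have simple: "((\<lambda>z. cscale (D z) (vint (q z) s)) has_integral - vint p s) disc"
    if s: "simple_function lborel s" for s :: "complex \<Rightarrow> 'x"
  proof -
    have fin: "finite (range s)" and A: "\<And>y. s -` {y} \<in> sets borel"
      using simple_functionD[OF s] by auto
    have 1: "((\<lambda>z. D z * (LINT w:disc|lborel. indicator (s -` {y}) w *\<^sub>R q z w)) has_integral
       - (LINT w:disc|lborel. indicator (s -` {y}) w *\<^sub>R p w)) disc" for y
      unfolding fub(2)[OF A[of y], symmetric] set_borel_integral_eq_integral(2)[OF fub(1)[OF A[of y]]]
      by (rule integrable_integral[OF set_borel_integral_eq_integral(1)[OF fub(1)[OF A[of y]]]])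
    have h1: "((\<lambda>z. \<Sum>y\<in>range s. cscale (D z * (LINT w:disc|lborel. indicator (s -` {y}) w *\<^sub>R q z w)) y) has_integral
       (\<Sum>y\<in>range s. cscale (- (LINT w:disc|lborel. indicator (s -` {y}) w *\<^sub>R p w)) y)) disc"
      using has_integral_linear[OF 1 bounded_linear_cscale_left] by (intro has_integral_sum fin) (simp add: o_def)
    have h2: "(\<Sum>y\<in>range s. cscale (- (LINT w:disc|lborel. indicator (s -` {y}) w *\<^sub>R p w)) y) = - vint p s"
      using integral_unique[OF vint_integrable_simple[OF p s]] by (simp add: vint_def cscale_minus_left sum_negf)
    have h3: "(\<Sum>y\<in>range s. cscale (D z * (LINT w:disc|lborel. indicator (s -` {y}) w *\<^sub>R q z w)) y) = cscale (D z) (vint (q z) s)"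
      if "z \<in> disc" for z
      using integral_unique[OF vint_integrable_simple[OF qi(2) s, of z]] that
      by (simp add: vint_def cscale_sum_right cscale_mult)
    show ?thesis using has_integral_eq[OF h3 h1] unfolding h2 .
  qed
  obtain M s e where M: "0 \<le> M" and s: "\<And>n. simple_function lborel (s n)" "\<And>n w. norm (s n w) \<le> M"
    and e: "\<And>n. (e n :: complex \<Rightarrow> real) \<in> borel_measurable borel" "\<And>n w. 0 \<le> e n w" "\<And>n w. e n w \<le> 2 * M"
      "AE w in lebesgue. (\<lambda>n. e n w) \<longlonglongrightarrow> 0" and le: "AE w in lebesgue. \<forall>n. norm (f w - s n w) \<le> e n w"
    using Linf_approx[OF f] by blast
  note [measurable] = e(1)
  have diff: "norm (vint k f - vint k (s n)) \<le> (LINT w:disc|lborel. cmod (k w) * e n w)"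
    if k: "set_integrable lborel disc k" for k n
  proof -
    have i: "(\<lambda>w. cscale (k w) (f w)) integrable_on disc" "(\<lambda>w. cscale (k w) (s n w)) integrable_on disc"
      using vint_integrable[OF k f] vint_integrable_simple[OF k s(1)] by (auto simp: integrable_on_def)
    have "vint k f - vint k (s n) = vint k (\<lambda>w. f w - s n w)"
      unfolding vint_def cscale_diff_right by (rule Henstock_Kurzweil_Integration.integral_diff[OF i, symmetric])
    also have "norm \<dots> \<le> (LINT w:disc|lborel. cmod (k w) * e n w)"
    proof (rule vint_norm_le)
      show "(\<lambda>w. cscale (k w) (f w - s n w)) integrable_on disc"
        unfolding cscale_diff_right by (rule Henstock_Kurzweil_Integration.integrable_diff[OF i])
      show "set_integrable lborel disc (\<lambda>w. cmod (k w) * e n w)"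
        by (rule set_integrable_disc_cmult_bounded[OF k e(1), where C = "2 * M"]) (use e in auto)
      show "AE w in lebesgue. norm (f w - s n w) \<le> e n w" using le by eventually_elim auto
    qed
    finally show ?thesis .
  qed
  \<comment> \<open>A measurable pointwise bound for the change of the inner integral when f is
    replaced by s n; it is bounded and tends to 0, so it can serve as an envelope for the outer
    integral.\<close>
  define d where "d n z = indicator disc z * (LINT w:disc|lborel. cmod (q z w) * e n w)" for n z
  have dm [measurable]: "d n \<in> borel_measurable borel" for n
  proof -
    have "(\<lambda>z. LINT w|lborel. indicator disc w *\<^sub>R (cmod (q z w) * e n w)) \<in> borel_measurable lborel"
      by (rule lborel.borel_measurable_lebesgue_integral) measurable
    thus ?thesis unfolding d_def set_lebesgue_integral_def by simp
  qed
  have d0: "0 \<le> d n z" for n z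
    unfolding d_def set_lebesgue_integral_def using e by (intro mult_nonneg_nonneg Bochner_Integration.integral_nonneg) auto
  have dle: "d n z \<le> C * (2 * M)" for n z
  proof (cases "z \<in> disc")
    case True
    hence z: "cmod z < 1" by simp
    have "(LINT w:disc|lborel. cmod (q z w) * e n w) \<le> (LINT w:disc|lborel. cmod (q z w) * (2 * M))"
    proof (rule set_integral_mono)
      show "set_integrable lborel disc (\<lambda>w. cmod (q z w) * e n w)"
        by (rule set_integrable_disc_cmult_bounded[OF qi(2)[OF z] e(1), where C = "2 * M"]) (use e in auto)
      show "set_integrable lborel disc (\<lambda>w. cmod (q z w) * (2 * M))"
        by (rule set_integrable_disc_cmult_bounded[OF qi(2)[OF z], where C = "2 * M"]) (use M in auto)
    qed (use e in \<open>auto intro!: mult_left_mono\<close>)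
    also have "\<dots> = (LINT w:disc|lborel. cmod (q z w)) * (2 * M)" by simp
    also have "\<dots> \<le> C * (2 * M)" using M by (intro mult_right_mono qi(3) z) auto
    finally show ?thesis using True by (simp add: d_def)
  qed (use C M in \<open>simp add: d_def\<close>)
  have dlim: "(\<lambda>n. d n z) \<longlonglongrightarrow> 0" for z
  proof (cases "z \<in> disc")
    case True
    have "(\<lambda>n. LINT w:disc|lborel. cmod (q z w) * e n w) \<longlonglongrightarrow> 0"
      by (rule vint_dominated_tendsto[OF qi(2)]) (use True e in auto)
    thus ?thesis using True by (simp add: d_def)
  qed (simp add: d_def)
  have Dlim: "(\<lambda>n. LINT z:disc|lborel. cmod (D z) * d n z) \<longlonglongrightarrow> 0"
    by (rule vint_dominated_tendsto[OF Di dm d0 dle]) (use dlim in auto)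
  have hI: "set_integrable lborel disc (\<lambda>z. cmod (D z) * d n z)" for n
    by (rule set_integrable_disc_cmult_bounded[OF Di dm, where C = "C * (2 * M)"]) (use d0 dle in auto)
  note hI' = set_borel_integral_eq_integral[OF hI]
  define F where "F g z = cscale (D z) (vint (q z) g)" for g :: "complex \<Rightarrow> 'x" and z
  have Fle: "norm (F f z - F (s n) z) \<le> cmod (D z) * d n z" if "z \<in> disc" for n z
    unfolding F_def cscale_diff_right[symmetric] cscale_norm
    using diff[OF qi(2), of z n] that by (intro mult_left_mono) (auto simp: d_def)
  have Fint: "F f integrable_on disc"
  proof (rule integrable_on_disc_approx)
    fix \<delta> :: real assume "\<delta> > 0"
    then obtain n where n: "(LINT z:disc|lborel. cmod (D z) * d n z) < \<delta>"
      using eventually_happens[OF order_tendstoD(2)[OF Dlim, of \<delta>]] by auto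
    show "\<exists>g h. g integrable_on disc \<and> (h::complex\<Rightarrow>real) integrable_on disc
        \<and> (\<forall>x\<in>disc. norm (F f x - g x) \<le> h x) \<and> integral disc h < \<delta>"
      using n hI'[of n] Fle[of _ n] simple[OF s(1)[of n]]
      by (intro exI[of _ "F (s n)"] exI[of _ "\<lambda>z. cmod (D z) * d n z"]) (auto simp: F_def[abs_def] integrable_on_def)
  qed
  have close: "norm (integral disc (F f) + vint p (s n)) \<le> (LINT z:disc|lborel. cmod (D z) * d n z)" for n
  proof -
    have i: "F (s n) integrable_on disc" "integral disc (F (s n)) = - vint p (s n)"
      using simple[OF s(1)[of n]] by (auto simp: F_def[abs_def] integrable_on_def intro: integral_unique)
    have "integral disc (F f) + vint p (s n) = integral disc (\<lambda>z. F f z - F (s n) z)"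
      using Henstock_Kurzweil_Integration.integral_diff[OF Fint i(1)] i(2) by simp
    moreover have "norm (integral disc (\<lambda>z. F f z - F (s n) z)) \<le> integral disc (\<lambda>z. cmod (D z) * d n z)"
      by (rule integral_norm_bound_integral)
         (use hI' Fle Henstock_Kurzweil_Integration.integrable_diff[OF Fint i(1)] in auto)
    ultimately show ?thesis by (simp only: hI'(2))
  qed
  have "(\<lambda>n. integral disc (F f) + vint p (s n)) \<longlonglongrightarrow> 0"
    by (rule Lim_null_comparison[OF _ Dlim]) (use close in auto)
  moreover have "(\<lambda>n. vint p f - vint p (s n)) \<longlonglongrightarrow> 0"
  proof (rule Lim_null_comparison)
    show "(\<lambda>n. LINT w:disc|lborel. cmod (p w) * e n w) \<longlonglongrightarrow> 0"
      by (rule vint_dominated_tendsto[OF p]) (use e in auto)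
  qed (use diff[OF p] in auto)
  ultimately have "(\<lambda>n. (integral disc (F f) + vint p (s n)) + (vint p f - vint p (s n))) \<longlonglongrightarrow> 0 + 0" by (rule tendsto_add)
  hence "(\<lambda>n::nat. integral disc (F f) + vint p f) \<longlonglongrightarrow> 0" by simp
  hence "integral disc (F f) = - vint p f" by (simp add: LIMSEQ_const_iff eq_neg_iff_add_eq_0)
  thus ?thesis using integrable_integral[OF Fint] by (simp add: F_def[abs_def])
qed

section \<open>Test functions and the weak equation\<close>

lemma test_fn_vanishes:
  assumes "test_fn \<phi>"
  obtains R where "0 < R" "R < 1" "\<And>z. R \<le> cmod z \<Longrightarrow> \<phi> z = 0"
    "\<And>z v. R \<le> cmod z \<Longrightarrow> frechet_derivative \<phi> (at z) v = 0"
proof -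
  define S where "S = closure {z. \<phi> z \<noteq> 0}"
  have S: "compact S" "S \<subseteq> disc" using assms by (auto simp: test_fn_def S_def)
  obtain R where R: "0 < R" "R < 1" "\<And>z. z \<in> S \<Longrightarrow> cmod z < R"
  proof (cases "S = {}")
    case True
    thus ?thesis by (intro that[of "1 / 2"]) auto
  next
    case False
    have "continuous_on S cmod" by (intro continuous_intros)
    from continuous_attains_sup[OF S(1) False this] obtain m where m: "m \<in> S" "\<And>z. z \<in> S \<Longrightarrow> cmod z \<le> cmod m" by blast
    hence "cmod m < 1" using S by auto
    thus ?thesis by (intro that[of "(1 + cmod m) / 2"]) (auto simp: add_pos_nonneg dest!: m(2))
  qed
  have 1: "\<phi> z = 0" if "z \<notin> S" for z using that closure_subset[of "{z. \<phi> z \<noteq> 0}"] by (auto simp: S_def)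
  have 2: "frechet_derivative \<phi> (at z) v = 0" if "z \<notin> S" for z v
  proof -
    have "open (- S)" using S compact_imp_closed by auto
    hence "(\<phi> has_derivative (\<lambda>_. 0)) (at z)"
      by (rule has_derivative_transform_within_open[OF has_derivative_const[of 0]]) (use that 1 in auto)
    thus ?thesis by (metis frechet_derivative_at)
  qed
  show ?thesis
  proof (rule that[OF R(1,2)])
    fix z v assume "R \<le> cmod z"
    hence "z \<notin> S" using R(3)[of z] by linarith
    thus "\<phi> z = 0" "frechet_derivative \<phi> (at z) v = 0" by (auto simp: 1 2)
  qed
qed

context jones
begin

lemma ker_measurable_pair: "(\<lambda>(z, w). ker z w) \<in> borel_measurable borel"
proof -
  have [measurable]: "(\<lambda>(z, w). num z w) \<in> borel_measurable (borel \<Otimes>\<^sub>M borel)" using num_measurable_pair by (simp add: borel_prod)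
  have "(\<lambda>(z, w). ker z w) \<in> borel_measurable (borel \<Otimes>\<^sub>M borel)" unfolding ker_def by measurable
  thus ?thesis by (simp add: borel_prod)
qed

text \<open>Since N = \<open>num\<close> in its first variable is holomorphic, d-bar of \<phi> N is
  N times d-bar of \<phi>. Cauchy--Pompeiu for \<phi> N then leaves pi times the diagonal value of
  \<open>num\<close>.\<close>

lemma dzbar_ker_integral:
  assumes \<phi>: "test_fn \<phi>" and w: "w \<in> U"
  shows "(LINT z|lborel. dzbar \<phi> z * ker z w) = - (\<phi> w / of_real (1 - (cmod w)\<^sup>2))"
proof -
  obtain R where R: "0 < R" "R < 1" "\<And>z. R \<le> cmod z \<Longrightarrow> \<phi> z = 0"
    "\<And>z v. R \<le> cmod z \<Longrightarrow> frechet_derivative \<phi> (at z) v = 0" using test_fn_vanishes[OF \<phi>] by blast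
  have "Ck (Suc 0) \<phi>" using \<phi> unfolding test_fn_def by blast
  hence dif: "\<And>z. \<phi> differentiable (at z)"
    and c: "continuous_on UNIV \<phi>" "continuous_on UNIV (\<lambda>z. frechet_derivative \<phi> (at z) 1)" "continuous_on UNIV (\<lambda>z. frechet_derivative \<phi> (at z) \<i>)"
    by auto
  define N where "N z = num z w" for z
  have w1: "w \<in> disc" using U_disc[OF w] by simp
  have Nh: "N holomorphic_on disc" unfolding N_def[abs_def] by (rule num_holomorphic) (use w1 in simp)
  \<comment> \<open>N is holomorphic only on the disc; the product is smooth on the plane because
    \<phi> vanishes near and beyond the unit circle.\<close>
  define g where "g z = (if z \<in> disc then \<phi> z * N z else 0)" for z
  define g' where "g' z v = (if z \<in> disc then \<phi> z * (deriv N z * v) + frechet_derivative \<phi> (at z) v * N z else 0)" for z v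
  have out: "open {z. R < cmod z}" using open_Collect_less[of "\<lambda>_. R" cmod] by (simp add: continuous_on_norm)
  have cover: "disc \<union> {z. R < cmod z} = UNIV" using R by auto
  have cont: "continuous_on UNIV (\<lambda>z. g' z v)" if cv: "continuous_on UNIV (\<lambda>z. frechet_derivative \<phi> (at z) v)" for v
    unfolding cover[symmetric]
  proof (rule continuous_on_open_Un[OF _ out])
    have "continuous_on disc (\<lambda>z. \<phi> z * (deriv N z * v) + frechet_derivative \<phi> (at z) v * N z)"
      by (intro continuous_intros continuous_on_subset[OF c(1)] continuous_on_subset[OF cv] holomorphic_on_imp_continuous_on holomorphic_deriv Nh) auto
    thus "continuous_on disc (\<lambda>z. g' z v)" by (rule continuous_on_eq) (simp add: g'_def)
    show "continuous_on {z. R < cmod z} (\<lambda>z. g' z v)"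
      by (rule continuous_on_eq[OF continuous_on_const[of _ 0]]) (use R in \<open>simp add: g'_def\<close>)
  qed simp
  have der: "(g has_derivative g' z) (at z)" for z
  proof (cases "z \<in> disc")
    case True
    have "(N has_field_derivative deriv N z) (at z)" by (rule holomorphic_derivI[OF Nh _ True]) simp
    hence "(N has_derivative (\<lambda>v. deriv N z * v)) (at z)" by (simp add: has_field_derivative_def)
    moreover have "(\<phi> has_derivative frechet_derivative \<phi> (at z)) (at z)" using dif by (simp add: frechet_derivative_works)
    ultimately have "((\<lambda>z. \<phi> z * N z) has_derivative (\<lambda>v. \<phi> z * (deriv N z * v) + frechet_derivative \<phi> (at z) v * N z)) (at z)"
      by (intro has_derivative_mult)
    moreover have "g' z = (\<lambda>v. \<phi> z * (deriv N z * v) + frechet_derivative \<phi> (at z) v * N z)" using True by (auto simp: g'_def)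
    ultimately show ?thesis
      by (auto intro: has_derivative_transform_within_open[OF _ open_ball True] simp: g_def)
  next
    case False
    have "((\<lambda>_. 0) has_derivative g' z) (at z)" using False by (simp add: g'_def[abs_def])
    thus ?thesis by (rule has_derivative_transform_within_open[OF _ out]) (use False R in \<open>auto simp: g_def\<close>)
  qed
  have supp: "g z = 0" "g' z v = 0" if "R \<le> cmod z" for z v using R that by (auto simp: g_def g'_def)
  have "(LINT z|lborel. (g' z 1 + \<i> * g' z \<i>) / 2 / (z - w)) = - pi * g w"
    by (rule Cauchy_Pompeiu(2)[OF der cont cont supp]) (use c in auto)
  also have "(\<lambda>z. (g' z 1 + \<i> * g' z \<i>) / 2 / (z - w)) = (\<lambda>z. dzbar \<phi> z * ker z w)"
  proof
    fix z
    have i: "\<i> * (a * (b * \<i>)) = - (a * b)" for a b :: complex by (simp add: algebra_simps)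
    show "(g' z 1 + \<i> * g' z \<i>) / 2 / (z - w) = dzbar \<phi> z * ker z w"
    proof (cases "z \<in> disc")
      case True
      thus ?thesis by (simp add: g'_def ker_def dzbar_def N_def distrib_left i) (simp add: algebra_simps)
    qed (simp add: g'_def ker_def num_def)
  qed
  also have "- pi * g w = - (\<phi> w / of_real (1 - (cmod w)\<^sup>2))"
    using w1 by (simp add: g_def N_def num_diag[OF w])
  finally show ?thesis .
qed

lemma weak_solution:
  fixes f :: "complex \<Rightarrow> 'x::complex_banach"
  assumes f: "f \<in> Linf K" and K: "K \<subseteq> U"
  shows "weak_sol (\<lambda>z. vint (ker z) f) f"
  unfolding weak_sol_def
proof (intro allI impI)
  fix \<phi> assume \<phi>: "test_fn \<phi>"
  obtain R where R: "0 < R" "R < 1" "\<And>z. R \<le> cmod z \<Longrightarrow> \<phi> z = 0"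
    "\<And>z v. R \<le> cmod z \<Longrightarrow> frechet_derivative \<phi> (at z) v = 0" using test_fn_vanishes[OF \<phi>] by blast
  have "Ck (Suc 0) \<phi>" using \<phi> unfolding test_fn_def by blast
  hence c: "continuous_on UNIV \<phi>" and cd: "continuous_on UNIV (dzbar \<phi>)"
    unfolding dzbar_def[abs_def] by (auto intro!: continuous_intros)
  have D0: "dzbar \<phi> z = 0" if "R \<le> cmod z" for z using R(4)[OF that] by (simp add: dzbar_def)
  obtain B where B: "\<And>z. cmod (dzbar \<phi> z) \<le> B" using integrable_continuous_compact_support(2)[OF cd D0] by blast
  \<comment> \<open>Cut off at U to match the kernel, which vanishes there in w; f does not see the
    cut because it vanishes almost everywhere off K, which lies in U.\<close>
  define p where "p w = (if w \<in> U then \<phi> w / of_real (1 - (cmod w)\<^sup>2) else 0)" for w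
  have [measurable]: "\<phi> \<in> borel_measurable borel" by (rule borel_measurable_continuous_onI[OF c])
  have [measurable]: "p \<in> borel_measurable borel" unfolding p_def by measurable
  obtain B' where B': "\<And>z. cmod (\<phi> z) \<le> B'" using integrable_continuous_compact_support(2)[OF c R(3)] by blast
  have pb: "cmod (p w) \<le> B' / (1 - R\<^sup>2)" for w
  proof (cases "w \<in> U \<and> cmod w < R")
    case True
    have "(cmod w)\<^sup>2 \<le> R\<^sup>2" using True by (intro power_mono) auto
    moreover have R2: "R\<^sup>2 < 1" using R by (simp add: power_less_one_iff)
    ultimately have "cmod (\<phi> w) / \<bar>1 - (cmod w)\<^sup>2\<bar> \<le> B' / (1 - R\<^sup>2)" using B'[of w] by (intro frac_le) (auto intro: order_trans[OF norm_ge_zero])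
    moreover have "cmod (p w) = cmod (\<phi> w) / \<bar>1 - (cmod w)\<^sup>2\<bar>" using True by (simp only: p_def if_True norm_divide norm_of_real)
    ultimately show ?thesis by (simp only:)
  next
    case False
    have "0 \<le> B'" using B'[of 0] norm_ge_zero order_trans by blast
    moreover have R2: "R\<^sup>2 < 1" using R by (simp add: power_less_one_iff)
    moreover have "p w = 0" using False R(3)[of w] by (auto simp: p_def)
    ultimately show ?thesis by simp
  qed
  have p: "set_integrable lborel disc p"
    unfolding set_integrable_def
  proof (rule integrableI_bounded_set_indicator[where B = "B' / (1 - R\<^sup>2)"])
    show "emeasure lborel disc < \<infinity>" using emeasure_lborel_ball_finite[of "0::complex" 1] by simp
  qed (use pb in auto)
  have 1: "((\<lambda>z. cscale (dzbar \<phi> z) (vint (ker z) f)) has_integral - vint p f) disc"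
  proof (rule kernel_duality[OF ker_measurable_pair ker_integral _ _ B _ _ p f])
    show "dzbar \<phi> \<in> borel_measurable borel" by (rule borel_measurable_continuous_onI[OF cd])
    show "dzbar \<phi> z = 0" if "1 \<le> cmod z" for z using D0 that R by simp
    show "(LINT z|lborel. dzbar \<phi> z * ker z w) = - p w" for w
    proof (cases "w \<in> U")
      case False
      hence "ker z w = 0" for z by (simp add: ker_def num_def)
      thus ?thesis using False by (simp add: p_def)
    qed (simp add: dzbar_ker_integral[OF \<phi>] p_def)
  qed (use r in auto)
  have "AE w in lebesgue. w \<notin> K \<longrightarrow> f w = 0" using f by (simp add: Linf_def)
  hence neg: "negligible {w. \<not> (w \<notin> K \<longrightarrow> f w = 0)}" by (rule AE_lebesgue_negligible)
  have "((\<lambda>w. cscale (p w) (f w)) has_integral vint p f) disc"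
    unfolding vint_def by (rule integrable_integral[OF vint_integrable[OF p f]])
  hence "((\<lambda>z. cscale (\<phi> z / complex_of_real (1 - (cmod z)\<^sup>2)) (f z)) has_integral vint p f) disc"
    by (rule has_integral_spike[OF neg, rotated]) (use K in \<open>auto simp: p_def\<close>)
  thus "\<exists>I. ((\<lambda>z. cscale (dzbar \<phi> z) (vint (ker z) f)) has_integral I) disc \<and>
      ((\<lambda>z. cscale (\<phi> z / complex_of_real (1 - (cmod z)\<^sup>2)) (f z)) has_integral - I) disc"
    using 1 by (intro exI[of _ "- vint p f"]) simp
qed

end

section \<open>Operators given by kernels\<close>

lemma opnorm_bounds:
  fixes T :: "'x::complex_banach op"
  assumes "\<And>f z. f \<in> Linf K \<Longrightarrow> z \<in> disc \<Longrightarrow> norm (T f z) \<le> M * essnorm f" and "0 \<le> M"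
  shows "0 \<le> opnorm K T" "opnorm K T \<le> M"
proof -
  have M: "M \<in> {M. M \<ge> 0 \<and> (\<forall>f\<in>Linf K. \<forall>z\<in>disc. norm (T f z) \<le> M * essnorm f)}" using assms by blast
  show "0 \<le> opnorm K T" unfolding opnorm_def by (rule cInf_greatest) (use M in blast)+
  show "opnorm K T \<le> M" unfolding opnorm_def by (rule cInf_lower[OF M]) (auto intro: bdd_belowI[of _ 0])
qed

context
  fixes q :: "complex \<Rightarrow> complex \<Rightarrow> complex" and M :: real
  assumes qm: "\<And>z. q z \<in> borel_measurable borel" and M: "0 \<le> M"
    and int: "\<And>z. cmod z < 1 \<Longrightarrow> (\<integral>\<^sup>+w. ennreal (cmod (q z w)) \<partial>lborel) \<le> ennreal M"
begin

lemma kernel_integrable: "cmod z < 1 \<Longrightarrow> set_integrable lborel disc (q z)"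
  by (rule set_integrable_disc_nn(2)[OF qm int M])

lemma norm_kernel_op_le:
  fixes f :: "complex \<Rightarrow> 'x::complex_banach"
  shows "f \<in> Linf K \<Longrightarrow> z \<in> disc \<Longrightarrow> norm (vint (q z) f) \<le> M * essnorm f"
  by (rule vint_bound[OF kernel_integrable _ set_integrable_disc_nn(3)[OF qm int M]]) auto

lemma opnorm_kernel:
  fixes T :: "'x::complex_banach op"
  assumes "\<And>f z. f \<in> Linf K \<Longrightarrow> z \<in> disc \<Longrightarrow> T f z = vint (q z) f"
  shows "0 \<le> opnorm K T" "opnorm K T \<le> M"
  by (rule opnorm_bounds[OF _ M]; simp add: assms norm_kernel_op_le del: mem_ball_0)+

lemma bdd_lin_op_kernel: "bdd_lin_op K (\<lambda>f z. vint (q z) (f :: complex \<Rightarrow> 'x::complex_banach))"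
  unfolding bdd_lin_op_def
proof (intro conjI ballI allI impI)
  fix f g :: "complex \<Rightarrow> 'x" and z assume z: "z \<in> disc"
  show "vint (q z) f = vint (q z) g" if "AE z in lebesgue. f z = g z"
    by (rule vint_cong) (use that in eventually_elim, simp)
  assume f: "f \<in> Linf K" and g: "g \<in> Linf K"
  show "vint (q z) (\<lambda>w. f w + g w) = vint (q z) f + vint (q z) g"
    by (rule vint_add_right[OF kernel_integrable f g]) (use z in simp)
next
  fix f :: "complex \<Rightarrow> 'x" and a z assume "f \<in> Linf K" "z \<in> disc"
  thus "vint (q z) (\<lambda>w. cscale a (f w)) = cscale a (vint (q z) f)"
    by (intro vint_cscale_right kernel_integrable) auto
next
  show "\<exists>M. \<forall>f\<in>Linf K. \<forall>z\<in>disc. norm (vint (q z) (f :: complex \<Rightarrow> 'x)) \<le> M * essnorm f"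
    using norm_kernel_op_le by blast
qed

end

text \<open>The vanishing diagonal removes the pole, so the values are holomorphic by
  \<open>vholo_vint_quotient\<close>; the bound on the mass of the kernel gives the operator
  norm.\<close>

lemma Bop_kernel:
  fixes u :: "complex \<Rightarrow> complex \<Rightarrow> complex"
  assumes um: "\<And>z. u z \<in> borel_measurable borel" and M: "0 \<le> M"
    and int: "\<And>z. cmod z < 1 \<Longrightarrow> (\<integral>\<^sup>+w. ennreal (cmod (u z w / (z - w))) \<partial>lborel) \<le> ennreal M"
    and hol: "\<And>w. w \<in> disc \<Longrightarrow> (\<lambda>z. u z w) holomorphic_on disc"
    and zero: "\<And>w. w \<in> disc \<Longrightarrow> u w w = 0"
    and bnd: "\<And>z w. cmod z < 1 \<Longrightarrow> cmod (u z w) \<le> B / (1 - cmod z)" and B: "0 \<le> B"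
  shows "Bop K (\<lambda>f z. vint (\<lambda>w. u z w / (z - w)) (f :: complex \<Rightarrow> 'x::complex_banach))"
proof -
  have qm: "(\<lambda>w. u z w / (z - w)) \<in> borel_measurable borel" for z using um[of z] by measurable
  have "vholo disc (\<lambda>z. vint (\<lambda>w. u z w / (z - w)) f)" if f: "f \<in> Linf K" for f :: "complex \<Rightarrow> 'x"
  proof (rule vholo_vint_quotient[OF _ hol zero _ f])
    show "set_integrable lborel disc (\<lambda>w. u z w / (z - w))" if "z \<in> disc" for z
      by (rule kernel_integrable[OF qm M int]) (use that in auto)
    show "\<exists>M. \<forall>w\<in>disc. \<forall>z\<in>cball 0 R. cmod (u z w) \<le> M" if R: "0 < R" "R < 1" for R
    proof (intro exI ballI)
      fix w z :: complex assume "z \<in> cball 0 R"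
      hence z: "cmod z < 1" "1 - R \<le> 1 - cmod z" using R by auto
      show "cmod (u z w) \<le> B / (1 - R)"
        using bnd[OF z(1), of w] divide_left_mono[OF z(2) B] z R by (auto intro: order_trans)
    qed
  qed
  moreover have "bounded ((\<lambda>z. vint (\<lambda>w. u z w / (z - w)) f) ` disc)" if f: "f \<in> Linf K" for f :: "complex \<Rightarrow> 'x"
    unfolding bounded_iff using norm_kernel_op_le[where q = "\<lambda>z w. u z w / (z - w)", OF qm M int f] by blast
  ultimately show ?thesis using bdd_lin_op_kernel[where q = "\<lambda>z w. u z w / (z - w)", OF qm M int] by (auto simp: Bop_def)
qed

section \<open>The operators of one family\<close>

context jones
begin

text \<open>Extended by 0 so that it is Borel on the plane and bounded by 1 everywhere.\<close>

definition Bf :: "nat \<Rightarrow> complex \<Rightarrow> complex" where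
  "Bf i w = (if w \<in> disc then blaschke (fam i) w else 0)"

text \<open>The weight c is left free: the operators, their derivatives in \<xi> and the remainders
  of the difference quotients all have this form with different c.\<close>

definition hnum :: "nat \<Rightarrow> (complex \<Rightarrow> complex) \<Rightarrow> complex \<Rightarrow> complex \<Rightarrow> complex" where
  "hnum i c z w = (if w \<in> {w\<in>U. idx (pt w) = i} then num z w * (Bf i z - Bf i w) * c w else 0)"

definition hker :: "nat \<Rightarrow> (complex \<Rightarrow> complex) \<Rightarrow> complex \<Rightarrow> complex \<Rightarrow> complex" where
  "hker i c z w = hnum i c z w / (z - w)"

lemma Bf_holomorphic: "Bf i holomorphic_on disc"
  by (rule holomorphic_transform[OF blaschke_holomorphic[OF blaschke_fam]]) (simp add: Bf_def)

lemma Bf_measurable [measurable]: "Bf i \<in> borel_measurable borel"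
proof -
  have "(\<lambda>w. indicator disc w *\<^sub>R blaschke (fam i) w) \<in> borel_measurable borel"
    by (rule borel_measurable_continuous_on_indicator)
       (auto intro: holomorphic_on_imp_continuous_on blaschke_holomorphic[OF blaschke_fam])
  moreover have "(\<lambda>w. indicator disc w *\<^sub>R blaschke (fam i) w) = Bf i" by (auto simp: Bf_def indicator_def)
  ultimately show ?thesis by simp
qed

lemma norm_Bf_le_one: "cmod (Bf i z) \<le> 1"
  by (auto simp: Bf_def intro: norm_blaschke_le_one[OF blaschke_fam])

lemma norm_Bf_less: "w \<in> {w\<in>U. idx (pt w) = i} \<Longrightarrow> cmod (Bf i w) < r"
  using norm_blaschke_le_rho[OF blaschke_fam, of "pt w" i w] pt[of w] U_disc[of w]
  by (auto simp: Bf_def fam_def)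

lemma hnum_measurable [measurable]:
  assumes [measurable]: "c \<in> borel_measurable borel" shows "hnum i c z \<in> borel_measurable borel"
  unfolding hnum_def by measurable

lemma hker_measurable [measurable]:
  assumes [measurable]: "c \<in> borel_measurable borel" shows "hker i c z \<in> borel_measurable borel"
  unfolding hker_def by measurable

text \<open>The bound of \<open>cell_integral_rho_sharp\<close> divided by pi.\<close>

definition J :: real where "J = T\<^sup>2 * (r / (1 - r))\<^sup>2 + 3 * T * (r / (1 - r))"

lemma J_nonneg: "0 \<le> J" using r T_bounds by (simp add: J_def)

definition hconst :: real where "hconst = 5 * T\<^sup>2 * KK * ((1 + r) * J)"

lemma hconst_nonneg: "0 \<le> hconst" using r KK_pos J_nonneg by (simp add: hconst_def)

text \<open>The centre v is chosen per cell: the bound of the weight c may blow up at one point of it.\<close>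

lemma hker_integral:
  assumes [measurable]: "c \<in> borel_measurable borel" and A: "0 \<le> A"
    and c: "\<And>a. a \<in> fam i \<Longrightarrow> \<exists>v. cmod v < 1 \<and> (\<forall>w\<in>cell a. w \<noteq> v \<longrightarrow> cmod (c w) \<le> A / rho v w)"
    and z: "cmod z < 1"
  shows "(\<integral>\<^sup>+w. ennreal (cmod (hker i c z w)) \<partial>lborel) \<le> ennreal (hconst * A)"
proof -
  define F where "F = {w\<in>U. idx (pt w) = i}"
  define g where "g w = (1 + r) / pi * cmod (c w)" for w
  have g0: "0 \<le> g w" for w using r by (simp add: g_def)
  have [measurable]: "g \<in> borel_measurable borel" unfolding g_def by measurable
  have "(\<integral>\<^sup>+w. ennreal (cmod (hker i c z w)) \<partial>lborel)
     \<le> (\<integral>\<^sup>+w. ennreal (cmod (num z w) * pi / cmod (1 - cnj w * z)) * ennreal (g w) * indicator F w \<partial>lborel)"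
  proof (rule nn_integral_mono)
    fix w
    show "ennreal (cmod (hker i c z w)) \<le> ennreal (cmod (num z w) * pi / cmod (1 - cnj w * z)) * ennreal (g w) * indicator F w"
    proof (cases "w \<in> F \<and> w \<noteq> z")
      case True
      hence wU: "w \<in> U" "w \<in> {w\<in>U. idx (pt w) = i}" by (auto simp: F_def)
      have w: "cmod w < 1" using U_disc[OF wU(1)] .
      define D where "D = cmod (1 - cnj w * z)"
      have D: "0 < D" unfolding D_def using one_minus_cnj_mult_pos[of z w] z w by simp
      \<comment> \<open>Schwarz--Pick yields a factor \<open>rho z w\<close>, which cancels |z - w|;
        on the cells of the family |B(w)| < r, whence 1 + r.\<close>
      have "cmod (Bf i z - Bf i w) \<le> (1 + cmod (Bf i w)) * rho z w"
        by (rule Schwarz_Pick_diff[OF Bf_holomorphic norm_Bf_le_one]) (use z w in auto)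
      also have "\<dots> \<le> (1 + r) * rho z w" using norm_Bf_less[OF wU(2)] by (intro mult_right_mono rho_nonneg) auto
      finally have b: "cmod (Bf i z - Bf i w) \<le> (1 + r) * (cmod (z - w) / D)" by (simp add: rho_def D_def)
      have zw: "0 < cmod (z - w)" using True by auto
      have "cmod (hker i c z w) = cmod (num z w) * cmod (c w) / cmod (z - w) * cmod (Bf i z - Bf i w)"
        using wU(2) by (simp add: hker_def hnum_def norm_mult norm_divide)
      also have "\<dots> \<le> cmod (num z w) * cmod (c w) / cmod (z - w) * ((1 + r) * (cmod (z - w) / D))"
        by (rule mult_left_mono[OF b]) simp
      also have "\<dots> = cmod (num z w) * pi / D * g w" using zw D by (simp add: g_def)
      finally have "ennreal (cmod (hker i c z w)) \<le> ennreal (cmod (num z w) * pi / D * g w)" by (rule ennreal_leI)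
      also have "\<dots> = ennreal (cmod (num z w) * pi / D) * ennreal (g w)" using g0 D by (intro ennreal_mult) auto
      finally show ?thesis using True by (simp add: D_def)
    next
      case False
      hence "hker i c z w = 0" by (auto simp: hker_def hnum_def F_def)
      thus ?thesis by simp
    qed
  qed
  also have "\<dots> \<le> ennreal (5 * T\<^sup>2 * KK * ((1 + r) * A * J))"
    unfolding F_def
  proof (rule family_bound)
    fix a assume a: "a \<in> fam i"
    hence aY: "a \<in> Y" by (simp add: fam_def)
    obtain v where v: "cmod v < 1" "\<And>w. w \<in> cell a \<Longrightarrow> w \<noteq> v \<Longrightarrow> cmod (c w) \<le> A / rho v w" using c[OF a] by blast
    have [measurable]: "cell a \<in> sets borel" by (rule cell_measurable[OF aY])
    have "(\<integral>\<^sup>+w. ennreal (1 / (1 - (cmod w)\<^sup>2)\<^sup>2) * ennreal (g w) * indicator (cell a) w \<partial>lborel)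
       \<le> (\<integral>\<^sup>+w. ennreal ((1 + r) / pi * A) * (ennreal (1 / (1 - (cmod w)\<^sup>2)\<^sup>2) * ennreal (1 / rho v w) * indicator (cell a) w) \<partial>lborel)"
    proof (rule nn_integral_mono_AE)
      have "AE w in lborel. w \<noteq> v" by (rule AE_lborel_singleton)
      thus "AE w in lborel. ennreal (1 / (1 - (cmod w)\<^sup>2)\<^sup>2) * ennreal (g w) * indicator (cell a) w
        \<le> ennreal ((1 + r) / pi * A) * (ennreal (1 / (1 - (cmod w)\<^sup>2)\<^sup>2) * ennreal (1 / rho v w) * indicator (cell a) w)"
      proof eventually_elim
        case (elim w)
        show ?case
        proof (cases "w \<in> cell a")
          case True
          have "g w \<le> (1 + r) / pi * A * (1 / rho v w)"
            using mult_left_mono[OF v(2)[OF True elim], of "(1 + r) / pi"] r by (simp add: g_def)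
          hence "ennreal (g w) \<le> ennreal ((1 + r) / pi * A) * ennreal (1 / rho v w)"
            using r A rho_nonneg[of v w] by (subst ennreal_mult[symmetric]) (auto intro: ennreal_leI)
          hence "ennreal (1 / (1 - (cmod w)\<^sup>2)\<^sup>2) * ennreal (g w) \<le> ennreal (1 / (1 - (cmod w)\<^sup>2)\<^sup>2) * (ennreal ((1 + r) / pi * A) * ennreal (1 / rho v w))"
            by (rule mult_left_mono) simp
          thus ?thesis using True by (simp add: mult_ac)
        qed simp
      qed
    qed
    also have "\<dots> = ennreal ((1 + r) / pi * A) * (\<integral>\<^sup>+w. (ennreal (1 / (1 - (cmod w)\<^sup>2)\<^sup>2) * ennreal (1 / rho v w) * indicator (cell a) w) \<partial>lborel)"
      by (rule nn_integral_cmult) measurable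
    also have "\<dots> \<le> ennreal ((1 + r) / pi * A) * ennreal (pi * J)"
      unfolding J_def by (intro mult_left_mono cell_integral_rho_sharp aY v) auto
    also have "\<dots> = ennreal ((1 + r) * A * J)"
      using r A J_nonneg by (subst ennreal_mult[symmetric]) auto
    finally show "(\<integral>\<^sup>+w. ennreal (1 / (1 - (cmod w)\<^sup>2)\<^sup>2) * ennreal (g w) * indicator (cell a) w \<partial>lborel) \<le> ennreal ((1 + r) * A * J)" .
  qed (use r A J_nonneg z in auto)
  also have "5 * T\<^sup>2 * KK * ((1 + r) * A * J) = hconst * A" by (simp add: hconst_def)
  finally show ?thesis .
qed

text \<open>A bounded weight is covered with the net point of the cell as centre v, since
  \<open>rho\<close> is at most 1.\<close>

lemma hker_integral_crude:
  assumes c: "c \<in> borel_measurable borel" and A: "0 \<le> A"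
    and le: "\<And>w. w \<in> {w\<in>U. idx (pt w) = i} \<Longrightarrow> cmod (c w) \<le> A" and z: "cmod z < 1"
  shows "(\<integral>\<^sup>+w. ennreal (cmod (hker i c z w)) \<partial>lborel) \<le> ennreal (hconst * A)"
proof (rule hker_integral[OF c A _ z], intro exI conjI ballI impI)
  fix a w assume a: "a \<in> fam i" and w: "w \<in> cell a" "w \<noteq> a"
  have wU: "w \<in> {w\<in>U. idx (pt w) = i}" using a w by (auto simp: cell_def fam_def)
  have "0 < rho a w" "rho a w \<le> 1"
    using w Y1[of a] a U_disc[of w] wU rho_eq_0_iff[of a w] rho_nonneg[of a w] rho_le_one[of a w] by (auto simp: fam_def less_le)
  hence "A \<le> A / rho a w" using A by (simp add: le_divide_eq mult_left_le)
  thus "cmod (c w) \<le> A / rho a w" using le[OF wU] by simp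
qed (use Y1 in \<open>auto simp: fam_def\<close>)

lemma Bop_hker:
  assumes c: "c \<in> borel_measurable borel" and A: "0 \<le> A"
    and le: "\<And>w. w \<in> {w\<in>U. idx (pt w) = i} \<Longrightarrow> cmod (c w) \<le> A"
  shows "Bop K (\<lambda>f z. vint (hker i c z) (f :: complex \<Rightarrow> 'x::complex_banach))"
  unfolding hker_def[abs_def]
proof (rule Bop_kernel)
  show "hnum i c z \<in> borel_measurable borel" for z using c by measurable
  show "(\<integral>\<^sup>+w. ennreal (cmod (hnum i c z w / (z - w))) \<partial>lborel) \<le> ennreal (hconst * A)" if "cmod z < 1" for z
    using hker_integral_crude[OF c A le that] by (simp add: hker_def)
  show "(\<lambda>z. hnum i c z w) holomorphic_on disc" if "w \<in> disc" for w
    unfolding hnum_def using that by (cases "w \<in> {w\<in>U. idx (pt w) = i}")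
      (auto intro!: holomorphic_intros num_holomorphic Bf_holomorphic simp del: mem_Collect_eq)
  show "cmod (hnum i c z w) \<le> KK * 2 * A / (1 - cmod z)" if z: "cmod z < 1" for z w
  proof (cases "w \<in> {w\<in>U. idx (pt w) = i}")
    case True
    have "cmod (Bf i z - Bf i w) \<le> 2"
      using norm_triangle_ineq4[of "Bf i z" "Bf i w"] norm_Bf_le_one[of i z] norm_Bf_le_one[of i w] by linarith
    hence "cmod (num z w) * cmod (Bf i z - Bf i w) * cmod (c w) \<le> KK / (1 - cmod z) * 2 * A"
      using norm_num_le[OF z, of w] le[OF True] z KK_pos by (intro mult_mono) auto
    thus ?thesis using True by (simp add: hnum_def norm_mult)
  next
    case False
    hence "hnum i c z w = 0" unfolding hnum_def by (rule if_not_P)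
    thus ?thesis using z KK_pos A by simp
  qed
qed (use hconst_nonneg A KK_pos in \<open>auto simp: hnum_def\<close>)

text \<open>For \<open>\<xi> = Bf i z\<close> this weight turns the numerator back into the original one, with the pole removed.\<close>

definition hweight :: "nat \<Rightarrow> complex \<Rightarrow> complex \<Rightarrow> complex" where
  "hweight i \<xi> w = 1 / (\<xi> - Bf i w)"

definition H :: "nat \<Rightarrow> complex \<Rightarrow> 'x::complex_banach op" where
  "H i \<xi> f z = vint (hker i (hweight i \<xi>) z) f"

lemma hweight_measurable [measurable]: "hweight i \<xi> \<in> borel_measurable borel"
  unfolding hweight_def by measurable

lemma norm_minus_Bf_ge:
  "w \<in> {w\<in>U. idx (pt w) = i} \<Longrightarrow> cmod \<xi> - r \<le> cmod (\<xi> - Bf i w)"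
  using norm_Bf_less[of w i] norm_triangle_ineq2[of \<xi> "Bf i w"] by linarith

lemma norm_hweight_le:
  "r < cmod \<xi> \<Longrightarrow> w \<in> {w\<in>U. idx (pt w) = i} \<Longrightarrow> cmod (hweight i \<xi> w) \<le> 1 / (cmod \<xi> - r)"
  using norm_minus_Bf_ge[of w i \<xi>] by (auto simp: hweight_def norm_divide intro!: divide_left_mono mult_pos_pos)

text \<open>This degenerates as |\<xi>| decreases to r, but it suffices for the decay at
  infinity.\<close>

lemma opnorm_H_crude:
  assumes "r < cmod \<xi>"
  shows "0 \<le> opnorm K (H i \<xi> :: 'x::complex_banach op)" "opnorm K (H i \<xi> :: 'x op) \<le> hconst * (1 / (cmod \<xi> - r))"
proof -
  have A: "0 \<le> 1 / (cmod \<xi> - r)" using assms by simp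
  note * = opnorm_kernel[OF hker_measurable[OF hweight_measurable] mult_nonneg_nonneg[OF hconst_nonneg A]
      hker_integral_crude[OF hweight_measurable A norm_hweight_le[OF assms]], where T = "H i \<xi> :: 'x op"]
  show "0 \<le> opnorm K (H i \<xi> :: 'x::complex_banach op)" "opnorm K (H i \<xi> :: 'x op) \<le> hconst * (1 / (cmod \<xi> - r))"
    using *[where K = K] by (auto simp: H_def)
qed

lemma opnorm_H_at_infinity: "((\<lambda>\<xi>. opnorm K (H i \<xi> :: 'x::complex_banach op)) \<longlongrightarrow> 0) at_infinity"
proof (rule Lim_null_comparison)
  have "\<forall>\<^sub>F \<xi> in at_infinity. r + 1 \<le> cmod \<xi>" by (auto simp: eventually_at_infinity)
  thus "\<forall>\<^sub>F \<xi> in at_infinity. norm (opnorm K (H i \<xi> :: 'x op)) \<le> hconst * (1 / (cmod \<xi> - r))"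
    by eventually_elim (use opnorm_H_crude[where K = K and i = i and ?'x = 'x] in auto)
  have "filterlim (\<lambda>\<xi>. - r + cmod \<xi>) at_top (at_infinity :: complex filter)"
    by (rule filterlim_tendsto_add_at_top[OF tendsto_const filterlim_norm_at_top])
  hence "((\<lambda>\<xi>::complex. inverse (cmod \<xi> - r)) \<longlongrightarrow> 0) at_infinity"
    by (intro tendsto_inverse_0_at_top) simp
  from tendsto_mult_left[OF this, of hconst]
  show "((\<lambda>\<xi>::complex. hconst * (1 / (cmod \<xi> - r))) \<longlongrightarrow> 0) at_infinity" by (simp add: inverse_eq_divide)
qed

text \<open>The resolvent identity for 1 / (\<xi> - b): difference quotient minus derivative carries
  a factor \<xi>' - \<xi>, and the other factors are bounded near \<xi> by the distance to the
  circle of radius r.\<close>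

lemma op_holo_H: "op_holo K {\<xi>. r < cmod \<xi>} (H i :: complex \<Rightarrow> 'x::complex_banach op)"
  unfolding op_holo_def
proof (intro conjI ballI)
  show B: "Bop K (H i \<xi> :: 'x op)" if "\<xi> \<in> {\<xi>. r < cmod \<xi>}" for \<xi>
    unfolding H_def[abs_def]
    by (rule Bop_hker[OF hweight_measurable _ norm_hweight_le]) (use that in auto)
  fix \<xi> assume "\<xi> \<in> {\<xi>. r < cmod \<xi>}"
  hence \<xi>: "r < cmod \<xi>" by simp
  \<comment> \<open>The derivative of 1 / (\<xi> - b) in \<xi>.\<close>
  define d where "d w = - (hweight i \<xi> w)\<^sup>2" for w
  have dm [measurable]: "d \<in> borel_measurable borel" unfolding d_def by measurable
  define A where "A = 1 / (cmod \<xi> - r)"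
  have A: "0 < A" using \<xi> by (simp add: A_def)
  have dle: "cmod (d w) \<le> A\<^sup>2" if "w \<in> {w\<in>U. idx (pt w) = i}" for w
    using power_mono[OF norm_hweight_le[OF \<xi> that], of 2] by (simp add: d_def norm_power A_def del: mem_Collect_eq)
  define D :: "'x op" where "D f z = vint (hker i d z) f" for f z
  show "\<exists>D :: 'x op. Bop K D \<and> ((\<lambda>\<xi>'. opnorm K (\<lambda>f z. cscale (1 / (\<xi>' - \<xi>)) (H i \<xi>' f z - H i \<xi> f z) - D f z)) \<longlongrightarrow> 0) (at \<xi>)"
  proof (intro exI[of _ D] conjI)
    show "Bop K D" unfolding D_def[abs_def] by (rule Bop_hker[OF dm _ dle]) auto
    have le: "norm (opnorm K (\<lambda>f z. cscale (1 / (\<xi>' - \<xi>)) (H i \<xi>' f z - H i \<xi> f z) - D f z))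
        \<le> hconst * (cmod (\<xi>' - \<xi>) * (1 / (cmod \<xi>' - r)) * A\<^sup>2)" if \<xi>': "r < cmod \<xi>'" "\<xi>' \<noteq> \<xi>" for \<xi>'
    proof -
      define e where "e w = (1 / (\<xi>' - \<xi>)) * (hweight i \<xi>' w - hweight i \<xi> w) - d w" for w
      have em [measurable]: "e \<in> borel_measurable borel" unfolding e_def by measurable
      define M where "M = cmod (\<xi>' - \<xi>) * (1 / (cmod \<xi>' - r)) * A\<^sup>2"
      have M: "0 \<le> M" using \<xi>' by (simp add: M_def)
      have ele: "cmod (e w) \<le> M" if w: "w \<in> {w\<in>U. idx (pt w) = i}" for w
      proof -
        have nz: "\<xi>' - Bf i w \<noteq> 0" "\<xi> - Bf i w \<noteq> 0"
          using norm_minus_Bf_ge[OF w, of \<xi>] norm_minus_Bf_ge[OF w, of \<xi>'] \<xi> \<xi>' by auto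
        have alg: "(1 / (x - y)) * (1 / (x - b) - 1 / (y - b)) + (1 / (y - b))\<^sup>2 = (x - y) * (1 / (x - b)) * (1 / (y - b))\<^sup>2"
          if "x \<noteq> y" "x - b \<noteq> 0" "y - b \<noteq> 0" for x y b :: complex
        proof -
          have 2: "1 / (x - b) - 1 / (y - b) = - (x - y) / ((x - b) * (y - b))" using that by (simp add: field_simps)
          have 3: "(1 / t) * (- t / P) = - 1 / P" if "t \<noteq> 0" for t P :: complex using that by simp
          have 1: "(1 / (x - y)) * (1 / (x - b) - 1 / (y - b)) = - 1 / ((x - b) * (y - b))"
            unfolding 2 by (rule 3) (use that in simp)
          have "- 1 / (p * q) + (1 / q)\<^sup>2 = (p - q) * (1 / p) * (1 / q)\<^sup>2" if "p \<noteq> 0" "q \<noteq> 0" for p q :: complex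
            using that by (simp add: field_simps power2_eq_square)
          from this[of "x - b" "y - b"] that show ?thesis unfolding 1 by simp
        qed
        have "e w = (\<xi>' - \<xi>) * hweight i \<xi>' w * (hweight i \<xi> w)\<^sup>2"
          using alg[of \<xi>' \<xi> "Bf i w"] \<xi>'(2) nz by (simp add: e_def d_def hweight_def)
        hence "cmod (e w) = cmod (\<xi>' - \<xi>) * cmod (hweight i \<xi>' w) * (cmod (hweight i \<xi> w))\<^sup>2"
          by (simp add: norm_mult norm_power)
        also have "\<dots> \<le> M"
          unfolding M_def A_def using norm_hweight_le[OF \<xi> w] norm_hweight_le[OF \<xi>'(1) w] \<xi>'
          by (intro mult_mono power_mono) auto
        finally show ?thesis .
      qed
      have eq: "cscale (1 / (\<xi>' - \<xi>)) (H i \<xi>' f z - H i \<xi> f z) - D f z = vint (hker i e z) f"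
        if f: "f \<in> Linf K" and z: "z \<in> disc" for f :: "complex \<Rightarrow> 'x" and z
      proof -
        have z1: "cmod z < 1" using z by simp
        have si: "set_integrable lborel disc (hker i c z)"
          if c: "c \<in> borel_measurable borel" "0 \<le> N" "\<And>w. w \<in> {w\<in>U. idx (pt w) = i} \<Longrightarrow> cmod (c w) \<le> N" for c N
          by (rule set_integrable_disc_nn(2)[OF hker_measurable[OF c(1)] hker_integral_crude[OF c z1] mult_nonneg_nonneg[OF hconst_nonneg c(2)]])
        have i1: "set_integrable lborel disc (hker i (hweight i \<xi>') z)"
          by (rule si[OF hweight_measurable _ norm_hweight_le[OF \<xi>'(1)]]) (use \<xi>' in simp_all)
        have i2: "set_integrable lborel disc (hker i (hweight i \<xi>) z)"
          by (rule si[OF hweight_measurable _ norm_hweight_le[OF \<xi>]]) (use \<xi> in simp_all)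
        have i3: "set_integrable lborel disc (hker i d z)" by (rule si[OF dm _ dle]) simp_all
        have i12: "set_integrable lborel disc (\<lambda>w. hker i (hweight i \<xi>') z w - hker i (hweight i \<xi>) z w)"
          by (rule set_integral_diff(1)[OF i1 i2])
        have i4: "set_integrable lborel disc (\<lambda>w. 1 / (\<xi>' - \<xi>) * (hker i (hweight i \<xi>') z w - hker i (hweight i \<xi>) z w))"
          by (rule set_integrable_mult_right) (rule i12)
        have "vint (hker i e z) f = vint (\<lambda>w. 1 / (\<xi>' - \<xi>) * (hker i (hweight i \<xi>') z w - hker i (hweight i \<xi>) z w) - hker i d z w) f"
        proof -
          have alg: "N * b * (x * (p - q) - s) / y = x * (N * b * p / y - N * b * q / y) - N * b * s / y" for N b x p q s y :: complex
            by (simp add: divide_inverse algebra_simps)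
          have "hker i e z = (\<lambda>w. 1 / (\<xi>' - \<xi>) * (hker i (hweight i \<xi>') z w - hker i (hweight i \<xi>) z w) - hker i d z w)"
          proof
            fix w
            show "hker i e z w = 1 / (\<xi>' - \<xi>) * (hker i (hweight i \<xi>') z w - hker i (hweight i \<xi>) z w) - hker i d z w"
            proof (cases "w \<in> {w\<in>U. idx (pt w) = i}")
              case True
              show ?thesis unfolding hker_def hnum_def e_def if_P[OF True] alg ..
            next
              case False
              show ?thesis unfolding hker_def hnum_def if_not_P[OF False] by simp
            qed
          qed
          thus ?thesis by simp
        qed
        also have "\<dots> = cscale (1 / (\<xi>' - \<xi>)) (vint (hker i (hweight i \<xi>') z) f - vint (hker i (hweight i \<xi>) z) f) - vint (hker i d z) f"
          unfolding vint_diff_left[OF i4 i3 f] vint_cmult_left[OF i12 f] vint_diff_left[OF i1 i2 f] ..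
        finally show ?thesis by (simp add: H_def D_def)
      qed
      note * = opnorm_kernel[OF hker_measurable[OF em] mult_nonneg_nonneg[OF hconst_nonneg M] hker_integral_crude[OF em M ele],
          where T = "\<lambda>f z. cscale (1 / (\<xi>' - \<xi>)) (H i \<xi>' f z - H i \<xi> f z) - D f z"]
      show ?thesis using *[where K = K] eq by (simp add: M_def)
    qed
    show "((\<lambda>\<xi>'. opnorm K (\<lambda>f z. cscale (1 / (\<xi>' - \<xi>)) (H i \<xi>' f z - H i \<xi> f z) - D f z)) \<longlongrightarrow> 0) (at \<xi>)"
    proof (rule Lim_null_comparison)
      have "open {x. r < cmod x}" using open_Collect_less[of "\<lambda>_. r" cmod] by (simp add: continuous_on_norm)
      hence "\<forall>\<^sub>F \<xi>' in at \<xi>. \<xi>' \<in> {x. r < cmod x}" using \<xi> by (intro eventually_at_in_open') auto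
      moreover have "\<forall>\<^sub>F \<xi>' in at \<xi>. \<xi>' \<noteq> \<xi>" by (simp add: eventually_at_filter)
      ultimately show "\<forall>\<^sub>F \<xi>' in at \<xi>. norm (opnorm K (\<lambda>f z. cscale (1 / (\<xi>' - \<xi>)) (H i \<xi>' f z - H i \<xi> f z) - D f z))
        \<le> hconst * (cmod (\<xi>' - \<xi>) * (1 / (cmod \<xi>' - r)) * A\<^sup>2)"
        by eventually_elim (use le in auto)
      have "((\<lambda>\<xi>'. hconst * (cmod (\<xi>' - \<xi>) * (1 / (cmod \<xi>' - r)) * A\<^sup>2)) \<longlongrightarrow> hconst * (cmod (\<xi> - \<xi>) * (1 / (cmod \<xi> - r)) * A\<^sup>2)) (at \<xi>)"
        using \<xi> by (intro tendsto_intros) auto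
      thus "((\<lambda>\<xi>'. hconst * (cmod (\<xi>' - \<xi>) * (1 / (cmod \<xi>' - r)) * A\<^sup>2)) \<longlongrightarrow> 0) (at \<xi>)" by simp
    qed
  qed
qed

text \<open>On a cell the weight is compared with the point of the pseudohyperbolic disc where it is largest;
  there the lower Lipschitz bound of the Blaschke product applies.\<close>

lemma opnorm_H:
  assumes \<xi>: "r < cmod \<xi>" and r': "r \<le> 1 / 1000"
  shows "opnorm K (H i \<xi> :: 'x::complex_banach op) \<le> 87 * r"
proof -
  have ex: "\<exists>v. cmod v < 1 \<and> (\<forall>w\<in>cell a. w \<noteq> v \<longrightarrow> cmod (hweight i \<xi> w) \<le> 4 / rho v w)" if a: "a \<in> fam i" for a
  proof -
    have aY: "a \<in> Y" using a by (simp add: fam_def)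
    have a1: "cmod a < 1" using Y1[OF aY] .
    have m1: "mob a u \<in> disc" if "u \<in> cball 0 r" for u
      using mob_in_disc[OF a1, of u] that T_bounds(4) by simp
    have cm: "continuous_on (cball 0 r) (mob a)"
      by (rule continuous_on_subset[OF holomorphic_on_imp_continuous_on[OF mob_holomorphic[OF a1]]]) (use T_bounds(4) in auto)
    have "continuous_on (cball 0 r) (\<lambda>u. Bf i (mob a u))"
      by (rule continuous_on_compose2[OF holomorphic_on_imp_continuous_on[OF Bf_holomorphic] cm]) (use m1 in auto)
    hence "continuous_on (cball 0 r) (\<lambda>u. cmod (\<xi> - Bf i (mob a u)))" by (intro continuous_intros)
    then obtain u0 where u0: "u0 \<in> cball 0 r" and min: "\<And>u. u \<in> cball 0 r \<Longrightarrow> cmod (\<xi> - Bf i (mob a u0)) \<le> cmod (\<xi> - Bf i (mob a u))"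
      using continuous_attains_inf[of "cball 0 r" "\<lambda>u. cmod (\<xi> - Bf i (mob a u))"] r by auto
    define v where "v = mob a u0"
    have v1: "cmod v < 1" using m1[OF u0] by (simp add: v_def)
    have u01: "cmod u0 < 1" using u0 T_bounds(4) by simp
    have va: "rho v a \<le> 1 / 100"
      using mob_mob[OF a1 u01] norm_mob[of a v] u0 r' by (simp add: v_def)
    show ?thesis
    proof (intro exI[of _ v] conjI v1 ballI impI)
      fix w assume w: "w \<in> cell a" "w \<noteq> v"
      have w1: "cmod w < 1" and wr: "rho w a < r" using cell_subset[of a] w by auto
      have wF: "w \<in> {w\<in>U. idx (pt w) = i}" using w a by (auto simp: cell_def fam_def)
      have pos: "0 < cmod (\<xi> - Bf i w)" using norm_minus_Bf_ge[OF wF, of \<xi>] \<xi> by linarith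
      have "cmod (\<xi> - Bf i v) \<le> cmod (\<xi> - Bf i (mob a (mob a w)))"
        unfolding v_def by (rule min) (use wr in \<open>simp add: norm_mob\<close>)
      hence le: "cmod (\<xi> - Bf i v) \<le> cmod (\<xi> - Bf i w)" by (simp add: mob_mob[OF a1 w1])
      \<comment> \<open>By the minimal choice of v, |B(v) - B(w)| is at most 2 |\<xi> - B(w)|; with
        the 1/2 on the left this gives the constant 4.\<close>
      have "rho v w / 2 \<le> cmod (blaschke (fam i) v - blaschke (fam i) w)"
        by (rule blaschke_lower_Lipschitz[OF blaschke_fam a sepset_prod_rho[OF sepset_fam a] v1 va w1]) (use wr r' in auto)
      also have "\<dots> = cmod ((\<xi> - Bf i w) - (\<xi> - Bf i v))" using v1 w1 by (simp add: Bf_def)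
      also have "\<dots> \<le> cmod (\<xi> - Bf i w) + cmod (\<xi> - Bf i v)" by (rule norm_triangle_ineq4)
      finally have "rho v w \<le> 4 * cmod (\<xi> - Bf i w)" using le by simp
      moreover have "0 < rho v w" using w rho_eq_0_iff[of v w] rho_nonneg[of v w] v1 w1 by (auto simp: less_le)
      ultimately have "1 / cmod (\<xi> - Bf i w) \<le> 4 / rho v w" using pos by (simp add: field_simps)
      thus "cmod (hweight i \<xi> w) \<le> 4 / rho v w" by (simp add: hweight_def norm_divide)
    qed
  qed
  have "opnorm K (H i \<xi> :: 'x op) \<le> hconst * 4"
    by (rule opnorm_kernel(2)[OF hker_measurable[OF hweight_measurable] mult_nonneg_nonneg[OF hconst_nonneg]
        hker_integral[OF hweight_measurable _ ex]]) (simp_all add: H_def)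
  also have "\<dots> \<le> 87 * r"
  proof -
    \<comment> \<open>For r \<le> 1/1000 the Harnack constant is nearly 1 and J is nearly 3 r, so
      \<open>hconst\<close> is about 20 r; the factor 4 of the weight leads to 87 r after
      rounding.\<close>
    have T: "T \<le> 251 / 250" using r r' by (simp add: T_def divide_le_eq)
    have q: "r / (1 - r) \<le> 501 / 500 * r" "0 \<le> r / (1 - r)"
      using r r' mult_left_mono[OF r', of r] by (auto simp: divide_le_eq algebra_simps)
    have T2: "T\<^sup>2 \<le> (251 / 250)\<^sup>2" using T T_bounds by (intro power_mono) auto
    have "T\<^sup>2 * (13 / 50) \<le> 27 / 100" using T2 by (simp add: power2_eq_square)
    hence "KK \<le> exp (27 / 100)" by (simp add: KK_def)
    also have "\<dots> \<le> 1 + 27 / 100 + (27 / 100)\<^sup>2" by (rule exp_bound) auto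
    finally have KK: "KK \<le> 1343 / 1000" by (simp add: power2_eq_square)
    have "J \<le> (251 / 250)\<^sup>2 * (501 / 500 * r)\<^sup>2 + 3 * (251 / 250) * (501 / 500 * r)"
      unfolding J_def using q T T_bounds by (intro add_mono mult_mono power_mono T2) auto
    also have "\<dots> = ((251 / 250)\<^sup>2 * (501 / 500)\<^sup>2 * r + 3 * (251 / 250) * (501 / 500)) * r"
      by (simp add: power2_eq_square algebra_simps)
    also have "\<dots> \<le> 303 / 100 * r" using r r' by (intro mult_right_mono) (auto simp: power2_eq_square)
    finally have J: "J \<le> 303 / 100 * r" .
    have J1: "(1 + r) * J \<le> 1001 / 1000 * (303 / 100 * r)" using J r r' J_nonneg by (intro mult_mono) auto
    have "hconst \<le> 5 * (251 / 250)\<^sup>2 * (1343 / 1000) * (1001 / 1000 * (303 / 100 * r))"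
      unfolding hconst_def
      by (rule mult_mono[OF mult_mono[OF mult_left_mono[OF T2] KK] J1]) (use KK_pos r J_nonneg in auto)
    thus ?thesis using r by (simp add: power2_eq_square)
  qed
  finally show ?thesis .
qed

end

section \<open>Nets and their partition into separated families\<close>

text \<open>Pseudohyperbolic discs of radius s / 2 about the points are open and pairwise
  disjoint.\<close>

lemma separated_countable:
  assumes Y: "Y \<subseteq> disc" and sep: "\<And>a b. a \<in> Y \<Longrightarrow> b \<in> Y \<Longrightarrow> a \<noteq> b \<Longrightarrow> s \<le> rho a b" and s: "0 < s"
  shows "countable Y"
proof -
  define V where "V a = {w \<in> disc. rho w a < s / 2}" for a
  have self: "a \<in> V a" if "a \<in> Y" for a using that Y s by (auto simp: V_def rho_self)
  have disj: "V a \<inter> V b = {}" if ab: "a \<in> Y" "b \<in> Y" "a \<noteq> b" for a b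
  proof (rule ccontr)
    assume "V a \<inter> V b \<noteq> {}"
    then obtain w where w: "cmod w < 1" "rho w a < s / 2" "rho w b < s / 2" by (auto simp: V_def)
    have "rho a b \<le> rho a w + rho w b" by (rule rho_triangle) (use w ab Y in auto)
    thus False using sep[OF ab] w by (simp add: rho_commute[of a w])
  qed
  have op: "open (V a)" if "a \<in> Y" for a
    unfolding V_def by (rule open_rho_disc) (use that Y in auto)
  have "countable (V ` Y)"
    by (rule countable_disjoint_open_subsets) (use disj op in \<open>auto simp: pairwise_def disjnt_def\<close>)
  moreover have "inj_on V Y"
  proof (rule inj_onI, rule ccontr)
    fix a b assume "a \<in> Y" "b \<in> Y" "V a = V b" "a \<noteq> b"
    thus False using disj[of a b] self[of a] by auto
  qed
  ultimately show ?thesis by (rule countable_image_inj_on)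
qed

text \<open>A maximal s-separated subset exists by Zorn's lemma, and maximality is the covering
  property.\<close>

lemma net_exists:
  assumes K: "K \<subseteq> disc" and s: "0 < s"
  obtains Y where "Y \<subseteq> K" "\<And>a b. a \<in> Y \<Longrightarrow> b \<in> Y \<Longrightarrow> a \<noteq> b \<Longrightarrow> s \<le> rho a b"
    "\<And>y. y \<in> K \<Longrightarrow> \<exists>a\<in>Y. rho y a < s"
proof -
  define \<A> where "\<A> = {Y. Y \<subseteq> K \<and> (\<forall>a\<in>Y. \<forall>b\<in>Y. a \<noteq> b \<longrightarrow> s \<le> rho a b)}"
  have "\<exists>M\<in>\<A>. \<forall>X\<in>\<A>. M \<subseteq> X \<longrightarrow> X = M"
  proof (rule subset_Zorn_nonempty)
    show "\<A> \<noteq> {}" by (auto simp: \<A>_def)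
    fix \<C> assume C: "\<C> \<noteq> {}" "subset.chain \<A> \<C>"
    show "\<Union>\<C> \<in> \<A>"
      unfolding \<A>_def
    proof (intro CollectI conjI ballI impI)
      show "\<Union>\<C> \<subseteq> K" using C by (auto simp: subset.chain_def \<A>_def)
      fix a b assume "a \<in> \<Union>\<C>" "b \<in> \<Union>\<C>" "a \<noteq> b"
      then obtain A B where AB: "A \<in> \<C>" "B \<in> \<C>" "a \<in> A" "b \<in> B" by blast
      hence "A \<subseteq> B \<or> B \<subseteq> A" using C by (auto simp: subset_chain_def)
      hence "\<exists>X\<in>\<C>. a \<in> X \<and> b \<in> X" using AB by blast
      thus "s \<le> rho a b" using C \<open>a \<noteq> b\<close> by (auto simp: subset_chain_def \<A>_def)
    qed
  qed
  then obtain M where M: "M \<in> \<A>" and max: "\<And>X. X \<in> \<A> \<Longrightarrow> M \<subseteq> X \<Longrightarrow> X = M" by blast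
  show ?thesis
  proof (rule that[of M])
    show "M \<subseteq> K" "\<And>a b. a \<in> M \<Longrightarrow> b \<in> M \<Longrightarrow> a \<noteq> b \<Longrightarrow> s \<le> rho a b" using M by (auto simp: \<A>_def)
    fix y assume y: "y \<in> K"
    show "\<exists>a\<in>M. rho y a < s"
    proof (cases "y \<in> M")
      case True thus ?thesis using s by (intro bexI[of _ y]) (auto simp: rho_self)
    next
      case False
      show ?thesis
      proof (rule ccontr)
        assume "\<not> ?thesis"
        hence "s \<le> rho y a" "s \<le> rho a y" if "a \<in> M" for a using that by (auto simp: not_less rho_commute[of a y])
        hence "insert y M \<in> \<A>" using M y by (auto simp: \<A>_def)
        from max[OF this] False show False by auto
      qed
    qed
  qed
qed

text \<open>1 - x \<le> - ln x turns the lower bound for the product into an upper bound for the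
  sum; - ln (\<delta>^2) is then bounded by 1 / \<delta>^2 - 1.\<close>

lemma sum_le_of_delta:
  assumes \<zeta>: "\<zeta> \<subseteq> disc" and z: "z \<in> \<zeta>" and F: "finite F" "F \<subseteq> \<zeta> - {z}" and \<delta>: "0 < \<delta>" "\<delta> \<le> delta \<zeta>"
  shows "(\<Sum>w\<in>F. 1 - (rho z w)\<^sup>2) \<le> 1 / \<delta>\<^sup>2 - 1"
proof -
  define S where "S x = {F. finite F \<and> F \<subseteq> \<zeta> - {x}}" for x
  have b: "bdd_below ((\<lambda>F. \<Prod>w\<in>F. rho w x) ` S x)" for x
    by (intro bdd_belowI2[of _ 0] prod_nonneg) (auto simp: rho_nonneg)
  have "delta \<zeta> = (INF x\<in>\<zeta>. INF F\<in>S x. \<Prod>w\<in>F. rho w x)" using z by (auto simp: delta_def S_def)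
  also have "\<dots> \<le> (INF F\<in>S z. \<Prod>w\<in>F. rho w z)"
  proof (rule cINF_lower[OF _ z])
    show "bdd_below ((\<lambda>x. INF F\<in>S x. \<Prod>w\<in>F. rho w x) ` \<zeta>)"
      by (intro bdd_belowI2[of _ 0] cINF_greatest prod_nonneg) (auto simp: rho_nonneg S_def)
  qed
  also have "\<dots> \<le> (\<Prod>w\<in>F. rho w z)" by (rule cINF_lower[OF b]) (use F in \<open>simp add: S_def\<close>)
  finally have p: "\<delta> \<le> (\<Prod>w\<in>F. rho w z)" using \<delta> by simp
  have pos: "0 < rho w z" if "w \<in> F" for w
  proof -
    have "w \<noteq> z" "cmod w < 1" "cmod z < 1" using that F z \<zeta> by auto
    thus ?thesis using rho_nonneg[of w z] rho_eq_0_iff[of w z] by (simp add: less_le)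
  qed
  have "(\<Sum>w\<in>F. 1 - (rho z w)\<^sup>2) \<le> (\<Sum>w\<in>F. - ln ((rho w z)\<^sup>2))"
  proof (rule sum_mono)
    fix w assume "w \<in> F"
    from ln_le_minus_one[of "(rho w z)\<^sup>2"] pos[OF this]
    show "1 - (rho z w)\<^sup>2 \<le> - ln ((rho w z)\<^sup>2)" by (simp add: rho_commute[of z])
  qed
  also have "\<dots> = - ln (\<Prod>w\<in>F. (rho w z)\<^sup>2)" using F by (subst ln_prod) (auto simp: sum_negf dest!: pos)
  also have "\<dots> = - ln ((\<Prod>w\<in>F. rho w z)\<^sup>2)" by (simp add: prod_power_distrib)
  also have "\<dots> \<le> - ln (\<delta>\<^sup>2)" using p \<delta> by (simp add: power_mono)
  also have "\<dots> = ln (1 / \<delta>\<^sup>2)" using \<delta> by (simp add: ln_div)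
  also have "\<dots> \<le> 1 / \<delta>\<^sup>2 - 1" by (rule ln_le_minus_one) (use \<delta> in simp)
  finally show ?thesis .
qed

text \<open>With t = sqrt m, (1 + m) / (1 - m) is at most 1 / (1 - t), because 1 + t^2 \<le> 1 + t.
  Its square cancels the (1 - t)^2 in x, and 2 / 8 divided by (791/800)^2 is below 13/50.\<close>

lemma separation_constant:
  fixes \<epsilon> :: real
  assumes \<epsilon>: "0 < \<epsilon>" "\<epsilon> < 1"
  defines "x \<equiv> (1 - sqrt (max (1/2) \<epsilon>))\<^sup>2 / 8"
  shows "0 < 1 - x" "((1 + \<epsilon>) / (1 - \<epsilon>))\<^sup>2 * (1 / (1 - x)\<^sup>2 - 1) \<le> 13 / 50"
proof -
  define m where "m = max (1/2) \<epsilon>"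
  define t where "t = sqrt m"
  have m: "1 / 2 \<le> m" "\<epsilon> \<le> m" "m < 1" using \<epsilon> by (auto simp: m_def)
  have t2: "t\<^sup>2 = m" using m by (simp add: t_def)
  \<comment> \<open>The floor 1/2 in the maximum is used here: t is bounded away from 0, so x is at
    most 9/800 and (1 - x)^2 is near 1.\<close>
  have t: "7 / 10 \<le> t" "t < 1"
    using m real_le_rsqrt[of "7/10" m] real_sqrt_lt_1_iff[of m] by (auto simp: t_def power2_eq_square)
  have x: "x = (1 - t)\<^sup>2 / 8" by (simp add: x_def t_def m_def)
  have "(1 - t)\<^sup>2 \<le> (3 / 10)\<^sup>2" using t by (intro power_mono) auto
  hence x1: "0 \<le> x" "x \<le> 9 / 800" unfolding x by (auto simp: power2_eq_square)
  thus "0 < 1 - x" by simp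
  have "(1 + \<epsilon>) / (1 - \<epsilon>) \<le> (1 + m) / (1 - m)" using m \<epsilon> by (intro frac_le) auto
  also have "\<dots> = ((1 + t\<^sup>2) / (1 + t)) * (1 / (1 - t))"
  proof -
    have "1 - t\<^sup>2 = (1 + t) * (1 - t)" by (simp add: power2_eq_square algebra_simps)
    thus ?thesis by (simp add: t2[symmetric])
  qed
  also have "\<dots> \<le> 1 * (1 / (1 - t))"
    using t mult_left_mono[of t 1 t] by (intro mult_right_mono) (auto simp: divide_le_eq power2_eq_square)
  finally have T: "((1 + \<epsilon>) / (1 - \<epsilon>))\<^sup>2 \<le> (1 / (1 - t))\<^sup>2" using \<epsilon> by (intro power_mono) auto
  have y: "1 / (1 - x)\<^sup>2 - 1 \<le> 2 * x / (1 - x)\<^sup>2"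
  proof -
    have "1 / (1 - x)\<^sup>2 - 1 = (1 - (1 - x)\<^sup>2) / (1 - x)\<^sup>2" using x1 by (simp add: diff_divide_distrib)
    also have "1 - (1 - x)\<^sup>2 \<le> 2 * x" by (simp add: power2_eq_square algebra_simps)
    hence "(1 - (1 - x)\<^sup>2) / (1 - x)\<^sup>2 \<le> 2 * x / (1 - x)\<^sup>2" by (rule divide_right_mono) simp
    finally show ?thesis .
  qed
  have "(791 / 800)\<^sup>2 \<le> (1 - x)\<^sup>2" using x1 by (intro power_mono) auto
  hence y2: "2 * x / (1 - x)\<^sup>2 \<le> 2 * x / (791 / 800)\<^sup>2" using x1 by (intro divide_left_mono mult_pos_pos) auto
  have "((1 + \<epsilon>) / (1 - \<epsilon>))\<^sup>2 * (1 / (1 - x)\<^sup>2 - 1) \<le> ((1 + \<epsilon>) / (1 - \<epsilon>))\<^sup>2 * (2 * x / (791 / 800)\<^sup>2)"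
    using y y2 by (intro mult_left_mono) auto
  also have "\<dots> \<le> (1 / (1 - t))\<^sup>2 * (2 * x / (791 / 800)\<^sup>2)" using T x1 by (intro mult_right_mono) auto
  also have "\<dots> = 1 / 4 / (791 / 800)\<^sup>2" using t by (simp add: x power2_eq_square)
  also have "\<dots> \<le> 13 / 50" by (simp add: power2_eq_square)
  finally show "((1 + \<epsilon>) / (1 - \<epsilon>))\<^sup>2 * (1 / (1 - x)\<^sup>2 - 1) \<le> 13 / 50" .
qed

text \<open>Each net point y is attached to a chain point n y within \<epsilon>. By packing at most
  k net points share a chain point, so they can be labelled injectively. Points with equal labels
  then have distinct chain points, and their separation is inherited from the chain.\<close>

lemma jones_system_exists:
  assumes K: "K \<subseteq> disc" and \<epsilon>: "0 < \<epsilon>" "\<epsilon> < 1" and chain: "eps_chain \<epsilon> K \<zeta>"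
    and del: "delta \<zeta> \<ge> 1 - (1 - sqrt (max (1/2) \<epsilon>))\<^sup>2 / 8" and s: "0 < s" "s \<le> 1 / 3"
  obtains Y idx k where "jones Y idx k s" "Y \<subseteq> K" "\<forall>y\<in>K. \<exists>a\<in>Y. rho y a < s"
    "real k * ((s / 2)\<^sup>2 * (1 - (s / 2)\<^sup>2) ^ 3 * (1 - \<epsilon>\<^sup>2)) \<le> (\<epsilon> + s / 2)\<^sup>2"
proof -
  obtain Y where Y: "Y \<subseteq> K" and Ysep: "\<And>a b. a \<in> Y \<Longrightarrow> b \<in> Y \<Longrightarrow> a \<noteq> b \<Longrightarrow> s \<le> rho a b"
    and net: "\<And>y. y \<in> K \<Longrightarrow> \<exists>a\<in>Y. rho y a < s" using net_exists[OF K s(1)] by blast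
  have \<zeta>K: "\<zeta> \<subseteq> K" using chain by (simp add: eps_chain_def)
  have "\<exists>z\<in>\<zeta>. rho y z < \<epsilon>" if "y \<in> K" for y
  proof (cases "y \<in> \<zeta>")
    case True thus ?thesis using \<epsilon> by (intro bexI[of _ y]) (auto simp: rho_self)
  next
    case False thus ?thesis using chain that by (auto simp: eps_chain_def)
  qed
  then obtain n where n: "\<And>y. y \<in> K \<Longrightarrow> n y \<in> \<zeta>" "\<And>y. y \<in> K \<Longrightarrow> rho y (n y) < \<epsilon>" by metis
  define P where "P = (s / 2)\<^sup>2 * (1 - (s / 2)\<^sup>2) ^ 3 * (1 - \<epsilon>\<^sup>2)"
  have s2: "0 < 1 - (s / 2)\<^sup>2" using s by (simp add: abs_square_less_1)
  have e2: "0 < 1 - \<epsilon>\<^sup>2" using \<epsilon> by (simp add: abs_square_less_1)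
  have P: "0 < P" unfolding P_def using s s2 e2 by simp
  \<comment> \<open>The packing bound for discs of radius s / 2 inside a disc of radius \<epsilon>,
    rounded down.\<close>
  define k where "k = nat \<lfloor>(\<epsilon> + s / 2)\<^sup>2 / P\<rfloor>"
  have kle: "real k \<le> (\<epsilon> + s / 2)\<^sup>2 / P" unfolding k_def using P by (intro of_nat_floor) simp
  define G where "G z = {y \<in> Y. n y = z}" for z
  have cardG: "card F \<le> k" if F: "finite F" "F \<subseteq> G z" and z: "z \<in> \<zeta>" for F z
  proof -
    have "real (card F) * P \<le> (\<epsilon> + s / 2)\<^sup>2"
      unfolding P_def
    proof (rule card_separated[OF F(1)])
      show "2 * (s / 2) \<le> rho a c" if "a \<in> F" "c \<in> F" "a \<noteq> c" for a c
        using Ysep[of a c] that F by (auto simp: G_def)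
    qed (use F n Y K \<zeta>K z s \<epsilon> in \<open>auto simp: G_def subset_iff\<close>)
    hence "real (card F) \<le> (\<epsilon> + s / 2)\<^sup>2 / P" using P by (simp add: le_divide_eq)
    thus ?thesis unfolding k_def by (rule le_nat_floor)
  qed
  have "\<exists>l. inj_on l (G z) \<and> l ` G z \<subseteq> {1..k}" if z: "z \<in> \<zeta>" for z
  proof -
    have fin: "finite (G z)"
    proof (rule ccontr)
      assume "infinite (G z)"
      then obtain F where "F \<subseteq> G z" "finite F" "card F = Suc k" using infinite_arbitrarily_large by blast
      thus False using cardG[of F z] z by simp
    qed
    obtain h where h: "bij_betw h (G z) {1..card (G z)}" using ex_bij_betw_nat_finite_1[OF fin] bij_betw_inv by blast
    thus ?thesis using cardG[OF fin order_refl z] by (intro exI[of _ h]) (auto simp: bij_betw_def)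
  qed
  then obtain l where l: "\<And>z. z \<in> \<zeta> \<Longrightarrow> inj_on (l z) (G z)" "\<And>z. z \<in> \<zeta> \<Longrightarrow> l z ` G z \<subseteq> {1..k}" by metis
  define idx where "idx y = l (n y) y" for y
  have idx: "idx a \<in> {1..k}" if "a \<in> Y" for a
  proof -
    have "a \<in> K" "a \<in> G (n a)" using that Y by (auto simp: G_def)
    thus ?thesis using l(2)[OF n(1)] unfolding idx_def by blast
  qed
  have inj: "inj_on n {a \<in> Y. idx a = i}" for i
  proof (rule inj_onI)
    fix a b assume ab: "a \<in> {a \<in> Y. idx a = i}" "b \<in> {a \<in> Y. idx a = i}" "n a = n b"
    hence aK: "a \<in> K" and G: "a \<in> G (n a)" "b \<in> G (n a)" and eq: "l (n a) a = l (n a) b"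
      using Y by (auto simp: idx_def G_def)
    show "a = b" by (rule inj_onD[OF l(1)[OF n(1)[OF aK]] eq G])
  qed
  define x where "x = (1 - sqrt (max (1/2) \<epsilon>))\<^sup>2 / 8"
  note sc = separation_constant[OF \<epsilon>, folded x_def]
  have sepset: "sepset {a \<in> Y. idx a = i}" for i
    unfolding sepset_def
  proof (intro conjI ballI allI impI)
    show "{a \<in> Y. idx a = i} \<subseteq> disc" using Y K by auto
    fix a F assume a: "a \<in> {a \<in> Y. idx a = i}" and F: "finite F \<and> F \<subseteq> {a \<in> Y. idx a = i} - {a}"
    have FK: "b \<in> K" if "b \<in> F" for b using that F Y by auto
    have aK: "a \<in> K" using a Y by auto
    have K1: "cmod y < 1" if "y \<in> K" for y using that K by auto
    have \<zeta>1: "cmod (n y) < 1" if "y \<in> K" for y using n(1)[OF that] \<zeta>K K by auto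
    \<comment> \<open>The comparison is made at distance \<epsilon>, the distance to the chain
      points, and not at the cell size s.\<close>
    have "(\<Sum>b\<in>F. 1 - (rho a b)\<^sup>2) \<le> (\<Sum>b\<in>F. ((1 + \<epsilon>) / (1 - \<epsilon>))\<^sup>2 * (1 - (rho (n a) (n b))\<^sup>2))"
      by (intro sum_mono distort_rho) (use FK aK K1 \<zeta>1 n(2) \<epsilon> in \<open>auto intro: less_imp_le\<close>)
    also have "\<dots> = ((1 + \<epsilon>) / (1 - \<epsilon>))\<^sup>2 * (\<Sum>b\<in>F. 1 - (rho (n a) (n b))\<^sup>2)" by (simp add: sum_distrib_left)
    also have "(\<Sum>b\<in>F. 1 - (rho (n a) (n b))\<^sup>2) = (\<Sum>w\<in>n ` F. 1 - (rho (n a) w)\<^sup>2)"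
      using F by (subst sum.reindex[OF inj_on_subset[OF inj[of i]]]) auto
    also have "((1 + \<epsilon>) / (1 - \<epsilon>))\<^sup>2 * \<dots> \<le> ((1 + \<epsilon>) / (1 - \<epsilon>))\<^sup>2 * (1 / (1 - x)\<^sup>2 - 1)"
    proof (intro mult_left_mono sum_le_of_delta)
      show "n ` F \<subseteq> \<zeta> - {n a}" 
      proof
        fix x assume "x \<in> n ` F"
        then obtain b where b: "b \<in> F" "x = n b" by blast
        have "b \<noteq> a" "b \<in> {a \<in> Y. idx a = i}" using b F by auto
        hence "n b \<noteq> n a" using inj_onD[OF inj[of i] _ _ a, of b] by blast
        thus "x \<in> \<zeta> - {n a}" using n(1)[OF FK[OF b(1)]] b(2) by simp
      qed
    qed (use \<zeta>K K n(1)[OF aK] F sc del in \<open>auto simp: x_def\<close>)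
    also have "\<dots> \<le> 13 / 50" by (rule sc)
    finally show "(\<Sum>b\<in>F. 1 - (rho a b)\<^sup>2) \<le> 13 / 50" .
  qed
  show ?thesis
  proof (rule that[OF _ Y])
    show "\<forall>y\<in>K. \<exists>a\<in>Y. rho y a < s" using net by blast
    show "jones Y idx k s"
      by standard (use Y K s idx sepset separated_countable[OF order_trans[OF Y K] Ysep s(1)] in auto)
    show "real k * ((s / 2)\<^sup>2 * (1 - (s / 2)\<^sup>2) ^ 3 * (1 - \<epsilon>\<^sup>2)) \<le> (\<epsilon> + s / 2)\<^sup>2"
      using kle unfolding P_def[symmetric] pos_le_divide_eq[OF P] .
  qed
qed

section \<open>The arithmetic of the constants\<close>

lemma add_sq_le: 
  fixes \<epsilon> t :: real
  assumes "0 \<le> \<epsilon>" "\<epsilon> \<le> 1" "0 \<le> t" "t \<le> 1"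
  shows "(\<epsilon> + t)\<^sup>2 \<le> (1 + \<epsilon>) * ((1 + t)\<^sup>2 / 2)"
proof -
  have "t\<^sup>2 \<le> 1" using assms by (simp add: power_le_one)
  hence "0 \<le> (1 - \<epsilon>) * (1 + 2 * \<epsilon> + 2 * t - t\<^sup>2)" using assms by (intro mult_nonneg_nonneg) auto
  also have "\<dots> = (1 + \<epsilon>) * (1 + t)\<^sup>2 - 2 * (\<epsilon> + t)\<^sup>2" by (simp add: power2_eq_square algebra_simps)
  finally show ?thesis by simp
qed

text \<open>\<open>add_sq_le\<close>, an equality at \<epsilon> = 1, supplies a factor 1 +
  \<epsilon> on the right that cancels the one in 1 - \<epsilon>^2, leaving 1 - \<epsilon>.\<close>

lemma number_of_families:
  fixes \<epsilon> s C N :: real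
  assumes \<epsilon>: "0 < \<epsilon>" "\<epsilon> < 1" and s: "0 < s" "s \<le> 1" and C: "0 < C"
    and N: "N * ((s / 2)\<^sup>2 * C * (1 - \<epsilon>\<^sup>2)) \<le> (\<epsilon> + s / 2)\<^sup>2"
  shows "N * s\<^sup>2 * (1 - \<epsilon>) \<le> 2 * (1 + s / 2)\<^sup>2 / C"
proof -
  have "(1 + \<epsilon>) * (N * ((s / 2)\<^sup>2 * C * (1 - \<epsilon>))) = N * ((s / 2)\<^sup>2 * C * (1 - \<epsilon>\<^sup>2))"
    by (simp add: power2_eq_square algebra_simps)
  also have "\<dots> \<le> (1 + \<epsilon>) * ((1 + s / 2)\<^sup>2 / 2)"
    using N add_sq_le[of \<epsilon> "s / 2"] \<epsilon> s by simp
  finally have "N * ((s / 2)\<^sup>2 * C * (1 - \<epsilon>)) \<le> (1 + s / 2)\<^sup>2 / 2"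
    by (rule mult_left_le_imp_le) (use \<epsilon> in simp)
  hence "N * s\<^sup>2 * (1 - \<epsilon>) * C \<le> 2 * (1 + s / 2)\<^sup>2" by (simp add: power_divide mult_ac)
  thus ?thesis using C by (simp add: le_divide_eq)
qed

text \<open>For \<epsilon> \<le> 1/3 the cell size is \<epsilon>, the squares of \<epsilon> cancel
  and N (1 - \<epsilon>) \<le> 10, so N s is of order \<epsilon> / (1 - \<epsilon>). For larger
  \<epsilon> the size is 1/3, N (1 - \<epsilon>) \<le> 36, and the factor \<epsilon> is bounded
  below.\<close>

lemma coarse_number:
  fixes \<epsilon> N :: real
  assumes \<epsilon>: "0 < \<epsilon>" "\<epsilon> < 1" and N0: "0 \<le> N" defines "s \<equiv> min \<epsilon> (1 / 3)"
  assumes N: "N * ((s / 2)\<^sup>2 * (1 - (s / 2)\<^sup>2) ^ 3 * (1 - \<epsilon>\<^sup>2)) \<le> (\<epsilon> + s / 2)\<^sup>2"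
  shows "N * (720 * s) \<le> 389422 * \<epsilon> / (1 - \<epsilon>)"
proof -
  have s: "0 < s" "s \<le> 1 / 3" "s \<le> \<epsilon>" using \<epsilon> by (auto simp: s_def)
  define C where "C = (1 - (s / 2)\<^sup>2) ^ 3"
  have "(s / 2)\<^sup>2 \<le> (1 / 6)\<^sup>2" using s by (intro power_mono) auto
  hence "(35 / 36) ^ 3 \<le> C" unfolding C_def by (intro power_mono) (auto simp: power2_eq_square)
  hence C: "9 / 10 \<le> C" by (simp add: power3_eq_cube)
  show ?thesis
  proof (cases "\<epsilon> \<le> 1 / 3")
    case True
    hence se: "s = \<epsilon>" by (simp add: s_def)
    have "(\<epsilon> / 2)\<^sup>2 * (N * C * (1 - \<epsilon>\<^sup>2)) \<le> (\<epsilon> / 2)\<^sup>2 * 9"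
      using N unfolding se C_def[symmetric, unfolded se] by (simp add: power2_eq_square algebra_simps)
    hence "N * C * (1 - \<epsilon>\<^sup>2) \<le> 9" using \<epsilon> by simp
    moreover have "N * (9 / 10) * (1 - \<epsilon>) \<le> N * C * (1 - \<epsilon>\<^sup>2)"
      using C N0 \<epsilon> mult_left_mono[of \<epsilon> 1 \<epsilon>] by (intro mult_mono) (auto simp: power2_eq_square)
    ultimately have "N * (1 - \<epsilon>) \<le> 10" by simp
    hence "N * (1 - \<epsilon>) * (720 * \<epsilon>) \<le> 10 * (720 * \<epsilon>)" using \<epsilon> by (intro mult_right_mono) auto
    thus ?thesis using \<epsilon> by (simp add: se le_divide_eq mult_ac)
  next
    case False
    hence se: "s = 1 / 3" by (simp add: s_def)
    have "N * s\<^sup>2 * (1 - \<epsilon>) \<le> 2 * (1 + s / 2)\<^sup>2 / C"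
      by (rule number_of_families[OF \<epsilon> _ _ _ N[folded C_def]]) (use s C in auto)
    also have "\<dots> \<le> 2 * (1 + s / 2)\<^sup>2 / (9 / 10)" using C by (intro divide_left_mono) auto
    also have "\<dots> \<le> 4" by (simp add: se power2_eq_square)
    finally have "N * (1 - \<epsilon>) \<le> 36" by (simp add: se power2_eq_square)
    hence "N * (720 * s) * (1 - \<epsilon>) \<le> 36 * 240" by (simp add: se)
    also have "\<dots> \<le> 389422 * \<epsilon>" using False by simp
    finally show ?thesis using \<epsilon> by (simp add: le_divide_eq)
  qed
qed

text \<open>2 - sqrt 3 is the inverse of 2 + sqrt 3, whose sixth power is 1351 + 780 sqrt 3. The
  convergent 1351/780 of sqrt 3 bounds that by 2702, and 97272 = 36 * 2702.\<close>

lemma two_minus_sqrt3: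
  "0 < 2 - sqrt 3" "2 - sqrt 3 \<le> 26795 / 100000" "1 / 97272 \<le> ((2 - sqrt 3) ^ 3 / 6)\<^sup>2"
proof -
  define t :: real where "t = sqrt 3"
  have t2: "t\<^sup>2 = 3" by (simp add: t_def)
  have t: "173205 / 100000 \<le> t" "t \<le> 1351 / 780"
    unfolding t_def by (rule real_le_rsqrt, simp add: power2_eq_square) (rule real_le_lsqrt, simp_all add: power2_eq_square)
  show "0 < 2 - sqrt 3" "2 - sqrt 3 \<le> 26795 / 100000" using t by (auto simp: t_def)
  have "(2 - t) * (2 + t) = 1" using t2 by (simp add: power2_eq_square algebra_simps)
  hence "((2 - t) * (2 + t)) ^ 6 = 1" by simp
  hence inv: "(2 - t) ^ 6 * (2 + t) ^ 6 = 1" by (simp only: power_mult_distrib)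
  have "(2 + t) ^ 6 = ((2 + t)\<^sup>2) ^ 3" by (simp flip: power_mult)
  also have "(2 + t)\<^sup>2 = 7 + 4 * t" using t2 by (simp add: power2_eq_square algebra_simps)
  also have "(7 + 4 * t) ^ 3 = 343 + 588 * t + 336 * t\<^sup>2 + 64 * t * t\<^sup>2" by (simp add: power3_eq_cube power2_eq_square algebra_simps)
  also have "\<dots> = 1351 + 780 * t" using t2 by simp
  finally have le: "(2 + t) ^ 6 \<le> 2702" using t by simp
  have "0 \<le> (2 - t) ^ 6" by simp
  hence "1 \<le> (2 - t) ^ 6 * 2702" using mult_left_mono[OF le, of "(2 - t) ^ 6"] inv by simp
  thus "1 / 97272 \<le> ((2 - sqrt 3) ^ 3 / 6)\<^sup>2" by (simp add: t_def power_divide flip: power_mult)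
qed

text \<open>The leading constant is 2 * 97272 = 194544. The corrections (1 + s / 2)^2 and C at the
  largest s bring it to just below 194711.9, so s has to be estimated sharply.\<close>

lemma fine_number:
  fixes \<epsilon> N \<nu> :: real
  assumes \<epsilon>: "0 < \<epsilon>" "\<epsilon> < 1" and \<nu>: "0 < \<nu>" "\<nu> \<le> 2 - sqrt 3" and N0: "0 \<le> N"
  defines "s \<equiv> (2 - sqrt 3) ^ 3 / 6 * \<nu>"
  assumes N: "N * ((s / 2)\<^sup>2 * (1 - (s / 2)\<^sup>2) ^ 3 * (1 - \<epsilon>\<^sup>2)) \<le> (\<epsilon> + s / 2)\<^sup>2"
  shows "0 < s" "s \<le> 8592 / 10000000" "N \<le> (1947119 / 10) / (\<nu>\<^sup>2 * (1 - \<epsilon>))"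
proof -
  note q = two_minus_sqrt3
  define Q where "Q = (2 - sqrt 3) ^ 3 / 6"
  have Q0: "0 < Q" using q by (simp add: Q_def)
  show s0: "0 < s" using Q0 \<nu> by (simp add: s_def Q_def)
  have "s \<le> (26795 / 100000) ^ 3 / 6 * (26795 / 100000)"
    unfolding s_def using q \<nu> by (intro mult_mono divide_right_mono power_mono) auto
  thus s: "s \<le> 8592 / 10000000" by (simp add: power3_eq_cube)
  define C where "C = (1 - (s / 2)\<^sup>2) ^ 3"
  have "(s / 2)\<^sup>2 \<le> (4296 / 10000000)\<^sup>2" using s s0 by (intro power_mono) auto
  hence "(1 - 2 / 10000000) ^ 3 \<le> C" unfolding C_def by (intro power_mono) (auto simp: power2_eq_square)
  moreover have "1 - 6 / 10000000 \<le> (1 - 2 / 10000000 :: real) ^ 3" by (simp add: power3_eq_cube)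
  ultimately have C: "1 - 6 / 10000000 \<le> C" by linarith
  have "N * s\<^sup>2 * (1 - \<epsilon>) \<le> 2 * (1 + s / 2)\<^sup>2 / C"
    by (rule number_of_families[OF \<epsilon> _ _ _ N[folded C_def]]) (use s s0 C in auto)
  also have "\<dots> \<le> 2 * (1 + 4296 / 10000000)\<^sup>2 / (1 - 6 / 10000000)"
    using s s0 C by (intro frac_le mult_left_mono power_mono) auto
  also have "\<dots> \<le> (1947119 / 10) / 97272" by (simp add: power2_eq_square)
  finally have 1: "N * s\<^sup>2 * (1 - \<epsilon>) \<le> (1947119 / 10) / 97272" .
  have "N * \<nu>\<^sup>2 * (1 - \<epsilon>) * (1 / 97272) \<le> N * \<nu>\<^sup>2 * (1 - \<epsilon>) * Q\<^sup>2"
    using q(3) N0 \<epsilon> unfolding Q_def by (intro mult_left_mono) auto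
  also have "\<dots> = N * s\<^sup>2 * (1 - \<epsilon>)" by (simp add: s_def Q_def[symmetric] power_mult_distrib)
  also note 1
  finally have "N * \<nu>\<^sup>2 * (1 - \<epsilon>) \<le> 1947119 / 10" by (simp add: mult_ac)
  hence "N * (\<nu>\<^sup>2 * (1 - \<epsilon>)) \<le> 1947119 / 10" by (simp only: mult.assoc)
  thus "N \<le> (1947119 / 10) / (\<nu>\<^sup>2 * (1 - \<epsilon>))" using \<nu> \<epsilon> by (subst pos_le_divide_eq) auto
qed

section \<open>Comparison of two Jones kernels\<close>

locale jones_pair = c: jones Yc idxc kc rc + F: jones Y idx k r
  for Yc idxc kc rc Y idx k r
begin

text \<open>On the common domain both numerators have the same diagonal value, so the difference
  vanishes there and the poles cancel.\<close>

definition enum :: "complex \<Rightarrow> complex \<Rightarrow> complex" where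
  "enum z w = (if w \<in> c.U \<inter> F.U then c.num z w - F.num z w else 0)"

definition eker :: "complex \<Rightarrow> complex \<Rightarrow> complex" where
  "eker z w = enum z w / (z - w)"

lemma enum_measurable: "enum z \<in> borel_measurable borel"
  unfolding enum_def by measurable

lemma eker_integral:
  assumes z: "cmod z < 1"
  shows "(\<integral>\<^sup>+w. ennreal (cmod (eker z w)) \<partial>lborel) \<le> ennreal (real kc * (720 * rc) + real k * (720 * r))"
proof -
  have "cmod (eker z w) \<le> cmod (c.ker z w) + cmod (F.ker z w)" for w
  proof -
    have "eker z w = c.ker z w - F.ker z w \<or> eker z w = 0"
      by (auto simp: eker_def enum_def c.ker_def F.ker_def diff_divide_distrib)
    thus ?thesis using norm_triangle_ineq4[of "c.ker z w" "F.ker z w"] by auto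
  qed
  hence "(\<integral>\<^sup>+w. ennreal (cmod (eker z w)) \<partial>lborel) \<le> (\<integral>\<^sup>+w. ennreal (cmod (c.ker z w)) + ennreal (cmod (F.ker z w)) \<partial>lborel)"
    by (intro nn_integral_mono) (auto simp flip: ennreal_plus intro!: ennreal_leI)
  also have "\<dots> = (\<integral>\<^sup>+w. ennreal (cmod (c.ker z w)) \<partial>lborel) + (\<integral>\<^sup>+w. ennreal (cmod (F.ker z w)) \<partial>lborel)"
    by (rule nn_integral_add) measurable
  also have "\<dots> \<le> ennreal (real kc * (720 * rc)) + ennreal (real k * (720 * r))"
    by (intro add_mono c.ker_integral F.ker_integral z)
  also have "\<dots> = ennreal (real kc * (720 * rc) + real k * (720 * r))"
    using c.r F.r by (intro ennreal_plus[symmetric]) auto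
  finally show ?thesis .
qed

lemma Bop_eker: "Bop K (\<lambda>f z. vint (eker z) (f :: complex \<Rightarrow> 'x::complex_banach))"
  unfolding eker_def[abs_def]
proof (rule Bop_kernel[OF enum_measurable _ eker_integral[unfolded eker_def]])
  show "0 \<le> real kc * (720 * rc) + real k * (720 * r)" using c.r F.r by simp
  show "(\<lambda>z. enum z w) holomorphic_on disc" if "w \<in> disc" for w
    unfolding enum_def using that
    by (cases "w \<in> c.U \<inter> F.U") (auto intro!: holomorphic_intros c.num_holomorphic F.num_holomorphic)
  show "enum w w = 0" for w by (simp add: enum_def c.num_diag F.num_diag)
  show "cmod (enum z w) \<le> (c.KK + F.KK) / (1 - cmod z)" if z: "cmod z < 1" for z w
  proof (cases "w \<in> c.U \<inter> F.U")
    case True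
    thus ?thesis using norm_triangle_ineq4[of "c.num z w" "F.num z w"] c.norm_num_le[OF z, of w] F.norm_num_le[OF z, of w]
      by (simp add: enum_def add_divide_distrib)
  next
    case False
    hence "enum z w = 0" unfolding enum_def by (rule if_not_P)
    thus ?thesis using z c.KK_pos F.KK_pos by simp
  qed
  show "0 \<le> c.KK + F.KK" using c.KK_pos F.KK_pos by simp
qed

text \<open>Where all Blaschke products of the fine net exceed r, the weight of the family of w cancels
  the factor that was inserted into the kernel.\<close>

lemma ker_decomposition:
  assumes w: "w \<in> c.U" "w \<in> F.U" and z: "z \<in> disc" and B: "\<And>i. i \<in> {1..k} \<Longrightarrow> r < cmod (F.Bf i z)"
  shows "eker z w = c.ker z w - (\<Sum>i=1..k. F.hker i (F.hweight i (F.Bf i z)) z w)"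
proof -
  define j where "j = idx (F.pt w)"
  have j: "j \<in> {1..k}" unfolding j_def by (rule F.idx[OF F.pt(1)[OF w(2)]])
  have "F.Bf j z \<noteq> F.Bf j w" using B[OF j] F.norm_Bf_less[of w j] w(2) by (auto simp: j_def)
  hence "F.hker j (F.hweight j (F.Bf j z)) z w = F.ker z w"
    using w(2) by (simp add: F.hker_def F.hnum_def F.hweight_def F.ker_def j_def)
  moreover have "F.hker i (F.hweight i (F.Bf i z)) z w = 0" if "i \<noteq> j" for i
    using that by (simp add: F.hker_def F.hnum_def j_def)
  ultimately have "(\<Sum>i=1..k. F.hker i (F.hweight i (F.Bf i z)) z w) = (\<Sum>i\<in>{1..k}. if i = j then F.ker z w else 0)"
    by (intro sum.cong) auto
  also have "\<dots> = F.ker z w" using j by (simp add: sum.delta)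
  finally show ?thesis using w by (simp add: eker_def enum_def c.ker_def F.ker_def diff_divide_distrib)
qed

text \<open>The kernel identity is needed only for w in K, where both nets cover, because f vanishes
  almost everywhere else.\<close>

lemma op_decomposition:
  fixes f :: "complex \<Rightarrow> 'x::complex_banach"
  assumes f: "f \<in> Linf K" and K: "K \<subseteq> c.U" "K \<subseteq> F.U" and z: "z \<in> disc"
    and B: "\<And>i. i \<in> {1..k} \<Longrightarrow> r < cmod (F.Bf i z)"
  shows "vint (c.ker z) f = vint (eker z) f + (\<Sum>i=1..k. F.H i (F.Bf i z) f z)"
proof -
  have z1: "cmod z < 1" using z by simp
  define h where "h i = F.hker i (F.hweight i (F.Bf i z)) z" for i
  have hi: "set_integrable lborel disc (h i)" if i: "i \<in> {1..k}" for i
  proof -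
    have A: "0 \<le> 1 / (cmod (F.Bf i z) - r)" using B[OF i] by simp
    show ?thesis unfolding h_def
      by (rule set_integrable_disc_nn(2)[OF F.hker_measurable[OF F.hweight_measurable]
          F.hker_integral_crude[OF F.hweight_measurable A F.norm_hweight_le[OF B[OF i]] z1] mult_nonneg_nonneg[OF F.hconst_nonneg A]])
  qed
  have ci: "set_integrable lborel disc (c.ker z)"
    by (rule set_integrable_disc_nn(2)[OF c.ker_measurable c.ker_integral[OF z1]]) (use c.r in auto)
  have si: "set_integrable lborel disc (\<lambda>w. \<Sum>i=1..k. h i w)"
    unfolding set_integrable_def scaleR_sum_right by (rule Bochner_Integration.integrable_sum) (use hi in \<open>auto simp: set_integrable_def\<close>)
  have "AE w in lebesgue. w \<notin> K \<longrightarrow> f w = 0" using f by (simp add: Linf_def)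
  hence "AE w in lebesgue. w \<in> disc \<longrightarrow> cscale (eker z w) (f w) = cscale (c.ker z w - (\<Sum>i=1..k. h i w)) (f w)"
  proof eventually_elim
    case (elim w)
    show ?case
    proof (cases "w \<in> K")
      case True
      hence "w \<in> c.U" "w \<in> F.U" using K by auto
      thus ?thesis unfolding h_def by (simp only: ker_decomposition[OF _ _ z B] simp_thms)
    qed (use elim in simp)
  qed
  hence "vint (eker z) f = vint (\<lambda>w. c.ker z w - (\<Sum>i=1..k. h i w)) f" by (rule vint_cong)
  also have "\<dots> = vint (c.ker z) f - (\<Sum>i=1..k. vint (h i) f)"
    unfolding vint_diff_left[OF ci si f] by (subst vint_sum_left[OF _ hi f]) auto
  finally show ?thesis by (simp add: h_def F.H_def)
qed

end

section \<open>Sublevel sets of the Blaschke products, and the assembly of the theorem\<close>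

lemma blaschke_sublevel_subset_nbhd:
  assumes Z: "sepset Z" "Z \<subseteq> K" and \<nu>: "0 < \<nu>" "\<nu> \<le> 3 / 10"
    and z: "z \<in> disc" "cmod (blaschke Z z) < \<nu> / 5"
  shows "z \<in> nbhd K \<nu>"
proof -
  have "\<exists>a\<in>Z. rho z a < \<nu>"
  proof (rule ccontr)
    assume "\<not> ?thesis"
    hence "\<nu> / 5 \<le> cmod (blaschke Z z)"
      by (intro norm_blaschke_ge_away[OF sepset_blaschke_set[OF Z(1)] sepset_prod_rho[OF Z(1)] \<nu>]) (use z in auto)
    thus False using z by simp
  qed
  then obtain a where a: "a \<in> K" "rho z a < \<nu>" using Z by blast
  have "(INF a\<in>K. rho z a) \<le> rho z a" by (rule cINF_lower[OF bdd_belowI2[of _ 0] a(1)]) (rule rho_nonneg)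
  thus ?thesis using a z by (auto simp: nbhd_def)
qed

theorem theorem4p8:
  shows "\<exists>c c'. c < 389423 \<and> c' < 194712 \<and>
    (\<forall>(K :: complex set) (\<epsilon> :: real) (\<zeta> :: complex set).
      K \<in> sets lebesgue \<and> K \<subseteq> ball 0 1 \<and> 0 < \<epsilon> \<and> \<epsilon> < 1 \<and> eps_chain \<epsilon> K \<zeta> \<and>
      delta \<zeta> \<ge> 1 - (1 - sqrt (max (1/2) \<epsilon>))\<^sup>2 / 8 \<longrightarrow>
      (\<exists>L :: 'x::complex_banach op.
         Cop K L \<and> opnorm K L \<le> c * \<epsilon> / (1 - \<epsilon>) \<and>
         (\<forall>f\<in>Linf K. weak_sol (L f) f) \<and>
         (\<forall>\<nu>::real. 0 < \<nu> \<and> \<nu> \<le> 2 - sqrt 3 \<longrightarrow>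
            (\<exists>(k::nat) (Z :: nat \<Rightarrow> complex set) (H :: nat \<Rightarrow> complex \<Rightarrow> 'x op) (E0 :: 'x op).
               real k \<le> c' / (\<nu>\<^sup>2 * (1 - \<epsilon>)) \<and>
               (\<forall>i\<in>{1..k}. Z i \<subseteq> K \<and> interpolating (Z i) \<and> delta (Z i) > 1/2) \<and>
               K \<subseteq> (\<Union>i\<in>{1..k}. {z \<in> ball 0 1. cmod (blaschke (Z i) z) \<le> (2 - sqrt 3)^3 / 6 * \<nu>}) \<and>
               (\<Union>i\<in>{1..k}. {z \<in> ball 0 1. cmod (blaschke (Z i) z) \<le> (2 - sqrt 3)^3 / 6 * \<nu>})
                 \<subseteq> (\<Union>i\<in>{1..k}. {z \<in> ball 0 1. cmod (blaschke (Z i) z) < 6 * ((2 - sqrt 3)^3 / 6 * \<nu>)}) \<and>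
               (\<Union>i\<in>{1..k}. {z \<in> ball 0 1. cmod (blaschke (Z i) z) < 6 * ((2 - sqrt 3)^3 / 6 * \<nu>)})
                 \<subseteq> nbhd K \<nu> \<and>
               (\<forall>i\<in>{1..k}.
                  op_holo K {w. (2 - sqrt 3)^3 / 6 * \<nu> < cmod w} (H i) \<and>
                  (\<forall>w. (2 - sqrt 3)^3 / 6 * \<nu> < cmod w \<longrightarrow> opnorm K (H i w) \<le> 3/5 * \<nu>) \<and>
                  ((\<lambda>w. opnorm K (H i w)) \<longlongrightarrow> 0) at_infinity) \<and>
               Bop K E0 \<and>
               (\<forall>f\<in>Linf K. \<forall>z\<in>ball 0 1 - closure (nbhd K \<nu>).
                  L f z = E0 f z + (\<Sum>i=1..k. H i (blaschke (Z i) z) f z))))))"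
proof (rule exI[of _ 389422], rule exI[of _ "1947119 / 10"], intro conjI allI impI; (elim conjE)?)
  fix K \<zeta> :: "complex set" and \<epsilon> :: real
  assume K: "K \<subseteq> ball 0 1" and \<epsilon>: "0 < \<epsilon>" "\<epsilon> < 1" and chain: "eps_chain \<epsilon> K \<zeta>"
    and del: "delta \<zeta> \<ge> 1 - (1 - sqrt (max (1/2) \<epsilon>))\<^sup>2 / 8"
  \<comment> \<open>The coarse net depends on \<epsilon> and K only, so \<open>L\<close> is fixed
    before \<nu> is chosen.\<close>
  define rc where "rc = min \<epsilon> (1 / 3)"
  have rc: "0 < rc" "rc \<le> 1 / 3" using \<epsilon> by (auto simp: rc_def)
  obtain Yc idxc kc where jc: "jones Yc idxc kc rc" and "Yc \<subseteq> K" and netc: "\<forall>y\<in>K. \<exists>a\<in>Yc. rho y a < rc"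
    and kc: "real kc * ((rc / 2)\<^sup>2 * (1 - (rc / 2)\<^sup>2) ^ 3 * (1 - \<epsilon>\<^sup>2)) \<le> (\<epsilon> + rc / 2)\<^sup>2"
    using jones_system_exists[OF K \<epsilon> chain del rc] by blast
  interpret c: jones Yc idxc kc rc by (rule jc)
  have KU: "K \<subseteq> c.U" using netc K by (auto simp: c.U_def)
  define L :: "'x op" where "L f z = vint (c.ker z) f" for f z
  have M0: "0 \<le> real kc * (720 * rc)" using rc by simp
  have "Crho (L f)" if f: "f \<in> Linf K" for f
    unfolding L_def[abs_def] c.ker_def[abs_def]
    by (rule Crho_vint[OF f c.num_measurable c.num_holomorphic c.norm_num_le _ c.ker_integral[unfolded c.ker_def] M0])
       (use c.KK_pos in auto)
  hence L1: "Cop K L"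
    using bdd_lin_op_kernel[OF c.ker_measurable M0 c.ker_integral, where K = K and ?'x = 'x] by (simp add: Cop_def L_def[abs_def])
  have "opnorm K L \<le> real kc * (720 * rc)"
    by (rule opnorm_kernel(2)[OF c.ker_measurable M0 c.ker_integral]) (simp_all add: L_def)
  also have "\<dots> \<le> 389422 * \<epsilon> / (1 - \<epsilon>)"
    unfolding rc_def by (rule coarse_number[OF \<epsilon> _ kc[unfolded rc_def]]) simp
  finally have L2: "opnorm K L \<le> 389422 * \<epsilon> / (1 - \<epsilon>)" .
  have L3: "weak_sol (L f) f" if "f \<in> Linf K" for f
    unfolding L_def[abs_def] by (rule c.weak_solution[OF that KU])
  show "\<exists>L :: 'x op.
         Cop K L \<and> opnorm K L \<le> 389422 * \<epsilon> / (1 - \<epsilon>) \<and>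
         (\<forall>f\<in>Linf K. weak_sol (L f) f) \<and>
         (\<forall>\<nu>::real. 0 < \<nu> \<and> \<nu> \<le> 2 - sqrt 3 \<longrightarrow>
            (\<exists>(k::nat) (Z :: nat \<Rightarrow> complex set) (H :: nat \<Rightarrow> complex \<Rightarrow> 'x op) (E0 :: 'x op).
               real k \<le> (1947119 / 10) / (\<nu>\<^sup>2 * (1 - \<epsilon>)) \<and>
               (\<forall>i\<in>{1..k}. Z i \<subseteq> K \<and> interpolating (Z i) \<and> delta (Z i) > 1/2) \<and>
               K \<subseteq> (\<Union>i\<in>{1..k}. {z \<in> ball 0 1. cmod (blaschke (Z i) z) \<le> (2 - sqrt 3)^3 / 6 * \<nu>}) \<and>
               (\<Union>i\<in>{1..k}. {z \<in> ball 0 1. cmod (blaschke (Z i) z) \<le> (2 - sqrt 3)^3 / 6 * \<nu>})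
                 \<subseteq> (\<Union>i\<in>{1..k}. {z \<in> ball 0 1. cmod (blaschke (Z i) z) < 6 * ((2 - sqrt 3)^3 / 6 * \<nu>)}) \<and>
               (\<Union>i\<in>{1..k}. {z \<in> ball 0 1. cmod (blaschke (Z i) z) < 6 * ((2 - sqrt 3)^3 / 6 * \<nu>)})
                 \<subseteq> nbhd K \<nu> \<and>
               (\<forall>i\<in>{1..k}.
                  op_holo K {w. (2 - sqrt 3)^3 / 6 * \<nu> < cmod w} (H i) \<and>
                  (\<forall>w. (2 - sqrt 3)^3 / 6 * \<nu> < cmod w \<longrightarrow> opnorm K (H i w) \<le> 3/5 * \<nu>) \<and>
                  ((\<lambda>w. opnorm K (H i w)) \<longlongrightarrow> 0) at_infinity) \<and>
               Bop K E0 \<and>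
               (\<forall>f\<in>Linf K. \<forall>z\<in>ball 0 1 - closure (nbhd K \<nu>).
                  L f z = E0 f z + (\<Sum>i=1..k. H i (blaschke (Z i) z) f z))))"
  proof (intro exI[of _ L] conjI L1 L2 ballI L3 allI impI; (elim conjE)?)
    fix \<nu> :: real assume \<nu>: "0 < \<nu>" "\<nu> \<le> 2 - sqrt 3"
    define r where "r = (2 - sqrt 3)^3 / 6 * \<nu>"
    \<comment> \<open>This makes 6 r at most 0.0193 \<nu>, below the threshold \<nu> / 5 at which a
      small Blaschke product forces a zero within \<nu>, and leaves 87 r below 3/5 \<nu>.\<close>
    have q: "(2 - sqrt 3) ^ 3 \<le> (26795 / 100000) ^ 3" using two_minus_sqrt3 by (intro power_mono) auto
    have q': "(2 - sqrt 3) ^ 3 \<le> 193 / 10000" by (rule order_trans[OF q]) (simp add: power3_eq_cube)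
    have r_le: "6 * r \<le> 193 / 10000 * \<nu>" unfolding r_def using mult_right_mono[OF q', of \<nu>] \<nu> by simp
    have r0: "0 < r" unfolding r_def using \<nu> two_minus_sqrt3 by simp
    have \<nu>': "\<nu> \<le> 3 / 10" using \<nu> two_minus_sqrt3 by simp
    have r3: "r \<le> 1 / 1000" using r_le \<nu>' by simp
    hence r4: "r \<le> 1 / 3" by simp
    obtain Y idx k where j: "jones Y idx k r" and YK: "Y \<subseteq> K" and net: "\<forall>y\<in>K. \<exists>a\<in>Y. rho y a < r"
      and k: "real k * ((r / 2)\<^sup>2 * (1 - (r / 2)\<^sup>2) ^ 3 * (1 - \<epsilon>\<^sup>2)) \<le> (\<epsilon> + r / 2)\<^sup>2"
      using jones_system_exists[OF K \<epsilon> chain del r0 r4] by blast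
    interpret P: jones_pair Yc idxc kc rc Y idx k r by (intro jones_pair.intro jc j)
    have KF: "K \<subseteq> P.F.U" using net K by (auto simp: P.F.U_def)
    have famK: "P.F.fam i \<subseteq> K" for i using YK by (auto simp: P.F.fam_def)
    have sub: "z \<in> nbhd K \<nu>" if "z \<in> disc" "cmod (blaschke (P.F.fam i) z) < 6 * r" for z i
      by (rule blaschke_sublevel_subset_nbhd[OF P.F.sepset_fam[of i] famK \<nu>(1) \<nu>' that(1)]) (use that r_le \<nu> in simp)
    have C1: "real k \<le> (1947119 / 10) / (\<nu>\<^sup>2 * (1 - \<epsilon>))"
      by (rule fine_number(3)[OF \<epsilon> \<nu> _ k[unfolded r_def]]) simp
    have C2: "\<forall>i\<in>{1..k}. P.F.fam i \<subseteq> K \<and> interpolating (P.F.fam i) \<and> delta (P.F.fam i) > 1/2"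
      using famK sepset_interpolating[OF P.F.sepset_fam] sepset_delta[OF P.F.sepset_fam] by blast
    have C3: "K \<subseteq> (\<Union>i\<in>{1..k}. {z \<in> ball 0 1. cmod (blaschke (P.F.fam i) z) \<le> r})"
    proof
      fix y assume y: "y \<in> K"
      then obtain a where a: "a \<in> Y" "rho y a < r" using net by blast
      have y1: "cmod y < 1" using y K by auto
      have "cmod (blaschke (P.F.fam (idx a)) y) \<le> rho y a"
        by (rule norm_blaschke_le_rho[OF P.F.blaschke_fam _ y1]) (use a in \<open>simp add: P.F.fam_def\<close>)
      thus "y \<in> (\<Union>i\<in>{1..k}. {z \<in> ball 0 1. cmod (blaschke (P.F.fam i) z) \<le> r})"
        using a P.F.idx[OF a(1)] y1 by (intro UN_I[of "idx a"]) auto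
    qed
    have C4: "(\<Union>i\<in>{1..k}. {z \<in> ball 0 1. cmod (blaschke (P.F.fam i) z) \<le> r})
       \<subseteq> (\<Union>i\<in>{1..k}. {z \<in> ball 0 1. cmod (blaschke (P.F.fam i) z) < 6 * r})"
      using r0 by fastforce
    have C5: "(\<Union>i\<in>{1..k}. {z \<in> ball 0 1. cmod (blaschke (P.F.fam i) z) < 6 * r}) \<subseteq> nbhd K \<nu>"
      using sub by blast
    have C6: "\<forall>i\<in>{1..k}. op_holo K {w. r < cmod w} (P.F.H i :: complex \<Rightarrow> 'x op) \<and>
        (\<forall>w. r < cmod w \<longrightarrow> opnorm K (P.F.H i w :: 'x op) \<le> 3/5 * \<nu>) \<and>
        ((\<lambda>w. opnorm K (P.F.H i w :: 'x op)) \<longlongrightarrow> 0) at_infinity"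
    proof (intro ballI conjI allI impI P.F.op_holo_H P.F.opnorm_H_at_infinity)
      fix i w assume "r < cmod w"
      from P.F.opnorm_H[OF this r3, where K = K and i = i and ?'x = 'x]
      show "opnorm K (P.F.H i w :: 'x op) \<le> 3/5 * \<nu>" using r_le \<nu> by simp
    qed
    have C7: "\<forall>f\<in>Linf K. \<forall>z\<in>ball 0 1 - closure (nbhd K \<nu>).
        L f z = vint (P.eker z) f + (\<Sum>i=1..k. P.F.H i (blaschke (P.F.fam i) z) f z)"
    proof (intro ballI)
      fix f :: "complex \<Rightarrow> 'x" and z assume f: "f \<in> Linf K" and z: "z \<in> ball 0 1 - closure (nbhd K \<nu>)"
      have zd: "z \<in> disc" and zn: "z \<notin> nbhd K \<nu>" using z closure_subset[of "nbhd K \<nu>"] by blast+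
      have Bz: "P.F.Bf i z = blaschke (P.F.fam i) z" for i using zd by (simp add: P.F.Bf_def)
      \<comment> \<open>A value of modulus at most r would place z in the sublevel set for 6 r and
        hence in the \<nu>-neighbourhood of K.\<close>
      have "r < cmod (P.F.Bf i z)" for i using sub[OF zd, of i] zn r0 unfolding Bz by (cases "r < cmod (blaschke (P.F.fam i) z)") auto
      from P.op_decomposition[OF f KU KF zd this]
      show "L f z = vint (P.eker z) f + (\<Sum>i=1..k. P.F.H i (blaschke (P.F.fam i) z) f z)" by (simp add: L_def Bz)
    qed
    show "\<exists>(k::nat) (Z :: nat \<Rightarrow> complex set) (H :: nat \<Rightarrow> complex \<Rightarrow> 'x op) (E0 :: 'x op).
               real k \<le> (1947119 / 10) / (\<nu>\<^sup>2 * (1 - \<epsilon>)) \<and>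
               (\<forall>i\<in>{1..k}. Z i \<subseteq> K \<and> interpolating (Z i) \<and> delta (Z i) > 1/2) \<and>
               K \<subseteq> (\<Union>i\<in>{1..k}. {z \<in> ball 0 1. cmod (blaschke (Z i) z) \<le> (2 - sqrt 3)^3 / 6 * \<nu>}) \<and>
               (\<Union>i\<in>{1..k}. {z \<in> ball 0 1. cmod (blaschke (Z i) z) \<le> (2 - sqrt 3)^3 / 6 * \<nu>})
                 \<subseteq> (\<Union>i\<in>{1..k}. {z \<in> ball 0 1. cmod (blaschke (Z i) z) < 6 * ((2 - sqrt 3)^3 / 6 * \<nu>)}) \<and>
               (\<Union>i\<in>{1..k}. {z \<in> ball 0 1. cmod (blaschke (Z i) z) < 6 * ((2 - sqrt 3)^3 / 6 * \<nu>)})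
                 \<subseteq> nbhd K \<nu> \<and>
               (\<forall>i\<in>{1..k}.
                  op_holo K {w. (2 - sqrt 3)^3 / 6 * \<nu> < cmod w} (H i) \<and>
                  (\<forall>w. (2 - sqrt 3)^3 / 6 * \<nu> < cmod w \<longrightarrow> opnorm K (H i w) \<le> 3/5 * \<nu>) \<and>
                  ((\<lambda>w. opnorm K (H i w)) \<longlongrightarrow> 0) at_infinity) \<and>
               Bop K E0 \<and>
               (\<forall>f\<in>Linf K. \<forall>z\<in>ball 0 1 - closure (nbhd K \<nu>).
                  L f z = E0 f z + (\<Sum>i=1..k. H i (blaschke (Z i) z) f z))"
      unfolding r_def[symmetric]
      by (rule exI[of _ k], rule exI[of _ P.F.fam], rule exI[of _ "P.F.H"], rule exI[of _ "\<lambda>f z. vint (P.eker z) f"],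
          intro conjI C1 C2 C3 C4 C5 C6 C7 P.Bop_eker)
  qed
qed simp_all

end
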